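(* Let $S\subseteq\mathbb{N}^d$ be a simplicial, fully embedded affine semigroup with extremal rays $\mathbf{a}_1,\dots,\mathbf{a}_d$. Suppose that $S$ is nearly Gorenstein of embedding dimension $d+3$. If $S$ is not Gorenstein, then $d\le\mathrm{type}(S)\le 3$.
   Context: Setting: $\mathbb{K}$ is a field and $\mathbb{N}$ contains $0$. $S\subseteq\mathbb{N}^d$ ($d\ge 1$) is an affine semigroup minimally generated by $\mathbf{a}_1,\dots,\mathbf{a}_{d+r}$ (so its embedding dimension is $d+r$; here $r=3$), simplicial and fully embedded in $\mathbb{N}^d$ with extremal rays $\mathbf{a}_1,\dots,\mathbf{a}_d$: the vectors $\mathbf{a}_1,\dots,\mathbf{a}_d$ are linearly independent and $S\subseteq\sum_{i=1}^d\mathbb{Q}_{\ge0}\mathbf{a}_i$. Moreover each $\mathbf{a}_i$ ($1\le i\le d$) is the smallest generator on its extremal ray: if another generator $\mathbf{a}_j=q\mathbf{a}_i$ with $0\neq q\in\mathbb{Q}$, then $q>1$. $\mathbb{K}[S]=\mathbb{K}[\mathbf{x}^{\mathbf{a}}:\mathbf{a}\in S]$ is the semigroup ring; $S$ is Gorenstein if $\mathbb{K}[S]$ is. $\mathrm{group}(S)=\{\mathbf{a}-\mathbf{b}:\mathbf{a},\mathbf{b}\in S\}$; $M=S\setminus\{\mathbf{0}\}$; $E=\{\mathbf{a}_1,\dots,\mathbf{a}_d\}$; $\mathrm{Ap}(S,E)=\{\mathbf{a}\in S : \mathbf{a}-\mathbf{a}_i\notin S \text{ for all } i=1,\dots,d\}$;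 $\mathbf{b}\preceq_S\mathbf{a}$ iff $\mathbf{a}-\mathbf{b}\in S$; $\mathrm{QF}(S)=\{\mathbf{m}-\sum_{i=1}^d\mathbf{a}_i : \mathbf{m}\in\max_{\preceq_S}\mathrm{Ap}(S,E)\}$. $\mathrm{type}(S)=|\mathrm{QF}(S)|=|\max_{\preceq_S}\mathrm{Ap}(S,E)|$, which equals the Cohen-Macaulay type of $\mathbb{K}[S]$ when $\mathbb{K}[S]$ is Cohen-Macaulay. $\omega_S=\{-\mathbf{f}:\mathbf{f}\in\mathrm{QF}(S)\}+S$, $\omega_S^{-1}=\{\mathbf{z}\in\mathrm{group}(S): \mathbf{z}+\omega_S\subseteq S\}$, and $\mathrm{tr}(S)=\omega_S+\omega_S^{-1}$ (the set of exponents of the monomials in the trace ideal of the canonical module of $\mathbb{K}[S]$ in the Cohen-Macaulay case). $S$ is nearly Gorenstein if $\mathbb{K}[S]$ is Cohen-Macaulay and $M\subseteq\mathrm{tr}(S)$. *)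

theory Defs
  imports
    "HOL-Analysis.Cartesian_Space"
    "HOL-Algebra.QuotRing"
    "HOL-Algebra.Ring_Divisibility"
    "HOL-Library.Poly_Mapping"
    "HOL-Library.Extended_Nat"
begin

section \<open>Commutative algebra\<close>

subsection \<open>Localization\<close>

definition loc_rel :: "('a, 'b) ring_scheme \<Rightarrow> 'a set \<Rightarrow> (('a \<times> 'a) \<times> ('a \<times> 'a)) set" where
  "loc_rel R W = {((r, s), (r', s')).
     r \<in> carrier R \<and> s \<in> W \<and> r' \<in> carrier R \<and> s' \<in> W \<and>
     (\<exists>t\<in>W. t \<otimes>\<^bsub>R\<^esub> (s' \<otimes>\<^bsub>R\<^esub> r \<ominus>\<^bsub>R\<^esub> s \<otimes>\<^bsub>R\<^esub> r') = \<zero>\<^bsub>R\<^esub>)}"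

text \<open>The ring of fractions \<open>W\<^sup>-\<^sup>1R\<close> of a commutative ring at a multiplicative set \<open>W\<close> of
  denominators; the class of a pair \<open>(r, s)\<close> is the fraction \<open>r/s\<close>.\<close>

definition ring_of_fractions :: "('a, 'b) ring_scheme \<Rightarrow> 'a set \<Rightarrow> ('a \<times> 'a) set ring" where
  "ring_of_fractions R W =
     \<lparr> carrier = (carrier R \<times> W) // loc_rel R W,
       mult = (\<lambda>A B. \<Union>(r, s)\<in>A. \<Union>(r', s')\<in>B.
                 loc_rel R W `` {(r \<otimes>\<^bsub>R\<^esub> r', s \<otimes>\<^bsub>R\<^esub> s')}),
       one = loc_rel R W `` {(\<one>\<^bsub>R\<^esub>, \<one>\<^bsub>R\<^esub>)},
       zero = loc_rel R W `` {(\<zero>\<^bsub>R\<^esub>, \<one>\<^bsub>R\<^esub>)},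
       add = (\<lambda>A B. \<Union>(r, s)\<in>A. \<Union>(r', s')\<in>B.
                 loc_rel R W `` {(s' \<otimes>\<^bsub>R\<^esub> r \<oplus>\<^bsub>R\<^esub> s \<otimes>\<^bsub>R\<^esub> r', s \<otimes>\<^bsub>R\<^esub> s')}) \<rparr>"

definition localization_at :: "('a, 'b) ring_scheme \<Rightarrow> 'a set \<Rightarrow> ('a \<times> 'a) set ring" where
  "localization_at R P = ring_of_fractions R (carrier R - P)"

subsection \<open>Dimension and depth\<close>

definition local_ring :: "('a, 'b) ring_scheme \<Rightarrow> bool" where
  "local_ring A \<longleftrightarrow> cring A \<and> (\<exists>!m. maximalideal m A)"

definition max_ideal :: "('a, 'b) ring_scheme \<Rightarrow> 'a set" where
  "max_ideal A = (THE m. maximalideal m A)"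

definition krull_dim :: "('a, 'b) ring_scheme \<Rightarrow> enat" where
  "krull_dim R = Sup {enat n | n. \<exists>P :: nat \<Rightarrow> 'a set.
     (\<forall>i\<le>n. primeideal (P i) R) \<and> (\<forall>i<n. P i \<subset> P (Suc i))}"

text \<open>The second clause says that \<open>xs ! k\<close> is a nonzerodivisor modulo the ideal generated
  by the preceding elements.\<close>

definition regular_seq :: "('a, 'b) ring_scheme \<Rightarrow> 'a list \<Rightarrow> bool" where
  "regular_seq R xs \<longleftrightarrow>
     set xs \<subseteq> carrier R \<and>
     (\<forall>k<length xs. \<forall>r\<in>carrier R.
        xs ! k \<otimes>\<^bsub>R\<^esub> r \<in> Idl\<^bsub>R\<^esub> (set (take k xs)) \<longrightarrow> r \<in> Idl\<^bsub>R\<^esub> (set (take k xs))) \<and>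
     Idl\<^bsub>R\<^esub> (set xs) \<noteq> carrier R"

definition depth :: "('a, 'b) ring_scheme \<Rightarrow> enat" where
  "depth A = Sup {enat (length xs) | xs. regular_seq A xs \<and> set xs \<subseteq> max_ideal A}"

subsection \<open>Cohen-Macaulay and Gorenstein rings\<close>

definition cohen_macaulay_local :: "('a, 'b) ring_scheme \<Rightarrow> bool" where
  "cohen_macaulay_local A \<longleftrightarrow> noetherian_ring A \<and> local_ring A \<and> depth A = krull_dim A"

definition cohen_macaulay :: "('a, 'b) ring_scheme \<Rightarrow> bool" where
  "cohen_macaulay R \<longleftrightarrow> noetherian_ring R \<and> cring R \<and>
     (\<forall>P. maximalideal P R \<longrightarrow> cohen_macaulay_local (localization_at R P))"

definition maximal_regular_seq :: "('a, 'b) ring_scheme \<Rightarrow> 'a list \<Rightarrow> bool" where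
  "maximal_regular_seq A xs \<longleftrightarrow> regular_seq A xs \<and> set xs \<subseteq> max_ideal A \<and>
     \<not> (\<exists>y\<in>max_ideal A. regular_seq A (xs @ [y]))"

definition socle :: "('a, 'b) ring_scheme \<Rightarrow> 'a set" where
  "socle B = {r \<in> carrier B. \<forall>y\<in>max_ideal B. y \<otimes>\<^bsub>B\<^esub> r = \<zero>\<^bsub>B\<^esub>}"

text \<open>The maximal ideal annihilates the socle of a Noetherian local ring \<open>B\<close>, so the socle is a
  vector space over the residue field whose subspaces are exactly the ideals of \<open>B\<close> inside it;
  its dimension is therefore the least number of elements generating it as an ideal.\<close>

definition socle_dim :: "('a, 'b) ring_scheme \<Rightarrow> nat" where
  "socle_dim B = (LEAST n. \<exists>X\<subseteq>carrier B. finite X \<and> card X = n \<and> Idl\<^bsub>B\<^esub> X = socle B)"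

text \<open>The Cohen-Macaulay type of a Cohen-Macaulay local ring \<open>A\<close> is the dimension of the socle
  of \<open>A/(xs)\<close>, where \<open>xs\<close> is a maximal regular sequence in the maximal ideal; it does not depend
  on the choice of \<open>xs\<close>.\<close>

definition has_cm_type :: "('a, 'b) ring_scheme \<Rightarrow> nat \<Rightarrow> bool" where
  "has_cm_type A n \<longleftrightarrow>
     (\<exists>xs. maximal_regular_seq A xs \<and> socle_dim (A Quot (Idl\<^bsub>A\<^esub> (set xs))) = n)"

definition gorenstein_local :: "('a, 'b) ring_scheme \<Rightarrow> bool" where
  "gorenstein_local A \<longleftrightarrow> cohen_macaulay_local A \<and> has_cm_type A 1"

definition gorenstein :: "('a, 'b) ring_scheme \<Rightarrow> bool" where
  "gorenstein R \<longleftrightarrow> noetherian_ring R \<and> cring R \<and>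
     (\<forall>P. maximalideal P R \<longrightarrow> gorenstein_local (localization_at R P))"


section \<open>Affine semigroups\<close>

text \<open>The lattice \<open>\<int>\<^sup>d\<close> is \<open>int ^ 'd\<close> with \<open>d = CARD('d)\<close>. Semigroups in \<open>\<nat>\<^sup>d\<close> are subsets of
  \<open>int ^ 'd\<close> with nonnegative coordinates, so that differences are available. The extremal rays
  are a family \<open>a\<close> indexed by \<open>'d\<close> itself.\<close>

definition rat_vec :: "int ^ 'd \<Rightarrow> rat ^ 'd" where
  "rat_vec v = (\<chi> i. of_int (v $ i))"

definition generated_semigroup :: "(int ^ 'd) set \<Rightarrow> (int ^ 'd) set" where
  "generated_semigroup G = {\<Sum>g\<in>G. int (n g) *s g | n :: int ^ 'd \<Rightarrow> nat. True}"

definition minimally_generated :: "(int ^ 'd) set \<Rightarrow> (int ^ 'd) set \<Rightarrow> bool" where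
  "minimally_generated S G \<longleftrightarrow> finite G \<and> generated_semigroup G = S \<and>
     (\<forall>H. H \<subset> G \<longrightarrow> generated_semigroup H \<noteq> S)"

text \<open>\<open>S\<close> is an affine semigroup in \<open>\<nat>\<^sup>d\<close> with minimal generating set \<open>G\<close>, simplicial and fully
  embedded with extremal rays \<open>a\<close>, where each \<open>a i\<close> is the smallest generator on its ray.\<close>

definition simplicial_affine_semigroup ::
    "(int ^ 'd) set \<Rightarrow> (int ^ 'd) set \<Rightarrow> ('d \<Rightarrow> int ^ 'd) \<Rightarrow> bool" where
  "simplicial_affine_semigroup S G a \<longleftrightarrow>
     (\<forall>s\<in>S. \<forall>i. 0 \<le> s $ i) \<and>
     minimally_generated S G \<and>
     range a \<subseteq> G \<and>
     inj a \<and> vec.independent (range (\<lambda>i. rat_vec (a i))) \<and>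
     (\<forall>s\<in>S. \<exists>q :: 'd \<Rightarrow> rat. (\<forall>i. 0 \<le> q i) \<and> rat_vec s = (\<Sum>i\<in>UNIV. q i *s rat_vec (a i))) \<and>
     (\<forall>i. \<forall>g\<in>G - {a i}. \<forall>q :: rat. q \<noteq> 0 \<longrightarrow> rat_vec g = q *s rat_vec (a i) \<longrightarrow> 1 < q)"

definition semigroup_ring ::
    "'k::field itself \<Rightarrow> (int ^ 'd) set \<Rightarrow> (int ^ 'd \<Rightarrow>\<^sub>0 'k) ring" where
  "semigroup_ring K S =
     \<lparr> carrier = {f. Poly_Mapping.keys f \<subseteq> S}, mult = (*), one = 1, zero = 0, add = (+) \<rparr>"

definition semigroup_group :: "(int ^ 'd) set \<Rightarrow> (int ^ 'd) set" where
  "semigroup_group S = {u - v | u v. u \<in> S \<and> v \<in> S}"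

definition apery :: "(int ^ 'd) set \<Rightarrow> ('d \<Rightarrow> int ^ 'd) \<Rightarrow> (int ^ 'd) set" where
  "apery S a = {u \<in> S. \<forall>i. u - a i \<notin> S}"

definition semigroup_le :: "(int ^ 'd) set \<Rightarrow> int ^ 'd \<Rightarrow> int ^ 'd \<Rightarrow> bool" where
  "semigroup_le S v u \<longleftrightarrow> u - v \<in> S"

definition max_apery :: "(int ^ 'd) set \<Rightarrow> ('d \<Rightarrow> int ^ 'd) \<Rightarrow> (int ^ 'd) set" where
  "max_apery S a = {m \<in> apery S a. \<forall>u\<in>apery S a. semigroup_le S m u \<longrightarrow> u = m}"

definition quasi_frobenius :: "(int ^ 'd) set \<Rightarrow> ('d \<Rightarrow> int ^ 'd) \<Rightarrow> (int ^ 'd) set" where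
  "quasi_frobenius S a = {m - (\<Sum>i\<in>UNIV. a i) | m. m \<in> max_apery S a}"

definition semigroup_type :: "(int ^ 'd) set \<Rightarrow> ('d \<Rightarrow> int ^ 'd) \<Rightarrow> nat" where
  "semigroup_type S a = card (quasi_frobenius S a)"

definition canonical :: "(int ^ 'd) set \<Rightarrow> ('d \<Rightarrow> int ^ 'd) \<Rightarrow> (int ^ 'd) set" where
  "canonical S a = {- f + s | f s. f \<in> quasi_frobenius S a \<and> s \<in> S}"

definition canonical_inverse :: "(int ^ 'd) set \<Rightarrow> ('d \<Rightarrow> int ^ 'd) \<Rightarrow> (int ^ 'd) set" where
  "canonical_inverse S a = {z \<in> semigroup_group S. \<forall>w\<in>canonical S a. z + w \<in> S}"

definition canonical_trace :: "(int ^ 'd) set \<Rightarrow> ('d \<Rightarrow> int ^ 'd) \<Rightarrow> (int ^ 'd) set" where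
  "canonical_trace S a = {w + z | w z. w \<in> canonical S a \<and> z \<in> canonical_inverse S a}"

definition nearly_gorenstein ::
    "'k::field itself \<Rightarrow> (int ^ 'd) set \<Rightarrow> ('d \<Rightarrow> int ^ 'd) \<Rightarrow> bool" where
  "nearly_gorenstein K S a \<longleftrightarrow> cohen_macaulay (semigroup_ring K S) \<and> S - {0} \<subseteq> canonical_trace S a"

end

theory Submission
  imports Defs "HOL-Computational_Algebra.Polynomial"
begin

text \<open>Cohen-Macaulayness is only used through the following saturation property: if
  \<open>s + a i\<close> and \<open>s + a j\<close> lie in \<open>S\<close> with \<open>i \<noteq> j\<close>, then so does \<open>s\<close>. Otherwise the monomials of
  \<open>a i\<close> and \<open>a j\<close> would both annihilate a nonzero element modulo \<open>a i\<close>, and a regular sequence of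
  length \<open>d\<close> would force a chain of \<open>d\<close> primes above these two monomials, which a dimension count
  excludes.

  Near Gorensteinness attaches to every generator \<open>g\<close> a maximal Apery element \<open>top g\<close> with
  \<open>g + top g - m \<in> S\<close> for all maximal \<open>m\<close> as soon as the type is at least two. By saturation the
  elements \<open>top (a i)\<close> are distinct, which is the lower bound. Four maximal elements would yield an
  infeasible system of linear inequalities for the exponents of these differences.

  If there is a unique maximal Apery element, then \<open>K[S]\<close> is Gorenstein: a maximal ideal contains a
  polynomial in each ray monomial by Zariski's lemma, these polynomials form a regular sequence, and
  the quotient carries a Frobenius form, so that its local socles are one-dimensional.\<close>

text \<open>Saturation says that two ray monomials behave like a regular sequence. The definition of
  Cohen-Macaulay only provides some regular sequence of length d in the local ring at the origin,
  made of unknown polynomials, so depth has to be carried over to monomials: a prime associated to a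
  principal ideal lies below a chain of d primes, whereas modulo two ray monomials the number of
  monomials of weight at most N grows only like N^(d-2). The second obstacle is that
  \<open>gorenstein\<close> speaks of all maximal ideals over an arbitrary field. They need not be
  monomial and their residue field may be larger than K; hence Zariski's lemma, and hence a socle
  compared with the residue field instead of K. For the upper bound only differences of maximal
  elements matter. If d = 1, the map \<open>top\<close> partitions the four generators in one of
  five ways up to order. If d is at least 2, the tops of two rays differ, and these two rays
  together with the three generators that are not rays already give the contradiction. In particular
  the two bounds force d to be at most 3.\<close>

section \<open>Ideals of a localization\<close>

text \<open>Gaussian elimination in place of the determinant trick. The last unknown is solved with
  pivot \<open>w - c n\<close>, which stays in \<open>W\<close> because \<open>W\<close> is closed
  under subtracting elements of \<open>C\<close>; the other equations are multiplied by this pivot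
  before substituting. It serves Nakayama's lemma (\<open>W\<close> the complement of a prime) and
  the descent step of Zariski's lemma (\<open>W\<close> the elements
  \<open>h ^ N - q * d\<close>).\<close>

lemma nakayama_elimination:
  fixes v :: "nat \<Rightarrow> 'a::comm_ring_1"
  assumes N: "0 \<in> N" "\<And>x y. x \<in> N \<Longrightarrow> y \<in> N \<Longrightarrow> x + y \<in> N" "\<And>d x. d \<in> D \<Longrightarrow> x \<in> N \<Longrightarrow> d * x \<in> N"
    and W: "1 \<in> W" "\<And>w w'. w \<in> W \<Longrightarrow> w' \<in> W \<Longrightarrow> w * w' \<in> W" "\<And>w c. w \<in> W \<Longrightarrow> c \<in> C \<Longrightarrow> w - c \<in> W"
      "W \<subseteq> D"
    and C: "\<And>c c'. c \<in> C \<Longrightarrow> c' \<in> C \<Longrightarrow> c + c' \<in> C" "\<And>d c. d \<in> D \<Longrightarrow> c \<in> C \<Longrightarrow> d * c \<in> C" "C \<subseteq> D"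
    and sys: "\<forall>i<n. \<exists>w\<in>W. \<exists>c. (\<forall>j<n. c j \<in> C) \<and> w * v i - (\<Sum>j<n. c j * v j) \<in> N"
  shows "\<exists>w\<in>W. \<forall>i<n. w * v i \<in> N"
  using sys
proof (induction n)
  case 0
  then show ?case using W(1) by auto
next
  case (Suc n)
  have Nsum: "(\<Sum>j<k. d j * x j) \<in> N" if "\<forall>j<k. d j \<in> D \<and> x j \<in> N" for d x :: "nat \<Rightarrow> 'a" and k
    using that by (induction k) (auto intro: N)
  obtain w c where w: "w \<in> W" "\<forall>j<Suc n. c j \<in> C" "w * v n - (\<Sum>j<Suc n. c j * v j) \<in> N"
    using Suc.prems by blast
  define w0 where "w0 = w - c n"
  have w0: "w0 \<in> W" "w0 \<in> D" "w0 * v n - (\<Sum>j<n. c j * v j) \<in> N"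
    using w W by (auto simp: w0_def algebra_simps)
  have "\<forall>i<n. \<exists>w\<in>W. \<exists>c. (\<forall>j<n. c j \<in> C) \<and> w * v i - (\<Sum>j<n. c j * v j) \<in> N"
  proof (intro allI impI)
    fix i assume "i < n"
    then obtain w' c' where w': "w' \<in> W" "\<forall>j<Suc n. c' j \<in> C" "w' * v i - (\<Sum>j<Suc n. c' j * v j) \<in> N"
      using Suc.prems by (meson less_Suc_eq)
    have "w0 * (w' * v i - (\<Sum>j<Suc n. c' j * v j)) + c' n * (w0 * v n - (\<Sum>j<n. c j * v j)) \<in> N"
      using w0 w' C(3) by (intro N) auto
    also have "w0 * (w' * v i - (\<Sum>j<Suc n. c' j * v j)) + c' n * (w0 * v n - (\<Sum>j<n. c j * v j)) =
       (w0 * w') * v i - (\<Sum>j<n. (w0 * c' j + c' n * c j) * v j)"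
      by (simp add: algebra_simps sum_distrib_left sum.distrib)
    finally show "\<exists>w\<in>W. \<exists>c. (\<forall>j<n. c j \<in> C) \<and> w * v i - (\<Sum>j<n. c j * v j) \<in> N"
      using w0 w w' W(2) C by (intro bexI[of _ "w0 * w'"] exI[of _ "\<lambda>j. w0 * c' j + c' n * c j"]) auto
  qed
  from Suc.IH[OF this] obtain w1 where w1: "w1 \<in> W" "\<forall>i<n. w1 * v i \<in> N" by blast
  have "(w1 * w0) * v n \<in> N"
  proof -
    have "w1 * (w0 * v n - (\<Sum>j<n. c j * v j)) + (\<Sum>j<n. c j * (w1 * v j)) \<in> N"
      using w0 w w1 W(4) C(3) by (intro N Nsum) auto
    then show ?thesis by (simp add: algebra_simps sum_distrib_left)
  qed
  moreover have "(w1 * w0) * v i \<in> N" if "i < n" for i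
    using N(3)[OF w0(2), of "w1 * v i"] w1 that by (simp add: algebra_simps)
  ultimately show ?case using W(2)[OF w1(1) w0(1)] by (metis less_Suc_eq)
qed

section \<open>Subrings and ideals as sets, with the operations of the ambient type class\<close>

locale comm_subring =
  fixes R :: "'a::comm_ring_1 set"
  assumes one_in[simp, intro]: "1 \<in> R"
    and add_in[simp, intro]: "a \<in> R \<Longrightarrow> b \<in> R \<Longrightarrow> a + b \<in> R"
    and uminus_in[simp, intro]: "a \<in> R \<Longrightarrow> - a \<in> R"
    and mult_in[simp, intro]: "a \<in> R \<Longrightarrow> b \<in> R \<Longrightarrow> a * b \<in> R"
begin

lemma zero_in[simp, intro]: "0 \<in> R"
  using add_in[OF one_in uminus_in[OF one_in]] by simp

lemma diff_in[simp, intro]: "a \<in> R \<Longrightarrow> b \<in> R \<Longrightarrow> a - b \<in> R"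
  using add_in[OF _ uminus_in, of a b] by simp

lemma sum_in: "(\<And>x. x \<in> A \<Longrightarrow> f x \<in> R) \<Longrightarrow> sum f A \<in> R"
  by (induction A rule: infinite_finite_induct) auto

lemma prod_in: "(\<And>x. x \<in> A \<Longrightarrow> f x \<in> R) \<Longrightarrow> prod f A \<in> R"
  by (induction A rule: infinite_finite_induct) auto

lemma power_in: "a \<in> R \<Longrightarrow> a ^ n \<in> R"
  by (induction n) auto

definition is_ideal :: "'a set \<Rightarrow> bool" where
  "is_ideal I \<longleftrightarrow> I \<subseteq> R \<and> 0 \<in> I \<and> (\<forall>a\<in>I. \<forall>b\<in>I. a + b \<in> I) \<and> (\<forall>r\<in>R. \<forall>a\<in>I. r * a \<in> I)"

lemma ideal_sub: "is_ideal I \<Longrightarrow> a \<in> I \<Longrightarrow> a \<in> R" by (auto simp: is_ideal_def)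
lemma ideal_zero: "is_ideal I \<Longrightarrow> 0 \<in> I" by (auto simp: is_ideal_def)
lemma ideal_add: "is_ideal I \<Longrightarrow> a \<in> I \<Longrightarrow> b \<in> I \<Longrightarrow> a + b \<in> I" by (auto simp: is_ideal_def)
lemma ideal_mult: "is_ideal I \<Longrightarrow> a \<in> I \<Longrightarrow> r \<in> R \<Longrightarrow> r * a \<in> I" by (auto simp: is_ideal_def)
lemma ideal_mult2: "is_ideal I \<Longrightarrow> a \<in> I \<Longrightarrow> r \<in> R \<Longrightarrow> a * r \<in> I"
  using ideal_mult by (simp add: mult.commute)
lemma ideal_uminus: "is_ideal I \<Longrightarrow> a \<in> I \<Longrightarrow> - a \<in> I"
  using ideal_mult[of I a "- 1"] by simp
lemma ideal_diff: "is_ideal I \<Longrightarrow> a \<in> I \<Longrightarrow> b \<in> I \<Longrightarrow> a - b \<in> I"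
  using ideal_add[OF _ _ ideal_uminus, of I a b] by simp
lemma ideal_sum: "is_ideal I \<Longrightarrow> (\<And>x. x \<in> A \<Longrightarrow> f x \<in> I) \<Longrightarrow> sum f A \<in> I"
  by (induction A rule: infinite_finite_induct) (auto intro: ideal_zero ideal_add)

lemmas ideal_rules = ideal_zero ideal_add ideal_mult ideal_mult2 ideal_uminus ideal_diff ideal_sub

lemma ideal_cancel: "is_ideal I \<Longrightarrow> a + b \<in> I \<Longrightarrow> a \<in> I \<Longrightarrow> b \<in> I"
  using ideal_diff[of I "a + b" a] by simp

definition ann :: "'a set \<Rightarrow> 'a \<Rightarrow> 'a set" where "ann I v = {x \<in> R. x * v \<in> I}"

lemma is_ideal_ann: "is_ideal I \<Longrightarrow> v \<in> R \<Longrightarrow> is_ideal (ann I v)"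
  unfolding is_ideal_def[of "ann I v"] unfolding ann_def
  by (auto simp: distrib_right mult.assoc intro: ideal_rules)

text \<open>Generators are indexed by an initial segment of the naturals, the form in which
  elimination consumes them.\<close>

definition finitely_generated :: "'a set \<Rightarrow> bool" where
  "finitely_generated I \<longleftrightarrow> (\<exists>n v. (\<forall>i<n::nat. v i \<in> I) \<and>
     (\<forall>x\<in>I. \<exists>c. (\<forall>i<n. c i \<in> R) \<and> x = (\<Sum>i<n. c i * v i)))"

end

locale noetherian_localized = comm_subring R for R :: "'a::comm_ring_1 set" +
  fixes P :: "'a set"
  assumes P_ideal: "is_ideal P" and one_notin_P: "1 \<notin> P"
    and P_prime: "a \<in> R \<Longrightarrow> b \<in> R \<Longrightarrow> a * b \<in> P \<Longrightarrow> a \<in> P \<or> b \<in> P"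
    and noetherian: "is_ideal I \<Longrightarrow> finitely_generated I"
begin

text \<open>Zorn's lemma. The union of a chain is an ideal with finitely many generators; these
  already lie in one member, which is therefore an upper bound.\<close>

lemma maximal_ideal_exists:
  assumes "\<A> \<noteq> {}" "\<And>I. I \<in> \<A> \<Longrightarrow> is_ideal I"
  shows "\<exists>I\<in>\<A>. \<forall>J\<in>\<A>. I \<subseteq> J \<longrightarrow> J = I"
proof (rule subset_Zorn)
  fix \<C> assume "subset.chain \<A> \<C>"
  then have ch: "\<C> \<subseteq> \<A>" "\<And>X Y. X \<in> \<C> \<Longrightarrow> Y \<in> \<C> \<Longrightarrow> X \<subseteq> Y \<or> Y \<subseteq> X"
    by (auto simp: subset.chain_def subset_chain_def)
  show "\<exists>U\<in>\<A>. \<forall>X\<in>\<C>. X \<subseteq> U"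
  proof (cases "\<C> = {}")
    case True
    then show ?thesis using assms(1) by auto
  next
    case False
    have id: "is_ideal X" if "X \<in> \<C>" for X using that ch assms by blast
    have "is_ideal (\<Union>\<C>)"
      unfolding is_ideal_def
    proof (intro conjI ballI)
      show "\<Union>\<C> \<subseteq> R" using id by (auto intro: ideal_sub)
      show "0 \<in> \<Union>\<C>" using id False by (auto intro: ideal_zero)
      fix a assume "a \<in> \<Union>\<C>"
      then obtain X where X: "X \<in> \<C>" "a \<in> X" by blast
      show "r * a \<in> \<Union>\<C>" if "r \<in> R" for r using X id that by (meson UnionI ideal_mult)
      fix b assume "b \<in> \<Union>\<C>"
      then obtain Y where Y: "Y \<in> \<C>" "b \<in> Y" by blast
      show "a + b \<in> \<Union>\<C>" using ch(2)[OF X(1) Y(1)] X Y id by (meson UnionI ideal_add subsetD)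
    qed
    then obtain n v where v: "\<forall>i<n::nat. v i \<in> \<Union>\<C>"
      "\<forall>x\<in>\<Union>\<C>. \<exists>c. (\<forall>i<n. c i \<in> R) \<and> x = (\<Sum>i<n. c i * v i)"
      using noetherian unfolding finitely_generated_def by blast
    have "\<exists>U\<in>\<C>. \<forall>i<n. v i \<in> U"
      using v(1)
    proof (induction n)
      case 0
      then show ?case using False by blast
    next
      case (Suc n)
      then obtain U V where "U \<in> \<C>" "\<forall>i<n. v i \<in> U" "V \<in> \<C>" "v n \<in> V" by (meson UnionE lessI less_SucI)
      then show ?case using ch(2)[of U V] by (metis less_Suc_eq subsetD)
    qed
    then obtain U where U: "U \<in> \<C>" "\<forall>i<n. v i \<in> U" by blast
    have "X \<subseteq> U" if X: "X \<in> \<C>" for X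
    proof
      fix x assume "x \<in> X"
      then obtain c where "\<forall>i<n. c i \<in> R" "x = (\<Sum>i<n. c i * v i)" using v(2) X by blast
      then show "x \<in> U" using U id by (auto intro!: ideal_sum ideal_mult)
    qed
    then show ?thesis using U ch by blast
  qed
qed

definition unit_den :: "'a set" where "unit_den = R - P"

lemma den_mult: "s \<in> unit_den \<Longrightarrow> t \<in> unit_den \<Longrightarrow> s * t \<in> unit_den"
  using P_prime by (auto simp: unit_den_def)
lemma den_one: "1 \<in> unit_den" using one_notin_P by (auto simp: unit_den_def)
lemma den_R: "s \<in> unit_den \<Longrightarrow> s \<in> R" by (auto simp: unit_den_def)
lemma den_diff: "s \<in> unit_den \<Longrightarrow> p \<in> P \<Longrightarrow> s - p \<in> unit_den"
  using ideal_add[OF P_ideal, of "s - p" p] ideal_sub[OF P_ideal] by (auto simp: unit_den_def)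

text \<open>Ideals of the localization at \<open>P\<close> are represented by their contractions to \<open>R\<close>.\<close>

definition lideal :: "'a set \<Rightarrow> bool" where
  "lideal I \<longleftrightarrow> is_ideal I \<and> (\<forall>s\<in>unit_den. \<forall>r\<in>R. s * r \<in> I \<longrightarrow> r \<in> I)"

text \<open>The contraction to \<open>R\<close> of the ideal that \<open>I\<close> and
  \<open>f\<close> generate in the localization. The factor \<open>s\<close> clears denominators, so
  the construction can be iterated without leaving \<open>R\<close>.\<close>

definition adj :: "'a set \<Rightarrow> 'a \<Rightarrow> 'a set" where
  "adj I f = {x \<in> R. \<exists>s\<in>unit_den. \<exists>i\<in>I. \<exists>r\<in>R. s * x = i + f * r}"

definition nzd :: "'a set \<Rightarrow> 'a \<Rightarrow> bool" where
  "nzd I f \<longleftrightarrow> f \<in> R \<and> (\<forall>r\<in>R. f * r \<in> I \<longrightarrow> r \<in> I)"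

text \<open>Membership of the entries in \<open>P\<close> takes the place of the properness clause
  of \<open>regular_seq\<close>.\<close>

fun reg :: "'a set \<Rightarrow> 'a list \<Rightarrow> bool" where
  "reg I [] \<longleftrightarrow> True"
| "reg I (f # fs) \<longleftrightarrow> f \<in> P \<and> nzd I f \<and> reg (adj I f) fs"

text \<open>Only primes inside \<open>P\<close> survive in the localization.\<close>

definition lprime :: "'a set \<Rightarrow> bool" where
  "lprime Q \<longleftrightarrow> is_ideal Q \<and> Q \<subseteq> P \<and> (\<forall>a\<in>R. \<forall>b\<in>R. a * b \<in> Q \<longrightarrow> a \<in> Q \<or> b \<in> Q)"

lemma lideal_ideal: "lideal I \<Longrightarrow> is_ideal I" by (simp add: lideal_def)
lemma lideal_cancel: "lideal I \<Longrightarrow> s \<in> unit_den \<Longrightarrow> r \<in> R \<Longrightarrow> s * r \<in> I \<Longrightarrow> r \<in> I"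
  by (auto simp: lideal_def)
lemma lprime_ideal: "lprime Q \<Longrightarrow> is_ideal Q" by (simp add: lprime_def)

lemma adjI: "x \<in> R \<Longrightarrow> s \<in> unit_den \<Longrightarrow> i \<in> I \<Longrightarrow> r \<in> R \<Longrightarrow> s * x = i + f * r \<Longrightarrow> x \<in> adj I f"
  unfolding adj_def by blast

lemma adjE:
  assumes "x \<in> adj I f"
  obtains s i r where "x \<in> R" "s \<in> unit_den" "i \<in> I" "r \<in> R" "s * x = i + f * r"
  using assms unfolding adj_def by blast

lemma lideal_adj:
  assumes I: "is_ideal I" and f: "f \<in> R"
  shows "lideal (adj I f)"
  unfolding lideal_def is_ideal_def
proof (intro conjI ballI impI)
  show "adj I f \<subseteq> R" by (auto simp: adj_def)
  show "0 \<in> adj I f" using den_one ideal_zero[OF I] by (intro adjI[of 0 1 0 I 0]) auto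
next
  fix a b assume "a \<in> adj I f" "b \<in> adj I f"
  then obtain s i r s' i' r' where *: "a \<in> R" "s \<in> unit_den" "i \<in> I" "r \<in> R" "s * a = i + f * r"
    "b \<in> R" "s' \<in> unit_den" "i' \<in> I" "r' \<in> R" "s' * b = i' + f * r'" by (metis adjE)
  have "(s * s') * (a + b) = s' * (s * a) + s * (s' * b)" by (simp add: algebra_simps)
  also have "\<dots> = (s' * i + s * i') + f * (s' * r + s * r')" unfolding * by (simp add: algebra_simps)
  finally show "a + b \<in> adj I f" using * I by (intro adjI[OF _ den_mult]) (auto intro: ideal_rules den_R)
next
  fix t a assume t: "t \<in> R" and "a \<in> adj I f"
  then obtain s i r where *: "a \<in> R" "s \<in> unit_den" "i \<in> I" "r \<in> R" "s * a = i + f * r" by (metis adjE)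
  have "s * (t * a) = t * (s * a)" by (simp add: algebra_simps)
  also have "\<dots> = t * i + f * (t * r)" unfolding * by (simp add: algebra_simps)
  finally show "t * a \<in> adj I f" using * I t by (intro adjI) (auto intro: ideal_rules)
next
  fix t a assume t: "t \<in> unit_den" "a \<in> R" and "t * a \<in> adj I f"
  then obtain s i r where *: "s \<in> unit_den" "i \<in> I" "r \<in> R" "s * (t * a) = i + f * r" by (metis adjE)
  then show "a \<in> adj I f" using t by (intro adjI[of a "s * t" i I r]) (auto intro: den_mult simp: mult.assoc)
qed

lemma adj_base: "is_ideal I \<Longrightarrow> x \<in> I \<Longrightarrow> x \<in> adj I f"
  using ideal_sub[of I x] den_one by (intro adjI[of x 1 x I 0]) auto

lemma adj_self: "is_ideal I \<Longrightarrow> f \<in> R \<Longrightarrow> r \<in> R \<Longrightarrow> f * r \<in> adj I f"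
  using den_one ideal_zero[of I] by (intro adjI[of "f * r" 1 0 I r]) auto

lemma lideal_not_one: "lideal I \<Longrightarrow> u \<in> R \<Longrightarrow> u \<notin> I \<Longrightarrow> x \<in> R \<Longrightarrow> x * u \<in> I \<Longrightarrow> x \<in> P"
  using lideal_cancel[of I x u] by (auto simp: unit_den_def)

text \<open>The hypothesis says that \<open>U\<close> is contained in \<open>P U + I\<close> up to
  denominators. Each generator of \<open>U\<close> thus yields a row of a linear system with pivot
  outside \<open>P\<close> and all other coefficients in \<open>P\<close>, which elimination
  solves.\<close>

lemma nakayama:
  assumes I: "lideal I" and U: "is_ideal U"
    and gen: "\<And>v. v \<in> U \<Longrightarrow> \<exists>s\<in>unit_den. \<exists>p\<in>P. \<exists>b\<in>U. s * v - p * b \<in> I"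
  shows "U \<subseteq> I"
proof -
  obtain n v where v: "\<forall>i<n::nat. v i \<in> U" "\<forall>x\<in>U. \<exists>c. (\<forall>i<n. c i \<in> R) \<and> x = (\<Sum>i<n. c i * v i)"
    using noetherian[OF U] unfolding finitely_generated_def by blast
  have "\<exists>w\<in>unit_den. \<forall>i<n. w * v i \<in> I"
  proof (rule nakayama_elimination[where C = P and D = R])
    show "\<forall>i<n. \<exists>w\<in>unit_den. \<exists>c. (\<forall>j<n. c j \<in> P) \<and> w * v i - (\<Sum>j<n. c j * v j) \<in> I"
    proof (intro allI impI)
      fix i assume "i < n"
      then obtain s p b where s: "s \<in> unit_den" "p \<in> P" "b \<in> U" "s * v i - p * b \<in> I"
        using gen v by blast
      obtain c where c: "\<forall>i<n. c i \<in> R" "b = (\<Sum>i<n. c i * v i)" using v s by blast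
      show "\<exists>w\<in>unit_den. \<exists>c. (\<forall>j<n. c j \<in> P) \<and> w * v i - (\<Sum>j<n. c j * v j) \<in> I"
        using s c P_ideal
        by (intro bexI[of _ s] exI[of _ "\<lambda>j. p * c j"])
          (auto simp: sum_distrib_left mult.assoc intro: ideal_rules)
    qed
  qed (use I P_ideal in \<open>auto intro: den_one den_mult den_diff den_R ideal_rules lideal_ideal\<close>)
  then obtain w where w: "w \<in> unit_den" "\<forall>i<n. w * v i \<in> I" by blast
  show ?thesis
  proof
    fix x assume "x \<in> U"
    then obtain c where c: "\<forall>i<n. c i \<in> R" "x = (\<Sum>i<n. c i * v i)" using v by blast
    have "w * x = (\<Sum>i<n. c i * (w * v i))" unfolding c by (simp add: sum_distrib_left algebra_simps)
    also have "\<dots> \<in> I" using c w by (intro ideal_sum[OF lideal_ideal[OF I]]) (auto intro: ideal_mult[OF lideal_ideal[OF I]])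
    finally show "x \<in> I" using lideal_cancel[OF I w(1)] U \<open>x \<in> U\<close> ideal_sub by blast
  qed
qed

section \<open>Maximal annihilators, prime avoidance, and elements killed by a whole ideal\<close>

definition maxann :: "'a set \<Rightarrow> 'a set \<Rightarrow> bool" where
  "maxann I Q \<longleftrightarrow> (\<exists>v\<in>R - I. Q = ann I v) \<and> (\<forall>w\<in>R - I. Q \<subseteq> ann I w \<longrightarrow> ann I w = Q)"

lemma maxann_exists:
  assumes I: "is_ideal I" and v: "v \<in> R" "v \<notin> I"
  shows "\<exists>Q. maxann I Q \<and> ann I v \<subseteq> Q"
proof -
  define \<A> where "\<A> = {J. \<exists>w\<in>R - I. J = ann I w \<and> ann I v \<subseteq> J}"
  have "\<A> \<noteq> {}" "\<And>J. J \<in> \<A> \<Longrightarrow> is_ideal J" using v is_ideal_ann[OF I] by (auto simp: \<A>_def)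
  then obtain X where X: "X \<in> \<A>" "\<forall>J\<in>\<A>. X \<subseteq> J \<longrightarrow> J = X" using maximal_ideal_exists by meson
  then obtain w where w: "w \<in> R - I" "X = ann I w" "ann I v \<subseteq> X" by (auto simp: \<A>_def)
  have "ann I w' = X" if "w' \<in> R - I" "X \<subseteq> ann I w'" for w'
  proof -
    have "ann I w' \<in> \<A>" using that w(3) unfolding \<A>_def by blast
    then show ?thesis using X(2) that by blast
  qed
  then have "maxann I X" using w unfolding maxann_def by blast
  then show ?thesis using w(3) by blast
qed

text \<open>If \<open>a * b\<close> kills \<open>v\<close> but \<open>b\<close> does not, then the
  annihilator of \<open>b * v\<close> contains \<open>Q\<close>, hence equals \<open>Q\<close> by
  maximality, and it contains \<open>a\<close>.\<close>

lemma maxann_lprime: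
  assumes I: "lideal I" and Q: "maxann I Q"
  shows "lprime Q"
proof -
  obtain v where v: "v \<in> R" "v \<notin> I" "Q = ann I v" using Q by (auto simp: maxann_def)
  have "a \<in> Q \<or> b \<in> Q" if ab: "a \<in> R" "b \<in> R" "a * b \<in> Q" for a b
  proof (rule disjCI)
    assume "b \<notin> Q"
    then have b: "b * v \<in> R - I" using v ab by (auto simp: ann_def)
    have "ann I v \<subseteq> ann I (b * v)"
      using v ab ideal_mult[OF lideal_ideal[OF I], of _ b] by (auto simp: ann_def mult.left_commute[of _ b])
    then have "ann I (b * v) = Q" using Q b v unfolding maxann_def by blast
    moreover have "a \<in> ann I (b * v)" using ab v by (auto simp: ann_def mult.assoc)
    ultimately show "a \<in> Q" by blast
  qed
  moreover have "Q \<subseteq> P" using lideal_not_one[OF I v(1,2)] v(3) by (auto simp: ann_def)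
  ultimately show ?thesis using is_ideal_ann[OF lideal_ideal[OF I] v(1)] v(3) by (auto simp: lprime_def)
qed

lemma lprime_sum:
  assumes "lprime Q" "finite A" "\<And>x. x \<in> A \<Longrightarrow> f x \<in> R" "prod f A \<in> Q"
  shows "\<exists>x\<in>A. f x \<in> Q"
  using assms(2-4)
proof (induction A rule: finite_induct)
  case empty
  then show ?case using assms(1) one_notin_P by (auto simp: lprime_def)
next
  case (insert x A)
  then have "f x \<in> Q \<or> prod f A \<in> Q" using assms(1) prod_in[of A f] by (auto simp: lprime_def)
  then show ?case using insert by auto
qed

text \<open>One witness \<open>w Q\<close> is chosen for every maximal annihilator; finitely many of
  them generate the ideal \<open>V\<close> spanned by all. If \<open>Q\<close> contained none of the
  corresponding finitely many \<open>Q'\<close>, a product of elements of the \<open>Q'\<close>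
  lying outside \<open>Q\<close> would kill \<open>w Q\<close>, against primality. So some
  \<open>Q'\<close> lies in \<open>Q\<close>, and maximality makes them equal.\<close>

lemma finite_maxann:
  assumes I: "lideal I"
  shows "finite {Q. maxann I Q}"
proof -
  note I' = lideal_ideal[OF I]
  define w where "w Q = (SOME v. v \<in> R - I \<and> Q = ann I v)" for Q
  have w: "w Q \<in> R - I \<and> Q = ann I (w Q)" if "maxann I Q" for Q
    unfolding w_def by (rule someI_ex) (use that in \<open>auto simp: maxann_def\<close>)
  have w_mem: "x \<in> Q \<longleftrightarrow> x \<in> R \<and> x * w Q \<in> I" if Q: "maxann I Q" for x Q
  proof -
    have "x \<in> Q \<longleftrightarrow> x \<in> ann I (w Q)"
      using w[OF Q] by (intro arg_cong[where f = "\<lambda>S. x \<in> S"]) blast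
    then show ?thesis by (simp only: ann_def mem_Collect_eq)
  qed
  define V where "V = {x. \<exists>F c. finite F \<and> (\<forall>Q\<in>F. maxann I Q \<and> c Q \<in> R) \<and> x = (\<Sum>Q\<in>F. c Q * w Q)}"
  have Vid: "is_ideal V"
    unfolding is_ideal_def
  proof (intro conjI ballI)
    show "V \<subseteq> R" using w by (auto simp: V_def intro!: sum_in)
    show "0 \<in> V" by (auto simp: V_def intro!: exI[of _ "{}"])
  next
    fix a b assume "a \<in> V" "b \<in> V"
    then obtain F c F' c' where *: "finite F" "\<forall>Q\<in>F. maxann I Q \<and> c Q \<in> R" "a = (\<Sum>Q\<in>F. c Q * w Q)"
      "finite F'" "\<forall>Q\<in>F'. maxann I Q \<and> c' Q \<in> R" "b = (\<Sum>Q\<in>F'. c' Q * w Q)"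
      unfolding V_def by blast
    have "a = (\<Sum>Q\<in>F \<union> F'. (if Q \<in> F then c Q else 0) * w Q)"
      unfolding *(3) using * by (intro sum.mono_neutral_cong_left) auto
    moreover have "b = (\<Sum>Q\<in>F \<union> F'. (if Q \<in> F' then c' Q else 0) * w Q)"
      unfolding *(6) using * by (intro sum.mono_neutral_cong_left) auto
    moreover define d where "d = (\<lambda>Q. (if Q \<in> F then c Q else 0) + (if Q \<in> F' then c' Q else 0))"
    ultimately have "a + b = (\<Sum>Q\<in>F \<union> F'. d Q * w Q)"
      by (simp add: sum.distrib distrib_right)
    moreover have "finite (F \<union> F')" "\<forall>Q\<in>F \<union> F'. maxann I Q \<and> d Q \<in> R"
      using * by (auto simp: d_def)
    ultimately have "finite (F \<union> F') \<and> (\<forall>Q\<in>F \<union> F'. maxann I Q \<and> d Q \<in> R) \<and>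
        a + b = (\<Sum>Q\<in>F \<union> F'. d Q * w Q)" by simp
    then have "\<exists>F c. finite F \<and> (\<forall>Q\<in>F. maxann I Q \<and> c Q \<in> R) \<and> a + b = (\<Sum>Q\<in>F. c Q * w Q)"
      by (intro exI)
    then show "a + b \<in> V" unfolding V_def by simp
  next
    fix r a assume r: "r \<in> R" and "a \<in> V"
    then obtain F c where *: "finite F" "\<forall>Q\<in>F. maxann I Q \<and> c Q \<in> R" "a = (\<Sum>Q\<in>F. c Q * w Q)"
      unfolding V_def by blast
    then have "finite F \<and> (\<forall>Q\<in>F. maxann I Q \<and> r * c Q \<in> R) \<and> r * a = (\<Sum>Q\<in>F. (r * c Q) * w Q)"
      using r by (auto simp: sum_distrib_left mult.assoc)
    then have "\<exists>F c. finite F \<and> (\<forall>Q\<in>F. maxann I Q \<and> c Q \<in> R) \<and> r * a = (\<Sum>Q\<in>F. c Q * w Q)"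
      by (intro exI[of _ F] exI[of _ "\<lambda>Q. r * c Q"])
    then show "r * a \<in> V" unfolding V_def by simp
  qed
  obtain n v where v: "\<forall>i<n::nat. v i \<in> V" "\<forall>x\<in>V. \<exists>c. (\<forall>i<n. c i \<in> R) \<and> x = (\<Sum>i<n. c i * v i)"
    using noetherian[OF Vid] unfolding finitely_generated_def by blast
  have "\<forall>i\<in>{..<n}. \<exists>F c. finite F \<and> (\<forall>Q\<in>F. maxann I Q \<and> c Q \<in> R) \<and> v i = (\<Sum>Q\<in>F. c Q * w Q)"
    using v(1) unfolding V_def by blast
  then obtain F c where F: "\<forall>i\<in>{..<n}. finite (F i) \<and> (\<forall>Q\<in>F i. maxann I Q \<and> c i Q \<in> R) \<and>
      v i = (\<Sum>Q\<in>F i. c i Q * w Q)" by metis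
  define FF where "FF = (\<Union>i<n. F i)"
  have FF: "finite FF" "\<And>Q. Q \<in> FF \<Longrightarrow> maxann I Q" using F by (auto simp: FF_def)
  have "Q \<in> FF" if Q: "maxann I Q" for Q
  proof -
    have "w Q \<in> V" unfolding V_def using w[OF Q] Q
      by (auto intro!: exI[of _ "{Q}"] exI[of _ "\<lambda>_. 1"])
    then obtain d where d: "\<forall>i<n. d i \<in> R" "w Q = (\<Sum>i<n. d i * v i)" using v(2) by blast
    have "\<exists>Q'\<in>FF. Q' \<subseteq> Q"
    proof (rule ccontr)
      assume "\<not> ?thesis"
      then have "\<forall>Q'\<in>FF. \<exists>x. x \<in> Q' \<and> x \<notin> Q" by blast
      then obtain x where x: "\<forall>Q'\<in>FF. x Q' \<in> Q' \<and> x Q' \<notin> Q" by metis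
      have xR: "x Q' \<in> R" if "Q' \<in> FF" for Q' using x that w_mem[OF FF(2)[OF that]] by blast
      have "prod x FF * (c i Q' * w Q') \<in> I" if "Q' \<in> FF" "c i Q' \<in> R" for i Q'
      proof -
        have "prod x FF = x Q' * prod x (FF - {Q'})" using FF(1) that by (simp add: prod.remove)
        moreover have "x Q' * w Q' \<in> I" using x that w_mem[OF FF(2)[OF that(1)]] by blast
        moreover have "prod x (FF - {Q'}) * c i Q' \<in> R" using xR that by (intro mult_in prod_in) auto
        ultimately show ?thesis using ideal_mult[OF I', of "x Q' * w Q'" "prod x (FF - {Q'}) * c i Q'"]
          by (simp add: algebra_simps)
      qed
      then have "prod x FF * v i \<in> I" if "i < n" for i
      proof -
        assume *: "\<And>Q' i. Q' \<in> FF \<Longrightarrow> c i Q' \<in> R \<Longrightarrow> prod x FF * (c i Q' * w Q') \<in> I"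
        have e: "v i = (\<Sum>Q\<in>F i. c i Q * w Q)" using F that by auto
        show ?thesis unfolding e sum_distrib_left
          by (rule ideal_sum[OF I' *]) (use F that FF_def in auto)
      qed
      then have "(\<Sum>i<n. d i * (prod x FF * v i)) \<in> I" using d by (intro ideal_sum[OF I']) (auto intro: ideal_mult[OF I'])
      also have "(\<Sum>i<n. d i * (prod x FF * v i)) = prod x FF * w Q"
        unfolding d(2) by (simp add: sum_distrib_left algebra_simps)
      finally have "prod x FF \<in> Q" using w_mem[OF Q] prod_in[of FF x] xR by blast
      then show False using lprime_sum[OF maxann_lprime[OF I Q] FF(1), of x] xR x by blast
    qed
    then obtain Q' where Q': "Q' \<in> FF" "Q' \<subseteq> Q" by blast
    have "w Q \<in> R - I" "Q = ann I (w Q)" using w[OF Q] by blast+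
    then have "Q = Q'" using FF(2)[OF Q'(1)] Q'(2) unfolding maxann_def by blast
    then show ?thesis using Q'(1) by blast
  qed
  then have "{Q. maxann I Q} \<subseteq> FF" by blast
  then show ?thesis using FF(1) by (rule finite_subset)
qed

text \<open>When the element \<open>x\<close> found so far falls into the new prime
  \<open>A\<close>, it is corrected by an element \<open>z\<close> that lies in \<open>Q\<close> and
  in all the other primes but not in \<open>A\<close>. Such a \<open>z\<close> exists because the
  primes are pairwise incomparable.\<close>

lemma prime_avoidance:
  assumes "finite \<A>" "\<And>A. A \<in> \<A> \<Longrightarrow> lprime A" "\<And>A B. A \<in> \<A> \<Longrightarrow> B \<in> \<A> \<Longrightarrow> A \<subseteq> B \<Longrightarrow> A = B"
    and Q: "is_ideal Q" "\<And>A. A \<in> \<A> \<Longrightarrow> \<not> Q \<subseteq> A"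
  shows "\<exists>x\<in>Q. \<forall>A\<in>\<A>. x \<notin> A"
  using assms(1-3,5)
proof (induction \<A> rule: finite_induct)
  case empty
  then show ?case using ideal_zero[OF Q(1)] by blast
next
  case (insert A \<A>)
  then obtain x where x: "x \<in> Q" "\<forall>B\<in>\<A>. x \<notin> B" by (metis insertCI)
  show ?case
  proof (cases "x \<in> A")
    case False
    then show ?thesis using x by blast
  next
    case True
    have A: "lprime A" using insert by blast
    obtain q where q: "q \<in> Q" "q \<notin> A" using insert.prems(3)[of A] by blast
    have "\<forall>B\<in>\<A>. \<exists>b. b \<in> B \<and> b \<notin> A"
      using insert.prems(2)[of _ A] insert.hyps by blast
    then obtain b where b: "\<forall>B\<in>\<A>. b B \<in> B \<and> b B \<notin> A" by metis
    have bR: "b B \<in> R" if "B \<in> \<A>" for B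
      using insert.prems(1)[of B] that b ideal_sub[OF lprime_ideal] by blast
    define z where "z = q * prod b \<A>"
    have pR: "prod b \<A> \<in> R" using bR by (rule prod_in)
    have zA: "z \<notin> A"
    proof
      assume "z \<in> A"
      then have "prod b \<A> \<in> A" using A q pR ideal_sub[OF Q(1) q(1)] unfolding z_def lprime_def by blast
      then show False using lprime_sum[OF A insert.hyps(1), of b] bR b by blast
    qed
    have zB: "z \<in> B" if "B \<in> \<A>" for B
    proof -
      have B: "is_ideal B" using insert.prems(1) that lprime_ideal by blast
      have "z = (q * prod b (\<A> - {B})) * b B" using insert.hyps(1) that by (simp add: z_def prod.remove algebra_simps)
      moreover have "q * prod b (\<A> - {B}) \<in> R" using q ideal_sub[OF Q(1)] bR by (intro mult_in prod_in) auto
      ultimately show ?thesis using ideal_mult[OF B, of "b B"] b that by simp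
    qed
    have "x + z \<in> Q" using x q pR Q(1) unfolding z_def by (auto intro: ideal_rules)
    moreover have "x + z \<notin> A" using True zA ideal_cancel[OF lprime_ideal[OF A]] by blast
    moreover have "x + z \<notin> B" if "B \<in> \<A>" for B
      using zB[OF that] x that ideal_cancel[OF lprime_ideal[of B], of z x] insert.prems(1)[of B] by (auto simp: add.commute)
    ultimately show ?thesis by blast
  qed
qed

text \<open>If no single element killed \<open>Q\<close>, then \<open>Q\<close> would lie in no
  maximal annihilator. By avoidance some \<open>x\<close> in \<open>Q\<close> would be outside all
  of them, and such an \<open>x\<close> is a nonzerodivisor modulo \<open>I\<close>.\<close>

lemma zero_divisors_ideal:
  assumes I: "lideal I" and Q: "is_ideal Q" and zd: "\<And>y. y \<in> Q \<Longrightarrow> \<not> nzd I y"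
  shows "\<exists>v\<in>R - I. \<forall>q\<in>Q. q * v \<in> I"
proof (rule ccontr)
  assume no: "\<not> ?thesis"
  have "\<exists>x\<in>Q. \<forall>A\<in>{Q. maxann I Q}. x \<notin> A"
  proof (rule prime_avoidance[OF finite_maxann[OF I]])
    fix A B assume "A \<in> {Q. maxann I Q}" "B \<in> {Q. maxann I Q}" "A \<subseteq> B"
    then obtain w where "w \<in> R - I" "B = ann I w" unfolding maxann_def by blast
    then show "A = B" using \<open>A \<in> _\<close> \<open>A \<subseteq> B\<close> unfolding maxann_def by blast
  next
    fix A assume "A \<in> {Q. maxann I Q}"
    then show "\<not> Q \<subseteq> A" using no by (auto simp: maxann_def ann_def)
  qed (use Q maxann_lprime[OF I] in auto)
  then obtain x where x: "x \<in> Q" "\<And>A. maxann I A \<Longrightarrow> x \<notin> A" by blast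
  then obtain v where v: "v \<in> R" "x * v \<in> I" "v \<notin> I" using zd[OF x(1)] ideal_sub[OF Q] by (auto simp: nzd_def)
  then obtain A where "maxann I A" "ann I v \<subseteq> A" using maxann_exists[OF lideal_ideal[OF I]] by blast
  then show False using x v ideal_sub[OF Q x(1)] by (auto simp: ann_def)
qed

text \<open>Let \<open>U\<close> be the ideal of elements killed by \<open>Q\<close> modulo
  \<open>I\<close>. If \<open>U\<close> were contained in \<open>adj I f\<close>, then
  \<open>s * v = i + f * r\<close> with \<open>v\<close> in \<open>U\<close> would give
  \<open>r\<close> in \<open>U\<close> by regularity of \<open>f\<close>. So \<open>U\<close> would
  be contained in \<open>f U + I\<close> up to denominators, and Nakayama would put
  \<open>U\<close>, and with it \<open>u\<close>, into \<open>I\<close>.\<close>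

lemma annihilated_step:
  assumes I: "lideal I" and f: "f \<in> P" "nzd I f" and Q: "is_ideal Q" and u: "u \<in> R" "u \<notin> I" "\<forall>q\<in>Q. q * u \<in> I"
  shows "\<exists>v\<in>R - adj I f. \<forall>q\<in>Q. q * v \<in> I"
proof (rule ccontr)
  assume no: "\<not> ?thesis"
  note I' = lideal_ideal[OF I]
  define U where "U = {v \<in> R. \<forall>q\<in>Q. q * v \<in> I}"
  have "is_ideal U"
    unfolding is_ideal_def U_def using I' by (auto simp: distrib_left mult.left_commute intro: ideal_rules)
  moreover have "\<exists>s\<in>unit_den. \<exists>p\<in>P. \<exists>b\<in>U. s * v - p * b \<in> I" if "v \<in> U" for v
  proof -
    have "v \<in> adj I f" using no that by (auto simp: U_def)
    then obtain s i r where *: "v \<in> R" "s \<in> unit_den" "i \<in> I" "r \<in> R" "s * v = i + f * r" by (metis adjE)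
    have "q * r \<in> I" if q: "q \<in> Q" for q
    proof -
      have "s * (q * v) = q * (s * v)" by (simp add: algebra_simps)
      then have "f * (q * r) = s * (q * v) - q * i" unfolding *(5) by (simp add: algebra_simps)
      moreover have "q * v \<in> I" using q \<open>v \<in> U\<close> by (auto simp: U_def)
      then have "s * (q * v) - q * i \<in> I"
        using ideal_diff[OF I' ideal_mult[OF I' _ den_R] ideal_mult[OF I']] * q ideal_sub[OF Q] by blast
      ultimately show ?thesis using f(2) q * ideal_sub[OF Q] by (auto simp: nzd_def)
    qed
    then have "r \<in> U" using * by (auto simp: U_def)
    moreover have "s * v - f * r \<in> I" using * by simp
    ultimately show ?thesis using * f by blast
  qed
  ultimately have "U \<subseteq> I" using nakayama[OF I] by blast
  then show False using u by (auto simp: U_def)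
qed

text \<open>A maximal annihilator above \<open>ann I v\<close> is prime and absorbs
  \<open>f\<close>, because \<open>f\<close> already kills \<open>v\<close>. This supplies the next
  link of the chains below.\<close>

lemma enlarge_prime:
  assumes I: "lideal I" and f: "f \<in> R" and Q: "is_ideal Q"
    and v: "v \<in> R" "v \<notin> I" "\<forall>q\<in>Q. q * v \<in> I" "f * v \<in> I"
  shows "\<exists>Q' w. lprime Q' \<and> Q \<subseteq> Q' \<and> f \<in> Q' \<and> w \<in> R \<and> w \<notin> I \<and> (\<forall>q\<in>Q'. q * w \<in> I)"
proof -
  obtain Q' where Q': "maxann I Q'" "ann I v \<subseteq> Q'" using maxann_exists[OF lideal_ideal[OF I] v(1,2)] by blast
  then obtain w where "w \<in> R - I" "Q' = ann I w" by (auto simp: maxann_def)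
  moreover have "Q \<subseteq> ann I v" "f \<in> ann I v" using v f ideal_sub[OF Q] by (auto simp: ann_def)
  ultimately show ?thesis using maxann_lprime[OF I Q'(1)] Q' by (auto simp: ann_def)
qed

section \<open>Chains of primes forced by a regular sequence\<close>

definition pchain :: "'a set list \<Rightarrow> bool" where
  "pchain Qs \<longleftrightarrow> sorted_wrt (\<subset>) Qs \<and> (\<forall>Q\<in>set Qs. lprime Q)"

lemma pchain_Cons: "lprime Q \<Longrightarrow> pchain (Q' # Qs) \<Longrightarrow> Q \<subset> Q' \<Longrightarrow> pchain (Q # Q' # Qs)"
  by (auto simp: pchain_def)

text \<open>An associated prime has dimension at least the depth. Passing from \<open>I\<close> to
  \<open>adj I f\<close> keeps \<open>Q\<close> annihilating something nonzero, and the enlarged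
  prime contains \<open>f\<close>, which is outside \<open>Q\<close> because it is a nonzerodivisor
  modulo \<open>I\<close>. So every entry of the sequence adds a strict inclusion.\<close>

lemma chain_of_annihilator:
  assumes "reg I fs" "lideal I" "lprime Q" "u \<in> R" "u \<notin> I" "\<forall>q\<in>Q. q * u \<in> I"
  shows "\<exists>Qs. length Qs = length fs \<and> pchain (Q # Qs)"
  using assms
proof (induction fs arbitrary: I Q u)
  case Nil
  then show ?case by (auto simp: pchain_def)
next
  case (Cons f fs)
  then have f: "f \<in> P" "nzd I f" "f \<in> R" by (auto simp: nzd_def)
  note I' = lideal_ideal[OF Cons.prems(2)]
  obtain v where v: "v \<in> R" "v \<notin> adj I f" "\<forall>q\<in>Q. q * v \<in> I"
    using annihilated_step[OF Cons.prems(2) f(1,2) lprime_ideal[OF Cons.prems(3)] Cons.prems(4-6)] by blast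
  have l: "lideal (adj I f)" using lideal_adj I' f by blast
  obtain Q' w where Q': "lprime Q'" "Q \<subseteq> Q'" "f \<in> Q'" "w \<in> R" "w \<notin> adj I f" "\<forall>q\<in>Q'. q * w \<in> adj I f"
    using enlarge_prime[OF l f(3) lprime_ideal[OF Cons.prems(3)] v(1,2)] v(3) adj_base[OF I'] adj_self[OF I' f(3) v(1)]
    by blast
  obtain Qs where Qs: "length Qs = length fs" "pchain (Q' # Qs)"
    using Cons.IH[OF _ l Q'(1,4,5,6)] Cons.prems(1) by auto
  have "f \<notin> Q" using Cons.prems(4-6) f(2) by (auto simp: nzd_def)
  then have "Q \<subset> Q'" using Q' by blast
  then show ?case using Qs pchain_Cons[OF Cons.prems(3) Qs(2)] by (intro exI[of _ "Q' # Qs"]) auto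
qed

lemma adj_commute:
  assumes I: "is_ideal I" and f: "f \<in> R" "g \<in> R"
  shows "adj (adj I f) g \<subseteq> adj (adj I g) f"
proof
  fix x assume "x \<in> adj (adj I f) g"
  then obtain s i r where 1: "x \<in> R" "s \<in> unit_den" "i \<in> adj I f" "r \<in> R" "s * x = i + g * r" by (metis adjE)
  then obtain s' i' r' where 2: "s' \<in> unit_den" "i' \<in> I" "r' \<in> R" "s' * i = i' + f * r'" by (metis adjE)
  have "(s' * s) * x = s' * (s * x)" by (simp add: mult.assoc)
  also have "\<dots> = s' * i + s' * (g * r)" unfolding 1 by (simp add: algebra_simps)
  also have "\<dots> = (i' + g * (s' * r)) + f * r'" unfolding 2 by (simp add: algebra_simps)
  finally have e: "(s' * s) * x = (i' + g * (s' * r)) + f * r'" .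
  have "i' + g * (s' * r) \<in> adj I g"
    by (rule adjI[OF _ den_one 2(2), of _ "s' * r"]) (use 1 2 f den_R ideal_sub[OF I 2(2)] in auto)
  then show "x \<in> adj (adj I g) f" by (rule adjI[OF 1(1) den_mult[OF 2(1) 1(2)] _ 2(3) e])
qed

text \<open>A prime associated to \<open>I + (y)\<close>, with \<open>y\<close> regular modulo
  \<open>I\<close>, has dimension at least the depth minus one. The given sequence has nothing to do
  with \<open>y\<close>, so \<open>y\<close> is exchanged for an element \<open>z\<close> of
  \<open>Q\<close> that is regular modulo the first entry \<open>f\<close>, and the annihilated
  element is carried along. The induction then continues modulo \<open>f\<close> with
  \<open>z\<close> in place of \<open>y\<close>.\<close>

lemma chain_of_quotient_annihilator:
  assumes "reg I fs" "fs \<noteq> []" "lideal I" "lprime Q" "y \<in> Q" "nzd I y"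
    "u \<in> R" "u \<notin> adj I y" "\<forall>q\<in>Q. q * u \<in> adj I y"
  shows "\<exists>Q' Qs. length Qs + 1 = length fs \<and> pchain (Q' # Qs) \<and> Q \<subseteq> Q'"
  using assms
proof (induction fs arbitrary: I Q y u)
  case Nil
  then show ?case by simp
next
  case (Cons f fs)
  note I = Cons.prems(3) and Q = Cons.prems(4) and yQ = Cons.prems(5) and ny = Cons.prems(6)
    and u = Cons.prems(7-9)
  have f: "f \<in> P" "nzd I f" "f \<in> R" "reg (adj I f) fs" using Cons.prems(1) by (auto simp: nzd_def)
  note I' = lideal_ideal[OF I] and Q' = lprime_ideal[OF Q]
  have l: "lideal (adj I f)" using lideal_adj I' f by blast
  have QR: "q \<in> Q \<Longrightarrow> q \<in> R" for q using ideal_sub[OF Q'] .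
  show ?case
  proof (cases "fs = []")
    case True
    then show ?thesis using Q by (intro exI[of _ Q] exI[of _ "[]"]) (auto simp: pchain_def)
  next
    case ne: False
    show ?thesis
    proof (cases "\<exists>v\<in>R - adj I f. \<forall>q\<in>Q. q * v \<in> adj I f")
      case True
      then obtain Qs where "length Qs = length fs" "pchain (Q # Qs)"
        using chain_of_annihilator[OF f(4) l Q] by blast
      then show ?thesis by auto
    next
      case False
      \<comment> \<open>If \<open>Q\<close> consisted of zero divisors modulo \<open>f\<close>, the
        previous lemma would apply to the remaining sequence. Otherwise \<open>Q\<close> contains an
        element that is regular modulo \<open>f\<close>.\<close>
      then obtain z where z: "z \<in> Q" "nzd (adj I f) z" using zero_divisors_ideal[OF l Q'] by blast
      note zR = QR[OF z(1)] and yR = QR[OF yQ]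
      \<comment> \<open>The elements \<open>T\<close> killed by \<open>z\<close> modulo
        \<open>I\<close> satisfy \<open>T \<subseteq> f T + I\<close> up to denominators, because
        \<open>z\<close> is regular modulo \<open>f\<close> and \<open>f\<close> is regular modulo
        \<open>I\<close>; Nakayama applies.\<close>
      have nz: "nzd I z"
      proof -
        define T where "T = {t \<in> R. z * t \<in> I}"
        have "is_ideal T" unfolding is_ideal_def T_def using I' zR
          by (auto simp: distrib_left mult.left_commute[of z] intro: ideal_rules)
        moreover have "\<exists>s\<in>unit_den. \<exists>p\<in>P. \<exists>b\<in>T. s * t - p * b \<in> I" if t: "t \<in> T" for t
        proof -
          have "z * t \<in> adj I f" "t \<in> R" using t adj_base[OF I'] by (auto simp: T_def)
          then have "t \<in> adj I f" using z by (auto simp: nzd_def)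
          then obtain s i r where *: "s \<in> unit_den" "i \<in> I" "r \<in> R" "s * t = i + f * r" by (metis adjE)
          have "f * (z * r) = s * (z * t) - z * i"
          proof -
            have "s * (z * t) = z * (s * t)" by (simp add: algebra_simps)
            then show ?thesis unfolding *(4) by (simp add: algebra_simps)
          qed
          moreover have "z * t \<in> I" using t by (simp add: T_def)
          then have "s * (z * t) - z * i \<in> I"
            using ideal_diff[OF I' ideal_mult[OF I' _ den_R] ideal_mult[OF I']] * zR by blast
          ultimately have "r \<in> T" using f(2) * zR by (auto simp: T_def nzd_def)
          moreover have "s * t - f * r \<in> I" using * by simp
          ultimately show ?thesis using * f by blast
        qed
        ultimately have "T \<subseteq> I" using nakayama[OF I] by blast
        then show ?thesis using zR by (auto simp: nzd_def T_def)
      qed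
      have lz: "lideal (adj I z)" using lideal_adj I' zR by blast
      \<comment> \<open>Interchange of the regular sequence \<open>f\<close>, \<open>z\<close>: from
        \<open>f * t = z * c\<close> modulo \<open>I\<close> the factor \<open>c\<close> is a
        multiple of \<open>f\<close> modulo \<open>I\<close>, and then \<open>f\<close>
        cancels.\<close>
      have nf: "nzd (adj I z) f"
        unfolding nzd_def
      proof (intro conjI ballI impI)
        fix t assume t: "t \<in> R" "f * t \<in> adj I z"
        then obtain s i c where *: "s \<in> unit_den" "i \<in> I" "c \<in> R" "s * (f * t) = i + z * c" by (metis adjE)
        have "z * c = - i + f * (s * t)" using *(4) by (simp add: algebra_simps)
        moreover have "z * c \<in> R" "s * t \<in> R" using * t zR den_R[of s] by auto
        ultimately have "z * c \<in> adj I f"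
          using adjI[OF _ den_one ideal_uminus[OF I' *(2)], of "z * c" "s * t" f] by simp
        then have "c \<in> adj I f" using z * by (auto simp: nzd_def)
        then obtain s' i' c' where **: "s' \<in> unit_den" "i' \<in> I" "c' \<in> R" "s' * c = i' + f * c'" by (metis adjE)
        have "f * (s' * s * t - z * c') = s' * (s * (f * t)) - z * (f * c')" by (simp add: algebra_simps)
        also have "\<dots> = s' * i + z * (s' * c) - z * (f * c')" unfolding *(4) by (simp add: algebra_simps)
        also have "\<dots> = s' * i + z * i'" unfolding **(4) by (simp add: algebra_simps)
        finally have "f * (s' * s * t - z * c') = s' * i + z * i'" .
        then have "f * (s' * s * t - z * c') \<in> I"
          using ideal_add[OF I' ideal_mult[OF I' *(2) den_R[OF **(1)]] ideal_mult[OF I' **(2) zR]] by simp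
        moreover have "s' * s * t - z * c' \<in> R" using * ** t zR den_R[of s] den_R[of s'] by auto
        ultimately have k: "s' * s * t - z * c' \<in> I" using f(2) by (auto simp: nzd_def)
        show "t \<in> adj I z" by (rule adjI[OF t(1) den_mult[OF **(1) *(1)] k **(3)]) simp
      qed (use f in auto)
      \<comment> \<open>The relation \<open>z * u = y * u'\<close>, up to a denominator and modulo
        \<open>I\<close>, defines the substitute for \<open>u\<close>. It is nonzero modulo
        \<open>z\<close> because \<open>z\<close> is regular modulo \<open>I\<close>, and
        \<open>Q\<close> kills it modulo \<open>z\<close> because \<open>y\<close> is regular modulo
        \<open>I\<close>.\<close>
      have "z * u \<in> adj I y" using u z by blast
      then obtain s i u' where su: "s \<in> unit_den" "i \<in> I" "u' \<in> R" "s * (z * u) = i + y * u'" by (metis adjE)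
      have u'1: "u' \<notin> adj I z"
      proof
        assume "u' \<in> adj I z"
        then obtain s' i' c where *: "s' \<in> unit_den" "i' \<in> I" "c \<in> R" "s' * u' = i' + z * c" by (metis adjE)
        have "z * (s' * s * u - y * c) = s' * (s * (z * u)) - y * (z * c)" by (simp add: algebra_simps)
        also have "\<dots> = s' * i + y * (s' * u') - y * (z * c)" unfolding su(4) by (simp add: algebra_simps)
        also have "\<dots> = s' * i + y * i'" unfolding *(4) by (simp add: algebra_simps)
        finally have "z * (s' * s * u - y * c) = s' * i + y * i'" .
        then have "z * (s' * s * u - y * c) \<in> I"
          using ideal_add[OF I' ideal_mult[OF I' su(2) den_R[OF *(1)]] ideal_mult[OF I' *(2) yR]] by simp
        moreover have "s' * s * u - y * c \<in> R" using * su(1) u(1) yR den_R[of s] den_R[of s'] by auto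
        ultimately have k: "s' * s * u - y * c \<in> I" using nz by (auto simp: nzd_def)
        have "u \<in> adj I y" by (rule adjI[OF u(1) den_mult[OF *(1) su(1)] k *(3)]) simp
        then show False using u by blast
      qed
      have u'2: "q * u' \<in> adj I z" if q: "q \<in> Q" for q
      proof -
        obtain s' i' b where *: "s' \<in> unit_den" "i' \<in> I" "b \<in> R" "s' * (q * u) = i' + y * b"
          using u(3) q by (metis adjE)
        have "y * (s' * (q * u') - s * (z * b)) = s' * (q * (y * u')) - s * (z * (y * b))" by (simp add: algebra_simps)
        also have "\<dots> = s' * (q * (s * (z * u) - i)) - s * (z * (y * b))" using su(4) by simp
        also have "\<dots> = s * (z * (s' * (q * u))) - s' * (q * i) - s * (z * (y * b))" by (simp add: algebra_simps)
        also have "\<dots> = s * (z * i') - s' * (q * i)" unfolding *(4) by (simp add: algebra_simps)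
        finally have "y * (s' * (q * u') - s * (z * b)) = s * (z * i') - s' * (q * i)" .
        moreover have "s * (z * i') \<in> I" by (rule ideal_mult[OF I' ideal_mult[OF I' *(2) zR] den_R[OF su(1)]])
        moreover have "s' * (q * i) \<in> I" by (rule ideal_mult[OF I' ideal_mult[OF I' su(2) QR[OF q]] den_R[OF *(1)]])
        ultimately have "y * (s' * (q * u') - s * (z * b)) \<in> I" using ideal_diff[OF I'] by simp
        moreover have R: "q * u' \<in> R" "s * b \<in> R" using * su QR[OF q] den_R[of s] by auto
        moreover have "s' * (q * u') - s * (z * b) \<in> R" using * su zR R den_R[of s] den_R[of s'] by auto
        ultimately have k: "s' * (q * u') - s * (z * b) \<in> I" using ny by (auto simp: nzd_def)
        show ?thesis by (rule adjI[OF R(1) *(1) k R(2)]) (simp add: algebra_simps)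
      qed
      obtain v where v: "v \<in> R" "v \<notin> adj (adj I z) f" "\<forall>q\<in>Q. q * v \<in> adj I z"
        using annihilated_step[OF lz f(1) nf Q' su(3) u'1] u'2 by (metis DiffE)
      have sub: "adj (adj I z) f \<subseteq> adj (adj I f) z" "adj (adj I f) z \<subseteq> adj (adj I z) f"
        using adj_commute[OF I'] zR f by auto
      have lzf: "lideal (adj (adj I f) z)" using lideal_adj lideal_ideal[OF l] zR by blast
      have 1: "\<forall>q\<in>Q. q * v \<in> adj (adj I f) z"
        using subsetD[OF sub(1) adj_base[OF lideal_ideal[OF lz]]] v(3) by simp
      have 2: "f * v \<in> adj (adj I f) z"
        by (rule subsetD[OF sub(1) adj_self[OF lideal_ideal[OF lz] f(3) v(1)]])
      have 3: "v \<notin> adj (adj I f) z" using v(2) subsetD[OF sub(2)] by metis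
      from enlarge_prime[OF lzf f(3) Q' v(1) 3 1 2]
      obtain Q1 w where Q1: "lprime Q1" "Q \<subseteq> Q1" "f \<in> Q1" "w \<in> R" "w \<notin> adj (adj I f) z"
        "\<forall>q\<in>Q1. q * w \<in> adj (adj I f) z" by (elim exE conjE)
      from Cons.IH[OF f(4) ne l Q1(1) subsetD[OF Q1(2) z(1)] z(2) Q1(4,5,6)]
      obtain Q2 Qs where Q2: "length Qs + 1 = length fs" "pchain (Q2 # Qs)" "Q1 \<subseteq> Q2"
        by (elim exE conjE)
      \<comment> \<open>\<open>Q\<close> kills the nonzero class of \<open>u'\<close> modulo
        \<open>z\<close>, whereas \<open>f\<close> is regular modulo \<open>z\<close>. Hence the
        inclusion of \<open>Q\<close> in the first prime of the new chain is strict.\<close>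
      have "f \<notin> Q"
      proof
        assume "f \<in> Q"
        then have "f * u' \<in> adj I z" using u'2 by blast
        then show False using nf u'1 su by (auto simp: nzd_def)
      qed
      then have "Q \<subset> Q2" using Q1 Q2 by blast
      then show ?thesis using Q2 pchain_Cons[OF Q Q2(2)] by (intro exI[of _ Q] exI[of _ "Q2 # Qs"]) auto
    qed
  qed
qed

end

section \<open>Translation between \<open>ring_of_fractions\<close> and saturated ideals of the base
  ring\<close>

lemma UN_pairs_const:
  assumes "X \<noteq> {}" "Y \<noteq> {}" "\<And>u v u' v'. (u, v) \<in> X \<Longrightarrow> (u', v') \<in> Y \<Longrightarrow> F u v u' v' = C"
  shows "(\<Union>(u, v)\<in>X. \<Union>(u', v')\<in>Y. F u v u' v') = C"
proof (rule SUP_eq_const[OF assms(1)])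
  fix p assume "p \<in> X"
  then obtain u v where p: "p = (u, v)" "(u, v) \<in> X" by (cases p) auto
  have "(\<Union>(u', v')\<in>Y. F u v u' v') = C"
    by (rule SUP_eq_const[OF assms(2)]) (use assms(3) p in auto)
  then show "(case p of (u, v) \<Rightarrow> \<Union>(u', v')\<in>Y. F u v u' v') = C" using p by simp
qed

text \<open>Bridges the two styles of algebra: a subset of a type-class ring becomes a record, and
  \<open>semigroup_ring\<close> is such a record.\<close>

definition ring_on :: "'a::comm_ring_1 set \<Rightarrow> 'a ring" where
  "ring_on R = \<lparr>carrier = R, mult = (*), one = 1, zero = 0, add = (+)\<rparr>"

lemma ring_on_simps [simp]:
  "carrier (ring_on R) = R" "x \<otimes>\<^bsub>ring_on R\<^esub> y = x * y" "\<one>\<^bsub>ring_on R\<^esub> = 1"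
  "\<zero>\<^bsub>ring_on R\<^esub> = 0" "x \<oplus>\<^bsub>ring_on R\<^esub> y = x + y"
  by (simp_all add: ring_on_def)

lemma semigroup_ring_eq: "semigroup_ring K S = ring_on {f. Poly_Mapping.keys f \<subseteq> S}"
  by (simp add: semigroup_ring_def ring_on_def)

context comm_subring
begin

lemma cring_ring_on: "cring (ring_on R)"
proof (rule cringI)
  show "abelian_group (ring_on R)"
    by (rule abelian_groupI) (auto simp: algebra_simps intro!: bexI[of _ "- x" for x])
  show "comm_monoid (ring_on R)"
    by (rule comm_monoidI) (auto simp: algebra_simps)
qed (auto simp: algebra_simps)

lemma ring_on_a_inv: "x \<in> R \<Longrightarrow> \<ominus>\<^bsub>ring_on R\<^esub> x = - x"
proof -
  assume x: "x \<in> R"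
  interpret cring "ring_on R" by (rule cring_ring_on)
  show ?thesis using x minus_equality[of "- x" x] by simp
qed

lemma ring_on_minus: "x \<in> R \<Longrightarrow> y \<in> R \<Longrightarrow> x \<ominus>\<^bsub>ring_on R\<^esub> y = x - y"
  by (simp add: a_minus_def ring_on_a_inv)

lemma ideal_ring_on: "ideal I (ring_on R) \<longleftrightarrow> is_ideal I"
proof
  assume I: "ideal I (ring_on R)"
  interpret ideal I "ring_on R" by (rule I)
  show "is_ideal I"
    unfolding is_ideal_def
    using a_subset I_l_closed additive_subgroup.a_closed[OF ideal.axioms(1)[OF I]]
      additive_subgroup.zero_closed[OF ideal.axioms(1)[OF I]] by auto
next
  assume I: "is_ideal I"
  show "ideal I (ring_on R)"
  proof (rule idealI)
    show "ring (ring_on R)" using cring_ring_on by (rule cring.axioms)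
    show "subgroup I (add_monoid (ring_on R))"
    proof
      show "inv\<^bsub>add_monoid (ring_on R)\<^esub> x \<in> I" if "x \<in> I" for x
        using that ring_on_a_inv[OF ideal_sub[OF I that]] ideal_uminus[OF I that] by (simp add: a_inv_def)
    qed (use I in \<open>auto intro: ideal_rules\<close>)
  qed (use I in \<open>auto intro: ideal_rules\<close>)
qed

text \<open>The combinations \<open>J\<close> of a finite generating set form an ideal, so the
  generated ideal \<open>I\<close> is contained in \<open>J\<close> and every element of
  \<open>I\<close> has explicit coefficients.\<close>

lemma genideal_ring_on:
  assumes "noetherian_ring (ring_on R)" "is_ideal I"
  shows "finitely_generated I"
proof -
  interpret cring "ring_on R" by (rule cring_ring_on)
  obtain A where A: "A \<subseteq> R" "finite A" "I = Idl\<^bsub>ring_on R\<^esub> A"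
    using noetherian_ring.finetely_gen[OF assms(1)] assms(2) by (auto simp: ideal_ring_on)
  obtain v and n :: nat where v: "A = v ` {i. i < n}" using finite_imp_nat_seg_image_inj_on[OF A(2)] by metis
  have AI: "A \<subseteq> I" using genideal_self[of A] A by simp
  define J where "J = {x. \<exists>c. (\<forall>i<n. c i \<in> R) \<and> x = (\<Sum>i<n. c i * v i)}"
  have vR: "v i \<in> R" if "i < n" for i using v A(1) that by auto
  have "is_ideal J"
    unfolding is_ideal_def
  proof (intro conjI ballI)
    show "J \<subseteq> R" using vR by (auto simp: J_def intro!: sum_in)
    show "0 \<in> J" by (auto simp: J_def intro!: exI[of _ "\<lambda>_. 0"])
  next
    fix a b assume "a \<in> J" "b \<in> J"
    then obtain c d where "\<forall>i<n. c i \<in> R" "a = (\<Sum>i<n. c i * v i)" "\<forall>i<n. d i \<in> R" "b = (\<Sum>i<n. d i * v i)"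
      by (auto simp: J_def)
    then show "a + b \<in> J" by (auto simp: J_def distrib_right sum.distrib intro!: exI[of _ "\<lambda>i. c i + d i"])
  next
    fix r a assume "r \<in> R" "a \<in> J"
    then obtain c where "\<forall>i<n. c i \<in> R" "a = (\<Sum>i<n. c i * v i)" by (auto simp: J_def)
    then show "r * a \<in> J" using \<open>r \<in> R\<close>
      by (auto simp: J_def sum_distrib_left mult.assoc intro!: exI[of _ "\<lambda>i. r * c i"])
  qed
  moreover have "A \<subseteq> J"
  proof
    fix x assume "x \<in> A"
    then obtain k where k: "k < n" "x = v k" using v by auto
    then have "x = (\<Sum>i<n. (if i = k then 1 else 0) * v i)" by (simp add: if_distrib if_distribR cong: if_cong)
    then show "x \<in> J" unfolding J_def by (auto intro!: exI[of _ "\<lambda>i. if i = k then 1 else 0"])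
  qed
  ultimately have "I \<subseteq> J" using genideal_minimal[of J A] A(3) by (simp add: ideal_ring_on)
  then show ?thesis unfolding finitely_generated_def J_def using AI v by blast
qed

end

text \<open>The assumption \<open>local_A\<close> is supplied by
  \<open>cohen_macaulay_local\<close>. It yields the ring axioms of the localization, so they need
  not be derived from the calculus of fractions, and it makes \<open>max_ideal\<close> well
  determined.\<close>

locale localized_domain = noetherian_localized R P for R P :: "'a::comm_ring_1 set" +
  assumes domain: "a \<in> R \<Longrightarrow> b \<in> R \<Longrightarrow> a * b = 0 \<Longrightarrow> a = 0 \<or> b = 0"
    and local_A: "local_ring (localization_at (ring_on R) P)"
begin

abbreviation "A \<equiv> localization_at (ring_on R) P"

definition fr :: "'a \<Rightarrow> 'a \<Rightarrow> ('a \<times> 'a) set" where "fr r s = loc_rel (ring_on R) unit_den `` {(r, s)}"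

lemma den_nonzero: "s \<in> unit_den \<Longrightarrow> s \<noteq> 0"
  using ideal_zero[OF P_ideal] by (auto simp: unit_den_def)

text \<open>In a domain the auxiliary factor \<open>t\<close> of the equivalence of fractions
  cancels, since 0 is not a denominator.\<close>

lemma loc_rel_eq: "loc_rel (ring_on R) unit_den =
    {((r, s), (r', s')). r \<in> R \<and> s \<in> unit_den \<and> r' \<in> R \<and> s' \<in> unit_den \<and> s' * r = s * r'}"
proof -
  have "s' * r = s * r'"
    if "r \<in> R" "s \<in> unit_den" "r' \<in> R" "s' \<in> unit_den" "t \<in> unit_den" "t * (s' * r - s * r') = 0" for r s r' s' t
  proof -
    have "s' * r - s * r' \<in> R" "t \<in> R" using that den_R by auto
    then have "s' * r - s * r' = 0" using domain[of t "s' * r - s * r'"] that den_nonzero by blast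
    then show ?thesis by simp
  qed
  note cancel = this
  show ?thesis
    unfolding loc_rel_def using den_one
    by (auto simp: ring_on_minus den_R intro: cancel intro!: bexI[of _ 1])
qed

lemma equiv_loc_rel: "equiv (R \<times> unit_den) (loc_rel (ring_on R) unit_den)"
proof (rule equivI)
  show "refl_on (R \<times> unit_den) (loc_rel (ring_on R) unit_den)"
    by (auto simp: refl_on_def loc_rel_eq)
  show "loc_rel (ring_on R) unit_den \<subseteq> (R \<times> unit_den) \<times> R \<times> unit_den"
    by (auto simp: loc_rel_eq)
  show "sym (loc_rel (ring_on R) unit_den)" by (auto simp: sym_def loc_rel_eq)
  show "trans (loc_rel (ring_on R) unit_den)"
  proof (rule transI, clarify)
    fix r s r' s' r'' s''
    assume "((r, s), (r', s')) \<in> loc_rel (ring_on R) unit_den" "((r', s'), (r'', s'')) \<in> loc_rel (ring_on R) unit_den"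
    then have *: "r \<in> R" "s \<in> unit_den" "r' \<in> R" "s' \<in> unit_den" "s' * r = s * r'" "r'' \<in> R" "s'' \<in> unit_den"
      "s'' * r' = s' * r''" by (auto simp: loc_rel_eq)
    have "s' * (s'' * r - s * r'') = s'' * (s' * r) - s * (s' * r'')" by (simp add: algebra_simps)
    also have "\<dots> = s'' * (s * r') - s * (s'' * r')" unfolding *(5,8) ..
    also have "\<dots> = 0" by (simp add: algebra_simps)
    finally have "s' * (s'' * r - s * r'') = 0" .
    moreover have "s' \<in> R" "s'' * r - s * r'' \<in> R" using * den_R by auto
    ultimately have "s'' * r - s * r'' = 0" using domain[of s' "s'' * r - s * r''"] den_nonzero[OF *(4)] by blast
    then show "((r, s), (r'', s'')) \<in> loc_rel (ring_on R) unit_den" using * by (auto simp: loc_rel_eq)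
  qed
qed

lemma fr_eq: "r \<in> R \<Longrightarrow> s \<in> unit_den \<Longrightarrow> r' \<in> R \<Longrightarrow> s' \<in> unit_den \<Longrightarrow> fr r s = fr r' s' \<longleftrightarrow> s' * r = s * r'"
  unfolding fr_def using eq_equiv_class_iff[OF equiv_loc_rel, of "(r, s)" "(r', s')"] by (simp add: loc_rel_eq)

lemma A_def': "A = ring_of_fractions (ring_on R) unit_den"
  by (simp add: localization_at_def unit_den_def)

lemma carrier_A: "carrier A = {fr r s |r s. r \<in> R \<and> s \<in> unit_den}"
  unfolding A_def' ring_of_fractions_def by (auto simp: quotient_def fr_def)

lemma fr_carrier [simp, intro]: "r \<in> R \<Longrightarrow> s \<in> unit_den \<Longrightarrow> fr r s \<in> carrier A"
  unfolding carrier_A by blast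

lemma fr_mult:
  assumes "r \<in> R" "s \<in> unit_den" "r' \<in> R" "s' \<in> unit_den"
  shows "fr r s \<otimes>\<^bsub>A\<^esub> fr r' s' = fr (r * r') (s * s')"
proof -
  have "(\<Union>(r, s)\<in>fr r s. \<Union>(r', s')\<in>fr r' s'. fr (r * r') (s * s')) = fr (r * r') (s * s')"
  \<comment> \<open>Multiplication of classes is a union over all pairs of representatives. It
    collapses to a single class once independence of the representatives is shown; addition is
    treated likewise.\<close>
  proof (rule UN_pairs_const)
    show "fr r s \<noteq> {}" "fr r' s' \<noteq> {}" using assms by (auto simp: fr_def loc_rel_eq)
    have "fr (u * u') (v * v') = fr (r * r') (s * s')" if "(u, v) \<in> fr r s" "(u', v') \<in> fr r' s'" for u v u' v'
    proof -
      have *: "u \<in> R" "v \<in> unit_den" "v * r = s * u" "u' \<in> R" "v' \<in> unit_den" "v' * r' = s' * u'"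
        using that unfolding fr_def loc_rel_eq by auto
      have "(s * s') * (u * u') = (s * u) * (s' * u')" by (simp add: algebra_simps)
      also have "\<dots> = (v * v') * (r * r')" unfolding *(3,6)[symmetric] by (simp add: algebra_simps)
      finally show ?thesis using * assms den_mult by (subst fr_eq) auto
    qed
    then show "fr (u * u') (v * v') = fr (r * r') (s * s')" if "(u, v) \<in> fr r s" "(u', v') \<in> fr r' s'" for u v u' v'
      using that by blast
  qed
  then show ?thesis unfolding A_def' ring_of_fractions_def by (simp add: fr_def)
qed

lemma fr_add:
  assumes "r \<in> R" "s \<in> unit_den" "r' \<in> R" "s' \<in> unit_den"
  shows "fr r s \<oplus>\<^bsub>A\<^esub> fr r' s' = fr (s' * r + s * r') (s * s')"
proof -
  have "(\<Union>(r, s)\<in>fr r s. \<Union>(r', s')\<in>fr r' s'. fr (s' * r + s * r') (s * s')) = fr (s' * r + s * r') (s * s')"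
  proof (rule UN_pairs_const)
    show "fr r s \<noteq> {}" "fr r' s' \<noteq> {}" using assms by (auto simp: fr_def loc_rel_eq)
    have "fr (v' * u + v * u') (v * v') = fr (s' * r + s * r') (s * s')"
      if "(u, v) \<in> fr r s" "(u', v') \<in> fr r' s'" for u v u' v'
    proof -
      have *: "u \<in> R" "v \<in> unit_den" "v * r = s * u" "u' \<in> R" "v' \<in> unit_den" "v' * r' = s' * u'"
        using that unfolding fr_def loc_rel_eq by auto
      have "(s * s') * (v' * u + v * u') = s' * v' * (s * u) + s * v * (s' * u')" by (simp add: algebra_simps)
      also have "\<dots> = (v * v') * (s' * r + s * r')" unfolding *(3,6)[symmetric] by (simp add: algebra_simps)
      finally show ?thesis using * assms den_mult den_R by (subst fr_eq) auto
    qed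
    then show "fr (v' * u + v * u') (v * v') = fr (s' * r + s * r') (s * s')" if "(u, v) \<in> fr r s" "(u', v') \<in> fr r' s'" for u v u' v'
      using that by blast
  qed
  then show ?thesis unfolding A_def' ring_of_fractions_def by (simp add: fr_def)
qed

lemma fr_one: "\<one>\<^bsub>A\<^esub> = fr 1 1" and fr_zero: "\<zero>\<^bsub>A\<^esub> = fr 0 1"
  unfolding A_def' ring_of_fractions_def by (simp_all add: fr_def)

sublocale A: cring A using local_A by (simp add: local_ring_def)

lemma fr_eq_mult: "r \<in> R \<Longrightarrow> s \<in> unit_den \<Longrightarrow> t \<in> unit_den \<Longrightarrow> fr (t * r) (t * s) = fr r s"
  using den_mult den_R by (subst fr_eq) (auto simp: algebra_simps)

lemma fr_minus:
  assumes "r \<in> R" "s \<in> unit_den"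
  shows "\<ominus>\<^bsub>A\<^esub> fr r s = fr (- r) s"
proof -
  have "fr (- r) s \<oplus>\<^bsub>A\<^esub> fr r s = \<zero>\<^bsub>A\<^esub>"
    using assms den_mult den_R den_one by (simp add: fr_add fr_zero fr_eq)
  then show ?thesis using A.minus_equality[of "fr (- r) s" "fr r s"] assms by simp
qed

text \<open>Extension \<open>ext\<close> and contraction \<open>con\<close> are mutually inverse
  between the ideals satisfying \<open>lideal\<close> and the ideals of \<open>A\<close>.\<close>

definition ext :: "'a set \<Rightarrow> ('a \<times> 'a) set set" where "ext I = {fr r s |r s. r \<in> I \<and> s \<in> unit_den}"

lemma extI: "r \<in> I \<Longrightarrow> s \<in> unit_den \<Longrightarrow> fr r s \<in> ext I"
  unfolding ext_def by blast

definition con :: "('a \<times> 'a) set set \<Rightarrow> 'a set" where "con J = {r \<in> R. fr r 1 \<in> J}"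

lemma fr_in_ext: "lideal I \<Longrightarrow> r \<in> R \<Longrightarrow> s \<in> unit_den \<Longrightarrow> fr r s \<in> ext I \<longleftrightarrow> r \<in> I"
proof
  assume I: "lideal I" and r: "r \<in> R" "s \<in> unit_den" and "fr r s \<in> ext I"
  then obtain r' s' where *: "fr r s = fr r' s'" "r' \<in> I" "s' \<in> unit_den" by (auto simp: ext_def)
  then have "r' \<in> R" using ideal_sub[OF lideal_ideal[OF I]] by blast
  then have "s' * r = s * r'" using * r by (simp add: fr_eq)
  then have "s' * r \<in> I" using ideal_mult[OF lideal_ideal[OF I] *(2) den_R[OF r(2)]] by simp
  then show "r \<in> I" using lideal_cancel[OF I *(3) r(1)] by blast
qed (auto simp: ext_def)

lemma ideal_ext:
  assumes I: "lideal I"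
  shows "ideal (ext I) A"
proof (rule idealI)
  note I' = lideal_ideal[OF I] and IR = ideal_sub[OF lideal_ideal[OF I]]
  show "ring A" by (rule A.ring_axioms)
  show "subgroup (ext I) (add_monoid A)"
  proof
    show "ext I \<subseteq> carrier (add_monoid A)" using IR by (auto simp: ext_def)
    show "\<one>\<^bsub>add_monoid A\<^esub> \<in> ext I" using ideal_zero[OF I'] den_one by (auto simp: ext_def fr_zero)
    show "x \<otimes>\<^bsub>add_monoid A\<^esub> y \<in> ext I" if xy: "x \<in> ext I" "y \<in> ext I" for x y
    proof -
      obtain r s r' s' where *: "x = fr r s" "y = fr r' s'" "r \<in> I" "s \<in> unit_den" "r' \<in> I" "s' \<in> unit_den"
        using xy unfolding ext_def by blast
      then have "s' * r + s * r' \<in> I"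
        using ideal_add[OF I' ideal_mult[OF I' _ den_R] ideal_mult[OF I' _ den_R]] by blast
      then have "fr (s' * r + s * r') (s * s') \<in> ext I" using extI den_mult[OF *(4,6)] by blast
      then show ?thesis using * IR fr_add by simp
    qed
    show "inv\<^bsub>add_monoid A\<^esub> x \<in> ext I" if xy: "x \<in> ext I" for x
    proof -
      obtain r s where *: "x = fr r s" "r \<in> I" "s \<in> unit_den" using xy unfolding ext_def by blast
      then have "\<ominus>\<^bsub>A\<^esub> x = fr (- r) s" using IR fr_minus by blast
      moreover have "fr (- r) s \<in> ext I" using * ideal_uminus[OF I'] by (intro extI) auto
      ultimately show ?thesis by (simp add: a_inv_def)
    qed
  qed
  show m: "x \<otimes>\<^bsub>A\<^esub> a \<in> ext I" if xy: "a \<in> ext I" "x \<in> carrier A" for a x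
  proof -
    obtain r s r' s' where *: "a = fr r s" "x = fr r' s'" "r \<in> I" "s \<in> unit_den" "r' \<in> R" "s' \<in> unit_den"
      using xy unfolding ext_def carrier_A by blast
    then have "r' * r \<in> I" using ideal_mult[OF I'] by blast
    then have "fr (r' * r) (s' * s) \<in> ext I" using extI den_mult[OF *(6,4)] by blast
    then show ?thesis using * IR fr_mult by simp
  qed
  show "a \<otimes>\<^bsub>A\<^esub> x \<in> ext I" if "a \<in> ext I" "x \<in> carrier A" for a x
  proof -
    have "a \<in> carrier A" using that(1) IR by (auto simp: ext_def)
    then show ?thesis using m[OF that] A.m_comm[of a x] that(2) by simp
  qed
qed

lemma fr_in_ideal:
  assumes J: "ideal J A" and r: "r \<in> R" "s \<in> unit_den"
  shows "fr r s \<in> J \<longleftrightarrow> r \<in> con J"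
proof -
  interpret ideal J A by (rule J)
  have "fr r s = fr 1 s \<otimes>\<^bsub>A\<^esub> fr r 1" "fr r 1 = fr s 1 \<otimes>\<^bsub>A\<^esub> fr r s"
    using r den_one den_R fr_eq_mult[of r 1 s] by (simp_all add: fr_mult)
  then show ?thesis using I_l_closed[of "fr r s" "fr s 1"] I_l_closed[of "fr r 1" "fr 1 s"] r den_one den_R
    by (auto simp: con_def)
qed

lemma lideal_con:
  assumes J: "ideal J A"
  shows "lideal (con J)"
proof -
  interpret ideal J A by (rule J)
  have "is_ideal (con J)"
    unfolding is_ideal_def
  proof (intro conjI ballI)
    show "con J \<subseteq> R" by (auto simp: con_def)
    show "0 \<in> con J" using zero_closed by (auto simp: con_def fr_zero)
    show "a + b \<in> con J" if "a \<in> con J" "b \<in> con J" for a b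
      using that a_closed[of "fr a 1" "fr b 1"] den_one by (auto simp: con_def fr_add)
    show "r * a \<in> con J" if "r \<in> R" "a \<in> con J" for a r
      using that I_l_closed[of "fr a 1" "fr r 1"] den_one by (auto simp: con_def fr_mult)
  qed
  moreover have "r \<in> con J" if "s \<in> unit_den" "r \<in> R" "s * r \<in> con J" for s r
    using fr_in_ideal[OF J that(2,1)] fr_in_ideal[OF J, of "s * r" s] fr_eq_mult[of r 1 s] that den_one den_R
      fr_in_ideal[OF J that(2) den_one] by auto
  ultimately show ?thesis by (simp add: lideal_def)
qed

lemma ext_con:
  assumes J: "ideal J A"
  shows "ext (con J) = J"
proof (intro subset_antisym subsetI)
  show "x \<in> J" if "x \<in> ext (con J)" for x
    using that fr_in_ideal[OF J] by (auto simp: ext_def con_def)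
  fix x assume x: "x \<in> J"
  then have "x \<in> carrier A" using ideal.Icarr[OF J] by blast
  then obtain r s where "x = fr r s" "r \<in> R" "s \<in> unit_den" by (auto simp: carrier_A)
  then show "x \<in> ext (con J)" using x fr_in_ideal[OF J] by (auto intro: extI)
qed

lemma con_ext: "lideal I \<Longrightarrow> con (ext I) = I"
  using fr_in_ext[of I _ 1] ideal_sub[OF lideal_ideal] den_one by (auto simp: con_def)

lemma ext_mono: "I \<subseteq> J \<Longrightarrow> ext I \<subseteq> ext J" by (auto simp: ext_def)
lemma con_mono: "I \<subseteq> J \<Longrightarrow> con I \<subseteq> con J" by (auto simp: con_def)

lemma lideal_zero: "lideal {0}"
  using domain den_R den_nonzero by (auto simp: lideal_def is_ideal_def)

lemma lprime_lideal: "lprime Q \<Longrightarrow> lideal Q"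
  unfolding lideal_def lprime_def unit_den_def by blast

lemma lprime_P: "lprime P" using P_ideal P_prime by (auto simp: lprime_def)

lemma primeideal_ext:
  assumes Q: "lprime Q"
  shows "primeideal (ext Q) A"
proof (rule primeidealI)
  note l = lprime_lideal[OF Q]
  show "ideal (ext Q) A" using ideal_ext[OF l] .
  show "cring A" by (rule A.cring_axioms)
  show "carrier A \<noteq> ext Q"
  proof
    assume "carrier A = ext Q"
    then have "fr 1 1 \<in> ext Q" using den_one by blast
    then show False using fr_in_ext[OF l, of 1 1] den_one Q one_notin_P by (auto simp: lprime_def)
  qed
  fix a b assume "a \<in> carrier A" "b \<in> carrier A" "a \<otimes>\<^bsub>A\<^esub> b \<in> ext Q"
  then obtain r s r' s' where *: "a = fr r s" "b = fr r' s'" "r \<in> R" "s \<in> unit_den" "r' \<in> R" "s' \<in> unit_den"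
    "fr (r * r') (s * s') \<in> ext Q" by (auto simp: carrier_A fr_mult)
  then have "r * r' \<in> Q" using fr_in_ext[OF l] den_mult by simp
  then show "a \<in> ext Q \<or> b \<in> ext Q" using * Q fr_in_ext[OF l] by (auto simp: lprime_def)
qed

lemma max_ideal_A: "max_ideal A = ext P"
proof -
  have "maximalideal (ext P) A"
  proof (rule maximalidealI)
    show "ideal (ext P) A" using ideal_ext[OF lprime_lideal[OF lprime_P]] .
    show "carrier A \<noteq> ext P" using primeideal_ext[OF lprime_P] by (simp add: primeideal.I_notcarr)
    fix J assume J: "ideal J A" "ext P \<subseteq> J" "J \<subseteq> carrier A"
    show "J = ext P \<or> J = carrier A"
    proof (cases "con J \<subseteq> P")
      case True
      then show ?thesis using ext_mono[OF True] ext_con[OF J(1)] J by blast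
    next
      case False
      then obtain s where "s \<in> con J" "s \<in> unit_den" by (auto simp: con_def unit_den_def)
      then have "s * 1 \<in> con J" by simp
      then have "1 \<in> con J" using lideal_cancel[OF lideal_con[OF J(1)] \<open>s \<in> unit_den\<close> one_in] by blast
      then have "con J = R" using ideal_mult[OF lideal_ideal[OF lideal_con[OF J(1)]], of 1] by (auto simp: con_def)
      then have "carrier A \<subseteq> J" using fr_in_ideal[OF J(1)] by (auto simp: carrier_A)
      then show ?thesis using J by blast
    qed
  qed
  then show ?thesis using local_A unfolding local_ring_def max_ideal_def by (metis theI')
qed

text \<open>Adding a generator in \<open>A\<close> amounts to \<open>adj\<close> on contractions;
  the denominator of the new generator is a unit and disappears. Iterating this matches
  \<open>regular_seq\<close> with \<open>reg\<close>.\<close>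

lemma con_genideal_insert:
  assumes X: "X \<subseteq> carrier A" and r: "r \<in> R" "s \<in> unit_den"
  shows "con (Idl\<^bsub>A\<^esub> (insert (fr r s) X)) = adj (con (Idl\<^bsub>A\<^esub> X)) r"
proof
  let ?I = "con (Idl\<^bsub>A\<^esub> X)" and ?J = "Idl\<^bsub>A\<^esub> (insert (fr r s) X)"
  have id: "ideal (Idl\<^bsub>A\<^esub> X) A" "ideal ?J A" using X r by (auto intro!: A.genideal_ideal)
  note l = lideal_con[OF id(1)]
  have la: "lideal (adj ?I r)" using lideal_adj lideal_ideal[OF l] r by blast
  have "Idl\<^bsub>A\<^esub> X \<subseteq> ext (adj ?I r)"
    using ext_con[OF id(1)] ext_mono[of ?I "adj ?I r"] adj_base[OF lideal_ideal[OF l]] by blast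
  moreover have "r \<in> adj ?I r" using adj_self[OF lideal_ideal[OF l] r(1) one_in] by simp
  then have "fr r s \<in> ext (adj ?I r)" using r by (auto simp: ext_def)
  ultimately have "?J \<subseteq> ext (adj ?I r)"
    using A.genideal_self[OF X] by (intro A.genideal_minimal[OF ideal_ext[OF la]]) auto
  then show "con ?J \<subseteq> adj ?I r" using con_mono con_ext[OF la] by metis
  show "adj ?I r \<subseteq> con ?J"
  proof
    fix x assume "x \<in> adj ?I r"
    then obtain t i c where *: "x \<in> R" "t \<in> unit_den" "i \<in> ?I" "c \<in> R" "t * x = i + r * c" by (metis adjE)
    note lJ = lideal_con[OF id(2)]
    have sub: "insert (fr r s) X \<subseteq> ?J" by (rule A.genideal_self) (use X r in auto)
    then have "Idl\<^bsub>A\<^esub> X \<subseteq> ?J" by (intro A.genideal_minimal[OF id(2)]) auto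
    then have "i \<in> con ?J" using * con_mono by blast
    moreover have "r \<in> con ?J" using sub fr_in_ideal[OF id(2) r] by blast
    then have "r * c \<in> con ?J" using ideal_mult2[OF lideal_ideal[OF lJ]] * by blast
    ultimately have "t * x \<in> con ?J" using ideal_add[OF lideal_ideal[OF lJ]] * by simp
    then show "x \<in> con ?J" using lideal_cancel[OF lJ] * by blast
  qed
qed

lemma con_genideal_empty: "con (Idl\<^bsub>A\<^esub> {}) = {0}"
proof -
  have "Idl\<^bsub>A\<^esub> {} \<subseteq> {\<zero>\<^bsub>A\<^esub>}" by (intro A.genideal_minimal A.zeroideal) auto
  moreover have "\<zero>\<^bsub>A\<^esub> \<in> Idl\<^bsub>A\<^esub> {}" using additive_subgroup.zero_closed[of "Idl\<^bsub>A\<^esub> {}" A] A.genideal_ideal[of "{}"]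
    by (simp add: ideal_def)
  ultimately have "Idl\<^bsub>A\<^esub> {} = {\<zero>\<^bsub>A\<^esub>}" by blast
  then show ?thesis using fr_eq[of _ 1 0 1] den_one by (auto simp: con_def fr_zero)
qed

lemma con_genideal:
  assumes "\<forall>(r, s)\<in>set ps. r \<in> R \<and> s \<in> unit_den"
  shows "con (Idl\<^bsub>A\<^esub> (set (map (\<lambda>(r, s). fr r s) ps))) = foldl adj {0} (map fst ps)"
  using assms
proof (induction ps rule: rev_induct)
  case Nil
  then show ?case by (simp add: con_genideal_empty)
next
  case (snoc p ps)
  obtain r s where p: "p = (r, s)" by (cases p)
  have "con (Idl\<^bsub>A\<^esub> (insert (fr r s) (set (map (\<lambda>(r, s). fr r s) ps)))) = adj (foldl adj {0} (map fst ps)) r"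
    using snoc p by (subst con_genideal_insert) auto
  then show ?case using p by simp
qed

lemma reg_iff_nth:
  "reg I fs \<longleftrightarrow> (\<forall>k<length fs. fs ! k \<in> P \<and> nzd (foldl adj I (take k fs)) (fs ! k))"
proof (induction fs arbitrary: I)
  case Nil
  then show ?case by simp
next
  case (Cons f fs)
  show ?case unfolding reg.simps Cons.IH by (auto simp: less_Suc_eq_0_disj)
qed

lemma nzd_con:
  assumes J: "ideal J A" and r: "r \<in> R" "s \<in> unit_den"
  shows "(\<forall>x\<in>carrier A. fr r s \<otimes>\<^bsub>A\<^esub> x \<in> J \<longrightarrow> x \<in> J) \<longleftrightarrow> nzd (con J) r"
proof
  assume *: "\<forall>x\<in>carrier A. fr r s \<otimes>\<^bsub>A\<^esub> x \<in> J \<longrightarrow> x \<in> J"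
  show "nzd (con J) r"
    unfolding nzd_def
  proof (intro conjI ballI impI)
    fix x assume x: "x \<in> R" "r * x \<in> con J"
    then have "fr r s \<otimes>\<^bsub>A\<^esub> fr x 1 \<in> J" using fr_in_ideal[OF J, of "r * x" s] r den_one by (simp add: fr_mult)
    then show "x \<in> con J" using * x den_one by (auto simp: con_def)
  qed (rule r)
next
  assume n: "nzd (con J) r"
  show "\<forall>x\<in>carrier A. fr r s \<otimes>\<^bsub>A\<^esub> x \<in> J \<longrightarrow> x \<in> J"
  proof (intro ballI impI)
    fix x assume "x \<in> carrier A" "fr r s \<otimes>\<^bsub>A\<^esub> x \<in> J"
    then obtain c t where *: "x = fr c t" "c \<in> R" "t \<in> unit_den" "fr (r * c) (s * t) \<in> J"
      using r by (auto simp: carrier_A fr_mult)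
    then have "r * c \<in> con J" using fr_in_ideal[OF J, of "r * c" "s * t"] r den_mult by blast
    then show "x \<in> J" using n * fr_in_ideal[OF J] by (auto simp: nzd_def)
  qed
qed

lemma regular_seq_iff_reg:
  assumes ps: "\<forall>(r, s)\<in>set ps. r \<in> P \<and> s \<in> unit_den"
  shows "regular_seq A (map (\<lambda>(r, s). fr r s) ps) \<longleftrightarrow> reg {0} (map fst ps)"
proof -
  let ?xs = "map (\<lambda>(r, s). fr r s) ps"
  have psR: "\<forall>(r, s)\<in>set ps. r \<in> R \<and> s \<in> unit_den" using ps ideal_sub[OF P_ideal] by auto
  have sub: "set ?xs \<subseteq> carrier A" using psR by auto
  have "Idl\<^bsub>A\<^esub> (set ?xs) \<subseteq> ext P"
    using ps by (intro A.genideal_minimal ideal_ext lprime_lideal lprime_P) (auto intro: extI)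
  then have ne: "Idl\<^bsub>A\<^esub> (set ?xs) \<noteq> carrier A" using primeideal.I_notcarr[OF primeideal_ext[OF lprime_P]]
    ideal.Icarr[OF ideal_ext[OF lprime_lideal[OF lprime_P]]] by blast
  have "(\<forall>x\<in>carrier A. ?xs ! k \<otimes>\<^bsub>A\<^esub> x \<in> Idl\<^bsub>A\<^esub> (set (take k ?xs)) \<longrightarrow> x \<in> Idl\<^bsub>A\<^esub> (set (take k ?xs))) \<longleftrightarrow>
      nzd (foldl adj {0} (take k (map fst ps))) (map fst ps ! k)" if k: "k < length ps" for k
  proof -
    obtain r s where p: "ps ! k = (r, s)" by (cases "ps ! k")
    then have rs: "r \<in> R" "s \<in> unit_den" using psR nth_mem[OF k] by auto
    have tk: "set (take k ?xs) \<subseteq> carrier A" by (rule order_trans[OF set_take_subset sub])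
    have "con (Idl\<^bsub>A\<^esub> (set (take k ?xs))) = foldl adj {0} (take k (map fst ps))"
      using con_genideal[of "take k ps"] psR by (simp add: take_map) (meson in_set_takeD)
    then show ?thesis using nzd_con[OF A.genideal_ideal[OF tk] rs] k p by simp
  qed
  moreover have "map fst ps ! k \<in> P" if "k < length ps" for k
    using ps nth_mem[OF that] that by (auto simp: case_prod_beta)
  ultimately show ?thesis unfolding regular_seq_def reg_iff_nth using sub ne by auto
qed

lemma regular_seq_P_list:
  assumes "set xs \<subseteq> ext P"
  obtains ps where "xs = map (\<lambda>(r, s). fr r s) ps" "\<forall>(r, s)\<in>set ps. r \<in> P \<and> s \<in> unit_den"
proof -
  have "\<forall>x\<in>set xs. \<exists>p. x = (\<lambda>(r, s). fr r s) p \<and> fst p \<in> P \<and> snd p \<in> unit_den" using assms by (force simp: ext_def)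
  then obtain h where h: "\<forall>x\<in>set xs. x = (\<lambda>(r, s). fr r s) (h x) \<and> fst (h x) \<in> P \<and> snd (h x) \<in> unit_den" by metis
  show thesis
    by (rule that[of "map h xs"]) (use h in \<open>auto simp: map_idI case_prod_beta\<close>)
qed

lemma reg_take: "reg I fs \<Longrightarrow> reg I (take n fs)"
  by (induction fs arbitrary: I n) (auto simp: take_Cons')

end

lemma exists_max:
  fixes \<phi> :: "'b \<Rightarrow> int"
  assumes "finite V" "V \<noteq> {}"
  obtains m where "m \<in> V" "\<And>v. v \<in> V \<Longrightarrow> \<phi> v \<le> \<phi> m"
proof -
  have "Max (\<phi> ` V) \<in> \<phi> ` V" using assms by simp
  then obtain m where "m \<in> V" "Max (\<phi> ` V) = \<phi> m" by blast
  moreover have "\<phi> v \<le> Max (\<phi> ` V)" if "v \<in> V" for v using that assms by simp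
  ultimately show thesis using that by metis
qed

section \<open>Simplicial affine semigroups\<close>

text \<open>Natural subtraction in the exponents is guarded by \<open>k \<le> n x\<close>. With
  \<open>k = 1\<close> the identity subtracts a generator that occurs in a representation.\<close>

lemma sum_scale_split:
  fixes v :: "'b \<Rightarrow> int ^ 'd"
  assumes "finite A" "x \<in> A" "k \<le> n x"
  shows "(\<Sum>h\<in>A. int (n h) *s v h) = int k *s v x + (\<Sum>h\<in>A. int (if h = x then n h - k else n h) *s v h)"
proof -
  have "(\<Sum>h\<in>A - {x}. int (if h = x then n h - k else n h) *s v h) = (\<Sum>h\<in>A - {x}. int (n h) *s v h)"
    by (intro sum.cong) auto
  moreover have "int (n x) *s v x = int k *s v x + int (n x - k) *s v x"
    using assms(3) by (simp add: vector_sadd_rdistrib[symmetric])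
  ultimately show ?thesis using assms(1,2) by (simp add: sum.remove[of A x])
qed

locale simplicial =
  fixes S G :: "(int ^ 'd) set" and a :: "'d \<Rightarrow> int ^ 'd"
  assumes simplicial: "simplicial_affine_semigroup S G a"
begin

lemma S_nonneg: "s \<in> S \<Longrightarrow> 0 \<le> s $ i"
  using simplicial by (auto simp: simplicial_affine_semigroup_def)

lemma finite_G: "finite G" and S_def: "S = generated_semigroup G"
  and G_minimal: "H \<subset> G \<Longrightarrow> generated_semigroup H \<noteq> S"
  using simplicial by (auto simp: simplicial_affine_semigroup_def minimally_generated_def)

lemma a_G: "a i \<in> G" and inj_a: "inj a"
  and independent_a: "vec.independent (range (\<lambda>i. rat_vec (a i)))"
  and rational_cone: "s \<in> S \<Longrightarrow> \<exists>q :: 'd \<Rightarrow> rat. (\<forall>i. 0 \<le> q i) \<and> rat_vec s = (\<Sum>i\<in>UNIV. q i *s rat_vec (a i))"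
  using simplicial by (auto simp: simplicial_affine_semigroup_def)

lemma gen_zero: "0 \<in> generated_semigroup H"
  unfolding generated_semigroup_def by (auto intro!: exI[of _ "\<lambda>_. 0"])

lemma gen_add:
  assumes "s \<in> generated_semigroup H" "t \<in> generated_semigroup H"
  shows "s + t \<in> generated_semigroup H"
proof -
  obtain n m where "s = (\<Sum>g\<in>H. int (n g) *s g)" "t = (\<Sum>g\<in>H. int (m g) *s g)"
    using assms unfolding generated_semigroup_def by blast
  then have "s + t = (\<Sum>g\<in>H. int (n g + m g) *s g)"
    by (simp add: sum.distrib vector_sadd_rdistrib)
  then show ?thesis unfolding generated_semigroup_def by (intro CollectI exI[of _ "\<lambda>g. n g + m g"]) simp
qed

lemma gen_base:
  assumes "finite H" "g \<in> H"
  shows "g \<in> generated_semigroup H"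
proof -
  have "g = (\<Sum>h\<in>H. int (if h = g then 1 else 0) *s h)"
    using assms by (simp add: if_distrib if_distribR cong: if_cong)
  then show ?thesis unfolding generated_semigroup_def by (intro CollectI exI[of _ "\<lambda>h. if h = g then 1 else 0"]) simp
qed

lemma zero_S: "0 \<in> S" and add_S: "s \<in> S \<Longrightarrow> t \<in> S \<Longrightarrow> s + t \<in> S" and G_S: "g \<in> G \<Longrightarrow> g \<in> S"
  unfolding S_def using gen_zero gen_add gen_base finite_G by auto

lemma S_sum: "s \<in> S \<Longrightarrow> \<exists>n. s = (\<Sum>g\<in>G. int (n g) *s g)"
  unfolding S_def generated_semigroup_def by blast

lemma a_S: "a i \<in> S" using a_G G_S by blast

lemma mult_S: "s \<in> S \<Longrightarrow> int n *s s \<in> S"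
  by (induction n) (auto simp: zero_S vector_sadd_rdistrib intro: add_S)

lemma sum_S: "(\<And>x. x \<in> A \<Longrightarrow> f x \<in> S) \<Longrightarrow> sum f A \<in> S"
  by (induction A rule: infinite_finite_induct) (auto intro: zero_S add_S)

lemma gen_subset:
  fixes H T :: "(int ^ 'd) set"
  assumes "finite H" "0 \<in> T" "\<And>s t. s \<in> T \<Longrightarrow> t \<in> T \<Longrightarrow> s + t \<in> T" "H \<subseteq> T"
  shows "generated_semigroup H \<subseteq> T"
proof -
  have m: "int n *s g \<in> T" if "g \<in> T" for n g
    by (induction n) (use assms that in \<open>auto simp: vector_sadd_rdistrib\<close>)
  have sum: "sum f A \<in> T" if "\<And>x. x \<in> A \<Longrightarrow> f x \<in> T" for f and A :: "(int ^ 'd) set"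
    using that by (induction A rule: infinite_finite_induct) (auto intro: assms)
  show ?thesis
  proof
    fix x assume "x \<in> generated_semigroup H"
    then obtain n where "x = (\<Sum>g\<in>H. int (n g) *s g)" unfolding generated_semigroup_def by blast
    moreover have "int (n g) *s g \<in> T" if "g \<in> H" for g using m assms(4) that by blast
    ultimately show "x \<in> T" using sum[of H "\<lambda>g. int (n g) *s g"] by simp
  qed
qed

lemma S_pointed: "s \<in> S \<Longrightarrow> t \<in> S \<Longrightarrow> s + t = 0 \<Longrightarrow> s = 0"
  using S_nonneg[of s] S_nonneg[of t] by (auto simp: vec_eq_iff) (metis add_nonneg_eq_0_iff)

lemma zero_notin_G: "0 \<notin> G"
proof
  assume 0: "0 \<in> G"
  have "g \<in> generated_semigroup (G - {0})" if "g \<in> G" for g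
    using that gen_zero gen_base[of "G - {0}" g] finite_G by (cases "g = 0") auto
  then have "S \<subseteq> generated_semigroup (G - {0})"
    unfolding S_def using finite_G gen_zero gen_add by (intro gen_subset) auto
  moreover have "generated_semigroup (G - {0}) \<subseteq> S"
    using finite_G zero_S add_S G_S by (intro gen_subset) auto
  ultimately show False using G_minimal[of "G - {0}"] 0 by blast
qed

lemma gen_remove:
  assumes "g \<in> G"
  shows "g \<notin> generated_semigroup (G - {g})"
proof
  assume "g \<in> generated_semigroup (G - {g})"
  then have "h \<in> generated_semigroup (G - {g})" if "h \<in> G" for h
    using that gen_base[of "G - {g}" h] finite_G by (cases "h = g") auto
  then have "S \<subseteq> generated_semigroup (G - {g})"
    unfolding S_def using finite_G gen_zero gen_add by (intro gen_subset) auto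
  moreover have "generated_semigroup (G - {g}) \<subseteq> S"
    using finite_G zero_S add_S G_S by (intro gen_subset) auto
  ultimately show False using G_minimal[of "G - {g}"] assms by blast
qed

text \<open>If a representation of the summand \<open>x\<close> used \<open>g\<close> itself, then
  \<open>g = g + x' + y\<close>, and pointedness gives \<open>y = 0\<close>. So both summands avoid
  \<open>g\<close>, and \<open>g\<close> would be generated by the other generators.\<close>

lemma irreducible:
  assumes "g \<in> G" "s \<in> S" "t \<in> S" "g = s + t"
  shows "s = 0 \<or> t = 0"
proof (rule ccontr)
  assume ne: "\<not> ?thesis"
  have part: "x \<in> generated_semigroup (G - {g})" if x: "x \<in> S" "y \<in> S" "g = x + y" "y \<noteq> 0" for x y
  proof -
    obtain n where n: "x = (\<Sum>h\<in>G. int (n h) *s h)" using S_sum[OF x(1)] by blast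
    show ?thesis
    proof (cases "n g = 0")
      case True
      then have "x = (\<Sum>h\<in>G - {g}. int (n h) *s h)" unfolding n
        using finite_G assms(1) by (simp add: sum.remove[of G g])
      then show ?thesis unfolding generated_semigroup_def by blast
    next
      case False
      define x' where "x' = (\<Sum>h\<in>G. int (if h = g then n h - 1 else n h) *s h)"
      have "x' \<in> S" unfolding S_def generated_semigroup_def x'_def
        by (intro CollectI exI[of _ "\<lambda>h. if h = g then n h - 1 else n h"]) simp
      moreover have "x = g + x'" unfolding n x'_def using sum_scale_split[of G g 1 n "\<lambda>h. h"] finite_G assms(1) False by simp
      ultimately have "y = 0" using S_pointed[of y x'] x by (simp add: algebra_simps)
      then show ?thesis using x by blast
    qed
  qed
  have "g \<in> generated_semigroup (G - {g})"
  proof -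
    have "s \<in> generated_semigroup (G - {g})" using part[OF assms(2,3,4)] ne by blast
    moreover have "t \<in> generated_semigroup (G - {g})" using part[OF assms(3,2)] assms(4) ne by (simp add: add.commute)
    ultimately show ?thesis using gen_add assms(4) by metis
  qed
  then show False using gen_remove[OF assms(1)] by blast
qed

text \<open>A grading that is at least 1 on nonzero elements of \<open>S\<close>. It drives the
  inductions and singles out leading terms.\<close>

definition wt :: "int ^ 'd \<Rightarrow> int" where "wt s = (\<Sum>i\<in>UNIV. s $ i)"

lemma wt_add: "wt (s + t) = wt s + wt t" and wt_diff: "wt (s - t) = wt s - wt t" and wt_zero: "wt 0 = 0"
  and wt_mult: "wt (c *s s) = c * wt s"
  by (simp_all add: wt_def sum.distrib sum_subtractf sum_distrib_left)

lemma wt_sum: "wt (sum f A) = (\<Sum>x\<in>A. wt (f x))"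
  by (induction A rule: infinite_finite_induct) (auto simp: wt_zero wt_add)

lemma wt_nonneg: "s \<in> S \<Longrightarrow> 0 \<le> wt s"
  unfolding wt_def by (intro sum_nonneg) (auto intro: S_nonneg)

lemma wt_pos:
  assumes "s \<in> S" "s \<noteq> 0"
  shows "1 \<le> wt s"
proof -
  have "wt s \<noteq> 0"
    using assms S_nonneg[OF assms(1)] unfolding wt_def by (subst sum_nonneg_eq_0_iff) (auto simp: vec_eq_iff)
  then show ?thesis using wt_nonneg[OF assms(1)] by linarith
qed

lemma a_nonzero: "a i \<noteq> 0" using a_G zero_notin_G by metis

subsection \<open>Coordinates along the extremal rays\<close>

lemma rat_vec_add: "rat_vec (u + v) = rat_vec u + rat_vec v"
  and rat_vec_zero: "rat_vec 0 = 0" and rat_vec_mult: "rat_vec (k *s v) = of_int k *s rat_vec v"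
  by (simp_all add: rat_vec_def vec_eq_iff)

lemma rat_vec_inj: "rat_vec u = rat_vec v \<Longrightarrow> u = v"
  by (simp add: rat_vec_def vec_eq_iff)

lemma rat_vec_sum: "rat_vec (sum f A) = (\<Sum>x\<in>A. rat_vec (f x))"
  by (induction A rule: infinite_finite_induct) (auto simp: rat_vec_zero rat_vec_add)

lemma inj_rat_a: "inj (\<lambda>i. rat_vec (a i))"
  using inj_a rat_vec_inj by (auto simp: inj_def)

lemma span_a: "vec.span (range (\<lambda>i. rat_vec (a i))) = UNIV"
  using vec.card_ge_dim_independent[OF subset_UNIV independent_a] card_image[OF inj_rat_a] by (auto simp: vec_dim_card simp del: vec.dim_UNIV)

text \<open>Coordinates in the basis of extremal rays. They are nonnegative on \<open>S\<close> but
  may be fractional, as the rays need not generate the lattice.\<close>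

definition coord :: "'d \<Rightarrow> int ^ 'd \<Rightarrow> rat" where
  "coord i v = vec.representation (range (\<lambda>i. rat_vec (a i))) (rat_vec v) (rat_vec (a i))"

lemma coord_add: "coord i (u + v) = coord i u + coord i v"
  unfolding coord_def rat_vec_add using independent_a span_a by (subst vec.representation_add) auto

lemma coord_zero: "coord i 0 = 0"
  unfolding coord_def rat_vec_zero by (simp add: vec.representation_zero)

lemma coord_mult: "coord i (k *s v) = of_int k * coord i v"
  unfolding coord_def rat_vec_mult using independent_a span_a by (subst vec.representation_scale) auto

lemma coord_diff: "coord i (u - v) = coord i u - coord i v"
  using coord_add[of i "u - v" v] by simp

lemma coord_sum: "coord i (sum f A) = (\<Sum>x\<in>A. coord i (f x))"
  by (induction A rule: infinite_finite_induct) (auto simp: coord_zero coord_add)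

lemma coord_a: "coord i (a j) = (if i = j then 1 else 0)"
  unfolding coord_def using vec.representation_basis[OF independent_a, of "rat_vec (a j)"] inj_rat_a
  by (auto dest: injD)

lemma rat_vec_coord: "rat_vec v = (\<Sum>i\<in>UNIV. coord i v *s rat_vec (a i))"
proof -
  have "(\<Sum>b\<in>range (\<lambda>i. rat_vec (a i)). vec.representation (range (\<lambda>i. rat_vec (a i))) (rat_vec v) b *s b) = rat_vec v"
    using independent_a span_a by (intro vec.sum_representation_eq) auto
  then show ?thesis unfolding coord_def by (subst (asm) sum.reindex[OF inj_rat_a]) simp
qed

lemma coord_nonneg:
  assumes "s \<in> S"
  shows "0 \<le> coord i s"
proof -
  obtain q :: "'d \<Rightarrow> rat" where q: "\<forall>i. 0 \<le> q i" "rat_vec s = (\<Sum>i\<in>UNIV. q i *s rat_vec (a i))"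
    using rational_cone[OF assms] by blast
  have "coord i s = (\<Sum>j\<in>UNIV. q j * (if i = j then 1 else 0))"
    unfolding coord_def q(2) using independent_a span_a coord_a[of i]
    by (subst vec.representation_sum) (auto simp: vec.representation_scale coord_def)
  then show ?thesis using q(1) by (auto intro!: sum_nonneg)
qed

lemma common_denominator:
  assumes "finite I" "\<And>i. i \<in> I \<Longrightarrow> 0 \<le> (x i :: rat)"
  shows "\<exists>N>0. \<forall>i\<in>I. \<exists>c::nat. of_nat N * x i = of_nat c"
  using assms
proof (induction I rule: finite_induct)
  case empty
  then show ?case by (intro exI[of _ 1]) auto
next
  case (insert j I)
  then obtain N where N: "N > 0" "\<forall>i\<in>I. \<exists>c::nat. of_nat N * x i = of_nat c" by auto
  obtain p q where pq: "quotient_of (x j) = (p, q)" by (cases "quotient_of (x j)")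
  then have q: "q > 0" "x j = of_int p / of_int q" using quotient_of_denom_pos quotient_of_div by blast+
  have p: "p \<ge> 0" using insert.prems[of j] q by (simp add: zero_le_divide_iff)
  have j: "of_nat (N * nat q) * x j = of_nat (N * nat p)" using q p by (simp add: field_simps)
  have i: "\<exists>c::nat. of_nat (N * nat q) * x i = of_nat c" if i: "i \<in> I" for i
  proof -
    obtain c :: nat where "of_nat N * x i = of_nat c" using N(2) i by blast
    then have "of_nat (N * nat q) * x i = of_nat (nat q * c)" by (simp add: algebra_simps)
    then show ?thesis by blast
  qed
  have "\<exists>c::nat. of_nat (N * nat q) * x i = of_nat c" if "i \<in> insert j I" for i
    using that i j by (cases "i = j") blast+
  moreover have "N * nat q > 0" using N q by simp
  ultimately show ?case by blast
qed

lemma multiple_in_rays: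
  assumes "s \<in> S"
  shows "\<exists>N>0. \<exists>c::'d \<Rightarrow> nat. int N *s s = (\<Sum>i\<in>UNIV. int (c i) *s a i)"
proof -
  obtain N where N: "N > 0" "\<forall>i. \<exists>c::nat. of_nat N * coord i s = of_nat c"
    using common_denominator[of UNIV "\<lambda>i. coord i s"] coord_nonneg[OF assms] by auto
  then obtain c where c: "\<forall>i. of_nat N * coord i s = of_nat (c i)" by metis
  have "rat_vec (int N *s s) = rat_vec (\<Sum>i\<in>UNIV. int (c i) *s a i)"
    unfolding rat_vec_sum rat_vec_mult using rat_vec_coord[of s] c
    by (simp add: vec.scale_sum_right vector_smult_assoc)
  then show ?thesis using rat_vec_inj N(1) by blast
qed

subsection \<open>The Apery set\<close>

lemma apery_S: "u \<in> apery S a \<Longrightarrow> u \<in> S" and apery_not: "u \<in> apery S a \<Longrightarrow> u - a i \<notin> S"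
  by (auto simp: apery_def)

text \<open>Some multiple \<open>N g\<close> of each generator \<open>g\<close> is a nonzero
  combination of rays. A generator occurring \<open>N g\<close> times would therefore allow a ray to
  be subtracted, which bounds all exponents of an Apery element.\<close>

lemma finite_apery: "finite (apery S a)"
proof -
  have "\<forall>g\<in>G. \<exists>N>0. \<exists>c::'d \<Rightarrow> nat. int N *s g = (\<Sum>i\<in>UNIV. int (c i) *s a i)"
    using multiple_in_rays G_S by blast
  then obtain N c where Nc: "\<forall>g\<in>G. N g > 0 \<and> int (N g) *s g = (\<Sum>i\<in>UNIV. int (c g i :: nat) *s a i)" by metis
  have "apery S a \<subseteq> (\<lambda>n. \<Sum>g\<in>G. int (n g) *s g) ` (PiE G (\<lambda>g. {..<N g}))"
  proof
    fix u assume u: "u \<in> apery S a"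
    then obtain n where n: "u = (\<Sum>g\<in>G. int (n g) *s g)" using S_sum apery_S by blast
    have "n g < N g" if g: "g \<in> G" for g
    proof (rule ccontr)
      assume "\<not> n g < N g"
      then have le: "N g \<le> n g" by simp
      define u' where "u' = (\<Sum>h\<in>G. int (if h = g then n h - N g else n h) *s h)"
      have u': "u' \<in> S" unfolding S_def generated_semigroup_def u'_def
        by (intro CollectI exI[of _ "\<lambda>h. if h = g then n h - N g else n h"]) simp
      have "u = int (N g) *s g + u'" unfolding n u'_def using sum_scale_split[of G g "N g" n "\<lambda>h. h"] finite_G g le by simp
      moreover have nz: "int (N g) *s g \<noteq> 0"
        using Nc g zero_notin_G by (metis less_irrefl of_nat_eq_0_iff vector_mul_eq_0)
      have "\<exists>i. c g i > 0"
      proof (rule ccontr)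
        assume "\<not> ?thesis"
        then have "int (N g) *s g = 0" using Nc g by simp
        then show False using nz by blast
      qed
      then obtain i where i: "c g i > 0" by blast
      have "int (N g) *s g = a i + (\<Sum>j\<in>UNIV. int (if j = i then c g j - 1 else c g j) *s a j)"
        using Nc g i sum_scale_split[of UNIV i 1 "c g" a] by (simp cong: if_cong)
      ultimately have "u - a i = (\<Sum>j\<in>UNIV. int (if j = i then c g j - 1 else c g j) *s a j) + u'" by simp
      moreover have "\<dots> \<in> S" using u' by (intro add_S sum_S mult_S a_S)
      ultimately show False using apery_not[OF u] by metis
    qed
    then have "restrict n G \<in> PiE G (\<lambda>g. {..<N g})" by auto
    moreover have "u = (\<Sum>g\<in>G. int (restrict n G g) *s g)" unfolding n by (intro sum.cong) auto
    ultimately show "u \<in> (\<lambda>n. \<Sum>g\<in>G. int (n g) *s g) ` (PiE G (\<lambda>g. {..<N g}))" by blast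
  qed
  then show ?thesis by (rule finite_subset) (intro finite_imageI finite_PiE finite_G finite_lessThan)
qed

lemma apery_decomposition:
  assumes "s \<in> S"
  shows "\<exists>u\<in>apery S a. \<exists>n::'d \<Rightarrow> nat. s = u + (\<Sum>i\<in>UNIV. int (n i) *s a i)"
  using assms
proof (induction "nat (wt s)" arbitrary: s rule: less_induct)
  case less
  show ?case
  proof (cases "s \<in> apery S a")
    case True
    then show ?thesis by (intro bexI[of _ s] exI[of _ "\<lambda>_. 0"]) auto
  next
    case False
    then obtain i where i: "s - a i \<in> S" using less.prems by (auto simp: apery_def)
    have "nat (wt (s - a i)) < nat (wt s)"
      using wt_pos[OF a_S a_nonzero, of i] wt_nonneg[OF i] by (simp add: wt_diff)
    from less.hyps[OF this i] obtain u n where un: "u \<in> apery S a" "s - a i = u + (\<Sum>j\<in>UNIV. int (n j) *s a j)" by blast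
    have "(\<Sum>j\<in>UNIV. int (n j + (if j = i then 1 else 0)) *s a j) =
        (\<Sum>j\<in>UNIV. int (n j) *s a j + (if j = i then a j else 0))"
      by (intro sum.cong) (auto simp: vector_sadd_rdistrib)
    then have "s = u + (\<Sum>j\<in>UNIV. int (n j + (if j = i then 1 else 0)) *s a j)"
      using un(2) by (simp add: sum.distrib algebra_simps)
    with un(1) show ?thesis
      by (intro bexI[of _ u] exI[of _ "\<lambda>j. n j + (if j = i then 1 else 0)"])
  qed
qed

lemma zero_apery: "0 \<in> apery S a"
proof -
  have "- a i \<notin> S" for i using S_pointed[of "- a i" "a i"] a_S a_nonzero by auto
  then show ?thesis using zero_S by (auto simp: apery_def)
qed

lemma below_max:
  assumes "u \<in> apery S a"
  shows "\<exists>m\<in>max_apery S a. m - u \<in> S"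
proof -
  let ?V = "{v \<in> apery S a. v - u \<in> S}"
  have f: "finite ?V" "?V \<noteq> {}" using finite_apery assms zero_S by auto
  obtain m where m: "m \<in> ?V" "\<And>v. v \<in> ?V \<Longrightarrow> wt v \<le> wt m"
    using exists_max[OF f, of wt] by blast
  have "v = m" if v: "v \<in> apery S a" "semigroup_le S m v" for v
  proof -
    have "v - m \<in> S" using v by (simp add: semigroup_le_def)
    moreover from add_S[OF this, of "m - u"] m(1) have "v \<in> ?V" using v by simp
    then have "wt (v - m) \<le> 0" using m(2) by (simp add: wt_diff)
    ultimately show ?thesis using wt_pos[of "v - m"] by fastforce
  qed
  then have "m \<in> max_apery S a" using m(1) by (auto simp: max_apery_def)
  then show ?thesis using m(1) by blast
qed

lemma max_apery_sub: "m \<in> max_apery S a \<Longrightarrow> m \<in> apery S a" by (simp add: max_apery_def)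

lemma max_antichain: "m \<in> max_apery S a \<Longrightarrow> m' \<in> max_apery S a \<Longrightarrow> m' - m \<in> S \<Longrightarrow> m' = m"
  by (auto simp: max_apery_def semigroup_le_def)

end

section \<open>The group algebra of a lattice\<close>

lemma lookup_single_mult:
  fixes f :: "int ^ 'd \<Rightarrow>\<^sub>0 'k::comm_ring_1"
  shows "Poly_Mapping.lookup (Poly_Mapping.single q c * f) k = c * Poly_Mapping.lookup f (k - q)"
proof -
  have "Sum_any (\<lambda>l. Poly_Mapping.lookup f l when k = q + l) = Sum_any (\<lambda>l. Poly_Mapping.lookup f l when l = k - q)"
    by (intro arg_cong[where f = Sum_any]) (auto simp: fun_eq_iff when_def algebra_simps)
  also have "\<dots> = Poly_Mapping.lookup f (k - q)" by simp
  finally show ?thesis by (simp add: lookup_mult lookup_single when_mult)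
qed

lemma poly_mapping_sum_single:
  "f = (\<Sum>q\<in>Poly_Mapping.keys f. Poly_Mapping.single q (Poly_Mapping.lookup f q))"
  by (rule poly_mapping_eqI) (auto simp: lookup_sum lookup_single when_def in_keys_iff)

lemma lookup_mult_group:
  fixes f g :: "int ^ 'd \<Rightarrow>\<^sub>0 'k::comm_ring_1"
  shows "Poly_Mapping.lookup (f * g) k =
    (\<Sum>q\<in>Poly_Mapping.keys f. Poly_Mapping.lookup f q * Poly_Mapping.lookup g (k - q))"
proof -
  have "f * g = (\<Sum>q\<in>Poly_Mapping.keys f. Poly_Mapping.single q (Poly_Mapping.lookup f q) * g)"
    by (subst poly_mapping_sum_single[of f]) (simp add: sum_distrib_right)
  then show ?thesis by (simp add: lookup_sum lookup_single_mult)
qed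

text \<open>Kronecker substitution: the coordinates become coefficients of a polynomial, which is
  evaluated at an integer outside the finitely many roots of the differences.\<close>

lemma exists_injective_functional:
  fixes X :: "(int ^ 'd) set"
  assumes "finite X"
  shows "\<exists>\<phi> :: int ^ 'd \<Rightarrow> int. (\<forall>u v. \<phi> (u + v) = \<phi> u + \<phi> v) \<and> inj_on \<phi> X"
proof -
  obtain idx :: "'d \<Rightarrow> nat" where idx: "inj idx" using finite_imp_inj_to_nat_seg[of "UNIV :: 'd set"] by auto
  define p :: "int ^ 'd \<Rightarrow> int poly" where "p v = (\<Sum>i\<in>UNIV. monom (v $ i) (idx i))" for v
  have p_add: "p (u + v) = p u + p v" for u v by (simp add: p_def add_monom[symmetric] sum.distrib)
  have coeff_p: "coeff (p v) (idx i) = v $ i" for v i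
    using idx by (simp add: p_def coeff_sum inj_eq)
  have "p (u - v) \<noteq> 0" if "u \<noteq> v" for u v
    using that coeff_p[of "u - v"] by (auto simp: vec_eq_iff)
  then have "finite (\<Union>u\<in>X. \<Union>v\<in>X - {u}. {t. poly (p (u - v)) t = 0})"
    using assms by (auto intro!: poly_roots_finite)
  then obtain t where t: "t \<notin> (\<Union>u\<in>X. \<Union>v\<in>X - {u}. {t. poly (p (u - v)) t = 0})"
    using ex_new_if_finite[OF infinite_UNIV_int] by blast
  have "inj_on (\<lambda>v. poly (p v) t) X"
  proof (rule inj_onI, rule ccontr)
    fix u v assume uv: "u \<in> X" "v \<in> X" "poly (p u) t = poly (p v) t" "u \<noteq> v"
    have "poly (p (u - v)) t = 0" using p_add[of "u - v" v] uv(3) by simp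
    then show False using t uv by blast
  qed
  then show ?thesis using p_add by (intro exI[of _ "\<lambda>v. poly (p v) t"]) auto
qed

text \<open>An injective additive functional orders the exponents without ties, so the product of
  the two leading terms cannot be cancelled by any other product.\<close>

lemma poly_mapping_domain:
  fixes f g :: "int ^ 'd \<Rightarrow>\<^sub>0 'k::field"
  assumes "f \<noteq> 0" "g \<noteq> 0"
  shows "f * g \<noteq> 0"
proof -
  let ?F = "Poly_Mapping.keys f" and ?G = "Poly_Mapping.keys g"
  obtain \<phi> :: "int ^ 'd \<Rightarrow> int" where \<phi>: "\<And>u v. \<phi> (u + v) = \<phi> u + \<phi> v" "inj_on \<phi> (?F \<union> ?G)"
    using exists_injective_functional[of "?F \<union> ?G"] by auto
  have ne: "?F \<noteq> {}" "?G \<noteq> {}" using assms by auto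
  obtain x where x: "x \<in> ?F" "\<And>q. q \<in> ?F \<Longrightarrow> \<phi> q \<le> \<phi> x" using exists_max[OF _ ne(1), of \<phi>] by auto
  obtain y where y: "y \<in> ?G" "\<And>q. q \<in> ?G \<Longrightarrow> \<phi> q \<le> \<phi> y" using exists_max[OF _ ne(2), of \<phi>] by auto
  have z: "Poly_Mapping.lookup g (x + y - q) = 0" if q: "q \<in> ?F" "q \<noteq> x" for q
  proof (rule ccontr)
    assume "Poly_Mapping.lookup g (x + y - q) \<noteq> 0"
    then have "\<phi> (x + y - q) \<le> \<phi> y" using y(2) by (simp add: in_keys_iff)
    moreover have "\<phi> (x + y - q) + \<phi> q = \<phi> x + \<phi> y" using \<phi>(1)[of "x + y - q" q] \<phi>(1)[of x y] by simp
    moreover have "\<phi> q \<noteq> \<phi> x" using \<phi>(2) q x(1) by (auto simp: inj_on_def)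
    ultimately show False using x(2)[OF q(1)] by linarith
  qed
  have "Poly_Mapping.lookup (f * g) (x + y) =
      (\<Sum>q\<in>?F. if q = x then Poly_Mapping.lookup f x * Poly_Mapping.lookup g y else 0)"
    unfolding lookup_mult_group using z by (intro sum.cong) auto
  also have "\<dots> = Poly_Mapping.lookup f x * Poly_Mapping.lookup g y" using x(1) by simp
  finally show ?thesis using x(1) y(1) by (auto simp: in_keys_iff)
qed

definition supported :: "(int ^ 'd) set \<Rightarrow> (int ^ 'd \<Rightarrow>\<^sub>0 'k::comm_ring_1) set" where
  "supported S = {f. Poly_Mapping.keys f \<subseteq> S}"

lemma supported_iff: "f \<in> supported S \<longleftrightarrow> (\<forall>k. Poly_Mapping.lookup f k \<noteq> 0 \<longrightarrow> k \<in> S)"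
  by (auto simp: supported_def in_keys_iff)

lemma supported_mult:
  assumes "f \<in> supported S" "g \<in> supported T" "\<And>s t. s \<in> S \<Longrightarrow> t \<in> T \<Longrightarrow> s + t \<in> U"
  shows "f * g \<in> supported U"
  using keys_mult[of f g] assms unfolding supported_def by blast

lemma supported_add: "f \<in> supported S \<Longrightarrow> g \<in> supported S \<Longrightarrow> f + g \<in> supported S"
  using Poly_Mapping.keys_add[of f g] unfolding supported_def by blast

lemma supported_uminus: "f \<in> supported S \<Longrightarrow> - f \<in> supported S"
  by (simp add: supported_iff)

lemma supported_single: "s \<in> S \<Longrightarrow> Poly_Mapping.single s c \<in> supported S"
  by (auto simp: supported_iff lookup_single when_def split: if_splits)

lemma supported_zero: "0 \<in> supported S" by (simp add: supported_iff)

lemma supported_sum: "(\<And>x. x \<in> A \<Longrightarrow> f x \<in> supported S) \<Longrightarrow> sum f A \<in> supported S"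
  by (induction A rule: infinite_finite_induct) (auto intro: supported_add supported_zero)

section \<open>Cohen-Macaulayness in terms of the semigroup\<close>

text \<open>More vectors than coordinates are dependent. The vectors form a family indexed by
  \<open>E\<close>, so repetitions are allowed; this matters for powers and products that may
  coincide.\<close>

lemma nontrivial_combination:
  fixes v :: "'e \<Rightarrow> 'b \<Rightarrow> 'k::field"
  assumes "finite B" "finite E" "card B < card E"
  shows "\<exists>c. (\<exists>e\<in>E. c e \<noteq> 0) \<and> (\<forall>b\<in>B. (\<Sum>e\<in>E. c e * v e b) = 0)"
  using assms
proof (induction B arbitrary: E v rule: finite_induct)
  case empty
  then have "E \<noteq> {}" by auto
  then show ?case by (intro exI[of _ "\<lambda>_. 1"]) auto
next
  case (insert b B)
  show ?case
  proof (cases "\<exists>e0\<in>E. v e0 b \<noteq> 0")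
    case False
    have "card B < card E" using insert by simp
    from insert.IH[OF insert.prems(1) this, of v] obtain c where
      "\<exists>e\<in>E. c e \<noteq> 0" "\<forall>b\<in>B. (\<Sum>e\<in>E. c e * v e b) = 0" by blast
    then show ?thesis using False by (intro exI[of _ c]) auto
  next
    case True
    then obtain e0 where e0: "e0 \<in> E" "v e0 b \<noteq> 0" by blast
    define v' where "v' e b' = v e b' - v e b / v e0 b * v e0 b'" for e b'
    have "card B < card (E - {e0})" using insert e0 by simp
    from insert.IH[OF _ this, of v'] insert.prems(1) obtain c
      where c: "\<exists>e\<in>E - {e0}. c e \<noteq> 0" "\<forall>b'\<in>B. (\<Sum>e\<in>E - {e0}. c e * v' e b') = 0" by blast
    define c0 where "c0 = - (\<Sum>e\<in>E - {e0}. c e * (v e b / v e0 b))"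
    define c' where "c' = c(e0 := c0)"
    have s: "(\<Sum>e\<in>E. c' e * v e b') = (\<Sum>e\<in>E - {e0}. c e * v' e b')" for b'
    proof -
      have "(\<Sum>e\<in>E. c' e * v e b') = c' e0 * v e0 b' + (\<Sum>e\<in>E - {e0}. c' e * v e b')"
        using e0 insert.prems(1) by (simp add: sum.remove[of E e0])
      also have "(\<Sum>e\<in>E - {e0}. c' e * v e b') = (\<Sum>e\<in>E - {e0}. c e * v e b')"
        by (intro sum.cong) (auto simp: c'_def)
      also have "c' e0 * v e0 b' + \<dots> = (\<Sum>e\<in>E - {e0}. c e * v e b' - c e * (v e b / v e0 b) * v e0 b')"
        by (simp add: c'_def c0_def sum_subtractf sum_distrib_right)
      also have "\<dots> = (\<Sum>e\<in>E - {e0}. c e * v' e b')"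
        by (intro sum.cong) (auto simp: v'_def algebra_simps)
      finally show ?thesis .
    qed
    have "v' e b = 0" for e using e0 by (simp add: v'_def)
    then have "(\<Sum>e\<in>E. c' e * v e b') = 0" if "b' \<in> insert b B" for b'
      using that c(2) unfolding s by auto
    moreover have "\<exists>e\<in>E. c' e \<noteq> 0" using c(1) by (auto simp: c'_def)
    ultimately show ?thesis by blast
  qed
qed

definition restr :: "(int ^ 'd) set \<Rightarrow> (int ^ 'd \<Rightarrow>\<^sub>0 'k::comm_ring_1) \<Rightarrow> int ^ 'd \<Rightarrow>\<^sub>0 'k" where
  "restr Z f = (\<Sum>s\<in>Poly_Mapping.keys f \<inter> Z. Poly_Mapping.single s (Poly_Mapping.lookup f s))"

lemma lookup_restr: "Poly_Mapping.lookup (restr Z f) s = (if s \<in> Z then Poly_Mapping.lookup f s else 0)"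
  by (auto simp: restr_def lookup_sum lookup_single when_def in_keys_iff)

locale simplicial_ring = simplicial S G a for S G :: "(int ^ 'd) set" and a +
  fixes K :: "'k::field itself"
begin

abbreviation R :: "(int ^ 'd \<Rightarrow>\<^sub>0 'k) set" where "R \<equiv> supported S"
abbreviation X :: "int ^ 'd \<Rightarrow> int ^ 'd \<Rightarrow>\<^sub>0 'k" where "X s \<equiv> Poly_Mapping.single s 1"
abbreviation C :: "'k \<Rightarrow> int ^ 'd \<Rightarrow>\<^sub>0 'k" where "C c \<equiv> Poly_Mapping.single 0 c"

sublocale comm_subring R
proof
  show "1 \<in> R" using supported_single[OF zero_S, of 1] by simp
  show "x * y \<in> R" if "x \<in> R" "y \<in> R" for x y using supported_mult[OF that add_S] .
qed (auto intro: supported_add supported_uminus)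

lemma X_R: "s \<in> S \<Longrightarrow> X s \<in> R" and C_R: "C c \<in> R" and single_R: "s \<in> S \<Longrightarrow> Poly_Mapping.single s c \<in> R"
  by (auto intro: supported_single zero_S)

lemma X_add: "X (s + t) = X s * X t" by (simp add: mult_single)

lemma R_key: "f \<in> R \<Longrightarrow> Poly_Mapping.lookup f s \<noteq> 0 \<Longrightarrow> s \<in> S" by (simp add: supported_iff)

lemma monomials_in_ideal:
  assumes I: "is_ideal I" and f: "f \<in> R" and m: "\<And>s. s \<in> Poly_Mapping.keys f \<Longrightarrow> X s \<in> I"
  shows "f \<in> I"
proof -
  have "Poly_Mapping.single s (Poly_Mapping.lookup f s) \<in> I" if "s \<in> Poly_Mapping.keys f" for s
    using ideal_mult[OF I m[OF that] C_R[of "Poly_Mapping.lookup f s"]] by (simp add: mult_single)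
  then show ?thesis by (subst poly_mapping_sum_single[of f]) (intro ideal_sum[OF I])
qed

lemma X_multiple:
  assumes I: "is_ideal I" and "X t \<in> I" "s - t \<in> S"
  shows "X s \<in> I"
  using ideal_mult[OF assms(1,2) X_R[OF assms(3)]] by (simp add: mult_single)

lemma constant_unit:
  assumes I: "is_ideal I" and "C c \<in> I" "c \<noteq> 0"
  shows "1 \<in> I"
  using ideal_mult[OF assms(1,2) C_R[of "inverse c"]] assms(3) by (simp add: mult_single)

text \<open>As \<open>S\<close> is pointed, 0 is a sum of two elements of \<open>S\<close> only as 0
  + 0. So the constant term is multiplicative, and \<open>aug\<close> below is its kernel.\<close>

lemma lookup_mult_zero:
  assumes "f \<in> R" "g \<in> R"
  shows "Poly_Mapping.lookup (f * g) 0 = Poly_Mapping.lookup f 0 * Poly_Mapping.lookup g 0"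
proof -
  have z: "Poly_Mapping.lookup g (- q) = 0" if "q \<in> Poly_Mapping.keys f" "q \<noteq> 0" for q
  proof (rule ccontr)
    assume "Poly_Mapping.lookup g (- q) \<noteq> 0"
    then have "- q \<in> S" "q \<in> S" using assms that R_key by (auto simp: in_keys_iff)
    from S_pointed[OF this(2,1)] that(2) show False by simp
  qed
  have "Poly_Mapping.lookup (f * g) 0 =
      (\<Sum>q\<in>Poly_Mapping.keys f. if q = 0 then Poly_Mapping.lookup f 0 * Poly_Mapping.lookup g 0 else 0)"
    unfolding lookup_mult_group using z by (intro sum.cong) auto
  then show ?thesis by (auto simp: in_keys_iff)
qed

definition aug :: "(int ^ 'd \<Rightarrow>\<^sub>0 'k) set" where "aug = {f \<in> R. Poly_Mapping.lookup f 0 = 0}"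

lemma aug_ideal: "is_ideal aug"
  unfolding is_ideal_def aug_def by (auto simp: lookup_mult_zero lookup_add)

lemma ring_on_R: "semigroup_ring TYPE('k) S = ring_on R"
  by (simp add: semigroup_ring_eq supported_def)

lemma aug_maximal: "maximalideal aug (ring_on R)"
proof (rule maximalidealI)
  show "ideal aug (ring_on R)" using aug_ideal by (simp add: ideal_ring_on)
  have "1 \<notin> aug" by (simp add: aug_def)
  then show "carrier (ring_on R) \<noteq> aug" using one_in by auto
  fix J assume J: "ideal J (ring_on R)" "aug \<subseteq> J" "J \<subseteq> carrier (ring_on R)"
  then have I: "is_ideal J" by (simp add: ideal_ring_on)
  show "J = aug \<or> J = carrier (ring_on R)"
  proof (cases "J = aug")
    case False
    then obtain f where f: "f \<in> J" "f \<notin> aug" using J by blast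
    let ?c = "Poly_Mapping.lookup f 0"
    have fR: "f \<in> R" using f I ideal_sub by blast
    then have "f - C ?c \<in> aug" using C_R by (simp add: aug_def lookup_minus)
    then have "f - (f - C ?c) \<in> J" using J(2) f(1) I ideal_diff by blast
    moreover have "?c \<noteq> 0" using f fR by (simp add: aug_def)
    ultimately have "1 \<in> J" using constant_unit[OF I, of ?c] by simp
    then have "R \<subseteq> J" using ideal_mult[OF I] by fastforce
    then show ?thesis using J(3) by auto
  qed simp
qed

lemma localized:
  assumes cm: "cohen_macaulay (semigroup_ring TYPE('k) S)" and P: "maximalideal P (ring_on R)"
  shows "localized_domain R P"
proof -
  have pr: "primeideal P (ring_on R)" using cring.maximalideal_prime[OF cring_ring_on P] .
  have id: "is_ideal P" using primeideal.axioms(1)[OF pr] by (simp add: ideal_ring_on)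
  have noe: "noetherian_ring (ring_on R)" using cm by (simp add: cohen_macaulay_def ring_on_R)
  have "1 \<notin> P"
  proof
    assume "1 \<in> P"
    then have "R \<subseteq> P" using ideal_mult[OF id] by fastforce
    then show False using primeideal.I_notcarr[OF pr] ideal_sub[OF id] by auto
  qed
  moreover have "local_ring (localization_at (ring_on R) P)"
    using cm P by (auto simp: cohen_macaulay_def ring_on_R cohen_macaulay_local_def)
  moreover have "x = 0 \<or> y = 0" if "x * y = 0" for x y :: "int ^ 'd \<Rightarrow>\<^sub>0 'k"
    using that poly_mapping_domain[of x y] by blast
  ultimately show ?thesis
    using id genideal_ring_on[OF noe] primeideal.I_prime[OF pr]
    by unfold_locales auto
qed

subsection \<open>Primes of faces\<close>

text \<open>The prime of the face spanned by the rays outside \<open>T\<close>: it is spanned by the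
  monomials off this face. For empty \<open>T\<close> it is the zero ideal.\<close>

definition face_prime :: "'d set \<Rightarrow> (int ^ 'd \<Rightarrow>\<^sub>0 'k) set" where
  "face_prime T = {f \<in> R. \<forall>s. Poly_Mapping.lookup f s \<noteq> 0 \<longrightarrow> (\<exists>i\<in>T. coord i s \<noteq> 0)}"

lemma face_prime_ideal: "is_ideal (face_prime T)"
  unfolding is_ideal_def
proof (intro conjI ballI)
  show "face_prime T \<subseteq> R" "0 \<in> face_prime T" by (auto simp: face_prime_def)
next
  fix f g assume fg: "f \<in> face_prime T" "g \<in> face_prime T"
  have "Poly_Mapping.lookup f s \<noteq> 0 \<or> Poly_Mapping.lookup g s \<noteq> 0" if "Poly_Mapping.lookup (f + g) s \<noteq> 0" for s
    using that by (auto simp: lookup_add)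
  then show "f + g \<in> face_prime T" using fg unfolding face_prime_def by blast
next
  fix r f assume r: "r \<in> R" and f: "f \<in> face_prime T"
  then have fR: "f \<in> R" by (simp add: face_prime_def)
  have "\<exists>i\<in>T. coord i s \<noteq> 0" if s: "Poly_Mapping.lookup (r * f) s \<noteq> 0" for s
  proof -
    obtain q where q: "q \<in> Poly_Mapping.keys r" "Poly_Mapping.lookup f (s - q) \<noteq> 0"
      using s unfolding lookup_mult_group by (metis (no_types, lifting) mult_zero_right sum.neutral)
    then obtain i where i: "i \<in> T" "coord i (s - q) \<noteq> 0" using f by (auto simp: face_prime_def)
    have "0 \<le> coord i (s - q)" "0 \<le> coord i q"
      using q r fR R_key by (auto intro!: coord_nonneg simp: in_keys_iff)
    then show ?thesis using i by (intro bexI[of _ i]) (auto simp: coord_diff)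
  qed
  then show "r * f \<in> face_prime T" using r fR by (simp add: face_prime_def)
qed

text \<open>Modulo \<open>face_prime T\<close> each factor may be replaced by its part supported on
  the face \<open>Z\<close>. The product of two nonzero parts is nonzero in the domain and still
  supported on the face, so it cannot lie in the ideal.\<close>

lemma face_prime_prime:
  assumes x: "x \<in> R" and y: "y \<in> R" and xy: "x * y \<in> face_prime T"
  shows "x \<in> face_prime T \<or> y \<in> face_prime T"
proof (rule ccontr)
  assume n: "\<not> ?thesis"
  define Z where "Z = {s. \<forall>i\<in>T. coord i s = 0}"
  have RR: "restr Z f \<in> R" "f - restr Z f \<in> face_prime T" if "f \<in> R" for f
    using that by (auto simp: supported_iff lookup_restr face_prime_def lookup_minus Z_def split: if_splits)
  have nz: "restr Z f \<noteq> 0" if "f \<in> R" "f \<notin> face_prime T" for f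
    using RR(2)[OF that(1)] that(2) by auto
  have "restr Z x * restr Z y \<noteq> 0" using poly_mapping_domain nz x y n by blast
  then obtain s where s: "Poly_Mapping.lookup (restr Z x * restr Z y) s \<noteq> 0"
    using poly_mapping_eqI[of "restr Z x * restr Z y" 0] by (auto simp: lookup_zero)
  then obtain q where "q \<in> Poly_Mapping.keys (restr Z x)" "Poly_Mapping.lookup (restr Z y) (s - q) \<noteq> 0"
    unfolding lookup_mult_group by (metis (no_types, lifting) mult_zero_right sum.neutral)
  then have "q \<in> Z" "s - q \<in> Z" by (auto simp: in_keys_iff lookup_restr split: if_splits)
  then have sZ: "s \<in> Z" by (auto simp: Z_def coord_diff)
  have "restr Z x * restr Z y = x * y - (x - restr Z x) * y - restr Z x * (y - restr Z y)"
    by (simp add: algebra_simps)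
  moreover have "\<dots> \<in> face_prime T"
    using ideal_diff[OF face_prime_ideal ideal_diff[OF face_prime_ideal xy
      ideal_mult2[OF face_prime_ideal RR(2)[OF x] y]] ideal_mult[OF face_prime_ideal RR(2)[OF y] RR(1)[OF x]]] .
  ultimately show False using s sZ by (auto simp: face_prime_def Z_def)
qed

lemma face_prime_aug: "face_prime T \<subseteq> aug"
  by (auto simp: face_prime_def aug_def coord_zero)

lemma face_prime_mono: "T \<subseteq> T' \<Longrightarrow> face_prime T \<subseteq> face_prime T'"
  unfolding face_prime_def by blast

lemma X_face_prime: "X (a i) \<in> face_prime T \<longleftrightarrow> i \<in> T"
  using X_R[OF a_S] by (auto simp: face_prime_def lookup_single when_def coord_a)

text \<open>Enlarging \<open>T\<close> by one ray at a time gives a chain of face primes with d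
  strict inclusions. So the local ring at the origin has dimension at least d, and
  Cohen-Macaulayness turns this into depth.\<close>

lemma regular_sequence_exists:
  assumes cm: "cohen_macaulay (semigroup_ring TYPE('k) S)"
  shows "\<exists>fs. noetherian_localized.reg R aug {0} fs \<and> length fs = CARD('d)"
proof -
  interpret L: localized_domain R aug using localized[OF cm aug_maximal] .
  have "cohen_macaulay_local L.A" using cm aug_maximal by (simp add: cohen_macaulay_def ring_on_R)
  then have dk: "depth L.A = krull_dim L.A" by (simp add: cohen_macaulay_local_def)
  obtain idx :: "'d \<Rightarrow> nat" where idx: "bij_betw idx UNIV {0..<CARD('d)}"
    using ex_bij_betw_finite_nat[OF finite] by blast
  define Q where "Q k = face_prime {i. idx i < k}" for k
  have lp: "L.lprime (Q k)" for k
    unfolding L.lprime_def Q_def using face_prime_ideal face_prime_aug face_prime_prime by blast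
  have chain: "L.ext (Q k) \<subset> L.ext (Q (Suc k))" if k: "k < CARD('d)" for k
  proof -
    obtain i where i: "idx i = k" using idx k by (metis (no_types, lifting) atLeast0LessThan bij_betw_imp_surj_on image_iff lessThan_iff)
    have "Q k \<subseteq> Q (Suc k)" unfolding Q_def by (intro face_prime_mono) auto
    moreover have "Q k \<noteq> Q (Suc k)" using X_face_prime[of i] i unfolding Q_def
      by (metis (no_types, lifting) lessI less_irrefl mem_Collect_eq)
    ultimately show ?thesis using L.ext_mono L.con_ext[OF L.lprime_lideal[OF lp]] by (metis psubsetI)
  qed
  have "enat CARD('d) \<le> krull_dim L.A"
    unfolding krull_dim_def
    by (intro Sup_upper CollectI exI[of _ "CARD('d)"] exI[of _ "\<lambda>k. L.ext (Q k)"] conjI refl allI impI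
      L.primeideal_ext lp chain)
  then have le: "enat CARD('d) \<le> depth L.A" using dk by simp
  \<comment> \<open>The depth is a supremum in \<open>enat\<close>. If every regular sequence had
    fewer than d entries, the supremum would be at most d - 1.\<close>
  have "\<exists>xs. regular_seq L.A xs \<and> set xs \<subseteq> max_ideal L.A \<and> CARD('d) \<le> length xs"
  proof (rule ccontr)
    assume n: "\<not> ?thesis"
    have len: "length xs \<le> CARD('d) - 1" if "regular_seq L.A xs" "set xs \<subseteq> max_ideal L.A" for xs
    proof (rule ccontr)
      assume "\<not> length xs \<le> CARD('d) - 1"
      then have "CARD('d) \<le> length xs" by linarith
      with that have "regular_seq L.A xs \<and> set xs \<subseteq> max_ideal L.A \<and> CARD('d) \<le> length xs" by (intro conjI)
      then show False using n by (rule notE[rotated, OF exI])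
    qed
    have "depth L.A \<le> enat (CARD('d) - 1)"
      unfolding depth_def by (rule Sup_least) (auto dest: len)
    then have "enat CARD('d) \<le> enat (CARD('d) - 1)" using le by (rule order_trans[rotated])
    moreover have "CARD('d) > 0" by simp
    ultimately show False unfolding enat_ord_simps by linarith
  qed
  then obtain xs where xs: "regular_seq L.A xs" "set xs \<subseteq> L.ext aug" "CARD('d) \<le> length xs"
    by (auto simp: L.max_ideal_A)
  obtain ps where ps: "xs = map (\<lambda>(r, s). L.fr r s) ps" "\<forall>(r, s)\<in>set ps. r \<in> aug \<and> s \<in> L.unit_den"
    using L.regular_seq_P_list[OF xs(2)] by blast
  have "L.reg {0} (map fst ps)" using L.regular_seq_iff_reg[OF ps(2)] xs(1) ps(1) by simp
  from L.reg_take[OF this, of "CARD('d)"] show ?thesis using xs(3) ps(1) by (intro exI) auto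
qed

subsection \<open>Long chains of primes avoid two extremal rays\<close>

lemma prime_power_cancel:
  assumes "\<And>x y. x \<in> R \<Longrightarrow> y \<in> R \<Longrightarrow> x * y \<in> Q \<Longrightarrow> x \<in> Q \<or> y \<in> Q"
    "t \<in> R" "t \<notin> Q" "g \<in> R" "t ^ m * g \<in> Q"
  shows "g \<in> Q"
  using assms(5)
proof (induction m)
  case (Suc m)
  then have "t * (t ^ m * g) \<in> Q" by (simp add: mult.assoc)
  then show ?case using Suc.IH assms(1)[of t "t ^ m * g"] assms(2-4) power_in by blast
qed simp

text \<open>Elements picked from the successive gaps of a chain of primes are algebraically
  independent over K modulo the bottom prime. In a relation modulo \<open>Q k\<close> the least
  power of \<open>t k\<close> cancels, since \<open>t k\<close> is not in that prime. Modulo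
  \<open>Q (Suc k)\<close> only the terms with this least exponent survive, leaving a nontrivial
  relation in the later elements.\<close>

lemma chain_independent:
  fixes t :: "nat \<Rightarrow> int ^ 'd \<Rightarrow>\<^sub>0 'k" and c :: "(nat \<Rightarrow> nat) \<Rightarrow> 'k"
  assumes k: "k \<le> n"
    and Q: "\<And>k. k \<le> n \<Longrightarrow> is_ideal (Q k)" "\<And>k. k \<le> n \<Longrightarrow> 1 \<notin> Q k"
      "\<And>k x y. k \<le> n \<Longrightarrow> x \<in> R \<Longrightarrow> y \<in> R \<Longrightarrow> x * y \<in> Q k \<Longrightarrow> x \<in> Q k \<or> y \<in> Q k"
      "\<And>k. k < n \<Longrightarrow> Q k \<subseteq> Q (Suc k)"
    and t: "\<And>k. k < n \<Longrightarrow> t k \<in> Q (Suc k)" "\<And>k. k < n \<Longrightarrow> t k \<notin> Q k"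
    and E: "finite E" "E \<noteq> {}" "\<And>e. e \<in> E \<Longrightarrow> c e \<noteq> 0" "\<And>e l. e \<in> E \<Longrightarrow> l < k \<or> n \<le> l \<Longrightarrow> e l = 0"
  shows "(\<Sum>e\<in>E. C (c e) * (\<Prod>l<n. t l ^ e l)) \<notin> Q k"
  using k E
proof (induction k arbitrary: E c rule: inc_induct)
  case base
  have "e = (\<lambda>_. 0)" if "e \<in> E" for e using base.prems(4)[OF that] not_le_imp_less by (auto simp: fun_eq_iff)
  then have E: "E = {\<lambda>_. 0}" using base.prems(2) by auto
  show ?case
  proof
    assume "(\<Sum>e\<in>E. C (c e) * (\<Prod>l<n. t l ^ e l)) \<in> Q n"
    then have "C (c (\<lambda>_. 0)) \<in> Q n" by (simp add: E)
    then show False using constant_unit[of "Q n"] Q(1,2)[of n] base.prems(3) E by auto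
  qed
next
  case (step k)
  have tR: "t l \<in> R" if "l < n" for l using t(1)[OF that] ideal_sub[OF Q(1), of "Suc l"] that by simp
  define r where "r e = (\<Prod>l\<in>{..<n} - {k}. t l ^ e l)" for e :: "nat \<Rightarrow> nat"
  have rR: "r e \<in> R" for e unfolding r_def by (intro prod_in power_in tR) auto
  have mono: "(\<Prod>l<n. t l ^ e l) = t k ^ e k * r e" for e
    unfolding r_def using step.hyps by (subst prod.remove[of _ k]) auto
  define m where "m = Min ((\<lambda>e. e k) ` E)"
  have m: "m \<le> e k" if "e \<in> E" for e using that step.prems(1) by (simp add: m_def)
  have "m \<in> (\<lambda>e. e k) ` E" unfolding m_def using step.prems(1,2) by (intro Min_in) auto
  then obtain e0 where e0: "e0 \<in> E" "e0 k = m" by auto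
  define E0 where "E0 = {e \<in> E. e k = m}"
  define g where "g = (\<Sum>e\<in>E. C (c e) * (t k ^ (e k - m) * r e))"
  have gR: "C (c e) * (t k ^ i * r e) \<in> R" for e i using C_R rR tR step.hyps power_in by (intro mult_in) auto
  have mon: "C (c e) * (\<Prod>l<n. t l ^ e l) = t k ^ m * (C (c e) * (t k ^ (e k - m) * r e))" if "e \<in> E" for e
  proof -
    have "t k ^ e k = t k ^ m * t k ^ (e k - m)" using m[OF that] by (simp add: power_add[symmetric])
    then show ?thesis unfolding mono by (simp add: algebra_simps)
  qed
  have sum: "(\<Sum>e\<in>E. C (c e) * (\<Prod>l<n. t l ^ e l)) = t k ^ m * g"
    unfolding g_def sum_distrib_left using mon by (intro sum.cong) auto
  show ?case
  proof
    assume "(\<Sum>e\<in>E. C (c e) * (\<Prod>l<n. t l ^ e l)) \<in> Q k"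
    then have "t k ^ m * g \<in> Q k" unfolding sum .
    moreover have "g \<in> R" unfolding g_def using gR by (intro sum_in) auto
    ultimately have "g \<in> Q k" using prime_power_cancel[of "Q k" "t k" g m] Q(3)[of k] tR t(2) step.hyps by auto
    then have gQ: "g \<in> Q (Suc k)" using Q(4) step.hyps by auto
    have QS: "is_ideal (Q (Suc k))" using Q(1) step.hyps by simp
    have "C (c e) * (t k ^ (e k - m) * r e) \<in> Q (Suc k)" if e: "e \<in> E - E0" for e
    proof -
      obtain i where "e k - m = Suc i" using e m[of e] by (cases "e k - m") (auto simp: E0_def)
      then have "C (c e) * (t k ^ (e k - m) * r e) = C (c e) * (t k ^ i * r e) * t k" by (simp add: algebra_simps)
      then show ?thesis using ideal_mult[OF QS t(1) gR] step.hyps by simp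
    qed
    then have A: "(\<Sum>e\<in>E - E0. C (c e) * (t k ^ (e k - m) * r e)) \<in> Q (Suc k)" by (rule ideal_sum[OF QS])
    have "g = (\<Sum>e\<in>E - E0. C (c e) * (t k ^ (e k - m) * r e)) + (\<Sum>e\<in>E0. C (c e) * (t k ^ (e k - m) * r e))"
      unfolding g_def using step.prems(1) by (intro sum.subset_diff) (auto simp: E0_def)
    then have s: "(\<Sum>e\<in>E0. C (c e) * (t k ^ (e k - m) * r e)) \<in> Q (Suc k)"
      using ideal_diff[OF QS gQ A] by simp
    \<comment> \<open>The surviving exponents all have the value \<open>m\<close> at
      \<open>k\<close>. Setting it to 0 is injective on \<open>E0\<close>, and \<open>c1\<close>
      finds the old coefficient by restoring \<open>m\<close>.\<close>
    define E1 where "E1 = (\<lambda>e. e(k := 0)) ` E0"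
    define c1 where "c1 e = c (e(k := m))" for e
    have inj: "inj_on (\<lambda>e. e(k := 0)) E0"
      by (rule inj_on_inverseI[where g = "\<lambda>e. e(k := m)"]) (auto simp: E0_def)
    have upd: "e(k := m) = e" if "e \<in> E0" for e using that by (auto simp: E0_def)
    have "(\<Sum>e\<in>E1. C (c1 e) * (\<Prod>l<n. t l ^ e l)) = (\<Sum>e\<in>E0. C (c e) * r (e(k := 0)))"
      unfolding E1_def sum.reindex[OF inj] by (intro sum.cong) (auto simp: mono c1_def upd)
    also have "\<dots> = (\<Sum>e\<in>E0. C (c e) * (t k ^ (e k - m) * r e))"
      by (intro sum.cong) (auto simp: E0_def r_def intro!: prod.cong)
    finally have "(\<Sum>e\<in>E1. C (c1 e) * (\<Prod>l<n. t l ^ e l)) \<in> Q (Suc k)" using s by simp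
    moreover have "(\<Sum>e\<in>E1. C (c1 e) * (\<Prod>l<n. t l ^ e l)) \<notin> Q (Suc k)"
    proof (rule step.IH)
      show "finite E1" "E1 \<noteq> {}" using step.prems(1) e0 by (auto simp: E1_def E0_def)
      show "c1 e \<noteq> 0" if "e \<in> E1" for e using that step.prems(3) upd by (auto simp: E1_def c1_def E0_def)
      show "e l = 0" if "e \<in> E1" "l < Suc k \<or> n \<le> l" for e l
        using that step.prems(4) by (auto simp: E1_def E0_def less_Suc_eq)
    qed
    ultimately show False by blast
  qed
qed

definition wt_le :: "(int ^ 'd \<Rightarrow>\<^sub>0 'k) \<Rightarrow> nat \<Rightarrow> bool" where
  "wt_le f N \<longleftrightarrow> (\<forall>s. Poly_Mapping.lookup f s \<noteq> 0 \<longrightarrow> wt s \<le> int N)"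

lemma wt_le_mult:
  assumes "wt_le f N" "wt_le g M"
  shows "wt_le (f * g) (N + M)"
  unfolding wt_le_def
proof (intro allI impI)
  fix s assume "Poly_Mapping.lookup (f * g) s \<noteq> 0"
  then obtain q where "q \<in> Poly_Mapping.keys f" "Poly_Mapping.lookup g (s - q) \<noteq> 0"
    unfolding lookup_mult_group by (metis (no_types, lifting) mult_zero_right sum.neutral)
  then have "wt q \<le> int N" "wt (s - q) \<le> int M" using assms by (auto simp: wt_le_def in_keys_iff)
  then show "wt s \<le> int (N + M)" by (simp add: wt_diff)
qed

lemma wt_le_one: "wt_le 1 N"
  by (auto simp: wt_le_def lookup_one when_def wt_zero)

lemma wt_le_power: "wt_le f N \<Longrightarrow> wt_le (f ^ e) (e * N)"
  by (induction e) (auto simp: wt_le_one intro: wt_le_mult)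

lemma wt_le_mono: "wt_le f N \<Longrightarrow> N \<le> M \<Longrightarrow> wt_le f M"
  unfolding wt_le_def by force

lemma wt_le_prod: "(\<And>l. l < n \<Longrightarrow> wt_le (f l) N) \<Longrightarrow> wt_le (\<Prod>l<n. f l) (n * N)" for n :: nat
  by (induction n) (auto simp: wt_le_one mult.commute[of "prod _ _"] intro: wt_le_mult)

lemma wt_le_exists: "\<exists>N. wt_le f N"
proof -
  have "finite (wt ` Poly_Mapping.keys f)" by simp
  then obtain b where "\<forall>x\<in>wt ` Poly_Mapping.keys f. x \<le> b" by (meson bdd_above.E bdd_above_finite)
  then have "wt_le f (nat b)" by (force simp: wt_le_def in_keys_iff)
  then show ?thesis by blast
qed

text \<open>If neither \<open>a i\<close> nor \<open>a j\<close> can be subtracted, the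
  decomposition into an Apery element and rays uses neither of them. So an element is determined by
  its Apery part and d - 2 exponents, each bounded by the weight.\<close>

lemma card_two_ray_apery:
  assumes ij: "i \<noteq> j"
  shows "finite {s \<in> S. s - a i \<notin> S \<and> s - a j \<notin> S \<and> wt s \<le> int N}" (is "finite ?B")
    and "card {s \<in> S. s - a i \<notin> S \<and> s - a j \<notin> S \<and> wt s \<le> int N} \<le> card (apery S a) * (N + 1) ^ (CARD('d) - 2)"
proof -
  let ?D = "apery S a \<times> (PiE (UNIV - {i, j}) (\<lambda>_. {..N}))"
  let ?h = "\<lambda>(u, n). u + (\<Sum>l\<in>UNIV - {i, j}. int (n l :: nat) *s a l)"
  have sub: "?B \<subseteq> ?h ` ?D"
  proof
    fix s assume s: "s \<in> ?B"
    then obtain u n where un: "u \<in> apery S a" "s = u + (\<Sum>l\<in>UNIV. int (n l :: nat) *s a l)"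
      using apery_decomposition by blast
    have z: "n l = 0" if l: "s - a l \<notin> S" for l
    proof (rule ccontr)
      assume "n l \<noteq> 0"
      then have "s - a l = u + (\<Sum>h\<in>UNIV. int (if h = l then n h - 1 else n h) *s a h)"
        using un(2) sum_scale_split[of UNIV l 1 n a] by (simp add: algebra_simps)
      also have "\<dots> \<in> S" using apery_S[OF un(1)] by (intro add_S sum_S mult_S a_S)
      finally show False using l by blast
    qed
    have "n l \<le> N" for l
    proof -
      have "int (n l) \<le> int (n l) * wt (a l)" using wt_pos[OF a_S a_nonzero, of l] by (simp add: mult_le_cancel_left1)
      also have "\<dots> \<le> (\<Sum>h\<in>UNIV. int (n h) * wt (a h))"
        using wt_nonneg[OF a_S] by (intro member_le_sum) auto
      also have "\<dots> \<le> wt s" unfolding un(2) using wt_nonneg[OF apery_S[OF un(1)]] by (simp add: wt_add wt_sum wt_mult)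
      finally show ?thesis using s by simp
    qed
    then have "restrict n (UNIV - {i, j}) \<in> PiE (UNIV - {i, j}) (\<lambda>_. {..N})" by auto
    moreover have "s = ?h (u, restrict n (UNIV - {i, j}))"
    proof -
      have "(\<Sum>l\<in>UNIV. int (n l) *s a l) = (\<Sum>l\<in>UNIV - {i, j}. int (n l) *s a l)"
        using z s by (intro sum.mono_neutral_right) auto
      also have "\<dots> = (\<Sum>l\<in>UNIV - {i, j}. int (restrict n (UNIV - {i, j}) l) *s a l)" by (intro sum.cong) auto
      finally show ?thesis using un(2) by simp
    qed
    ultimately show "s \<in> ?h ` ?D" using un(1) by blast
  qed
  have fin: "finite ?D" using finite_apery by (intro finite_cartesian_product finite_PiE) auto
  then show "finite ?B" using finite_surj[OF fin sub] by blast
  have "card ?B \<le> card ?D" using surj_card_le[OF fin sub] .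
  also have "card ?D = card (apery S a) * (N + 1) ^ card (UNIV - {i, j})"
    by (simp add: card_cartesian_product card_PiE)
  also have "card (UNIV - {i, j}) = CARD('d) - 2" using ij by (simp add: card_Diff_subset)
  finally show "card ?B \<le> card (apery S a) * (N + 1) ^ (CARD('d) - 2)" .
qed

text \<open>Two growth rates collide. Products of d - 1 independent elements with exponents up to
  \<open>N\<close> number \<open>(N + 1) ^ (d - 1)\<close>, but modulo the two ray monomials they
  live in a space whose dimension is of order \<open>N ^ (d - 2)\<close>. A linear dependence
  between them is an algebraic relation in \<open>Q 0\<close>.\<close>

lemma no_long_prime_chain:
  assumes ij: "i \<noteq> j" and n: "n = CARD('d) - 1"
    and Q: "\<And>k. k \<le> n \<Longrightarrow> is_ideal (Q k)" "\<And>k. k \<le> n \<Longrightarrow> 1 \<notin> Q k"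
      "\<And>k x y. k \<le> n \<Longrightarrow> x \<in> R \<Longrightarrow> y \<in> R \<Longrightarrow> x * y \<in> Q k \<Longrightarrow> x \<in> Q k \<or> y \<in> Q k"
      "\<And>k. k < n \<Longrightarrow> Q k \<subset> Q (Suc k)"
    and X: "X (a i) \<in> Q 0" "X (a j) \<in> Q 0"
  shows False
proof -
  have "\<forall>k. k < n \<longrightarrow> (\<exists>t. t \<in> Q (Suc k) \<and> t \<notin> Q k)" using Q(4) by blast
  then obtain t where t: "\<And>k. k < n \<Longrightarrow> t k \<in> Q (Suc k)" "\<And>k. k < n \<Longrightarrow> t k \<notin> Q k" by metis
  have tR: "t l \<in> R" if "l < n" for l using t(1)[OF that] ideal_sub[OF Q(1), of "Suc l"] that by simp
  obtain w where w: "\<And>l. l < n \<Longrightarrow> wt_le (t l) w"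
  proof -
    have "\<forall>l. \<exists>N. wt_le (t l) N" using wt_le_exists by blast
    then obtain W where W: "\<forall>l. wt_le (t l) (W l)" by metis
    have "wt_le (t l) (\<Sum>l<n. W l)" if "l < n" for l
      using that W
      by - (rule wt_le_mono[where N = "W l" and M = "sum W {..<n}"], auto intro: member_le_sum)
    then show thesis by (rule that)
  qed
  have "2 \<le> CARD('d)" using card_mono[of "UNIV :: 'd set" "{i, j}"] ij by simp
  then have n1: "n = Suc (CARD('d) - 2)" using n by simp
  define c0 where "c0 = n * w"
  \<comment> \<open>The products have weight at most \<open>c0 * N\<close>. Since
    \<open>c0 * N + 1 \<le> (c0 + 1) * (N + 1)\<close>, this choice bounds the number of relevant
    monomials by \<open>N * (N + 1) ^ (d - 2)\<close>, which is below
    \<open>(N + 1) ^ (d - 1)\<close>.\<close>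
  define N where "N = card (apery S a) * (c0 + 1) ^ (CARD('d) - 2)"
  define B where "B = {s \<in> S. s - a i \<notin> S \<and> s - a j \<notin> S \<and> wt s \<le> int (c0 * N)}"
  \<comment> \<open>Functions in \<open>PiE\<close> are undefined outside their domain;
    \<open>chain_independent\<close> wants exponent 0 there.\<close>
  define E where "E = (\<lambda>e l. if l < n then e l else 0) ` (PiE {..<n} (\<lambda>_. {..N}))"
  have inj: "inj_on (\<lambda>e l. if l < n then e l else (0::nat)) (PiE {..<n} (\<lambda>_. {..N}))"
  proof (rule inj_onI)
    fix e e' :: "nat \<Rightarrow> nat" assume e: "e \<in> PiE {..<n} (\<lambda>_. {..N})" "e' \<in> PiE {..<n} (\<lambda>_. {..N})"
      and eq: "(\<lambda>l. if l < n then e l else 0) = (\<lambda>l. if l < n then e' l else 0)"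
    have "e l = e' l" if "l < n" for l using fun_cong[OF eq, of l] that by simp
    then show "e = e'" using PiE_ext[OF e] by simp
  qed
  have finE: "finite E" unfolding E_def by (intro finite_imageI finite_PiE) auto
  have cardE: "card E = (N + 1) ^ n" unfolding E_def card_image[OF inj] by (simp add: card_PiE)
  have "card B \<le> card (apery S a) * (c0 * N + 1) ^ (CARD('d) - 2)"
    unfolding B_def using card_two_ray_apery(2)[OF ij] .
  also have "\<dots> \<le> card (apery S a) * ((c0 + 1) * (N + 1)) ^ (CARD('d) - 2)"
    by (intro mult_left_mono power_mono) (auto simp: algebra_simps)
  also have "\<dots> = N * (N + 1) ^ (CARD('d) - 2)" by (simp only: power_mult_distrib N_def mult.assoc)
  also have "\<dots> < (N + 1) ^ n" unfolding n1 by simp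
  finally have "card B < card E" using cardE by simp
  then obtain c where c: "\<exists>e\<in>E. c e \<noteq> 0"
    "\<forall>b\<in>B. (\<Sum>e\<in>E. c e * Poly_Mapping.lookup (\<Prod>l<n. t l ^ e l) b) = 0"
    using nontrivial_combination[OF card_two_ray_apery(1)[OF ij] finE, of "c0 * N"
      "\<lambda>e. Poly_Mapping.lookup (\<Prod>l<n. t l ^ e l)"] unfolding B_def by blast
  define f where "f = (\<Sum>e\<in>E. C (c e) * (\<Prod>l<n. t l ^ e l))"
  have lf: "Poly_Mapping.lookup f s = (\<Sum>e\<in>E. c e * Poly_Mapping.lookup (\<Prod>l<n. t l ^ e l) s)" for s
    by (simp add: f_def lookup_sum lookup_single_mult)
  have fR: "f \<in> R" unfolding f_def using tR by (intro sum_in mult_in C_R prod_in power_in) auto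
  have "X s \<in> Q 0" if s: "s \<in> Poly_Mapping.keys f" for s
  proof -
    have sS: "s \<in> S" using s fR R_key by (simp add: in_keys_iff)
    have "\<exists>e\<in>E. Poly_Mapping.lookup (\<Prod>l<n. t l ^ e l) s \<noteq> 0"
      using s unfolding in_keys_iff lf by (metis (no_types, lifting) mult_zero_right sum.neutral)
    then obtain e where e: "e \<in> E" "Poly_Mapping.lookup (\<Prod>l<n. t l ^ e l) s \<noteq> 0" by blast
    obtain e' where e': "e' \<in> PiE {..<n} (\<lambda>_. {..N})" "e = (\<lambda>l. if l < n then e' l else 0)"
      using e(1) unfolding E_def by (elim imageE)
    have "e l \<le> N" if "l < n" for l using PiE_mem[OF e'(1), of l] that by (simp add: e'(2))
    then have "wt_le (t l ^ e l) (N * w)" if "l < n" for l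
      using that by - (rule wt_le_mono[OF wt_le_power[OF w]], auto)
    then have "wt_le (\<Prod>l<n. t l ^ e l) (n * (N * w))" by (rule wt_le_prod)
    then have "wt s \<le> int (c0 * N)" using e(2) by (simp add: wt_le_def c0_def algebra_simps)
    moreover have "s \<notin> B" using c(2) s by (auto simp: in_keys_iff lf)
    ultimately have "s - a i \<in> S \<or> s - a j \<in> S" using sS by (auto simp: B_def)
    then show ?thesis using X_multiple[OF Q(1)] X by blast
  qed
  then have f0: "f \<in> Q 0" using monomials_in_ideal[OF Q(1) fR] by blast
  define E' where "E' = {e \<in> E. c e \<noteq> 0}"
  have "f = (\<Sum>e\<in>E'. C (c e) * (\<Prod>l<n. t l ^ e l))"
    unfolding f_def E'_def using finE by (intro sum.mono_neutral_right) auto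
  moreover have "(\<Sum>e\<in>E'. C (c e) * (\<Prod>l<n. t l ^ e l)) \<notin> Q 0"
  proof (rule chain_independent[of 0 n Q t])
    show "Q k \<subseteq> Q (Suc k)" if "k < n" for k using Q(4)[OF that] by blast
    show "finite E'" "E' \<noteq> {}" "\<And>e. e \<in> E' \<Longrightarrow> c e \<noteq> 0" using finE c(1) by (auto simp: E'_def)
    have "e l = 0" if "e \<in> E" "n \<le> l" for e l using that unfolding E_def by (elim imageE) simp
    then show "e l = 0" if "e \<in> E'" "l < 0 \<or> n \<le> l" for e l using that by (simp add: E'_def)
  qed (use Q t in auto)
  ultimately show False using f0 by simp
qed

lemma cm_saturated:
  assumes cm: "cohen_macaulay (semigroup_ring TYPE('k) S)"
    and ij: "i \<noteq> j" and s: "s + a i \<in> S" "s + a j \<in> S"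
  shows "s \<in> S"
proof (rule ccontr)
  assume sS: "s \<notin> S"
  interpret L: localized_domain R aug using localized[OF cm aug_maximal] .
  obtain fs where fs: "L.reg {0} fs" "length fs = CARD('d)" using regular_sequence_exists[OF cm] by blast
  let ?y = "X (a i)" and ?u = "X (s + a i)"
  have yR: "?y \<in> R" "?u \<in> R" using X_R a_S s by blast+
  have "?y \<noteq> 0" by (metis lookup_single_eq lookup_zero zero_neq_one)
  then have "r = 0" if "?y * r = 0" for r using poly_mapping_domain[of ?y r] that by blast
  then have y0: "L.nzd {0} ?y" using yR by (auto simp: L.nzd_def)
  have zi: "is_ideal {0}" using L.lideal_ideal[OF L.lideal_zero] .
  have la: "L.lideal (L.adj {0} ?y)" using L.lideal_adj[OF zi yR(1)] .
  \<comment> \<open>Compare coefficients at \<open>s + a i\<close> in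
    \<open>v * ?u = ?y * r\<close>. On the left stands the constant term of \<open>v\<close>,
    nonzero because \<open>v\<close> is outside \<open>aug\<close>; on the right stands the
    coefficient of \<open>r\<close> at \<open>s\<close>, zero because \<open>s\<close> is not in
    \<open>S\<close>.\<close>
  have nu: "?u \<notin> L.adj {0} ?y"
  proof
    assume "?u \<in> L.adj {0} ?y"
    then obtain v r where vr: "v \<in> L.unit_den" "r \<in> R" "v * ?u = ?y * r" by (auto elim!: L.adjE)
    have "Poly_Mapping.lookup v 0 = Poly_Mapping.lookup (?u * v) (s + a i)" by (simp add: lookup_single_mult)
    also have "?u * v = ?y * r" using vr(3) by (simp add: mult.commute)
    also have "Poly_Mapping.lookup (?y * r) (s + a i) = Poly_Mapping.lookup r s" by (simp add: lookup_single_mult)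
    also have "\<dots> = 0" using R_key[OF vr(2)] sS by blast
    finally show False using vr(1) unfolding L.unit_den_def by (simp add: aug_def)
  qed
  obtain Q where Q: "L.maxann (L.adj {0} ?y) Q" "ann (L.adj {0} ?y) ?u \<subseteq> Q"
    using L.maxann_exists[OF L.lideal_ideal[OF la] yR(2) nu] by blast
  obtain v where v: "v \<in> R" "v \<notin> L.adj {0} ?y" "Q = ann (L.adj {0} ?y) v" using Q(1) by (auto simp: L.maxann_def)
  have "?y * ?u \<in> L.adj {0} ?y" using L.adj_self[OF zi yR] .
  moreover have "X (a j) * ?u \<in> L.adj {0} ?y"
  proof -
    have "X (a j) * ?u = ?y * X (s + a j)" by (simp add: mult_single algebra_simps)
    then show ?thesis using L.adj_self[OF zi yR(1) X_R[OF s(2)]] by simp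
  qed
  ultimately have XQ: "?y \<in> Q" "X (a j) \<in> Q" using Q(2) yR X_R[OF a_S] by (auto simp: ann_def)
  have "fs \<noteq> []" using fs(2) by auto
  then obtain Q' Qs where ch: "length Qs + 1 = CARD('d)" "L.pchain (Q' # Qs)" "Q \<subseteq> Q'"
    using L.chain_of_quotient_annihilator[OF fs(1) _ L.lideal_zero L.maxann_lprime[OF la Q(1)] XQ(1) y0 v(1,2)]
      v(3) fs(2) by (auto simp: ann_def)
  let ?Q = "\<lambda>k. (Q' # Qs) ! k"
  have len: "k < length (Q' # Qs)" if "k \<le> CARD('d) - 1" for k using that ch(1) by simp
  have lp: "L.lprime (?Q k)" if "k \<le> CARD('d) - 1" for k using ch(2) nth_mem[OF len[OF that]] by (auto simp: L.pchain_def)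
  show False
  \<comment> \<open>The number in that lemma counts strict inclusions: the d primes
    \<open>Q' # Qs\<close> have d - 1 of them.\<close>
  proof (rule no_long_prime_chain[OF ij refl, of ?Q])
    show "is_ideal (?Q k)" "1 \<notin> ?Q k" if "k \<le> CARD('d) - 1" for k
      using lp[OF that] L.one_notin_P by (auto simp: L.lprime_def)
    show "x \<in> ?Q k \<or> y \<in> ?Q k" if "k \<le> CARD('d) - 1" "x \<in> R" "y \<in> R" "x * y \<in> ?Q k" for k x y
      using lp[OF that(1)] that(2-4) by (auto simp: L.lprime_def)
    have srt: "sorted_wrt (\<subset>) (Q' # Qs)" using ch(2) by (simp only: L.pchain_def)
    show "?Q k \<subset> ?Q (Suc k)" if "k < CARD('d) - 1" for k
      by (rule sorted_wrt_nth_less[OF srt lessI len]) (use that in linarith)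
    show "X (a i) \<in> ?Q 0" "X (a j) \<in> ?Q 0" using XQ ch(3) by auto
  qed
qed

end

section \<open>Zariski's lemma\<close>

context noetherian_localized
begin

definition subring :: "'a set \<Rightarrow> bool" where "subring D \<longleftrightarrow> D \<subseteq> R \<and> comm_subring D"

definition coeffs_in :: "'a set \<Rightarrow> 'a poly \<Rightarrow> bool" where "coeffs_in D f \<longleftrightarrow> (\<forall>i. coeff f i \<in> D)"

definition adjoin :: "'a set \<Rightarrow> 'a \<Rightarrow> 'a set" where "adjoin D g = {poly f g |f. coeffs_in D f}"

text \<open>A coefficient outside \<open>P\<close> makes \<open>f\<close> nonzero modulo
  \<open>P\<close>. All statements about the domain \<open>R / P\<close> are phrased in
  \<open>R\<close>, so no quotient has to be formed.\<close>

definition algebraic_over :: "'a set \<Rightarrow> 'a \<Rightarrow> bool" where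
  "algebraic_over D g \<longleftrightarrow> (\<exists>f. coeffs_in D f \<and> (\<exists>i. coeff f i \<notin> P) \<and> poly f g \<in> P)"

text \<open>Some localization \<open>D[1/h]\<close> is a field modulo \<open>P\<close>.\<close>

definition generically_field :: "'a set \<Rightarrow> bool" where
  "generically_field D \<longleftrightarrow> (\<exists>h\<in>D - P. \<forall>q\<in>D - P. \<exists>p\<in>D. \<exists>n. q * p - h ^ n \<in> P)"

lemmas P_rules = ideal_zero[OF P_ideal] ideal_add[OF P_ideal] ideal_diff[OF P_ideal] ideal_mult[OF P_ideal]
  ideal_mult2[OF P_ideal] ideal_uminus[OF P_ideal]

lemma dependent_mod:
  assumes D: "subring D" and fin: "finite B" "finite E" "card B < card E"
    and v: "\<And>e b. e \<in> E \<Longrightarrow> b \<in> B \<Longrightarrow> v e b \<in> D"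
  shows "\<exists>c. (\<forall>e. c e \<in> D) \<and> (\<exists>e\<in>E. c e \<notin> P) \<and> (\<forall>b\<in>B. (\<Sum>e\<in>E. c e * v e b) \<in> P)"
  using fin v
proof (induction B arbitrary: E v rule: finite_induct)
  case empty
  interpret D: comm_subring D using D by (simp add: subring_def)
  from empty have "E \<noteq> {}" by auto
  then show ?case using one_notin_P by (intro exI[of _ "\<lambda>_. 1"]) auto
next
  case (insert b B)
  interpret D: comm_subring D using D by (simp add: subring_def)
  have DR: "x \<in> R" if "x \<in> D" for x using D that by (auto simp: subring_def)
  show ?case
  proof (cases "\<exists>e0\<in>E. v e0 b \<notin> P")
    case False
    have lt: "card B < card E" using insert by simp
    have "v e b' \<in> D" if "e \<in> E" "b' \<in> B" for e b' using insert.prems(3)[of e b'] that by simp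
    then obtain c where
      c: "\<forall>e. c e \<in> D" "\<exists>e\<in>E. c e \<notin> P" "\<forall>b\<in>B. (\<Sum>e\<in>E. c e * v e b) \<in> P"
      using insert.IH[of E v, OF insert.prems(1) lt] by blast
    have "(\<Sum>e\<in>E. c e * v e b) \<in> P"
    proof (rule ideal_sum[OF P_ideal])
      fix e assume "e \<in> E"
      then have "v e b \<in> P" using False by blast
      then show "c e * v e b \<in> P" by (rule P_rules(4)[OF _ DR[OF c(1)[rule_format]]])
    qed
    then show ?thesis using c by (intro exI[of _ c]) auto
  next
    case True
    then obtain e0 where e0: "e0 \<in> E" "v e0 b \<notin> P" by blast
    define v' where "v' e b' = v e0 b * v e b' - v e b * v e0 b'" for e b'
    have "card B < card (E - {e0})" using insert e0 by simp
    moreover have "v' e b' \<in> D" if "e \<in> E - {e0}" "b' \<in> B" for e b'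
      unfolding v'_def using that e0 by (intro D.diff_in D.mult_in insert.prems(3)) auto
    ultimately obtain c where c: "\<forall>e. c e \<in> D" "\<exists>e\<in>E - {e0}. c e \<notin> P"
      "\<forall>b'\<in>B. (\<Sum>e\<in>E - {e0}. c e * v' e b') \<in> P"
      using insert.IH[of "E - {e0}" v'] insert.prems(1) by auto
    define c0 where "c0 = - (\<Sum>e\<in>E - {e0}. c e * v e b)"
    define c' where "c' e = (if e = e0 then c0 else c e * v e0 b)" for e
    have s: "(\<Sum>e\<in>E. c' e * v e b') = (\<Sum>e\<in>E - {e0}. c e * v' e b')" for b'
    proof -
      have "(\<Sum>e\<in>E. c' e * v e b') = c0 * v e0 b' + (\<Sum>e\<in>E - {e0}. c' e * v e b')"
        using e0 insert.prems(1) by (simp add: sum.remove[of E e0] c'_def)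
      also have "(\<Sum>e\<in>E - {e0}. c' e * v e b') = (\<Sum>e\<in>E - {e0}. c e * v e0 b * v e b')"
        by (intro sum.cong) (auto simp: c'_def)
      also have "c0 * v e0 b' + \<dots> = (\<Sum>e\<in>E - {e0}. c e * v e0 b * v e b' - c e * v e b * v e0 b')"
        by (simp add: c0_def sum_subtractf sum_distrib_right)
      also have "\<dots> = (\<Sum>e\<in>E - {e0}. c e * v' e b')"
        by (intro sum.cong) (auto simp: v'_def algebra_simps)
      finally show ?thesis .
    qed
    have "v' e b = 0" for e by (simp add: v'_def mult.commute)
    then have "(\<Sum>e\<in>E. c' e * v e b') \<in> P" if "b' \<in> insert b B" for b'
      using that c(3) P_rules(1) unfolding s by auto
    moreover have vD: "v e0 b \<in> D" using insert.prems(3)[of e0 b] e0 by simp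
    have "c0 \<in> D" unfolding c0_def using c(1) by (intro D.uminus_in D.sum_in D.mult_in insert.prems(3)) auto
    then have "\<forall>e. c' e \<in> D" using c(1) vD by (auto simp: c'_def)
    moreover obtain e1 where e1: "e1 \<in> E" "e1 \<noteq> e0" "c e1 \<notin> P" using c(2) by blast
    have "c' e1 \<notin> P" using P_prime[of "c e1" "v e0 b"] e1 e0 c(1) vD DR by (auto simp: c'_def)
    ultimately show ?thesis using e1(1) by (intro exI[of _ c']) blast
  qed
qed

lemma poly_in:
  assumes "comm_subring D" "coeffs_in D f" "x \<in> D"
  shows "poly f x \<in> D"
proof -
  interpret D: comm_subring D by fact
  show ?thesis unfolding poly_altdef using assms(2,3)
    by (intro D.sum_in D.mult_in D.power_in) (auto simp: coeffs_in_def)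
qed

lemma coeffs_in_rules:
  assumes "comm_subring D"
  shows "coeffs_in D 1" "x \<in> D \<Longrightarrow> coeffs_in D [:x:]" "x \<in> D \<Longrightarrow> coeffs_in D f \<Longrightarrow> coeffs_in D (pCons x f)"
    "coeffs_in D f \<Longrightarrow> coeffs_in D g \<Longrightarrow> coeffs_in D (f + g)"
    "coeffs_in D f \<Longrightarrow> coeffs_in D g \<Longrightarrow> coeffs_in D (f - g)"
    "coeffs_in D f \<Longrightarrow> coeffs_in D g \<Longrightarrow> coeffs_in D (f * g)"
    "coeffs_in D f \<Longrightarrow> coeffs_in D (- f)"
proof -
  interpret D: comm_subring D by fact
  show "coeffs_in D 1" "x \<in> D \<Longrightarrow> coeffs_in D [:x:]" "x \<in> D \<Longrightarrow> coeffs_in D f \<Longrightarrow> coeffs_in D (pCons x f)"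
    by (auto simp: coeffs_in_def coeff_pCons split: nat.split)
  show "coeffs_in D f \<Longrightarrow> coeffs_in D g \<Longrightarrow> coeffs_in D (f + g)"
    "coeffs_in D f \<Longrightarrow> coeffs_in D g \<Longrightarrow> coeffs_in D (f - g)" "coeffs_in D f \<Longrightarrow> coeffs_in D (- f)"
    by (auto simp: coeffs_in_def)
  show "coeffs_in D f \<Longrightarrow> coeffs_in D g \<Longrightarrow> coeffs_in D (f * g)"
    unfolding coeffs_in_def coeff_mult by (intro allI D.sum_in D.mult_in) auto
qed

lemma coeffs_in_power: "comm_subring D \<Longrightarrow> coeffs_in D f \<Longrightarrow> coeffs_in D (f ^ n)"
  by (induction n) (auto intro: coeffs_in_rules)

lemma coeffs_in_sum: "comm_subring D \<Longrightarrow> (\<And>x. x \<in> A \<Longrightarrow> coeffs_in D (f x)) \<Longrightarrow> coeffs_in D (sum f A)"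
  by (auto simp: coeffs_in_def coeff_sum intro: comm_subring.sum_in)

lemma subring_adjoin:
  assumes D: "subring D" and g: "g \<in> R"
  shows "subring (adjoin D g)" "D \<subseteq> adjoin D g" "g \<in> adjoin D g"
proof -
  have cD: "comm_subring D" and DR: "D \<subseteq> R" using D by (auto simp: subring_def)
  have "comm_subring R" by unfold_locales
  then have "adjoin D g \<subseteq> R" unfolding adjoin_def using poly_in[of R] DR g by (auto simp: coeffs_in_def subset_iff)
  moreover have "comm_subring (adjoin D g)"
  proof
    show "1 \<in> adjoin D g" unfolding adjoin_def using coeffs_in_rules(1)[OF cD] by (intro CollectI exI[of _ 1]) auto
    fix x y assume "x \<in> adjoin D g" "y \<in> adjoin D g"
    then obtain p q where pq: "x = poly p g" "y = poly q g" "coeffs_in D p" "coeffs_in D q" by (auto simp: adjoin_def)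
    show "x + y \<in> adjoin D g" unfolding adjoin_def using pq coeffs_in_rules(4)[OF cD] by (intro CollectI exI[of _ "p + q"]) auto
    show "x * y \<in> adjoin D g" unfolding adjoin_def using pq coeffs_in_rules(6)[OF cD] by (intro CollectI exI[of _ "p * q"]) auto
  next
    fix x assume "x \<in> adjoin D g"
    then obtain p where pq: "x = poly p g" "coeffs_in D p" by (auto simp: adjoin_def)
    show "- x \<in> adjoin D g" unfolding adjoin_def using pq coeffs_in_rules(7)[OF cD] by (intro CollectI exI[of _ "- p"]) auto
  qed
  ultimately show "subring (adjoin D g)" by (simp add: subring_def)
  show "D \<subseteq> adjoin D g"
  proof
    fix x assume "x \<in> D"
    then show "x \<in> adjoin D g" unfolding adjoin_def using coeffs_in_rules(2)[OF cD] by (intro CollectI exI[of _ "[:x:]"]) auto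
  qed
  have "coeffs_in D [:0, 1:]" using cD by (intro coeffs_in_rules) (auto simp: comm_subring.zero_in comm_subring.one_in)
  then show "g \<in> adjoin D g" unfolding adjoin_def by (intro CollectI exI[of _ "[:0, 1:]"]) auto
qed

text \<open>The index found is the degree of \<open>f\<close> modulo \<open>P\<close>.\<close>

lemma top_index:
  assumes "coeff f k \<notin> P"
  shows "\<exists>i\<ge>k. coeff f i \<notin> P \<and> (\<forall>j>i. coeff f j \<in> P)"
proof -
  have b: "i \<le> degree f" if "coeff f i \<notin> P" for i using that P_rules(1) le_degree by metis
  let ?i = "GREATEST i. coeff f i \<notin> P"
  have "coeff f ?i \<notin> P" by (rule GreatestI_nat[where P = "\<lambda>i. coeff f i \<notin> P", OF assms b])
  moreover have "j \<le> ?i" if "coeff f j \<notin> P" for j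
    by (rule Greatest_le_nat[where P = "\<lambda>i. coeff f i \<notin> P", OF that b])
  ultimately show ?thesis using assms by (intro exI[of _ ?i]) (metis not_less)
qed

lemma top_product:
  assumes f: "coeffs_in R f" "coeff f i \<notin> P" "\<forall>k>i. coeff f k \<in> P"
    and g: "coeffs_in R g" "coeff g j \<notin> P" "\<forall>k>j. coeff g k \<in> P"
  shows "coeff (f * g) (i + j) \<notin> P"
proof
  have R: "coeff f k \<in> R" "coeff g k \<in> R" for k using f g by (auto simp: coeffs_in_def)
  assume *: "coeff (f * g) (i + j) \<in> P"
  have eq: "coeff (f * g) (i + j) = coeff f i * coeff g j + (\<Sum>k\<in>{..i + j} - {i}. coeff f k * coeff g (i + j - k))"
    unfolding coeff_mult by (subst sum.remove[of _ i]) auto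
  have S: "(\<Sum>k\<in>{..i + j} - {i}. coeff f k * coeff g (i + j - k)) \<in> P"
  proof (rule ideal_sum[OF P_ideal])
    fix k assume k: "k \<in> {..i + j} - {i}"
    show "coeff f k * coeff g (i + j - k) \<in> P"
    proof (cases "k > i")
      case True
      then show ?thesis using f(3) R P_rules(5) by blast
    next
      case False
      then have "i + j - k > j" using k by auto
      then show ?thesis using g(3) R P_rules(4) by blast
    qed
  qed
  have "coeff f i * coeff g j \<in> P" using P_rules(3)[OF * S] unfolding eq by simp
  then show False using P_prime R f(2) g(2) by blast
qed

text \<open>Write \<open>h = poly f0 g\<close>. Modulo \<open>P\<close> the element
  \<open>1 + g * h\<close> divides a power of \<open>h\<close>, although it is coprime to
  \<open>h\<close>. If \<open>g\<close> were transcendental, this would hold between polynomials and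
  make \<open>1 + x * f0\<close> invertible, while its degree modulo \<open>P\<close> is
  positive.\<close>

lemma algebraic_if_generically_field:
  assumes D: "subring D" and g: "g \<in> R" and F: "generically_field (adjoin D g)"
  shows "algebraic_over D g"
proof (rule ccontr)
  assume na: "\<not> ?thesis"
  have cD: "comm_subring D" and DR: "D \<subseteq> R" using D by (auto simp: subring_def)
  interpret D: comm_subring D by fact
  have cR: "comm_subring R" by unfold_locales
  have inR: "coeffs_in R f" if "coeffs_in D f" for f using that DR by (auto simp: coeffs_in_def)
  have trans: "coeff f i \<in> P" if "coeffs_in D f" "poly f g \<in> P" for f i
    using na that by (auto simp: algebraic_over_def)
  have inP: "poly f g \<in> P" if "\<forall>i. coeff f i \<in> P" for f
    unfolding poly_altdef using that g power_in by (intro ideal_sum[OF P_ideal] P_rules(5)) auto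
  obtain h where h: "h \<in> adjoin D g - P" "\<forall>q\<in>adjoin D g - P. \<exists>p\<in>adjoin D g. \<exists>n. q * p - h ^ n \<in> P"
    using F unfolding generically_field_def by blast
  obtain f0 where f0: "h = poly f0 g" "coeffs_in D f0" using h(1) by (auto simp: adjoin_def)
  define q0 where "q0 = 1 + pCons 0 f0"
  have q0: "coeffs_in D q0" unfolding q0_def using f0 cD by (intro coeffs_in_rules) auto
  have "coeff q0 0 = 1" by (simp add: q0_def)
  then have "poly q0 g \<notin> P" using trans[OF q0, of 0] one_notin_P by auto
  moreover have "poly q0 g \<in> adjoin D g" using q0 by (auto simp: adjoin_def)
  ultimately obtain p n where p: "p \<in> adjoin D g" "poly q0 g * p - h ^ n \<in> P" using h(2) by blast
  obtain p0 where p0: "p = poly p0 g" "coeffs_in D p0" using p(1) by (auto simp: adjoin_def)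
  \<comment> \<open>The geometric sum gives \<open>1 - (- x * f0) ^ n = q0 * s0\<close>. Replacing
    \<open>f0 ^ n\<close> by its multiple \<open>q0 * p0\<close> turns \<open>w0\<close> below into
    an inverse of \<open>q0\<close> modulo \<open>P\<close>.\<close>
  define s0 where "s0 = (\<Sum>i<n. (1 - q0) ^ i)"
  have s0: "coeffs_in D s0" unfolding s0_def using q0 cD
    by (intro coeffs_in_sum coeffs_in_power coeffs_in_rules) auto
  have id: "1 - (1 - q0) ^ n = q0 * s0" unfolding s0_def using one_diff_power_eq[of "1 - q0" n] by simp
  define w0 where "w0 = s0 + [:0, - 1:] ^ n * p0"
  have m1: "coeffs_in D [:0, - 1:]" using cD by (intro coeffs_in_rules) auto
  have w0: "coeffs_in D w0" unfolding w0_def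
    by (rule coeffs_in_rules(4)[OF cD s0 coeffs_in_rules(6)[OF cD coeffs_in_power[OF cD m1] p0(2)]])
  have c1: "coeffs_in D (q0 * w0 - 1)" using q0 w0 cD by (intro coeffs_in_rules)
  have "poly (q0 * w0 - 1) g = (- g) ^ n * (poly q0 g * p - h ^ n)"
  proof -
    have "poly (1 - (1 - q0) ^ n) g = poly (q0 * s0) g" using id by simp
    moreover have "1 - poly q0 g = - g * h" by (simp add: q0_def f0)
    moreover have "poly ((1 - q0) ^ n) g = (1 - poly q0 g) ^ n" by (simp add: poly_power)
    ultimately have "1 - (- g * h) ^ n = poly q0 g * poly s0 g" by simp
    then have e: "poly q0 g * poly s0 g = 1 - (- g) ^ n * h ^ n" unfolding power_mult_distrib by simp
    have "poly (q0 * w0 - 1) g = poly q0 g * poly s0 g + poly q0 g * ((- g) ^ n * p) - 1"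
      by (simp add: w0_def poly_power p0 distrib_left)
    then show ?thesis unfolding e by (simp add: right_diff_distrib mult.left_commute)
  qed
  also have "\<dots> \<in> P" using p(2) g power_in by (intro P_rules(4)) auto
  finally have cP: "coeff (q0 * w0 - 1) i \<in> P" for i using trans[OF c1] by blast
  have "\<exists>k. coeff f0 k \<notin> P" using inP[of f0] h(1) f0 by auto
  then obtain k where "coeff q0 (Suc k) \<notin> P" by (auto simp: q0_def)
  then obtain i where i: "i \<ge> Suc k" "coeff q0 i \<notin> P" "\<forall>j>i. coeff q0 j \<in> P" using top_index by blast
  have "\<exists>k. coeff w0 k \<notin> P"
  proof (rule ccontr)
    assume "\<not> ?thesis"
    then have "coeff (q0 * w0) 0 \<in> P" using inR[OF q0] P_rules(4) by (simp add: coeff_mult coeffs_in_def)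
    then have "1 \<in> P" using cP[of 0] P_rules(3)[of "coeff (q0 * w0) 0" "coeff (q0 * w0 - 1) 0"] by simp
    then show False using one_notin_P by blast
  qed
  then obtain j where j: "coeff w0 j \<notin> P" "\<forall>k>j. coeff w0 k \<in> P" using top_index by blast
  have "coeff (q0 * w0) (i + j) \<notin> P" using top_product[OF inR[OF q0] i(2,3) inR[OF w0] j] .
  moreover have "coeff (q0 * w0 - 1) (i + j) = coeff (q0 * w0) (i + j)" using i(1) by (simp add: coeff_1)
  ultimately show False using cP[of "i + j"] by metis
qed

text \<open>As long as the constant coefficient lies in \<open>P\<close>, a factor \<open>h\<close>
  can be cancelled from the relation. The first constant coefficient outside \<open>P\<close> is the
  desired \<open>e\<close>, a multiple of \<open>h\<close> modulo \<open>P\<close>.\<close>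

lemma algebraic_divides:
  assumes D: "subring D" and h: "h \<in> R" "h \<notin> P"
  shows "coeffs_in D f \<Longrightarrow> \<exists>i. coeff f i \<notin> P \<Longrightarrow> poly f h \<in> P \<Longrightarrow> \<exists>e\<in>D - P. \<exists>f'. coeffs_in D f' \<and> e - h * poly f' h \<in> P"
proof (induction f rule: pCons_induct)
  case 0
  then show ?case using P_rules(1) by simp
next
  case (pCons x f)
  have cD: "comm_subring D" and DR: "D \<subseteq> R" using D by (auto simp: subring_def)
  have xD: "x \<in> D" and fD: "coeffs_in D f" using pCons.prems(1)
    by (auto simp: coeffs_in_def coeff_pCons split: nat.splits)
  have cR: "comm_subring R" by unfold_locales
  have pR: "poly f h \<in> R" using poly_in[OF cR _ h(1)] fD DR by (auto simp: coeffs_in_def)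
  show ?case
  proof (cases "x \<in> P")
    case False
    then show ?thesis using xD pCons.prems(3) coeffs_in_rules(7)[OF cD fD]
      by (intro bexI[of _ x] exI[of _ "- f"]) auto
  next
    case True
    have "h * poly f h \<in> P" using pCons.prems(3) ideal_cancel[OF P_ideal, of x "h * poly f h"] True by simp
    then have "poly f h \<in> P" using P_prime[OF h(1) pR] h(2) by blast
    moreover obtain i where "coeff (pCons x f) i \<notin> P" using pCons.prems(2) by blast
    then have "coeff f (i - 1) \<notin> P" using True by (cases i) auto
    ultimately show ?thesis using pCons.IH fD by blast
  qed
qed

text \<open>Inverting the leading coefficient \<open>c\<close> of a relation for \<open>g\<close>
  makes \<open>D[g]\<close> finite over \<open>D\<close>. So \<open>h\<close> is algebraic over
  \<open>D\<close> and divides some \<open>e\<close> in \<open>D\<close> modulo \<open>P\<close>.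
  Then \<open>c * e\<close> is the element required for \<open>D\<close>: a divisibility found in
  \<open>D[g]\<close> is brought down to \<open>D\<close> by elimination on the powers of
  \<open>g\<close>.\<close>

lemma generically_field_descends:
  assumes D: "subring D" and g: "g \<in> R" and F: "generically_field (adjoin D g)"
  shows "generically_field D"
proof -
  have cD: "comm_subring D" and DR: "x \<in> D \<Longrightarrow> x \<in> R" for x using D by (auto simp: subring_def)
  interpret D: comm_subring D by fact
  let ?E = "adjoin D g"
  have E: "subring ?E" "D \<subseteq> ?E" "g \<in> ?E" using subring_adjoin[OF D g] by auto
  then have cE: "comm_subring ?E" and ER: "x \<in> ?E \<Longrightarrow> x \<in> R" for x by (auto simp: subring_def)
  interpret E: comm_subring ?E by fact
  obtain f i0 where f: "coeffs_in D f" "coeff f i0 \<notin> P" "poly f g \<in> P"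
    using algebraic_if_generically_field[OF D g F] by (auto simp: algebraic_over_def)
  obtain n where n: "coeff f n \<notin> P" "\<forall>j>n. coeff f j \<in> P" using top_index[OF f(2)] by blast
  define c where "c = coeff f n"
  have cD': "c \<in> D" "c \<notin> P" using f(1) n by (auto simp: c_def coeffs_in_def)
  have rel: "c * g ^ n + (\<Sum>i<n. coeff f i * g ^ i) \<in> P"
  proof -
    have deg: "n \<le> degree f" using n(1) P_rules(1) le_degree by metis
    have "poly f g = (\<Sum>i\<le>n. coeff f i * g ^ i) + (\<Sum>i\<in>{n<..degree f}. coeff f i * g ^ i)"
      unfolding poly_altdef using deg by (subst sum.union_disjoint[symmetric]) (auto intro!: sum.cong)
    moreover have S: "(\<Sum>i\<in>{n<..degree f}. coeff f i * g ^ i) \<in> P"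
      using n(2) g power_in by (intro ideal_sum[OF P_ideal] P_rules(5)) auto
    ultimately have "(\<Sum>i\<le>n. coeff f i * g ^ i) \<in> P"
      using P_rules(3)[OF f(3) S] by simp
    then show ?thesis by (simp add: c_def lessThan_Suc_atMost[symmetric] add.commute)
  qed
  have n0: "n > 0"
  proof (rule ccontr)
    assume "\<not> n > 0"
    then show False using rel cD'(2) by simp
  qed
  then obtain n' where n': "n = Suc n'" by (cases n) auto
  \<comment> \<open>Modulo \<open>P\<close> and after inverting \<open>c\<close>, the powers
    \<open>g ^ j\<close> with \<open>j < n\<close> span everything that satisfies
    \<open>red\<close>.\<close>
  define red where "red w \<longleftrightarrow> (\<exists>s d. (\<forall>j. d j \<in> D) \<and> c ^ s * w - (\<Sum>j<n. d j * g ^ j) \<in> P)" for w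
  have red_power: "red (g ^ k)" for k
  proof (induction k)
    case 0
    have "(\<Sum>j<n. (if j = 0 then 1 else 0) * g ^ j) = 1" using n0 by (simp add: if_distrib[of "\<lambda>x. x * _"] sum.delta' cong: if_cong)
    then show ?case unfolding red_def using P_rules(1)
      by (intro exI[of _ 0] exI[of _ "\<lambda>j. if j = 0 then 1 else 0"]) auto
  next
    case (Suc k)
    then obtain s d where d: "\<forall>j. d j \<in> D" "c ^ s * g ^ k - (\<Sum>j<n. d j * g ^ j) \<in> P" by (auto simp: red_def)
    define d' where "d' j = (if j = 0 then 0 else c * d (j - 1)) - d n' * coeff f j" for j
    have "(\<Sum>j<n. d' j * g ^ j) = (\<Sum>j<n. (if j = 0 then 0 else c * d (j - 1)) * g ^ j) - d n' * (\<Sum>j<n. coeff f j * g ^ j)"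
      by (simp add: d'_def left_diff_distrib sum_subtractf sum_distrib_left mult.assoc)
    also have "(\<Sum>j<n. (if j = 0 then 0 else c * d (j - 1)) * g ^ j) = (\<Sum>j<n'. c * d j * g ^ Suc j)"
      unfolding n' sum.lessThan_Suc_shift by simp
    also have "\<dots> = c * g * (\<Sum>j<n. d j * g ^ j) - d n' * (c * g ^ n)"
      by (simp add: n' sum_distrib_left algebra_simps)
    finally have "c ^ Suc s * g ^ Suc k - (\<Sum>j<n. d' j * g ^ j) =
        c * g * (c ^ s * g ^ k - (\<Sum>j<n. d j * g ^ j)) + d n' * (c * g ^ n + (\<Sum>i<n. coeff f i * g ^ i))"
      by (simp add: algebra_simps)
    also have "\<dots> \<in> P"
      by (intro P_rules(2)[OF P_rules(4)[OF d(2)] P_rules(4)[OF rel]]) (use d cD' g DR in auto)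
    finally have "c ^ Suc s * g ^ Suc k - (\<Sum>j<n. d' j * g ^ j) \<in> P" .
    moreover have "\<forall>j. d' j \<in> D" using d(1) cD'(1) f(1) by (auto simp: d'_def coeffs_in_def)
    ultimately show ?case unfolding red_def by blast
  qed
  have red_add: "red (x + y)" if xy: "red x" "red y" for x y
  proof -
    obtain s d s' d' where *: "\<forall>j. d j \<in> D" "c ^ s * x - (\<Sum>j<n. d j * g ^ j) \<in> P"
      "\<forall>j. d' j \<in> D" "c ^ s' * y - (\<Sum>j<n. d' j * g ^ j) \<in> P" using xy unfolding red_def by blast
    have "c ^ (s + s') * (x + y) - (\<Sum>j<n. (c ^ s' * d j + c ^ s * d' j) * g ^ j) =
      c ^ s' * (c ^ s * x - (\<Sum>j<n. d j * g ^ j)) + c ^ s * (c ^ s' * y - (\<Sum>j<n. d' j * g ^ j))"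
      by (simp add: algebra_simps power_add sum.distrib sum_distrib_left)
    also have "\<dots> \<in> P" using * cD'(1) DR D.power_in by (intro P_rules(2) P_rules(4)) auto
    finally show ?thesis unfolding red_def using * cD'(1) D.power_in
      by (intro exI[of _ "s + s'"] exI[of _ "\<lambda>j. c ^ s' * d j + c ^ s * d' j"]) auto
  qed
  have red_mult: "red (x * y)" if xy: "x \<in> D" "red y" for x y
  proof -
    obtain s d where *: "\<forall>j. d j \<in> D" "c ^ s * y - (\<Sum>j<n. d j * g ^ j) \<in> P" using xy unfolding red_def by blast
    have "c ^ s * (x * y) - (\<Sum>j<n. x * d j * g ^ j) = x * (c ^ s * y - (\<Sum>j<n. d j * g ^ j))"
      by (simp add: algebra_simps sum_distrib_left)
    also have "\<dots> \<in> P" using * xy DR by (intro P_rules(4)) auto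
    finally show ?thesis unfolding red_def using * xy
      by (intro exI[of _ s] exI[of _ "\<lambda>j. x * d j"]) auto
  qed
  have red_zero: "red 0" unfolding red_def using P_rules(1) by (intro exI[of _ 0] exI[of _ "\<lambda>_. 0"]) auto
  have red_sum: "red (sum F A)" if "\<And>x. x \<in> A \<Longrightarrow> red (F x)" for F and A :: "nat set"
    using that by (induction A rule: infinite_finite_induct) (auto intro: red_add red_zero)
  have red_all: "red w" if w: "w \<in> ?E" for w
  proof -
    obtain p where p: "w = poly p g" "coeffs_in D p" using w by (auto simp: adjoin_def)
    show ?thesis unfolding p(1) poly_altdef using p(2) red_power
      by (intro red_sum red_mult) (auto simp: coeffs_in_def)
  qed
  obtain h where h: "h \<in> ?E - P" "\<forall>q\<in>?E - P. \<exists>p\<in>?E. \<exists>n. q * p - h ^ n \<in> P"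
    using F unfolding generically_field_def by blast
  have hE: "h \<in> ?E" "h \<notin> P" "h \<in> R" using h(1) ER by auto
  have "\<forall>k. \<exists>s d. (\<forall>j. d j \<in> D) \<and> c ^ s * h ^ k - (\<Sum>j<n. d j * g ^ j) \<in> P"
    using red_all[OF E.power_in[OF hE(1)]] unfolding red_def by blast
  then obtain s d where sd: "\<And>k j. d k j \<in> D" "\<And>k. c ^ s k * h ^ k - (\<Sum>j<n. d k j * g ^ j) \<in> P" by metis
  \<comment> \<open>There are n + 1 powers of \<open>h\<close> against n spanning powers of
    \<open>g\<close>.\<close>
  obtain l where l: "\<forall>k. l k \<in> D" "\<exists>k\<in>{..n}. l k \<notin> P" "\<forall>j\<in>{..<n}. (\<Sum>k\<le>n. l k * d k j) \<in> P"
    using dependent_mod[OF D, of "{..<n}" "{..n}" d] sd(1) by auto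
  define f1 where "f1 = (\<Sum>k\<le>n. monom (l k * c ^ s k) k)"
  have cf1: "coeff f1 k = (if k \<le> n then l k * c ^ s k else 0)" for k
    by (simp add: f1_def coeff_sum)
  have cs: "c ^ k \<notin> P" "c ^ k \<in> D" for k
  proof -
    show "c ^ k \<in> D" using cD'(1) D.power_in by blast
    show "c ^ k \<notin> P"
    proof (induction k)
      case (Suc k)
      then show ?case using P_prime[OF DR[OF cD'(1)] DR[OF D.power_in[OF cD'(1)]], of k] cD'(2) by auto
    qed (simp add: one_notin_P)
  qed
  have f1D: "coeffs_in D f1" using l(1) cs(2) by (auto simp: coeffs_in_def cf1)
  obtain k0 where k0: "k0 \<le> n" "l k0 \<notin> P" using l(2) by auto
  have f1nz: "coeff f1 k0 \<notin> P" using k0 P_prime[of "l k0" "c ^ s k0"] cs l(1) DR by (auto simp: cf1)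
  have "poly f1 h = (\<Sum>k\<le>n. l k * (c ^ s k * h ^ k - (\<Sum>j<n. d k j * g ^ j))) + (\<Sum>j<n. (\<Sum>k\<le>n. l k * d k j) * g ^ j)"
  proof -
    have "(\<Sum>j<n. (\<Sum>k\<le>n. l k * d k j) * g ^ j) = (\<Sum>k\<le>n. l k * (\<Sum>j<n. d k j * g ^ j))"
      unfolding sum_distrib_right sum_distrib_left by (subst sum.swap) (simp add: mult.assoc)
    then show ?thesis
      by (simp add: f1_def poly_sum poly_monom right_diff_distrib sum_subtractf mult.assoc)
  qed
  also have "\<dots> \<in> P"
  proof (rule P_rules(2))
    show "(\<Sum>k\<le>n. l k * (c ^ s k * h ^ k - (\<Sum>j<n. d k j * g ^ j))) \<in> P"
      using sd(2) l DR by (intro ideal_sum[OF P_ideal] P_rules(4)) auto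
    show "(\<Sum>j<n. (\<Sum>k\<le>n. l k * d k j) * g ^ j) \<in> P"
      by (rule ideal_sum[OF P_ideal], rule P_rules(5)) (use l g power_in in auto)
  qed
  finally have "poly f1 h \<in> P" .
  then obtain e f' where e: "e \<in> D" "e \<notin> P" "coeffs_in D f'" "e - h * poly f' h \<in> P"
    using algebraic_divides[OF D hE(3,2) f1D] f1nz by blast
  define u where "u = poly f' h"
  have uE: "u \<in> ?E" unfolding u_def using poly_in[OF cE _ hE(1)] e(3) E(2) by (auto simp: coeffs_in_def)
  let ?h = "c * e"
  have hD: "?h \<in> D - P" using cD' e P_prime[of c e] DR by auto
  have "\<exists>p\<in>D. \<exists>N. q * p - ?h ^ N \<in> P" if q: "q \<in> D - P" for q
  proof -
    have qE: "q \<in> ?E - P" using q E(2) by auto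
    obtain p m where p: "p \<in> ?E" "q * p - h ^ m \<in> P" using h(2) qE by blast
    \<comment> \<open>With \<open>e = h * u\<close> and \<open>q * p = h ^ m\<close> modulo
      \<open>P\<close> one gets \<open>q * w0 = e ^ m\<close>. So \<open>w0\<close> is the cofactor
      sought, except that it lies in \<open>D[g]\<close> and not yet in \<open>D\<close>.\<close>
    define w0 where "w0 = p * u ^ m"
    have w0E: "w0 \<in> ?E" unfolding w0_def using p(1) uE E.power_in by auto
    have em: "e ^ m - q * w0 \<in> P"
    proof -
      have "e ^ k - (h * u) ^ k \<in> P" for k
      proof (induction k)
        case (Suc k)
        have "e ^ Suc k - (h * u) ^ Suc k = e * (e ^ k - (h * u) ^ k) + (e - h * u) * (h * u) ^ k"
          by (simp add: algebra_simps)
        also have "\<dots> \<in> P"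
          by (rule P_rules(2)[OF P_rules(4)[OF Suc] P_rules(5)[OF e(4)[folded u_def]]])
            (use e(1) DR hE(3) ER[OF uE] power_in in auto)
        finally show ?case .
      qed (simp add: P_rules(1))
      note em0 = this[of m]
      have "(e ^ m - (h * u) ^ m) - (q * p - h ^ m) * u ^ m \<in> P"
        by (rule P_rules(3)[OF em0 P_rules(5)[OF p(2) power_in[OF ER[OF uE]]]])
      then show ?thesis by (simp add: w0_def algebra_simps power_mult_distrib)
    qed
    \<comment> \<open>A power of \<open>?h\<close> sends each \<open>g ^ i\<close> into
      \<open>q\<close> times the \<open>D\<close>-span of the powers of \<open>g\<close>.
      Elimination then produces some \<open>?h ^ N - q * d\<close> that kills
      \<open>g ^ 0 = 1\<close> modulo \<open>P\<close>, which is the divisibility over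
      \<open>D\<close>.\<close>
    define W where "W = {x \<in> D. \<exists>N. \<exists>d\<in>D. x = ?h ^ N - q * d}"
    define C where "C = {q * d |d. d \<in> D}"
    have qD: "q \<in> D" using q by blast
    have "\<exists>w\<in>W. \<forall>i<n. w * g ^ i \<in> P"
    proof (rule nakayama_elimination[where D = D and C = C])
      show "0 \<in> P" by (rule P_rules)
      show "x + y \<in> P" if "x \<in> P" "y \<in> P" for x y using P_rules(2) that by blast
      show "d * x \<in> P" if "d \<in> D" "x \<in> P" for d x using P_rules(4) DR that by blast
      show "1 \<in> W" unfolding W_def by (intro CollectI conjI exI[of _ 0] bexI[of _ 0]) auto
      show "W \<subseteq> D" by (auto simp: W_def)
      show "w * w' \<in> W" if ww: "w \<in> W" "w' \<in> W" for w w'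
      proof -
        obtain N d N' d' where *: "w \<in> D" "w' \<in> D" "d \<in> D" "d' \<in> D" "w = ?h ^ N - q * d" "w' = ?h ^ N' - q * d'"
          using ww by (auto simp: W_def)
        have "w * w' = ?h ^ (N + N') - q * (?h ^ N * d' + ?h ^ N' * d - q * d * d')"
          unfolding * by (simp add: algebra_simps power_add)
        moreover have "?h ^ N * d' + ?h ^ N' * d - q * d * d' \<in> D" using * qD hD D.power_in by auto
        ultimately show ?thesis unfolding W_def using *(1,2) by blast
      qed
      show "w - x \<in> W" if wx: "w \<in> W" "x \<in> C" for w x
      proof -
        obtain N d d' where *: "w \<in> D" "d \<in> D" "d' \<in> D" "w = ?h ^ N - q * d" "x = q * d'"
          using wx by (auto simp: W_def C_def)
        have "w - x = ?h ^ N - q * (d + d')" unfolding * by (simp add: algebra_simps)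
        moreover have "w - x \<in> D" using * qD by auto
        ultimately show ?thesis unfolding W_def using *(2,3) D.add_in by blast
      qed
      show "x + y \<in> C" if xy: "x \<in> C" "y \<in> C" for x y
      proof -
        obtain d d' where "x = q * d" "y = q * d'" "d \<in> D" "d' \<in> D" using xy by (auto simp: C_def)
        then show ?thesis unfolding C_def by (intro CollectI exI[of _ "d + d'"]) (auto simp: algebra_simps)
      qed
      show "x * y \<in> C" if xy: "x \<in> D" "y \<in> C" for x y
      proof -
        obtain d where "y = q * d" "d \<in> D" using xy by (auto simp: C_def)
        then show ?thesis unfolding C_def using xy(1) by (intro CollectI exI[of _ "x * d"]) (auto simp: algebra_simps)
      qed
      show "C \<subseteq> D" using qD by (auto simp: C_def)
      show "\<forall>i<n. \<exists>w\<in>W. \<exists>b. (\<forall>j<n. b j \<in> C) \<and> w * g ^ i - (\<Sum>j<n. b j * g ^ j) \<in> P"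
      proof (intro allI impI)
        fix i assume "i < n"
        have "w0 * g ^ i \<in> ?E" using w0E E(3) E.power_in by blast
        then obtain s d where d: "\<forall>j. d j \<in> D" "c ^ s * (w0 * g ^ i) - (\<Sum>j<n. d j * g ^ j) \<in> P"
          using red_all unfolding red_def by blast
        define b where "b j = q * (c ^ m * e ^ s * d j)" for j
        have "?h ^ (s + m) * g ^ i - (\<Sum>j<n. b j * g ^ j) =
          c ^ (s + m) * e ^ s * g ^ i * (e ^ m - q * w0) + c ^ m * e ^ s * q * (c ^ s * (w0 * g ^ i) - (\<Sum>j<n. d j * g ^ j))"
          by (simp add: b_def algebra_simps power_add power_mult_distrib sum_distrib_left)
        also have "\<dots> \<in> P"
          using em d g qD cD' e(1) DR power_in by (intro P_rules(2) P_rules(4)) auto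
        finally have "?h ^ (s + m) * g ^ i - (\<Sum>j<n. b j * g ^ j) \<in> P" .
        moreover have "?h ^ (s + m) \<in> W" unfolding W_def
          using hD D.power_in by (intro CollectI conjI exI[of _ "s + m"] bexI[of _ 0]) auto
        moreover have "c ^ m * e ^ s * d j \<in> D" for j using d(1) cD'(1) e(1) D.power_in by auto
        then have "\<forall>j<n. b j \<in> C" unfolding b_def C_def by blast
        ultimately show "\<exists>w\<in>W. \<exists>b. (\<forall>j<n. b j \<in> C) \<and> w * g ^ i - (\<Sum>j<n. b j * g ^ j) \<in> P" by blast
      qed
    qed
    then obtain w where "w \<in> W" "w * g ^ 0 \<in> P" using n0 by blast
    then obtain N d where "d \<in> D" "?h ^ N - q * d \<in> P" by (auto simp: W_def)
    then show ?thesis using P_rules(6)[of "?h ^ N - q * d"] by (intro bexI[of _ d] exI[of _ N]) auto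
  qed
  then show ?thesis unfolding generically_field_def using hD by blast
qed

lemma generically_field_foldl:
  "subring D \<Longrightarrow> set gs \<subseteq> R \<Longrightarrow> generically_field (foldl adjoin D gs) \<Longrightarrow> generically_field D"
proof (induction gs arbitrary: D)
  case (Cons g gs)
  then have "generically_field (adjoin D g)" using subring_adjoin(1)[OF Cons.prems(1)] by auto
  then show ?case using generically_field_descends Cons.prems by auto
qed simp

lemma subring_foldl:
  "subring D \<Longrightarrow> set gs \<subseteq> R \<Longrightarrow> subring (foldl adjoin D gs) \<and> D \<subseteq> foldl adjoin D gs \<and> set gs \<subseteq> foldl adjoin D gs"
proof (induction gs arbitrary: D)
  case (Cons g gs)
  have *: "subring (adjoin D g)" "D \<subseteq> adjoin D g" "g \<in> adjoin D g" using subring_adjoin[OF Cons.prems(1)] Cons.prems(2) by auto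
  then show ?case using Cons.IH[OF *(1)] Cons.prems(2) by auto
qed simp

end

context simplicial_ring
begin

lemma maximal_inverse:
  assumes P: "maximalideal P (ring_on R)" and q: "q \<in> R" "q \<notin> P"
  shows "\<exists>p\<in>R. q * p - 1 \<in> P"
proof -
  have id: "is_ideal P" using maximalideal.axioms(1)[OF P] by (simp add: ideal_ring_on)
  define J where "J = {x. \<exists>p\<in>P. \<exists>r\<in>R. x = p + q * r}"
  have JI: "p + q * r \<in> J" if "p \<in> P" "r \<in> R" for p r using that unfolding J_def by blast
  have "is_ideal J" unfolding is_ideal_def
  proof (intro conjI ballI)
    show "J \<subseteq> R" using q(1) ideal_sub[OF id] by (auto simp: J_def)
    show "0 \<in> J" using JI[OF ideal_zero[OF id] zero_in] by simp
    fix x y assume "x \<in> J" "y \<in> J"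
    then obtain p r p' r' where "p \<in> P" "r \<in> R" "p' \<in> P" "r' \<in> R" "x = p + q * r" "y = p' + q * r'" by (auto simp: J_def)
    then show "x + y \<in> J" using ideal_add[OF id]
      JI[of "p + p'" "r + r'"] by (auto simp: algebra_simps)
  next
    fix x y assume x: "x \<in> R" and "y \<in> J"
    then obtain p r where "p \<in> P" "r \<in> R" "y = p + q * r" by (auto simp: J_def)
    then show "x * y \<in> J" using ideal_mult[OF id] x
      JI[of "x * p" "x * r"] by (auto simp: algebra_simps)
  qed
  then have J: "ideal J (ring_on R)" by (simp add: ideal_ring_on)
  have PJ: "P \<subseteq> J" using JI[OF _ zero_in] by auto
  have "J = P \<or> J = carrier (ring_on R)"
    by (rule maximalideal.I_maximal[OF P J PJ]) (use ideal.Icarr[OF J] in blast)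
  moreover have "q \<in> J" using JI[OF ideal_zero[OF id] one_in] by simp
  ultimately have "1 \<in> J" using q(2) by auto
  then obtain p r where "p \<in> P" "r \<in> R" "1 = p + q * r" by (auto simp: J_def)
  then have "r \<in> R" "q * r - 1 = - p" by (simp_all add: algebra_simps)
  then show ?thesis using ideal_uminus[OF id \<open>p \<in> P\<close>] by metis
qed

text \<open>The ring arises from the constants by adjoining \<open>X (a i)\<close> first and the
  monomials of all generators afterwards. Modulo \<open>P\<close> it is a field, and descent reaches
  the subring of polynomials in \<open>X (a i)\<close>; so this monomial is algebraic over K modulo
  \<open>P\<close>. The degree is positive because a nonzero constant in \<open>P\<close> would be a
  unit.\<close>

lemma algebraic_rays:
  assumes cm: "cohen_macaulay (semigroup_ring TYPE('k) S)" and P: "maximalideal P (ring_on R)"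
  shows "\<exists>n>0. \<exists>c. c n \<noteq> 0 \<and> (\<Sum>j\<le>n. Poly_Mapping.single (int j *s a i) (c j)) \<in> P"
proof -
  interpret L: localized_domain R P using localized[OF cm P] .
  let ?y = "X (a i)"
  let ?D = "range C"
  have yR: "?y \<in> R" using X_R a_S by blast
  have D: "L.subring ?D"
    unfolding L.subring_def
  proof (intro conjI)
    show "range C \<subseteq> R" using C_R by blast
    show "comm_subring (range C)"
    proof
      show "1 \<in> range C" using single_one by (metis rangeI)
      fix x y assume "x \<in> range C" "y \<in> range C"
      then obtain u v where uv: "x = C u" "y = C v" by blast
      show "x + y \<in> range C" unfolding uv by (simp add: single_add[symmetric])
      show "x * y \<in> range C" unfolding uv by (simp add: mult_single)
    next
      fix x assume "x \<in> range C"
      then obtain u where u: "x = C u" by blast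
      show "- x \<in> range C" unfolding u by (simp add: single_uminus[symmetric])
    qed
  qed
  let ?E = "L.adjoin ?D ?y"
  have E: "L.subring ?E" "?D \<subseteq> ?E" using L.subring_adjoin[OF D yR] by auto
  obtain gs where gs: "set gs = G" using finite_list[OF finite_G] by blast
  let ?T = "foldl L.adjoin ?E (map X gs)"
  have gR: "set (map X gs) \<subseteq> R" using gs X_R G_S by auto
  have T: "L.subring ?T" "?E \<subseteq> ?T" "X ` G \<subseteq> ?T" using L.subring_foldl[OF E(1) gR] gs by auto
  interpret T: comm_subring ?T using T(1) by (simp add: L.subring_def)
  have XT: "X s \<in> ?T" if "s \<in> S" for s
  proof -
    have "X s \<in> ?T" if "s \<in> {s. X s \<in> ?T}" for s using that by simp
    have "S \<subseteq> {s. X s \<in> ?T}" unfolding S_def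
    proof (rule gen_subset[OF finite_G])
      show "0 \<in> {s. X s \<in> ?T}" using T.one_in by simp
      show "s + t \<in> {s. X s \<in> ?T}" if "s \<in> {s. X s \<in> ?T}" "t \<in> {s. X s \<in> ?T}" for s t
        using that X_add[of s t] T.mult_in by simp
      show "G \<subseteq> {s. X s \<in> ?T}" using T(3) by blast
    qed
    then show ?thesis using that by blast
  qed
  have "R \<subseteq> ?T"
  proof
    fix f :: "int ^ 'd \<Rightarrow>\<^sub>0 'k" assume f: "f \<in> R"
    have CT: "C x \<in> ?T" for x using E(2) T(2) by blast
    have all: "Poly_Mapping.single s (Poly_Mapping.lookup f s) \<in> ?T" if s: "s \<in> Poly_Mapping.keys f" for s
    proof -
      have "C (Poly_Mapping.lookup f s) * X s \<in> ?T"
        using R_key[OF f, of s] s by (intro T.mult_in CT XT) (simp add: in_keys_iff)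
      then show ?thesis by (simp add: mult_single)
    qed
    have "(\<Sum>s\<in>Poly_Mapping.keys f. Poly_Mapping.single s (Poly_Mapping.lookup f s)) \<in> ?T"
      by (rule T.sum_in) (rule all)
    then show "f \<in> ?T" unfolding poly_mapping_sum_single[symmetric] .
  qed
  then have TR: "?T = R" using T(1) by (auto simp: L.subring_def)
  have "L.generically_field R"
    unfolding L.generically_field_def
  proof (rule bexI[of _ 1], rule ballI)
    fix q assume "q \<in> R - P"
    then obtain p where "p \<in> R" "q * p - 1 \<in> P" using maximal_inverse[OF P] by blast
    then show "\<exists>p\<in>R. \<exists>n. q * p - 1 ^ n \<in> P" by auto
  qed (use L.one_notin_P in auto)
  then have "L.generically_field ?E" using L.generically_field_foldl[OF E(1) gR] TR by simp
  then obtain f k where f: "L.coeffs_in ?D f" "coeff f k \<notin> P" "poly f ?y \<in> P"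
    using L.algebraic_if_generically_field[OF D yR] by (auto simp: L.algebraic_over_def)
  define c where "c j = Poly_Mapping.lookup (coeff f j) 0" for j
  have c: "coeff f j = C (c j)" for j using f(1) unfolding L.coeffs_in_def c_def
    by (metis (no_types, lifting) lookup_single_eq rangeE)
  have zero: "c j = 0" if "coeff f j \<in> P" for j
    using constant_unit[OF L.P_ideal, of "c j"] that L.one_notin_P unfolding c by blast
  obtain n where n: "coeff f n \<notin> P" "\<forall>j>n. coeff f j \<in> P" using L.top_index[OF f(2)] by blast
  have cn: "c n \<noteq> 0" using n(1) ideal_zero[OF L.P_ideal] unfolding c by auto
  have pw: "?y ^ j = X (int j *s a i)" for j
    by (induction j) (auto simp: mult_single vector_sadd_rdistrib)
  have "coeff f i = 0" if "n < i" for i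
  proof -
    have "c i = 0" using zero n(2) that by blast
    then show ?thesis using c by simp
  qed
  then have deg: "degree f \<le> n" by (intro degree_le) blast
  have "poly f ?y = (\<Sum>j\<le>n. coeff f j * ?y ^ j)"
    unfolding poly_altdef using deg by (intro sum.mono_neutral_left) (auto simp: coeff_eq_0)
  also have "\<dots> = (\<Sum>j\<le>n. Poly_Mapping.single (int j *s a i) (c j))"
    by (intro sum.cong refl) (simp add: c pw mult_single)
  finally have s: "(\<Sum>j\<le>n. Poly_Mapping.single (int j *s a i) (c j)) \<in> P" using f(3) by simp
  have "n \<noteq> 0"
  proof
    assume "n = 0"
    then have "C (c n) \<in> P" using s by simp
    then show False using n(1) c by metis
  qed
  then show ?thesis using s cn by blast
qed

end

section \<open>The Frobenius form\<close>

text \<open>The linear recurrence with characteristic polynomial \<open>c\<close>: its terms are the values on the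
  powers of \<open>t\<close> of the residue form on \<open>K[t]/(c)\<close>.\<close>

function rec_seq :: "nat \<Rightarrow> (nat \<Rightarrow> 'k::field) \<Rightarrow> nat \<Rightarrow> 'k" where
  "rec_seq n c k = (if k < n - 1 then 0 else if k = n - 1 then 1
     else - (\<Sum>j<n. c j * rec_seq n c (k - n + j)) / c n)"
  by pat_completeness auto
termination by (relation "measure (\<lambda>(n, c, k). k)") auto

declare rec_seq.simps [simp del]

lemma rec_seq_recurrence:
  assumes "n > 0" "c n \<noteq> 0"
  shows "(\<Sum>j\<le>n. c j * rec_seq n c (k + j)) = 0"
proof -
  have "rec_seq n c (k + n) = - (\<Sum>j<n. c j * rec_seq n c (k + j)) / c n"
    using assms(1) by (subst rec_seq.simps) auto
  then show ?thesis using assms(2) by (simp add: lessThan_Suc_atMost[symmetric])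
qed

lemma rec_seq_small: "k < n - 1 \<Longrightarrow> rec_seq n c k = 0" and rec_seq_one: "rec_seq n c (n - 1) = 1"
  by (subst rec_seq.simps; simp)+

text \<open>In the application \<open>c i\<close> holds the coefficients of a polynomial in
  \<open>X (a i)\<close> lying in a given maximal ideal, and \<open>m\<close> is the only maximal
  Apery element. Cohen-Macaulayness is represented by \<open>saturated\<close>.\<close>

locale ray_polynomials = simplicial_ring S G a K
  for S G :: "(int ^ 'd) set" and a and K :: "'k::field itself" +
  fixes n :: "'d \<Rightarrow> nat" and c :: "'d \<Rightarrow> nat \<Rightarrow> 'k" and m :: "int ^ 'd"
  assumes saturated: "i \<noteq> j \<Longrightarrow> s + a i \<in> S \<Longrightarrow> s + a j \<in> S \<Longrightarrow> s \<in> S"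
    and n_pos: "n i > 0" and lead: "c i (n i) \<noteq> 0"
    and m_apery: "m \<in> apery S a" and m_max: "u \<in> apery S a \<Longrightarrow> m - u \<in> S"
begin

lemma cancel_one:
  assumes "i \<noteq> l" "z + int k *s a l \<in> S" "z + a i \<in> S"
  shows "z \<in> S"
  using assms(2)
proof (induction k)
  case (Suc k)
  let ?w = "z + int k *s a l"
  have "?w + a l \<in> S" using Suc.prems by (simp add: vector_sadd_rdistrib algebra_simps)
  moreover have "?w + a i \<in> S" using add_S[OF assms(3) mult_S[OF a_S, of k l]] by (simp add: algebra_simps)
  ultimately show ?case using Suc.IH saturated[OF assms(1)] by blast
qed simp

lemma cancel:
  assumes "i \<noteq> l" "z + int k *s a l \<in> S" "z + int k' *s a i \<in> S"
  shows "z \<in> S"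
  using assms(3)
proof (induction k')
  case (Suc k')
  let ?w = "z + int k' *s a i"
  have "?w + a i \<in> S" using Suc.prems by (simp add: vector_sadd_rdistrib algebra_simps)
  moreover have "?w + int k *s a l \<in> S" using add_S[OF assms(2) mult_S[OF a_S, of k' i]] by (simp add: algebra_simps)
  ultimately show ?case using Suc.IH cancel_one[OF assms(1)] by blast
qed simp

lemma cancel_sum:
  assumes "finite L" "i \<notin> L" "z + (\<Sum>l\<in>L. int (k l) *s a l) \<in> S" "z + int k' *s a i \<in> S"
  shows "z \<in> S"
  using assms
proof (induction L rule: finite_induct)
  case (insert l L)
  let ?w = "z + (\<Sum>l\<in>L. int (k l) *s a l)"
  have "?w + int (k l) *s a l \<in> S" using insert.prems(2) insert.hyps by (simp add: algebra_simps)
  moreover have "(\<Sum>l\<in>L. int (k l) *s a l) \<in> S" by (intro sum_S mult_S a_S)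
  from add_S[OF insert.prems(3) this] have "?w + int k' *s a i \<in> S" by (simp add: algebra_simps)
  moreover have "i \<noteq> l" using insert.prems(1) by blast
  ultimately have "?w \<in> S" using cancel by blast
  then show ?case using insert by blast
qed simp

section \<open>A monomial basis of the quotient by the ray polynomials\<close>

definition F :: "'d \<Rightarrow> int ^ 'd \<Rightarrow>\<^sub>0 'k" where
  "F i = (\<Sum>j\<le>n i. Poly_Mapping.single (int j *s a i) (c i j))"

definition I :: "'d set \<Rightarrow> (int ^ 'd \<Rightarrow>\<^sub>0 'k) set" where
  "I T = {x. \<exists>r. (\<forall>i. r i \<in> R) \<and> x = (\<Sum>i\<in>T. F i * r i)}"

text \<open>The monomials that cannot be reduced by the leading terms of the \<open>F i\<close> with
  \<open>i \<in> T\<close>; they turn out to be a K-basis of \<open>R / I T\<close>.\<close>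

definition box :: "'d set \<Rightarrow> (int ^ 'd) set" where
  "box T = {s \<in> S. \<forall>i\<in>T. s - int (n i) *s a i \<notin> S}"

lemma F_R: "F i \<in> R"
  unfolding F_def by (intro sum_in single_R mult_S a_S)

lemma I_ideal: "is_ideal (I T)"
  unfolding is_ideal_def
proof (intro conjI ballI)
  show "I T \<subseteq> R" by (auto simp: I_def intro!: sum_in F_R)
  show "0 \<in> I T" unfolding I_def by (intro CollectI exI[of _ "\<lambda>_. 0"]) auto
  fix x y assume "x \<in> I T" "y \<in> I T"
  then obtain r r' where "\<forall>i. r i \<in> R" "\<forall>i. r' i \<in> R" "x = (\<Sum>i\<in>T. F i * r i)" "y = (\<Sum>i\<in>T. F i * r' i)"
    by (auto simp: I_def)
  then show "x + y \<in> I T" unfolding I_def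
    by (intro CollectI exI[of _ "\<lambda>i. r i + r' i"]) (auto simp: sum.distrib algebra_simps)
next
  fix x y assume x: "x \<in> R" and "y \<in> I T"
  then obtain r where "\<forall>i. r i \<in> R" "y = (\<Sum>i\<in>T. F i * r i)" by (auto simp: I_def)
  then show "x * y \<in> I T" unfolding I_def using x
    by (intro CollectI exI[of _ "\<lambda>i. x * r i"]) (auto simp: sum_distrib_left mult.left_commute)
qed

lemma I_insert: "i \<notin> T \<Longrightarrow> x \<in> I (insert i T) \<longleftrightarrow> (\<exists>y\<in>I T. \<exists>r\<in>R. x = y + F i * r)"
proof
  assume i: "i \<notin> T" and "x \<in> I (insert i T)"
  then obtain r where r: "\<forall>i. r i \<in> R" "x = (\<Sum>l\<in>insert i T. F l * r l)" unfolding I_def by blast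
  then have "x = (\<Sum>l\<in>T. F l * r l) + F i * r i" using i by (simp add: add.commute)
  moreover have "(\<Sum>l\<in>T. F l * r l) \<in> I T" unfolding I_def using r by blast
  ultimately show "\<exists>y\<in>I T. \<exists>r\<in>R. x = y + F i * r" using r(1) by blast
next
  assume i: "i \<notin> T" and "\<exists>y\<in>I T. \<exists>r\<in>R. x = y + F i * r"
  then obtain r r' where r: "\<forall>i. r i \<in> R" "r' \<in> R" "x = (\<Sum>l\<in>T. F l * r l) + F i * r'" unfolding I_def by blast
  have "(\<Sum>l\<in>T. F l * r l) = (\<Sum>l\<in>T. F l * (r(i := r')) l)" using i by (intro sum.cong) auto
  then have "x = (\<Sum>l\<in>insert i T. F l * (r(i := r')) l)" using r i by (simp add: add.commute)
  then show "x \<in> I (insert i T)" unfolding I_def using r by (intro CollectI exI[of _ "r(i := r')"]) auto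
qed

lemma F_I:
  assumes "i \<in> T" "r \<in> R"
  shows "F i * r \<in> I T"
proof -
  have T: "insert i (T - {i}) = T" using assms(1) by blast
  have "\<exists>y\<in>I (T - {i}). \<exists>r'\<in>R. F i * r = y + F i * r'"
    using ideal_zero[OF I_ideal, of "T - {i}"] assms(2) by (intro bexI[of _ 0] bexI[of _ r]) auto
  then have "F i * r \<in> I (insert i (T - {i}))" using I_insert[of i "T - {i}" "F i * r"] by blast
  then show ?thesis unfolding T .
qed

lemma lookup_F_mult:
  "Poly_Mapping.lookup (F i * f) s = (\<Sum>j\<le>n i. c i j * Poly_Mapping.lookup f (s - int j *s a i))"
  by (simp add: F_def sum_distrib_right lookup_sum lookup_single_mult)

lemma box_S: "s \<in> box T \<Longrightarrow> s \<in> S" by (simp add: box_def)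

text \<open>This is where saturation enters: if \<open>n l\<close> copies of \<open>a l\<close>
  could be subtracted after adding copies of another ray \<open>a i\<close>, then cancelling that
  ray shows that they could be subtracted before.\<close>

lemma box_shift:
  assumes "s \<in> box T" "i \<notin> T"
  shows "s + int j *s a i \<in> box T"
proof -
  have "s + int j *s a i - int (n l) *s a l \<notin> S" if l: "l \<in> T" for l
  proof
    assume z: "s + int j *s a i - int (n l) *s a l \<in> S"
    have "s - int (n l) *s a l \<in> S"
      by (rule cancel[of i l _ "n l" j]) (use z assms l box_S in \<open>auto simp: algebra_simps\<close>)
    then show False using assms(1) l by (auto simp: box_def)
  qed
  then show ?thesis using assms(1) add_S[OF _ mult_S[OF a_S]] by (auto simp: box_def)
qed

lemma F_supported:
  assumes "f \<in> supported (box T)" "i \<notin> T"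
  shows "F i * f \<in> supported (box T)"
  unfolding supported_iff
proof (intro allI impI)
  fix s assume "Poly_Mapping.lookup (F i * f) s \<noteq> 0"
  then obtain j where "Poly_Mapping.lookup f (s - int j *s a i) \<noteq> 0"
    unfolding lookup_F_mult by (metis (no_types, lifting) mult_zero_right sum.neutral)
  then have "s - int j *s a i \<in> box T" using assms(1) by (simp add: supported_iff)
  from box_shift[OF this assms(2), of j] show "s \<in> box T" by simp
qed

lemma supported_diff: "f \<in> supported U \<Longrightarrow> g \<in> supported U \<Longrightarrow> f - g \<in> supported U"
  using supported_add[OF _ supported_uminus, of f U g] by simp

lemma supported_C: "f \<in> supported U \<Longrightarrow> C x * f \<in> supported U"
  by (auto simp: supported_iff lookup_single_mult)

lemma supported_box_R: "f \<in> supported (box T) \<Longrightarrow> f \<in> R"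
  by (auto simp: supported_iff box_def)

lemma max_key:
  assumes "f \<noteq> (0 :: int ^ 'd \<Rightarrow>\<^sub>0 'k)"
  shows "\<exists>s. Poly_Mapping.lookup f s \<noteq> 0 \<and> (\<forall>t. wt s < wt t \<longrightarrow> Poly_Mapping.lookup f t = 0)"
proof -
  have "Poly_Mapping.keys f \<noteq> {}" using assms by simp
  then obtain s where "s \<in> Poly_Mapping.keys f" "\<And>t. t \<in> Poly_Mapping.keys f \<Longrightarrow> wt t \<le> wt s"
    using exists_max[OF finite_keys, of f wt] by blast
  then show ?thesis by (intro exI[of _ s]) (auto simp: in_keys_iff not_le[symmetric])
qed

lemma F_top:
  assumes "\<forall>t. wt s < wt t \<longrightarrow> Poly_Mapping.lookup f t = 0"
  shows "Poly_Mapping.lookup (F i * f) (s + int (n i) *s a i) = c i (n i) * Poly_Mapping.lookup f s"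
proof -
  have "Poly_Mapping.lookup f (s + int (n i) *s a i - int j *s a i) = 0" if "j < n i" for j
  proof -
    have "wt (s + int (n i) *s a i - int j *s a i) = wt s + (int (n i) - int j) * wt (a i)"
      by (simp add: wt_add wt_diff wt_mult algebra_simps)
    moreover have "(int (n i) - int j) * wt (a i) > 0" using that wt_pos[OF a_S a_nonzero, of i] by simp
    ultimately show ?thesis using assms by simp
  qed
  then show ?thesis unfolding lookup_F_mult by (simp add: lessThan_Suc_atMost[symmetric])
qed

text \<open>Division by the \<open>F i\<close>: the monomial of \<open>?t + n i * a i\<close> is
  traded for those of \<open>?t + j * a i\<close> with \<open>j < n i\<close>, which have smaller
  weight. The leading coefficient is inverted by \<open>?\<alpha>\<close>.\<close>

lemma reduce_monomial:
  assumes "s \<in> S"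
  shows "\<exists>x\<in>supported (box T). X s - x \<in> I T"
  using assms
proof (induction "nat (wt s)" arbitrary: s rule: less_induct)
  case less
  show ?case
  proof (cases "s \<in> box T")
    case True
    then show ?thesis using supported_single[of s "box T" 1] ideal_zero[OF I_ideal] by (intro bexI[of _ "X s"]) auto
  next
    case False
    then obtain i where i: "i \<in> T" "s - int (n i) *s a i \<in> S" using less.prems by (auto simp: box_def)
    let ?t = "s - int (n i) *s a i" and ?\<alpha> = "inverse (c i (n i))"
    have "\<forall>j<n i. \<exists>x\<in>supported (box T). X (?t + int j *s a i) - x \<in> I T"
    proof (intro allI impI less.hyps)
      fix j assume j: "j < n i"
      show "?t + int j *s a i \<in> S" using add_S[OF i(2) mult_S[OF a_S]] .
      from wt_nonneg[OF this] have "0 \<le> wt (?t + int j *s a i)" .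
      moreover have "wt (?t + int j *s a i) = wt s - (int (n i) - int j) * wt (a i)"
        by (simp add: wt_add wt_diff wt_mult algebra_simps)
      moreover have "(int (n i) - int j) * wt (a i) > 0" using j wt_pos[OF a_S a_nonzero, of i] by simp
      ultimately show "nat (wt (?t + int j *s a i)) < nat (wt s)" by linarith
    qed
    then obtain x where x: "\<And>j. j < n i \<Longrightarrow> x j \<in> supported (box T)" "\<And>j. j < n i \<Longrightarrow> X (?t + int j *s a i) - x j \<in> I T"
      by metis
    define y where "y = - (\<Sum>j<n i. C (?\<alpha> * c i j) * x j)"
    have "F i * (C ?\<alpha> * X ?t) = (\<Sum>j\<le>n i. C (?\<alpha> * c i j) * X (?t + int j *s a i))"
      unfolding F_def sum_distrib_right by (intro sum.cong refl) (simp add: mult_single algebra_simps)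
    also have "\<dots> = (\<Sum>j<n i. C (?\<alpha> * c i j) * X (?t + int j *s a i)) + X s"
      using lead[of i] by (simp add: lessThan_Suc_atMost[symmetric])
    finally have "X s - y = F i * (C ?\<alpha> * X ?t) - (\<Sum>j<n i. C (?\<alpha> * c i j) * (X (?t + int j *s a i) - x j))"
      by (simp add: y_def right_diff_distrib sum_subtractf)
    moreover have "F i * (C ?\<alpha> * X ?t) \<in> I T" using F_I[OF i(1)] C_R X_R[OF i(2)] by blast
    moreover have "(\<Sum>j<n i. C (?\<alpha> * c i j) * (X (?t + int j *s a i) - x j)) \<in> I T"
      using x(2) by (intro ideal_sum[OF I_ideal] ideal_mult[OF I_ideal] C_R) auto
    ultimately have "X s - y \<in> I T" using ideal_diff[OF I_ideal] by simp
    moreover have "y \<in> supported (box T)"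
      unfolding y_def using x(1) by (intro supported_uminus supported_sum supported_C) auto
    ultimately show ?thesis by blast
  qed
qed

lemma reduce:
  assumes f: "f \<in> R"
  shows "\<exists>x\<in>supported (box T). f - x \<in> I T"
proof -
  have "\<forall>s\<in>S. \<exists>x\<in>supported (box T). X s - x \<in> I T" using reduce_monomial by blast
  then obtain \<rho> where \<rho>: "\<And>s. s \<in> S \<Longrightarrow> \<rho> s \<in> supported (box T)" "\<And>s. s \<in> S \<Longrightarrow> X s - \<rho> s \<in> I T" by metis
  let ?K = "Poly_Mapping.keys f" and ?c = "\<lambda>s. C (Poly_Mapping.lookup f s)"
  have K: "s \<in> S" if "s \<in> ?K" for s using that f by (auto simp: supported_def)
  have "f = (\<Sum>s\<in>?K. ?c s * X s)" by (subst poly_mapping_sum_single[of f]) (simp add: mult_single)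
  then have "f - (\<Sum>s\<in>?K. ?c s * \<rho> s) = (\<Sum>s\<in>?K. ?c s * (X s - \<rho> s))"
    by (simp add: right_diff_distrib sum_subtractf)
  also have "\<dots> \<in> I T" by (intro ideal_sum[OF I_ideal] ideal_mult[OF I_ideal] C_R \<rho>(2) K)
  finally show ?thesis using \<rho>(1) K by (intro bexI[of _ "\<Sum>s\<in>?K. ?c s * \<rho> s"] supported_sum supported_C) auto
qed

text \<open>Modulo \<open>I T\<close> the element \<open>x\<close> agrees with
  \<open>F i * r'\<close>, where \<open>r'\<close> is reduced. Both are supported on
  \<open>box T\<close>, so they are equal by induction. The term of largest weight in
  \<open>r'\<close> then contributes to \<open>x\<close> a monomial from which \<open>n i\<close>
  copies of \<open>a i\<close> can be subtracted, against the support of \<open>x\<close>.\<close>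

lemma box_independent:
  assumes "finite T" "x \<in> supported (box T)" "x \<in> I T"
  shows "x = 0"
  using assms
proof (induction T arbitrary: x rule: finite_induct)
  case empty
  then show ?case by (simp add: I_def)
next
  case (insert i T)
  obtain y r where yr: "y \<in> I T" "r \<in> R" "x = y + F i * r" using insert.prems(2) I_insert[OF insert.hyps(2)] by blast
  obtain r' where r': "r' \<in> supported (box T)" "r - r' \<in> I T" using reduce[OF yr(2)] by blast
  have sub: "x \<in> supported (box T)" using insert.prems(1) by (auto simp: supported_iff box_def)
  have "x - F i * r' = y + F i * (r - r')" unfolding yr by (simp add: algebra_simps)
  also have "\<dots> \<in> I T" using ideal_add[OF I_ideal yr(1) ideal_mult[OF I_ideal r'(2) F_R]] .
  finally have "x - F i * r' = 0"
    using insert.IH supported_diff[OF sub F_supported[OF r'(1) insert.hyps(2)]] by blast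
  then have x: "x = F i * r'" by simp
  show ?case
  proof (rule ccontr)
    assume "x \<noteq> 0"
    then have "r' \<noteq> 0" using x by auto
    then obtain s where s: "Poly_Mapping.lookup r' s \<noteq> 0" "\<forall>t. wt s < wt t \<longrightarrow> Poly_Mapping.lookup r' t = 0"
      using max_key by blast
    have "Poly_Mapping.lookup x (s + int (n i) *s a i) \<noteq> 0" unfolding x F_top[OF s(2)] using s(1) lead by simp
    then have "s + int (n i) *s a i \<in> box (insert i T)" using insert.prems(1) by (simp add: supported_iff)
    then have "s \<notin> S" by (simp add: box_def)
    then show False using s(1) supported_box_R[OF r'(1)] R_key by blast
  qed
qed

text \<open>For reduced \<open>x\<close> the product \<open>F i * x\<close> is again reduced, hence
  zero if it lies in \<open>I T\<close>. Its top coefficient is \<open>c i (n i)\<close> times that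
  of \<open>x\<close>, so \<open>x\<close> vanishes.\<close>

lemma F_regular:
  assumes "i \<notin> T" "f \<in> R" "F i * f \<in> I T"
  shows "f \<in> I T"
proof -
  obtain x where x: "x \<in> supported (box T)" "f - x \<in> I T" using reduce[OF assms(2)] by blast
  have "F i * x = F i * f - F i * (f - x)" by (simp add: algebra_simps)
  also have "\<dots> \<in> I T" using ideal_diff[OF I_ideal assms(3) ideal_mult[OF I_ideal x(2) F_R]] .
  finally have z: "F i * x = 0" using box_independent[of T] F_supported[OF x(1) assms(1)] by simp
  have "x = 0"
  proof (rule ccontr)
    assume "x \<noteq> 0"
    then obtain s where s: "Poly_Mapping.lookup x s \<noteq> 0" "\<forall>t. wt s < wt t \<longrightarrow> Poly_Mapping.lookup x t = 0"
      using max_key by blast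
    then show False using F_top[OF s(2), of i] lead[of i] z by simp
  qed
  then show ?thesis using x(2) by simp
qed

lemma box_decomposition:
  assumes "s \<in> box UNIV"
  shows "\<exists>u\<in>apery S a. \<exists>k. (\<forall>i. k i < n i) \<and> s = u + (\<Sum>i\<in>UNIV. int (k i) *s a i)"
proof -
  obtain u k where uk: "u \<in> apery S a" "s = u + (\<Sum>i\<in>UNIV. int (k i :: nat) *s a i)"
    using apery_decomposition[OF box_S[OF assms]] by blast
  have "k i < n i" for i
  proof (rule ccontr)
    assume "\<not> k i < n i"
    then have "n i \<le> k i" by simp
    from sum_scale_split[of UNIV i "n i" k a, OF _ _ this]
    have "s - int (n i) *s a i = u + (\<Sum>h\<in>UNIV. int (if h = i then k h - n i else k h) *s a h)"
      using uk(2) by simp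
    also have "\<dots> \<in> S" using apery_S[OF uk(1)] by (intro add_S sum_S mult_S a_S)
    finally show False using assms by (auto simp: box_def)
  qed
  then show ?thesis using uk by blast
qed

lemma finite_box: "finite (box UNIV)"
proof -
  have "box UNIV \<subseteq> (\<lambda>(u, k). u + (\<Sum>i\<in>UNIV. int (k i) *s a i)) ` (apery S a \<times> (PiE UNIV (\<lambda>i. {..<n i})))"
  proof
    fix s assume "s \<in> box UNIV"
    then obtain u k where "u \<in> apery S a" "\<forall>i. k i < n i" "s = u + (\<Sum>i\<in>UNIV. int (k i) *s a i)"
      using box_decomposition by blast
    then show "s \<in> (\<lambda>(u, k). u + (\<Sum>i\<in>UNIV. int (k i) *s a i)) ` (apery S a \<times> (PiE UNIV (\<lambda>i. {..<n i})))"
      by (intro image_eqI[of _ _ "(u, k)"]) auto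
  qed
  then show ?thesis
    by (rule finite_subset) (intro finite_imageI finite_cartesian_product finite_apery finite_PiE finite finite_lessThan)
qed

section \<open>A nondegenerate linear form on this quotient\<close>

definition exponents :: "int ^ 'd \<Rightarrow> 'd \<Rightarrow> nat" where
  "exponents s i = nat \<lfloor>coord i (s - m)\<rfloor>"

text \<open>The product of the residue forms in the ray directions, shifted by \<open>m\<close> and
  extended by zero. The values of \<open>exponents\<close> are meaningless off the set of
  \<open>m\<close> plus nonnegative ray combinations, hence the equality test.\<close>

definition psi0 :: "int ^ 'd \<Rightarrow> 'k" where
  "psi0 s = (if s = m + (\<Sum>i\<in>UNIV. int (exponents s i) *s a i)
     then (\<Prod>i\<in>UNIV. rec_seq (n i) (c i) (exponents s i)) else 0)"

definition psi :: "(int ^ 'd \<Rightarrow>\<^sub>0 'k) \<Rightarrow> 'k" where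
  "psi f = (\<Sum>s\<in>Poly_Mapping.keys f. Poly_Mapping.lookup f s * psi0 s)"

lemma exponents_rep: "exponents (m + (\<Sum>i\<in>UNIV. int (k i) *s a i)) = k"
proof
  fix i
  have "coord i (\<Sum>i\<in>UNIV. int (k i) *s a i) = (\<Sum>j\<in>UNIV. if i = j then of_nat (k j) else 0)"
    unfolding coord_sum coord_mult coord_a by (intro sum.cong) auto
  then show "exponents (m + (\<Sum>i\<in>UNIV. int (k i) *s a i)) i = k i" by (simp add: exponents_def)
qed

lemma psi0_rep: "psi0 (m + (\<Sum>i\<in>UNIV. int (k i) *s a i)) = (\<Prod>i\<in>UNIV. rec_seq (n i) (c i) (k i))"
  unfolding psi0_def exponents_rep by simp

lemma psi0_nonzero: "psi0 s \<noteq> 0 \<Longrightarrow> \<exists>k. s = m + (\<Sum>i\<in>UNIV. int (k i) *s a i)"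
  unfolding psi0_def by (meson)

lemma psi_superset:
  assumes "finite A" "Poly_Mapping.keys f \<subseteq> A"
  shows "psi f = (\<Sum>s\<in>A. Poly_Mapping.lookup f s * psi0 s)"
  unfolding psi_def using assms by (intro sum.mono_neutral_left) (auto simp: in_keys_iff)

lemma psi_add: "psi (f + g) = psi f + psi g"
proof -
  let ?A = "Poly_Mapping.keys f \<union> Poly_Mapping.keys g"
  have "psi (f + g) = (\<Sum>s\<in>?A. Poly_Mapping.lookup (f + g) s * psi0 s)"
    using Poly_Mapping.keys_add[of f g] by (intro psi_superset) auto
  also have "\<dots> = (\<Sum>s\<in>?A. Poly_Mapping.lookup f s * psi0 s) + (\<Sum>s\<in>?A. Poly_Mapping.lookup g s * psi0 s)"
    by (simp add: lookup_add distrib_right sum.distrib)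
  also have "\<dots> = psi f + psi g" using psi_superset[of ?A f] psi_superset[of ?A g] by simp
  finally show ?thesis .
qed

lemma psi_zero: "psi 0 = 0" by (simp add: psi_def)

lemma psi_sum: "psi (sum f A) = (\<Sum>x\<in>A. psi (f x))"
  by (induction A rule: infinite_finite_induct) (auto simp: psi_add psi_zero)

lemma psi_single: "psi (Poly_Mapping.single s x) = x * psi0 s"
  using psi_superset[of "{s}" "Poly_Mapping.single s x"] by (auto simp: lookup_single)

lemma psi_C: "psi (C x * f) = x * psi f"
proof -
  have "psi (C x * f) = (\<Sum>s\<in>Poly_Mapping.keys f. Poly_Mapping.lookup (C x * f) s * psi0 s)"
    by (intro psi_superset) (auto simp: in_keys_iff lookup_single_mult)
  then show ?thesis by (simp add: psi_def lookup_single_mult sum_distrib_left mult.assoc)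
qed

text \<open>If \<open>s\<close> is \<open>m\<close> plus rays, this is the recurrence in direction
  \<open>i\<close>. Otherwise no \<open>s + j * a i\<close> may have this form: its exponent at
  \<open>a i\<close> would be less than \<open>j\<close>, and stripping the other rays by saturation
  would give \<open>m - a i\<close> in \<open>S\<close>, although \<open>m\<close> is Apery.\<close>

lemma psi0_recurrence:
  assumes s: "s \<in> S"
  shows "(\<Sum>j\<le>n i. c i j * psi0 (s + int j *s a i)) = 0"
proof (cases "\<exists>k. s = m + (\<Sum>l\<in>UNIV. int (k l) *s a l)")
  case True
  then obtain k where k: "s = m + (\<Sum>l\<in>UNIV. int (k l) *s a l)" by blast
  let ?p = "\<Prod>l\<in>UNIV - {i}. rec_seq (n l) (c l) (k l)"
  have "psi0 (s + int j *s a i) = rec_seq (n i) (c i) (k i + j) * ?p" for j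
  proof -
    have "(\<Sum>l\<in>UNIV. int ((k(i := k i + j)) l) *s a l) =
        (\<Sum>l\<in>UNIV. int (k l) *s a l + (if l = i then int j *s a i else 0))"
      by (intro sum.cong) (auto simp: vector_sadd_rdistrib)
    then have "s + int j *s a i = m + (\<Sum>l\<in>UNIV. int ((k(i := k i + j)) l) *s a l)"
      unfolding k by (simp add: sum.distrib)
    then have "psi0 (s + int j *s a i) = (\<Prod>l\<in>UNIV. rec_seq (n l) (c l) ((k(i := k i + j)) l))"
      by (simp only: psi0_rep)
    also have "\<dots> = rec_seq (n i) (c i) (k i + j) * (\<Prod>l\<in>UNIV - {i}. rec_seq (n l) (c l) ((k(i := k i + j)) l))"
      by (subst prod.remove[of UNIV i]) auto
    also have "(\<Prod>l\<in>UNIV - {i}. rec_seq (n l) (c l) ((k(i := k i + j)) l)) = ?p" by (intro prod.cong) auto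
    finally show ?thesis .
  qed
  then have "(\<Sum>j\<le>n i. c i j * psi0 (s + int j *s a i)) = (\<Sum>j\<le>n i. c i j * rec_seq (n i) (c i) (k i + j)) * ?p"
    by (simp add: sum_distrib_right mult.assoc)
  then show ?thesis using rec_seq_recurrence[of "n i" "c i", OF n_pos lead] by simp
next
  case False
  have "psi0 (s + int j *s a i) = 0" for j
  proof (rule ccontr)
    assume "psi0 (s + int j *s a i) \<noteq> 0"
    then obtain k where k: "s + int j *s a i = m + (\<Sum>l\<in>UNIV. int (k l) *s a l)" using psi0_nonzero by blast
    have split: "(\<Sum>l\<in>UNIV. int (k l) *s a l) = int (k i) *s a i + (\<Sum>l\<in>UNIV - {i}. int (k l) *s a l)"
      by (simp add: sum.remove[of UNIV i])
    show False
    proof (cases "j \<le> k i")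
      case True
      have "s = m + (\<Sum>h\<in>UNIV. int (if h = i then k h - j else k h) *s a h)"
        using k sum_scale_split[of UNIV i j k a, OF _ _ True] by (simp add: algebra_simps)
      then have "\<exists>k. s = m + (\<Sum>l\<in>UNIV. int (k l) *s a l)" by (rule exI[of _ "\<lambda>h. if h = i then k h - j else k h"])
      then show False using False by contradiction
    next
      case le: False
      define q where "q = j - k i - 1"
      have "j = k i + q + 1" unfolding q_def using le by linarith
      then have j: "int j = int (k i) + int q + 1" by simp
      have "s + int q *s a i + a i = m + (\<Sum>l\<in>UNIV - {i}. int (k l) *s a l)"
        using k unfolding split j by (simp add: vector_sadd_rdistrib algebra_simps)
      then have "m - a i + (\<Sum>l\<in>UNIV - {i}. int (k l) *s a l) = s + int q *s a i" by (simp add: algebra_simps)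
      then have A: "m - a i + (\<Sum>l\<in>UNIV - {i}. int (k l) *s a l) \<in> S" using add_S[OF s mult_S[OF a_S]] by simp
      have B: "m - a i + int 1 *s a i \<in> S" using apery_S[OF m_apery] by simp
      have "m - a i \<in> S" by (rule cancel_sum[of "UNIV - {i}" i "m - a i" k 1, OF _ _ A B]) simp_all
      then show False using apery_not[OF m_apery] by blast
    qed
  qed
  then show ?thesis by simp
qed

lemma psi_F:
  assumes "f \<in> R"
  shows "psi (F i * f) = 0"
proof -
  have "psi (F i * Poly_Mapping.single s x) = x * (\<Sum>j\<le>n i. c i j * psi0 (s + int j *s a i))" for s x
    by (simp add: F_def sum_distrib_right psi_sum mult_single psi_single sum_distrib_left algebra_simps)
  then have z: "psi (F i * Poly_Mapping.single s x) = 0" if "s \<in> S" for s x using psi0_recurrence[OF that] by simp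
  have "F i * f = (\<Sum>s\<in>Poly_Mapping.keys f. F i * Poly_Mapping.single s (Poly_Mapping.lookup f s))"
    by (subst poly_mapping_sum_single[of f]) (simp add: sum_distrib_left)
  then have "psi (F i * f) = (\<Sum>s\<in>Poly_Mapping.keys f. psi (F i * Poly_Mapping.single s (Poly_Mapping.lookup f s)))"
    by (simp add: psi_sum)
  also have "\<dots> = 0" using assms by (intro sum.neutral ballI z) (auto simp: supported_def)
  finally show ?thesis .
qed

lemma psi_I: "x \<in> I T \<Longrightarrow> psi x = 0"
  by (auto simp: I_def psi_sum psi_F)

text \<open>The term of largest weight in the reduced form of \<open>f\<close> is moved by
  \<open>t\<close> onto \<open>m\<close> plus \<open>n i - 1\<close> copies of each ray, where
  \<open>psi0\<close> is 1. Maximality of \<open>m\<close> makes \<open>t\<close> an element of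
  \<open>S\<close>. Any other term that is moved into the support of \<open>psi0\<close> would
  exceed the chosen one in weight.\<close>

lemma psi_nondegenerate:
  assumes f: "f \<in> R" "f \<notin> I UNIV"
  shows "\<exists>t\<in>S. psi (f * X t) \<noteq> 0"
proof -
  obtain x where x: "x \<in> supported (box UNIV)" "f - x \<in> I UNIV" using reduce[OF f(1)] by blast
  have "x \<noteq> 0" using x(2) f(2) by auto
  then obtain s where s: "Poly_Mapping.lookup x s \<noteq> 0" "\<forall>t. wt s < wt t \<longrightarrow> Poly_Mapping.lookup x t = 0"
    using max_key by blast
  then have "s \<in> box UNIV" using x(1) by (simp add: supported_iff)
  then obtain u k where uk: "u \<in> apery S a" "\<forall>i. k i < n i" "s = u + (\<Sum>i\<in>UNIV. int (k i) *s a i)"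
    using box_decomposition by blast
  define t where "t = (m - u) + (\<Sum>i\<in>UNIV. int (n i - 1 - k i) *s a i)"
  have tS: "t \<in> S" unfolding t_def using m_max[OF uk(1)] by (intro add_S sum_S mult_S a_S)
  have "s + t = m + ((\<Sum>i\<in>UNIV. int (k i) *s a i) + (\<Sum>i\<in>UNIV. int (n i - 1 - k i) *s a i))"
    unfolding uk(3) t_def by (simp add: algebra_simps)
  also have "(\<Sum>i\<in>UNIV. int (k i) *s a i) + (\<Sum>i\<in>UNIV. int (n i - 1 - k i) *s a i) = (\<Sum>i\<in>UNIV. int (n i - 1) *s a i)"
    unfolding sum.distrib[symmetric]
  proof (intro sum.cong refl)
    fix i
    have "k i \<le> n i - 1" using uk(2)[rule_format, of i] by linarith
    then have "int (n i - 1) = int (k i) + int (n i - 1 - k i)" by linarith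
    then show "int (k i) *s a i + int (n i - 1 - k i) *s a i = int (n i - 1) *s a i"
      by (simp only: vector_sadd_rdistrib)
  qed
  finally have st: "s + t = m + (\<Sum>i\<in>UNIV. int (n i - 1) *s a i)" .
  have one: "psi0 (s + t) = 1" unfolding st psi0_rep by (simp add: rec_seq_one del: One_nat_def)
  have other: "Poly_Mapping.lookup x q * psi0 (q + t) = 0" if q: "q \<noteq> s" for q
  proof (rule ccontr)
    assume nz: "Poly_Mapping.lookup x q * psi0 (q + t) \<noteq> 0"
    then have xq: "Poly_Mapping.lookup x q \<noteq> 0" and p0: "psi0 (q + t) \<noteq> 0" by auto
    obtain l where l: "q + t = m + (\<Sum>i\<in>UNIV. int (l i) *s a i)" using psi0_nonzero[OF p0] by blast
    have "(\<Prod>i\<in>UNIV. rec_seq (n i) (c i) (l i)) \<noteq> 0" using p0 unfolding l psi0_rep .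
    then have "rec_seq (n i) (c i) (l i) \<noteq> 0" for i by (simp add: prod_zero_iff)
    then have li: "n i - 1 \<le> l i" for i using rec_seq_small[of "l i" "n i" "c i"] not_less by blast
    have "q - s = (q + t) - (s + t)" by simp
    also have "\<dots> = (\<Sum>i\<in>UNIV. int (l i) *s a i - int (n i - 1) *s a i)" unfolding l st by (simp add: sum_subtractf)
    also have "\<dots> = (\<Sum>i\<in>UNIV. int (l i - (n i - 1)) *s a i)"
    proof (intro sum.cong refl)
      fix i
      have e: "int (l i) = int (l i - (n i - 1)) + int (n i - 1)" using li[of i] by linarith
      show "int (l i) *s a i - int (n i - 1) *s a i = int (l i - (n i - 1)) *s a i"
        unfolding e vector_sadd_rdistrib by simp
    qed
    also have "\<dots> \<in> S" by (intro sum_S mult_S a_S)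
    finally have "1 \<le> wt (q - s)" using wt_pos q by auto
    then have "wt s < wt q" by (simp add: wt_diff)
    then show False using s(2) xq by blast
  qed
  have "x * X t = (\<Sum>q\<in>Poly_Mapping.keys x. Poly_Mapping.single (q + t) (Poly_Mapping.lookup x q))"
    by (subst poly_mapping_sum_single[of x]) (simp add: sum_distrib_right mult_single)
  then have "psi (x * X t) = (\<Sum>q\<in>Poly_Mapping.keys x. Poly_Mapping.lookup x q * psi0 (q + t))"
    by (simp add: psi_sum psi_single)
  also have "\<dots> = (\<Sum>q\<in>Poly_Mapping.keys x. if q = s then Poly_Mapping.lookup x s else 0)"
    using one other by (intro sum.cong) auto
  also have "\<dots> = Poly_Mapping.lookup x s" using s(1) by (simp add: in_keys_iff)
  finally have px: "psi (x * X t) \<noteq> 0" using s(1) by simp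
  have "psi (f * X t) = psi (x * X t) + psi ((f - x) * X t)"
    unfolding psi_add[symmetric] by (simp add: algebra_simps)
  also have "psi ((f - x) * X t) = 0" using psi_I[OF ideal_mult2[OF I_ideal x(2) X_R[OF tS]]] .
  finally have e: "psi (f * X t) = psi (x * X t)" by simp
  show ?thesis by (rule bexI[OF _ tS]) (unfold e, rule px)
qed

end

section \<open>Socles\<close>

lemma (in cring) max_ideal_eqI:
  assumes M: "ideal M R" "M \<noteq> carrier R" and unit: "\<And>x. x \<in> carrier R \<Longrightarrow> x \<notin> M \<Longrightarrow> \<exists>y\<in>carrier R. y \<otimes> x = \<one>"
  shows "max_ideal R = M"
proof -
  have full: "J = carrier R" if J: "ideal J R" "\<not> J \<subseteq> M" for J
  proof -
    obtain x where x: "x \<in> J" "x \<notin> M" using J(2) by blast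
    then obtain y where "y \<in> carrier R" "y \<otimes> x = \<one>" using unit ideal.Icarr[OF J(1)] by blast
    then have "\<one> \<in> J" using ideal.I_l_closed[OF J(1) x(1)] by metis
    then show ?thesis using ideal.one_imp_carrier[OF J(1)] by blast
  qed
  have "maximalideal M R"
    by (rule maximalidealI) (use M full in auto)
  moreover have "M' = M" if M': "maximalideal M' R" for M'
  proof -
    have sub: "M' \<subseteq> M"
      using full[OF maximalideal.axioms(1)[OF M']] maximalideal.I_notcarr[OF M'] by blast
    have "M = M' \<or> M = carrier R"
      by (rule maximalideal.I_maximal[OF M' M(1) sub]) (use ideal.Icarr[OF M(1)] in blast)
    then show ?thesis using M(2) by blast
  qed
  ultimately show ?thesis unfolding max_ideal_def by (rule the_equality)
qed

text \<open>Modulo \<open>J\<close> the element \<open>r0\<close> is nonzero, killed by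
  \<open>P\<close>, and generates everything killed by \<open>P\<close>, so its class spans the
  socle. It also shows that the sequence cannot be extended, as every element of \<open>P\<close> is
  a zero divisor modulo \<open>J\<close>.\<close>

lemma (in localized_domain) has_cm_type_one:
  assumes fs: "reg {0} fs" and J: "J = foldl adj {0} fs"
    and r0: "r0 \<in> R" "r0 \<notin> J" "\<And>p. p \<in> P \<Longrightarrow> p * r0 \<in> J"
    and unique: "\<And>z. z \<in> R \<Longrightarrow> (\<And>p. p \<in> P \<Longrightarrow> p * z \<in> J) \<Longrightarrow> \<exists>q\<in>R. z - q * r0 \<in> J"
  shows "has_cm_type A 1"
proof -
  define ps where "ps = map (\<lambda>f. (f, 1::'a)) fs"
  define xs where "xs = map (\<lambda>(r, s). fr r s) ps"
  have fsP: "f \<in> P" if "f \<in> set fs" for f using fs that unfolding reg_iff_nth by (auto simp: in_set_conv_nth)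
  then have ps: "\<forall>(r, s)\<in>set ps. r \<in> P \<and> s \<in> unit_den" using den_one by (auto simp: ps_def)
  have fst: "map fst ps = fs" by (simp add: ps_def comp_def)
  have rs: "regular_seq A xs" using regular_seq_iff_reg[OF ps] fs fst by (simp add: xs_def)
  have sub: "set xs \<subseteq> ext P" using ps by (auto simp: xs_def intro!: extI)
  have subA: "set xs \<subseteq> carrier A" using rs by (simp add: regular_seq_def)
  have "\<not> regular_seq A (xs @ [y])" if y: "y \<in> ext P" for y
  proof
    assume *: "regular_seq A (xs @ [y])"
    obtain p s where p: "p \<in> P" "s \<in> unit_den" "y = fr p s" using y by (auto simp: ext_def)
    have ps': "\<forall>(r, s)\<in>set (ps @ [(p, s)]). r \<in> P \<and> s \<in> unit_den" using ps p by auto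
    have "reg {0} (map fst (ps @ [(p, s)]))" using regular_seq_iff_reg[OF ps'] * p(3) by (simp add: xs_def)
    then have "reg {0} (fs @ [p])" using fst by simp
    then have "nzd J p" unfolding reg_iff_nth J by (auto dest!: spec[of _ "length fs"])
    then show False using r0 p(1) by (auto simp: nzd_def)
  qed
  then have max: "maximal_regular_seq A xs"
    using rs sub by (auto simp: maximal_regular_seq_def max_ideal_A)
  define JJ where "JJ = Idl\<^bsub>A\<^esub> (set xs)"
  have idJ: "ideal JJ A" unfolding JJ_def by (rule A.genideal_ideal[OF subA])
  interpret I: ideal JJ A by (rule idJ)
  have psR: "\<forall>(r, s)\<in>set ps. r \<in> R \<and> s \<in> unit_den" using ps ideal_sub[OF P_ideal] by auto
  have conJ: "con JJ = J" unfolding JJ_def xs_def con_genideal[OF psR] fst J ..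
  have lJ: "lideal J" using lideal_con[OF idJ] conJ by simp
  have J_id: "is_ideal J" by (rule lideal_ideal[OF lJ])
  have "1 \<notin> J" using ideal_mult[OF J_id, of 1 r0] r0 by auto
  have JP: "J \<subseteq> P"
  proof
    fix j assume j: "j \<in> J"
    show "j \<in> P"
    proof (rule ccontr)
      assume "j \<notin> P"
      then have "j \<in> unit_den" using j ideal_sub[OF J_id] by (simp add: unit_den_def)
      then have "1 \<in> J" using lideal_cancel[OF lJ, of j 1] j by simp
      then show False using \<open>1 \<notin> J\<close> by blast
    qed
  qed
  define B where "B = A Quot JJ"
  define cl where "cl r s = JJ +>\<^bsub>A\<^esub> fr r s" for r s
  have cB: "cring B" unfolding B_def by (rule I.quotient_is_cring[OF A.is_cring])
  interpret B: cring B by (rule cB)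
  have carrier_B: "carrier B = {cl r s |r s. r \<in> R \<and> s \<in> unit_den}"
    unfolding B_def FactRing_def A_RCOSETS_def' cl_def by (auto simp: carrier_A)
  have clB: "cl r s \<in> carrier B" if "r \<in> R" "s \<in> unit_den" for r s using that carrier_B by blast
  have cl_mult: "cl r s \<otimes>\<^bsub>B\<^esub> cl r' s' = cl (r * r') (s * s')"
    if "r \<in> R" "s \<in> unit_den" "r' \<in> R" "s' \<in> unit_den" for r s r' s'
    using that I.rcoset_mult_add[of "fr r s" "fr r' s'"] by (simp add: B_def FactRing_def cl_def fr_mult)
  have fr_J: "fr r s \<in> JJ \<longleftrightarrow> r \<in> J" if "r \<in> R" "s \<in> unit_den" for r s
    using fr_in_ideal[OF idJ that] conJ by simp
  have cl_zero: "cl r s = \<zero>\<^bsub>B\<^esub> \<longleftrightarrow> r \<in> J" if "r \<in> R" "s \<in> unit_den" for r s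
  proof -
    have "cl r s = JJ \<longleftrightarrow> fr r s \<in> JJ"
      unfolding cl_def using A.a_rcos_zero[OF idJ] I.rcos_const_imp_mem fr_carrier[OF that] by blast
    then show ?thesis using fr_J[OF that] by (simp add: B_def FactRing_def)
  qed
  have cl_eq: "cl r s = cl r' s'" if "r \<in> R" "s \<in> unit_den" "r' \<in> R" "s' \<in> unit_den" "s' * r - s * r' \<in> J" for r s r' s'
  proof -
    have "fr r s \<ominus>\<^bsub>A\<^esub> fr r' s' = fr (s' * r - s * r') (s * s')"
      using that(1-4) by (simp add: a_minus_def fr_minus fr_add)
    also have "\<dots> \<in> JJ" using fr_J[of "s' * r - s * r'" "s * s'"] that den_mult den_R by auto
    finally show ?thesis unfolding cl_def
      using A.quotient_eq_iff_same_a_r_cos[OF idJ fr_carrier[OF that(1,2)] fr_carrier[OF that(3,4)]] by blast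
  qed
  have cl_eq_conv: "s' * r - s * r' \<in> J" if "r \<in> R" "s \<in> unit_den" "r' \<in> R" "s' \<in> unit_den" "cl r s = cl r' s'" for r s r' s'
  proof -
    have "fr r s \<ominus>\<^bsub>A\<^esub> fr r' s' \<in> JJ"
      using A.quotient_eq_iff_same_a_r_cos[OF idJ fr_carrier[OF that(1,2)] fr_carrier[OF that(3,4)]] that(5)
      unfolding cl_def by blast
    moreover have "fr r s \<ominus>\<^bsub>A\<^esub> fr r' s' = fr (s' * r - s * r') (s * s')"
      using that(1-4) by (simp add: a_minus_def fr_minus fr_add)
    ultimately show ?thesis using fr_J[of "s' * r - s * r'" "s * s'"] that den_mult den_R by auto
  qed
  have one_B: "\<one>\<^bsub>B\<^esub> = cl 1 1" by (simp add: B_def FactRing_def cl_def fr_one)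
  define MB where "MB = (+>\<^bsub>A\<^esub>) JJ ` ext P"
  have MB: "x \<in> MB \<longleftrightarrow> (\<exists>p s. p \<in> P \<and> s \<in> unit_den \<and> x = cl p s)" for x
    unfolding MB_def ext_def cl_def by auto
  have max_B: "max_ideal B = MB"
  proof (rule B.max_ideal_eqI)
    show "ideal MB B" unfolding MB_def B_def
      using A.ring_ideal_imp_quot_ideal[OF idJ ideal_ext[OF lprime_lideal[OF lprime_P]]] .
    have "\<one>\<^bsub>B\<^esub> \<notin> MB"
    proof
      assume "\<one>\<^bsub>B\<^esub> \<in> MB"
      then obtain p s where p: "p \<in> P" "s \<in> unit_den" "cl 1 1 = cl p s" by (auto simp: MB one_B)
      then have "s * 1 - 1 * p \<in> J" using cl_eq_conv[of 1 1 p s] den_one ideal_sub[OF P_ideal] by auto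
      then have "s - p + p \<in> P" using ideal_add[OF P_ideal, of "s - p" p] JP p(1) by auto
      then show False using p(2) by (simp add: unit_den_def)
    qed
    then show "MB \<noteq> carrier B" using B.one_closed by blast
    fix x assume x: "x \<in> carrier B" "x \<notin> MB"
    then obtain r s where rs: "r \<in> R" "s \<in> unit_den" "x = cl r s" by (auto simp: carrier_B)
    then have "r \<in> unit_den" using x(2) MB by (auto simp: unit_den_def)
    moreover from this rs have "cl s r \<otimes>\<^bsub>B\<^esub> x = cl 1 1"
      using cl_mult[of s r r s] den_R cl_eq[of "s * r" "r * s" 1 1] den_mult den_one ideal_zero[OF J_id]
      by (auto simp: mult.commute)
    ultimately show "\<exists>y\<in>carrier B. y \<otimes>\<^bsub>B\<^esub> x = \<one>\<^bsub>B\<^esub>" using clB[of s r] den_R rs one_B by auto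
  qed
  let ?b = "cl r0 1"
  have bB: "?b \<in> carrier B" using clB r0(1) den_one by blast
  have soc: "cl z s \<in> socle B \<longleftrightarrow> (\<forall>p\<in>P. p * z \<in> J)" if z: "z \<in> R" "s \<in> unit_den" for z s
  proof -
    have "cl z s \<in> socle B \<longleftrightarrow> (\<forall>p\<in>P. \<forall>t\<in>unit_den. cl p t \<otimes>\<^bsub>B\<^esub> cl z s = \<zero>\<^bsub>B\<^esub>)"
      unfolding socle_def max_B using clB[OF z] MB by auto
    also have "\<dots> \<longleftrightarrow> (\<forall>p\<in>P. \<forall>t\<in>unit_den. p * z \<in> J)"
      using cl_mult cl_zero z ideal_sub[OF P_ideal] den_mult by (intro ball_cong refl) auto
    finally show ?thesis using den_one by blast
  qed
  have socB: "Idl\<^bsub>B\<^esub> {?b} = socle B"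
  proof -
    have "Idl\<^bsub>B\<^esub> {?b} = {x \<otimes>\<^bsub>B\<^esub> ?b |x. x \<in> carrier B}"
      using B.cgenideal_eq_genideal[OF bB] by (simp add: cgenideal_def)
    also have "\<dots> = socle B"
    proof (intro equalityI subsetI)
      fix x assume "x \<in> {x \<otimes>\<^bsub>B\<^esub> ?b |x. x \<in> carrier B}"
      then obtain q s where q: "q \<in> R" "s \<in> unit_den" "x = cl q s \<otimes>\<^bsub>B\<^esub> ?b" by (auto simp: carrier_B)
      then have x: "x = cl (q * r0) s" using cl_mult[of q s r0 1] r0(1) den_one by simp
      have "p * (q * r0) \<in> J" if "p \<in> P" for p
        using ideal_mult[OF J_id r0(3)[OF that] q(1)] by (simp add: mult.left_commute)
      then show "x \<in> socle B" unfolding x using soc q r0(1) by blast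
    next
      fix x assume x: "x \<in> socle B"
      then have "x \<in> carrier B" by (simp add: socle_def)
      then obtain z s where z: "z \<in> R" "s \<in> unit_den" "x = cl z s" by (auto simp: carrier_B)
      then obtain q where q: "q \<in> R" "z - q * r0 \<in> J" using unique[of z] soc[OF z(1,2)] x by blast
      have "s * z - s * (q * r0) \<in> J" using ideal_mult[OF J_id q(2) den_R[OF z(2)]] by (simp add: right_diff_distrib)
      then have "x = cl (q * r0) s" unfolding z(3) using z q r0(1) by (intro cl_eq) auto
      then have "x = cl q s \<otimes>\<^bsub>B\<^esub> ?b" using cl_mult[of q s r0 1] z q r0(1) den_one by simp
      then show "x \<in> {x \<otimes>\<^bsub>B\<^esub> ?b |x. x \<in> carrier B}" using clB[OF q(1) z(2)] by blast
    qed
    finally show ?thesis .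
  qed
  have "socle_dim B = 1"
    unfolding socle_dim_def
  proof (rule Least_equality)
    show "\<exists>X\<subseteq>carrier B. finite X \<and> card X = 1 \<and> Idl\<^bsub>B\<^esub> X = socle B"
      using bB socB by (intro exI[of _ "{?b}"]) auto
    fix k assume "\<exists>X\<subseteq>carrier B. finite X \<and> card X = k \<and> Idl\<^bsub>B\<^esub> X = socle B"
    then obtain X where X: "finite X" "card X = k" "Idl\<^bsub>B\<^esub> X = socle B" by blast
    \<comment> \<open>An empty generating set would make the socle zero, but it contains the nonzero
      class of \<open>r0\<close>.\<close>
    show "1 \<le> k"
    proof (rule ccontr)
      assume "\<not> 1 \<le> k"
      then have "card X = 0" using X(2) by linarith
      then have "X = {}" using X(1) by simp
      moreover have "Idl\<^bsub>B\<^esub> {} \<subseteq> {\<zero>\<^bsub>B\<^esub>}" by (intro B.genideal_minimal B.zeroideal) auto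
      ultimately have "socle B \<subseteq> {\<zero>\<^bsub>B\<^esub>}" using X(3) by simp
      moreover have "?b \<in> socle B" using soc[OF r0(1) den_one] r0(3) by blast
      ultimately have "?b = \<zero>\<^bsub>B\<^esub>" by blast
      then show False using cl_zero[OF r0(1) den_one] r0(2) by blast
    qed
  qed
  then show ?thesis unfolding has_cm_type_def using max by (auto simp: B_def JJ_def)
qed

section \<open>Type one at every maximal ideal\<close>

context ray_polynomials
begin

text \<open>A nonzero constant coefficient would put a unit into \<open>P\<close>. A zero one lets
  \<open>p\<close> be split off, and primality of \<open>Q\<close> leaves either \<open>p\<close> in
  \<open>Q\<close> or a shorter relation.\<close>

lemma nonzero_relation_in_prime:
  assumes Q: "is_ideal Q" "Q \<subseteq> P" "\<And>x y. x \<in> R \<Longrightarrow> y \<in> R \<Longrightarrow> x * y \<in> Q \<Longrightarrow> x \<in> Q \<or> y \<in> Q"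
    and P: "is_ideal P" "1 \<notin> P" "p \<in> P"
  shows "(\<Sum>k\<le>N. C (e k) * p ^ k) \<in> Q \<Longrightarrow> \<exists>k\<le>N. e k \<noteq> 0 \<Longrightarrow> p \<in> Q"
proof (induction N arbitrary: e)
  case 0
  then have "C (e 0) \<in> P" "e 0 \<noteq> 0" using Q(2) by auto
  then show ?case using constant_unit[OF P(1)] P(2) by blast
next
  case (Suc N)
  have pR: "p \<in> R" using P ideal_sub by blast
  let ?g = "\<Sum>k\<le>N. C (e (Suc k)) * p ^ k"
  have gR: "?g \<in> R" using pR C_R power_in by (intro sum_in mult_in) auto
  have eq: "(\<Sum>k\<le>Suc N. C (e k) * p ^ k) = C (e 0) + p * ?g"
    unfolding sum.atMost_Suc_shift by (simp add: sum_distrib_left mult.left_commute)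
  show ?case
  proof (cases "e 0 = 0")
    case True
    then have "p * ?g \<in> Q" using Suc.prems(1) unfolding eq by simp
    moreover obtain k where "k \<le> Suc N" "e k \<noteq> 0" using Suc.prems(2) by blast
    then have "\<exists>k\<le>N. e (Suc k) \<noteq> 0" using True by (cases k) auto
    ultimately show ?thesis using Suc.IH[of "\<lambda>k. e (Suc k)"] Q(3)[OF pR gR] by blast
  next
    case False
    have "C (e 0) + p * ?g \<in> P" using Suc.prems(1) Q(2) unfolding eq by blast
    from ideal_diff[OF P(1) this ideal_mult2[OF P(1,3) gR]] have "C (e 0) \<in> P" by simp
    then show ?thesis using constant_unit[OF P(1)] P(2) False by blast
  qed
qed

text \<open>The form \<open>x \<mapsto> psi (s0 * x)\<close> makes \<open>R / J\<close> a local Frobenius algebra when \<open>s0\<close> is a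
  denominator with \<open>s0 J \<subseteq> I UNIV\<close>, so its socle is one-dimensional over the residue field.\<close>

lemma type_one_at:
  assumes loc: "localized_domain R P" and FP: "\<And>i. F i \<in> P"
  shows "has_cm_type (localization_at (ring_on R) P) 1"
proof -
  interpret L: localized_domain R P by (rule loc)
  \<comment> \<open>The contraction of the localized ideal of the ray polynomials indexed by
    \<open>T\<close>; \<open>fold\<close> identifies it with the iterated
    \<open>adj\<close>.\<close>
  define sat where "sat T = {x \<in> R. \<exists>s\<in>L.unit_den. s * x \<in> I T}" for T
  obtain ds :: "'d list" where ds: "set ds = UNIV" "distinct ds" using finite_distinct_list[OF finite] by blast
  have fold: "distinct is \<Longrightarrow> foldl L.adj {0} (map F is) = sat (set is)" for "is"
  proof (induction "is" rule: rev_induct)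
    case Nil
    have "x = 0" if "s \<in> L.unit_den" "x \<in> R" "s * x = 0" for s x
      using L.domain[OF L.den_R[OF that(1)] that(2,3)] L.den_nonzero[OF that(1)] by blast
    then show ?case using L.den_one by (auto simp: sat_def I_def)
  next
    case (snoc i "is")
    have i: "i \<notin> set is" using snoc.prems by simp
    have "L.adj (sat (set is)) (F i) = sat (insert i (set is))"
    proof (intro equalityI subsetI)
      fix x assume "x \<in> L.adj (sat (set is)) (F i)"
      then obtain s y r where x: "x \<in> R" "s \<in> L.unit_den" "y \<in> sat (set is)" "r \<in> R" "s * x = y + F i * r"
        by (metis L.adjE)
      then obtain s' where s': "s' \<in> L.unit_den" "s' * y \<in> I (set is)" by (auto simp: sat_def)
      have "(s' * s) * x = s' * y + F i * (s' * r)" using x(5) by (simp add: algebra_simps)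
      then have "(s' * s) * x \<in> I (insert i (set is))"
        unfolding I_insert[OF i] using s' x(4) L.den_R by (intro bexI[of _ "s' * y"] bexI[of _ "s' * r"]) auto
      then show "x \<in> sat (insert i (set is))" unfolding sat_def using x(1) L.den_mult[OF s'(1) x(2)] by blast
    next
      fix x assume "x \<in> sat (insert i (set is))"
      then obtain s where s: "x \<in> R" "s \<in> L.unit_den" "s * x \<in> I (insert i (set is))" by (auto simp: sat_def)
      then obtain y r where yr: "y \<in> I (set is)" "r \<in> R" "s * x = y + F i * r" unfolding I_insert[OF i] by blast
      have "y \<in> sat (set is)" unfolding sat_def using yr(1) ideal_sub[OF I_ideal] L.den_one by (intro CollectI conjI bexI[of _ 1]) auto
      then show "x \<in> L.adj (sat (set is)) (F i)" using s yr by (intro L.adjI)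
    qed
    then show ?case using snoc by simp
  qed
  have take_not: "ds ! k \<notin> set (take k ds)" if "k < length ds" for k
    using that ds(2) by (auto simp: in_set_conv_nth nth_eq_iff_index_eq)
  have regs: "L.reg {0} (map F ds)"
    unfolding L.reg_iff_nth
  proof (intro allI impI conjI)
    fix k assume "k < length (map F ds)"
    then have k: "k < length ds" by simp
    show "map F ds ! k \<in> P" using k FP by simp
    have "foldl L.adj {0} (take k (map F ds)) = sat (set (take k ds))"
      unfolding take_map by (rule fold) (use ds(2) in simp)
    moreover have "L.nzd (sat (set (take k ds))) (F (ds ! k))"
      unfolding L.nzd_def
    proof (intro conjI ballI impI F_R)
      fix r assume r: "r \<in> R" "F (ds ! k) * r \<in> sat (set (take k ds))"
      then obtain s where s: "s \<in> L.unit_den" "s * (F (ds ! k) * r) \<in> I (set (take k ds))" by (auto simp: sat_def)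
      have "F (ds ! k) * (s * r) \<in> I (set (take k ds))" using s(2) by (simp add: mult.left_commute)
      then have "s * r \<in> I (set (take k ds))" using F_regular[OF take_not[OF k]] r(1) L.den_R[OF s(1)] by blast
      then show "r \<in> sat (set (take k ds))" unfolding sat_def using r(1) s(1) by blast
    qed
    ultimately show "L.nzd (foldl L.adj {0} (take k (map F ds))) (map F ds ! k)" using k by simp
  qed
  define J where "J = sat UNIV"
  have J: "J = foldl L.adj {0} (map F ds)" using fold[OF ds(2)] ds(1) by (simp add: J_def)
  have fold_lideal: "set fs \<subseteq> R \<Longrightarrow> L.lideal (foldl L.adj {0} fs)" for fs
    by (induction fs rule: rev_induct) (auto intro: L.lideal_zero L.lideal_adj L.lideal_ideal)
  have lJ: "L.lideal J" unfolding J by (rule fold_lideal) (use F_R in auto)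
  have J_id: "is_ideal J" by (rule L.lideal_ideal[OF lJ])
  have IP: "I UNIV \<subseteq> P" unfolding I_def using FP by (auto intro!: ideal_sum[OF L.P_ideal] ideal_mult2[OF L.P_ideal])
  have IJ: "x \<in> J" if "x \<in> I UNIV" for x
    unfolding J_def sat_def using that ideal_sub[OF I_ideal that] L.den_one by (intro CollectI conjI bexI[of _ 1]) auto
  have one_J: "1 \<notin> J" using IP by (auto simp: J_def sat_def L.unit_den_def)
  \<comment> \<open>\<open>J\<close> is finitely generated, so one common denominator carries all of
    it into \<open>I UNIV\<close>, on which \<open>psi\<close> vanishes.\<close>
  obtain s0 where s0: "s0 \<in> L.unit_den" "\<And>x. x \<in> J \<Longrightarrow> s0 * x \<in> I UNIV"
  proof -
    obtain N v where v: "\<forall>i<N::nat. v i \<in> J" "\<forall>x\<in>J. \<exists>c. (\<forall>i<N. c i \<in> R) \<and> x = (\<Sum>i<N. c i * v i)"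
      using L.noetherian[OF J_id] unfolding finitely_generated_def by blast
    have "\<exists>s\<in>L.unit_den. \<forall>i<k. s * v i \<in> I UNIV" if "k \<le> N" for k using that
    proof (induction k)
      case 0
      then show ?case using L.den_one by blast
    next
      case (Suc k)
      then obtain s where s: "s \<in> L.unit_den" "\<forall>i<k. s * v i \<in> I UNIV" by auto
      have "v k \<in> J" using v(1) Suc.prems by simp
      then obtain t where t: "t \<in> L.unit_den" "t * v k \<in> I UNIV" by (auto simp: J_def sat_def)
      have "(t * s) * v i \<in> I UNIV" if "i < Suc k" for i
      proof (cases "i = k")
        case True
        then show ?thesis using ideal_mult[OF I_ideal t(2) L.den_R[OF s(1)]] by (simp add: algebra_simps)
      next
        case False
        then have "s * v i \<in> I UNIV" using s(2) that by simp
        from ideal_mult[OF I_ideal this L.den_R[OF t(1)]] show ?thesis by (simp add: mult.assoc)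
      qed
      then show ?case using L.den_mult[OF t(1) s(1)] by blast
    qed
    then obtain s where s: "s \<in> L.unit_den" "\<forall>i<N. s * v i \<in> I UNIV" by blast
    have "s * x \<in> I UNIV" if xJ: "x \<in> J" for x
    proof -
      obtain b where b: "\<forall>i<N. b i \<in> R" "x = (\<Sum>i<N. b i * v i)" using bspec[OF v(2) xJ] by blast
      have "s * x = (\<Sum>i<N. b i * (s * v i))" unfolding b(2) sum_distrib_left
        by (intro sum.cong refl) (simp add: ac_simps)
      also have "\<dots> \<in> I UNIV"
      proof (rule ideal_sum[OF I_ideal])
        fix i assume "i \<in> {..<N}"
        then show "b i * (s * v i) \<in> I UNIV" using ideal_mult[OF I_ideal, of "s * v i" UNIV "b i"] b(1) s(2) by simp
      qed
      finally show ?thesis .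
    qed
    then show thesis by (rule that[OF s(1)])
  qed
  have s0R: "s0 \<in> R" by (rule L.den_R[OF s0(1)])
  have psi_J: "psi (s0 * x) = 0" if "x \<in> J" for x using psi_I[OF s0(2)[OF that]] .
  have nondeg: "\<exists>t\<in>S. psi (s0 * (x * X t)) \<noteq> 0" if x: "x \<in> R" "x \<notin> J" for x
  proof -
    have "s0 * x \<notin> I UNIV" using x s0(1) by (auto simp: J_def sat_def)
    from psi_nondegenerate[OF mult_in[OF s0R x(1)] this] show ?thesis by (simp add: mult.assoc)
  qed
  have JP: "x \<in> J \<Longrightarrow> x \<in> P" for x
    using L.lideal_not_one[OF lJ one_in one_J, of x] ideal_sub[OF J_id, of x] by simp
  \<comment> \<open>\<open>R / I UNIV\<close> is finite-dimensional, so every \<open>p\<close> in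
    \<open>P\<close> satisfies a polynomial relation over K modulo a maximal annihilator
    \<open>Q\<close> of \<open>J\<close>. Therefore \<open>Q\<close> contains \<open>P\<close>, and
    the witness of \<open>Q\<close> is killed by \<open>P\<close>.\<close>
  obtain r0 where r0: "r0 \<in> R" "r0 \<notin> J" "\<And>p. p \<in> P \<Longrightarrow> p * r0 \<in> J"
  proof -
    obtain Q where Q: "L.maxann J Q" using L.maxann_exists[OF J_id one_in one_J] by blast
    obtain w where w: "w \<in> R" "w \<notin> J" "Q = ann J w" using Q by (auto simp: L.maxann_def)
    have lQ: "L.lprime Q" by (rule L.maxann_lprime[OF lJ Q])
    have IQ: "x \<in> Q" if "x \<in> I UNIV" for x
      using ideal_mult2[OF J_id IJ[OF that] w(1)] ideal_sub[OF I_ideal that] by (simp add: w(3) ann_def)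
    have "p \<in> Q" if p: "p \<in> P" for p
    proof -
      have pR: "p \<in> R" using p ideal_sub[OF L.P_ideal] by blast
      let ?N = "card (box UNIV)"
      have "\<forall>k. \<exists>x\<in>supported (box UNIV). p ^ k - x \<in> I UNIV" using reduce power_in[OF pR] by blast
      then obtain x where x: "\<And>k. x k \<in> supported (box UNIV)" "\<And>k. p ^ k - x k \<in> I UNIV" by metis
      obtain e where e: "\<exists>k\<in>{..?N}. e k \<noteq> 0" "\<forall>b\<in>box UNIV. (\<Sum>k\<le>?N. e k * Poly_Mapping.lookup (x k) b) = 0"
        using nontrivial_combination[OF finite_box, of "{..?N}" "\<lambda>k. Poly_Mapping.lookup (x k)"] by auto
      have "(\<Sum>k\<le>?N. C (e k) * x k) = 0"
      proof (rule poly_mapping_eqI)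
        fix b
        have "Poly_Mapping.lookup (x k) b = 0" if "b \<notin> box UNIV" for k using x(1) that by (auto simp: supported_iff)
        then show "Poly_Mapping.lookup (\<Sum>k\<le>?N. C (e k) * x k) b = Poly_Mapping.lookup 0 b"
          using e(2) by (cases "b \<in> box UNIV") (auto simp: lookup_sum lookup_single_mult)
      qed
      then have "(\<Sum>k\<le>?N. C (e k) * p ^ k) = (\<Sum>k\<le>?N. C (e k) * (p ^ k - x k))"
        by (simp add: right_diff_distrib sum_subtractf)
      also have "\<dots> \<in> I UNIV" using x(2) C_R by (intro ideal_sum[OF I_ideal] ideal_mult[OF I_ideal])
      finally have "(\<Sum>k\<le>?N. C (e k) * p ^ k) \<in> Q" by (rule IQ)
      then show ?thesis
        using nonzero_relation_in_prime[where Q = Q and P = P and p = p and N = "?N" and e = e] lQ L.P_ideal L.one_notin_P p e(1)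
        by (auto simp: L.lprime_def)
    qed
    then have "p * w \<in> J" if "p \<in> P" for p using that by (auto simp: w(3) ann_def)
    then show thesis using that w by blast
  qed
  \<comment> \<open>A smallest spanning set of monomials gives a K-basis of the residue field
    \<open>R / P\<close>.\<close>
  define spanning where "spanning A \<longleftrightarrow> finite A \<and> A \<subseteq> S \<and>
    (\<forall>r\<in>R. \<exists>c. r - (\<Sum>b\<in>A. C (c b) * X b) \<in> P)" for A
  have "spanning (box UNIV)"
    unfolding spanning_def
  proof (intro conjI ballI finite_box)
    show "box UNIV \<subseteq> S" using box_S by blast
    fix r assume "r \<in> R"
    then obtain x where x: "x \<in> supported (box UNIV)" "r - x \<in> I UNIV" using reduce by blast
    have "x = (\<Sum>b\<in>Poly_Mapping.keys x. C (Poly_Mapping.lookup x b) * X b)"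
      by (subst poly_mapping_sum_single[of x]) (simp add: mult_single)
    also have "\<dots> = (\<Sum>b\<in>box UNIV. C (Poly_Mapping.lookup x b) * X b)"
      using x(1) finite_box by (intro sum.mono_neutral_left) (auto simp: supported_def in_keys_iff)
    finally have "r - (\<Sum>b\<in>box UNIV. C (Poly_Mapping.lookup x b) * X b) \<in> P" using x(2) IP by auto
    then show "\<exists>c. r - (\<Sum>b\<in>box UNIV. C (c b) * X b) \<in> P" by blast
  qed
  then obtain A where A: "spanning A" "\<And>A'. spanning A' \<Longrightarrow> card A \<le> card A'"
    using ex_has_least_nat[of spanning "box UNIV" card] by blast
  have fA: "finite A" and AS: "A \<subseteq> S" using A(1) by (auto simp: spanning_def)
  have XA: "X b \<in> R" if "b \<in> A" for b using X_R AS that by blast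
  have indep: "c b = 0" if c: "(\<Sum>b\<in>A. C (c b) * X b) \<in> P" and b: "b \<in> A" for c b
  proof (rule ccontr)
    assume nz: "c b \<noteq> 0"
    have "spanning (A - {b})"
      unfolding spanning_def
    proof (intro conjI ballI)
      show "finite (A - {b})" "A - {b} \<subseteq> S" using fA AS by auto
      fix r assume "r \<in> R"
      then obtain d where d: "r - (\<Sum>b\<in>A. C (d b) * X b) \<in> P" using A(1) unfolding spanning_def by blast
      define e where "e x = d x - d b / c b * c x" for x
      have "C (e x) = C (d x) - C (d b / c b) * C (c x)" for x
        unfolding e_def by (simp add: mult_single single_diff)
      then have "(\<Sum>x\<in>A. C (e x) * X x) = (\<Sum>x\<in>A. C (d x) * X x) - C (d b / c b) * (\<Sum>x\<in>A. C (c x) * X x)"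
        by (simp only: left_diff_distrib sum_subtractf sum_distrib_left mult.assoc)
      moreover have "e b = 0" using nz by (simp add: e_def)
      then have "(\<Sum>x\<in>A. C (e x) * X x) = (\<Sum>x\<in>A - {b}. C (e x) * X x)"
        using fA b by (simp add: sum.remove[of A b])
      ultimately have "r - (\<Sum>x\<in>A - {b}. C (e x) * X x) =
          (r - (\<Sum>b\<in>A. C (d b) * X b)) + C (d b / c b) * (\<Sum>x\<in>A. C (c x) * X x)"
        by simp
      also have "\<dots> \<in> P" by (rule ideal_add[OF L.P_ideal d ideal_mult[OF L.P_ideal c C_R]])
      finally show "\<exists>c. r - (\<Sum>b\<in>A - {b}. C (c b) * X b) \<in> P" by blast
    qed
    then have "card A \<le> card (A - {b})" by (rule A(2))
    then show False using b fA by (metis card_Diff1_less not_le)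
  qed
  \<comment> \<open>There are \<open>card A + 1\<close> vectors, namely \<open>z\<close> and the
    products \<open>X x * r0\<close>, against \<open>card A\<close> conditions
    \<open>psi (s0 * (_ * X b)) = 0\<close>. A dependence \<open>w\<close> satisfies them; since
    \<open>P\<close> sends \<open>w\<close> into \<open>J\<close> and \<open>A\<close> spans modulo
    \<open>P\<close>, it pairs to zero with all monomials. By nondegeneracy \<open>w\<close> lies in
    \<open>J\<close>.\<close>
  have unique: "\<exists>q\<in>R. z - q * r0 \<in> J" if z: "z \<in> R" "\<And>p. p \<in> P \<Longrightarrow> p * z \<in> J" for z
  proof -
    let ?E = "insert None (Some ` A)"
    define v where "v e b = psi (s0 * ((case e of None \<Rightarrow> z | Some x \<Rightarrow> X x * r0) * X b))" for e b
    have "card A < card ?E" using fA by (simp add: card_image)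
    then obtain c where c: "\<exists>e\<in>?E. c e \<noteq> 0" "\<forall>b\<in>A. (\<Sum>e\<in>?E. c e * v e b) = 0"
      using nontrivial_combination[OF fA, of ?E v] fA by auto
    define y where "y = (\<Sum>x\<in>A. C (c (Some x)) * X x)"
    define w where "w = C (c None) * z + y * r0"
    have yR: "y \<in> R" unfolding y_def using XA C_R by (intro sum_in mult_in) auto
    have wR: "w \<in> R" unfolding w_def using z(1) yR r0(1) C_R by (intro add_in mult_in)
    have psi_w: "psi (s0 * (w * X b)) = 0" if "b \<in> A" for b
    proof -
      have "s0 * (w * X b) = C (c None) * (s0 * (z * X b)) + (\<Sum>x\<in>A. C (c (Some x)) * (s0 * ((X x * r0) * X b)))"
        by (simp add: w_def y_def distrib_left distrib_right sum_distrib_left sum_distrib_right ac_simps)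
      then have "psi (s0 * (w * X b)) = c None * v None b + (\<Sum>x\<in>A. c (Some x) * v (Some x) b)"
        by (simp only: psi_add psi_sum psi_C v_def option.case)
      also have "\<dots> = (\<Sum>e\<in>?E. c e * v e b)"
        using fA by (simp add: sum.reindex)
      finally show ?thesis using c(2) that by simp
    qed
    have Pw: "p * w \<in> J" if p: "p \<in> P" for p
    proof -
      have "p * w = C (c None) * (p * z) + y * (p * r0)" by (simp add: w_def algebra_simps)
      also have "\<dots> \<in> J" by (rule ideal_add[OF J_id ideal_mult[OF J_id z(2)[OF p] C_R] ideal_mult[OF J_id r0(3)[OF p] yR]])
      finally show ?thesis .
    qed
    have wJ: "w \<in> J"
    proof (rule ccontr)
      assume "w \<notin> J"
      then obtain t where t: "t \<in> S" "psi (s0 * (w * X t)) \<noteq> 0" using nondeg[OF wR] by blast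
      obtain d where d: "X t - (\<Sum>b\<in>A. C (d b) * X b) \<in> P" using A(1) X_R[OF t(1)] unfolding spanning_def by blast
      have "s0 * (w * X t) = s0 * ((X t - (\<Sum>b\<in>A. C (d b) * X b)) * w) + (\<Sum>b\<in>A. C (d b) * (s0 * (w * X b)))"
        by (simp add: left_diff_distrib right_diff_distrib sum_distrib_left sum_distrib_right ac_simps)
      then have "psi (s0 * (w * X t)) = psi (s0 * ((X t - (\<Sum>b\<in>A. C (d b) * X b)) * w)) + (\<Sum>b\<in>A. d b * psi (s0 * (w * X b)))"
        by (simp only: psi_add psi_sum psi_C)
      also have "\<dots> = 0" using psi_J[OF Pw[OF d]] psi_w by simp
      finally show False using t(2) by blast
    qed
    \<comment> \<open>Otherwise \<open>y * r0\<close> lies in \<open>J\<close> with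
      \<open>r0\<close> outside, so \<open>y\<close> lies in \<open>P\<close>, and independence of
      \<open>A\<close> makes all coefficients vanish.\<close>
    have cN: "c None \<noteq> 0"
    proof
      assume c0: "c None = 0"
      then have "y * r0 \<in> J" using wJ by (simp add: w_def)
      then have "y \<in> P" using L.lideal_not_one[OF lJ r0(1,2) yR] by blast
      then have "c (Some x) = 0" if "x \<in> A" for x using indep[of "\<lambda>x. c (Some x)" x] that unfolding y_def by blast
      then show False using c(1) c0 by auto
    qed
    let ?\<alpha> = "inverse (c None)"
    have "C ?\<alpha> * w = C (?\<alpha> * c None) * z + C ?\<alpha> * y * r0"
      by (simp add: w_def distrib_left mult.assoc[symmetric] mult_single)
    then have "z - (- (C ?\<alpha> * y)) * r0 = C ?\<alpha> * w" using cN by simp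
    then have "z - (- (C ?\<alpha> * y)) * r0 \<in> J" using ideal_mult[OF J_id wJ C_R] by simp
    then show ?thesis using yR C_R by (intro bexI[of _ "- (C ?\<alpha> * y)"]) auto
  qed
  show ?thesis by (rule L.has_cm_type_one[OF regs J r0 unique])
qed

end

lemma (in simplicial_ring) gorenstein_if_unique_max:
  assumes cm: "cohen_macaulay (semigroup_ring TYPE('k) S)" and m: "max_apery S a = {m}"
  shows "gorenstein (semigroup_ring TYPE('k) S)"
  unfolding gorenstein_def
proof (intro conjI allI impI)
  show "noetherian_ring (semigroup_ring TYPE('k) S)" "cring (semigroup_ring TYPE('k) S)"
    using cm by (auto simp: cohen_macaulay_def)
  fix P assume "maximalideal P (semigroup_ring TYPE('k) S)"
  then have P: "maximalideal P (ring_on R)" by (simp add: ring_on_R)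
  have "\<forall>i. \<exists>n. \<exists>c. n > 0 \<and> c n \<noteq> 0 \<and> (\<Sum>j\<le>n. Poly_Mapping.single (int j *s a i) (c j)) \<in> P"
    using algebraic_rays[OF cm P] by blast
  then obtain n where "\<forall>i. \<exists>c. n i > 0 \<and> c (n i) \<noteq> 0 \<and>
      (\<Sum>j\<le>n i. Poly_Mapping.single (int j *s a i) (c j)) \<in> P"
    by metis
  then obtain c where nc: "\<And>i. n i > 0" "\<And>i. c i (n i) \<noteq> 0"
    "\<And>i. (\<Sum>j\<le>n i. Poly_Mapping.single (int j *s a i) (c i j)) \<in> P"
    by metis
  interpret ray_polynomials S G a K n c m
  proof
    show "s \<in> S" if "i \<noteq> j" "s + a i \<in> S" "s + a j \<in> S" for i j s using cm_saturated[OF cm that] .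
    show "m \<in> apery S a" using m max_apery_sub by blast
    show "m - u \<in> S" if "u \<in> apery S a" for u using below_max[OF that] m by simp
  qed (use nc in auto)
  have "has_cm_type (localization_at (ring_on R) P) 1"
    by (rule type_one_at[OF localized[OF cm P]]) (use nc(3) in \<open>simp add: F_def\<close>)
  moreover have "cohen_macaulay_local (localization_at (ring_on R) P)"
    using cm P by (simp add: cohen_macaulay_def ring_on_R)
  ultimately show "gorenstein_local (localization_at (semigroup_ring TYPE('k) S) P)"
    by (simp add: gorenstein_local_def ring_on_R)
qed

section \<open>Linear inequalities for numerical semigroups\<close>

text \<open>In the application \<open>F\<close> consists of the pseudo-Frobenius elements of a
  semigroup with a single ray. Everything is reduced to coefficients of the four generators, so that
  the contradictions become questions of integer linear arithmetic.\<close>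

locale four_gens =
  fixes S F :: "(int ^ 'd) set" and n0 n1 n2 n3 :: "int ^ 'd"
  assumes S_iff: "s \<in> S \<longleftrightarrow> (\<exists>x0 x1 x2 x3. 0 \<le> x0 \<and> 0 \<le> x1 \<and> 0 \<le> x2 \<and> 0 \<le> x3 \<and>
      s = x0 *s n0 + x1 *s n1 + x2 *s n2 + x3 *s n3)"
    and pointed: "0 \<le> x0 \<Longrightarrow> 0 \<le> x1 \<Longrightarrow> 0 \<le> x2 \<Longrightarrow> 0 \<le> x3 \<Longrightarrow>
      x0 *s n0 + x1 *s n1 + x2 *s n2 + x3 *s n3 = 0 \<Longrightarrow> x0 = 0 \<and> x1 = 0 \<and> x2 = 0 \<and> x3 = 0"
    and min0: "0 \<le> x1 \<Longrightarrow> 0 \<le> x2 \<Longrightarrow> 0 \<le> x3 \<Longrightarrow> n0 \<noteq> x1 *s n1 + x2 *s n2 + x3 *s n3"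
    and min1: "0 \<le> x0 \<Longrightarrow> 0 \<le> x2 \<Longrightarrow> 0 \<le> x3 \<Longrightarrow> n1 \<noteq> x0 *s n0 + x2 *s n2 + x3 *s n3"
    and min2: "0 \<le> x0 \<Longrightarrow> 0 \<le> x1 \<Longrightarrow> 0 \<le> x3 \<Longrightarrow> n2 \<noteq> x0 *s n0 + x1 *s n1 + x3 *s n3"
    and min3: "0 \<le> x0 \<Longrightarrow> 0 \<le> x1 \<Longrightarrow> 0 \<le> x2 \<Longrightarrow> n3 \<noteq> x0 *s n0 + x1 *s n1 + x2 *s n2"
    and F_notin: "f \<in> F \<Longrightarrow> f \<notin> S" "f \<in> F \<Longrightarrow> - f \<notin> S"
    and F_antichain: "f \<in> F \<Longrightarrow> g \<in> F \<Longrightarrow> f \<noteq> g \<Longrightarrow> f - g \<notin> S"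
    and F_plus: "f \<in> F \<Longrightarrow> f + n0 \<in> S" "f \<in> F \<Longrightarrow> f + n1 \<in> S" "f \<in> F \<Longrightarrow> f + n2 \<in> S" "f \<in> F \<Longrightarrow> f + n3 \<in> S"
begin

text \<open>A labelled edge between vertices, usually elements of \<open>F\<close> or 0: the label
  gives \<open>v - u\<close> in terms of the generators. Edges compose by \<open>tr\<close>, are
  reversed by \<open>sy\<close>, and absorb closed paths by \<open>cy\<close>.\<close>

definition rel :: "int ^ 'd \<Rightarrow> int ^ 'd \<Rightarrow> int \<Rightarrow> int \<Rightarrow> int \<Rightarrow> int \<Rightarrow> bool" where
  "rel u v x0 x1 x2 x3 \<longleftrightarrow> u - v + (x0 *s n0 + x1 *s n1 + x2 *s n2 + x3 *s n3) = 0"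

lemma tr: "rel u v x0 x1 x2 x3 \<Longrightarrow> rel v w y0 y1 y2 y3 \<Longrightarrow>
    rel u w (x0 + y0) (x1 + y1) (x2 + y2) (x3 + y3)"
  by (simp add: rel_def vec_eq_iff algebra_simps) smt

lemma cy: "rel u v x0 x1 x2 x3 \<Longrightarrow> rel w w y0 y1 y2 y3 \<Longrightarrow>
    rel u v (x0 + y0) (x1 + y1) (x2 + y2) (x3 + y3)"
  by (simp add: rel_def vec_eq_iff algebra_simps)

lemma sy: "rel u v x0 x1 x2 x3 \<Longrightarrow> rel v u (- x0) (- x1) (- x2) (- x3)"
  by (simp add: rel_def vec_eq_iff algebra_simps)

lemma re: "rel u v x0 x1 x2 x3 \<Longrightarrow> u' - v' = u - v \<Longrightarrow> rel u' v' x0 x1 x2 x3"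
  by (simp add: rel_def)

lemma in_S: "0 \<le> x0 \<Longrightarrow> 0 \<le> x1 \<Longrightarrow> 0 \<le> x2 \<Longrightarrow> 0 \<le> x3 \<Longrightarrow>
    s = x0 *s n0 + x1 *s n1 + x2 *s n2 + x3 *s n3 \<Longrightarrow> s \<in> S"
  using S_iff by blast

text \<open>A label without negative entries would place \<open>v - u\<close> in \<open>S\<close>;
  dually, \<open>gt\<close> forbids labels without positive entries.\<close>

lemma lt: assumes "rel u v x0 x1 x2 x3" "v - u \<notin> S" shows "x0 < 0 \<or> x1 < 0 \<or> x2 < 0 \<or> x3 < 0"
proof (rule ccontr)
  assume "\<not> ?thesis"
  moreover have "v - u = x0 *s n0 + x1 *s n1 + x2 *s n2 + x3 *s n3"
    using assms(1) by (simp add: rel_def algebra_simps)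
  ultimately show False using assms(2) in_S[of x0 x1 x2 x3 "v - u"] by linarith
qed

lemma gt: "rel u v x0 x1 x2 x3 \<Longrightarrow> u - v \<notin> S \<Longrightarrow> x0 > 0 \<or> x1 > 0 \<or> x2 > 0 \<or> x3 > 0"
  using lt[OF sy] by fastforce

lemma pos: "rel u u x0 x1 x2 x3 \<Longrightarrow>
    x0 < 0 \<or> x1 < 0 \<or> x2 < 0 \<or> x3 < 0 \<or> (x0 = 0 \<and> x1 = 0 \<and> x2 = 0 \<and> x3 = 0)"
  using pointed[of x0 x1 x2 x3] by (simp add: rel_def) linarith

text \<open>A closed path with entry -1 at \<open>n0\<close> and no other negative entry would write
  \<open>n0\<close> in terms of the other generators, against minimality. The three lemmas that
  follow do this for the other generators.\<close>

lemma irr0: assumes "rel u u x0 x1 x2 x3" shows "x0 \<noteq> - 1 \<or> x1 < 0 \<or> x2 < 0 \<or> x3 < 0"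
proof (rule ccontr)
  assume "\<not> ?thesis"
  moreover from this assms have "n0 = x1 *s n1 + x2 *s n2 + x3 *s n3"
    by (simp add: rel_def vec_eq_iff algebra_simps)
  ultimately show False using min0[of x1 x2 x3] by linarith
qed

lemma irr1: assumes "rel u u x0 x1 x2 x3" shows "x1 \<noteq> - 1 \<or> x0 < 0 \<or> x2 < 0 \<or> x3 < 0"
proof (rule ccontr)
  assume "\<not> ?thesis"
  moreover from this assms have "n1 = x0 *s n0 + x2 *s n2 + x3 *s n3"
    by (simp add: rel_def vec_eq_iff algebra_simps)
  ultimately show False using min1[of x0 x2 x3] by linarith
qed

lemma irr2: assumes "rel u u x0 x1 x2 x3" shows "x2 \<noteq> - 1 \<or> x0 < 0 \<or> x1 < 0 \<or> x3 < 0"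
proof (rule ccontr)
  assume "\<not> ?thesis"
  moreover from this assms have "n2 = x0 *s n0 + x1 *s n1 + x3 *s n3"
    by (simp add: rel_def vec_eq_iff algebra_simps)
  ultimately show False using min2[of x0 x1 x3] by linarith
qed

lemma irr3: assumes "rel u u x0 x1 x2 x3" shows "x3 \<noteq> - 1 \<or> x0 < 0 \<or> x1 < 0 \<or> x2 < 0"
proof (rule ccontr)
  assume "\<not> ?thesis"
  moreover from this assms have "n3 = x0 *s n0 + x1 *s n1 + x2 *s n2"
    by (simp add: rel_def vec_eq_iff algebra_simps)
  ultimately show False using min3[of x0 x1 x2] by linarith
qed

lemma in_S_cases:
  assumes "s \<in> S"
  obtains x0 x1 x2 x3 where "0 \<le> x0" "0 \<le> x1" "0 \<le> x2" "0 \<le> x3"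
    "s = x0 *s n0 + x1 *s n1 + x2 *s n2 + x3 *s n3"
  using assms S_iff by blast

text \<open>A representation of \<open>u - v + n0\<close> cannot use \<open>n0\<close>, because
  cancelling it would put \<open>u - v\<close> into \<open>S\<close>. This makes the entry at
  \<open>n0\<close> exactly 1 and the others nonpositive.\<close>

lemma edge0: assumes "u - v + n0 \<in> S" "u - v \<notin> S"
  obtains x1 x2 x3 where "0 \<le> x1" "0 \<le> x2" "0 \<le> x3" "rel u v 1 (- x1) (- x2) (- x3)"
proof -
  obtain x0 x1 x2 x3 where x: "0 \<le> x0" "0 \<le> x1" "0 \<le> x2" "0 \<le> x3"
    "u - v + n0 = x0 *s n0 + x1 *s n1 + x2 *s n2 + x3 *s n3" by (rule in_S_cases[OF assms(1)])
  have r: "rel u v (1 - x0) (- x1) (- x2) (- x3)"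
    using x(5) by (simp add: rel_def vec_eq_iff algebra_simps)
  show thesis using that[of x1 x2 x3] gt[OF r assms(2)] x r by (cases "x0 = 0") auto
qed

lemma edge1: assumes "u - v + n1 \<in> S" "u - v \<notin> S"
  obtains x0 x2 x3 where "0 \<le> x0" "0 \<le> x2" "0 \<le> x3" "rel u v (- x0) 1 (- x2) (- x3)"
proof -
  obtain x0 x1 x2 x3 where x: "0 \<le> x0" "0 \<le> x1" "0 \<le> x2" "0 \<le> x3"
    "u - v + n1 = x0 *s n0 + x1 *s n1 + x2 *s n2 + x3 *s n3" by (rule in_S_cases[OF assms(1)])
  have r: "rel u v (- x0) (1 - x1) (- x2) (- x3)"
    using x(5) by (simp add: rel_def vec_eq_iff algebra_simps)
  show thesis using that[of x0 x2 x3] gt[OF r assms(2)] x r by (cases "x1 = 0") auto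
qed

lemma edge2: assumes "u - v + n2 \<in> S" "u - v \<notin> S"
  obtains x0 x1 x3 where "0 \<le> x0" "0 \<le> x1" "0 \<le> x3" "rel u v (- x0) (- x1) 1 (- x3)"
proof -
  obtain x0 x1 x2 x3 where x: "0 \<le> x0" "0 \<le> x1" "0 \<le> x2" "0 \<le> x3"
    "u - v + n2 = x0 *s n0 + x1 *s n1 + x2 *s n2 + x3 *s n3" by (rule in_S_cases[OF assms(1)])
  have r: "rel u v (- x0) (- x1) (1 - x2) (- x3)"
    using x(5) by (simp add: rel_def vec_eq_iff algebra_simps)
  show thesis using that[of x0 x1 x3] gt[OF r assms(2)] x r by (cases "x2 = 0") auto
qed

lemma edge3: assumes "u - v + n3 \<in> S" "u - v \<notin> S"
  obtains x0 x1 x2 where "0 \<le> x0" "0 \<le> x1" "0 \<le> x2" "rel u v (- x0) (- x1) (- x2) 1"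
proof -
  obtain x0 x1 x2 x3 where x: "0 \<le> x0" "0 \<le> x1" "0 \<le> x2" "0 \<le> x3"
    "u - v + n3 = x0 *s n0 + x1 *s n1 + x2 *s n2 + x3 *s n3" by (rule in_S_cases[OF assms(1)])
  have r: "rel u v (- x0) (- x1) (- x2) (1 - x3)"
    using x(5) by (simp add: rel_def vec_eq_iff algebra_simps)
  show thesis using that[of x0 x1 x2] gt[OF r assms(2)] x r by (cases "x3 = 0") auto
qed

end

text \<open>The digits of a pattern give the indices of the maximal elements attached to \<open>n0\<close>, \<open>n1\<close>, \<open>n2\<close>, \<open>n3\<close>;
  other patterns arise by permuting the generators. The instances of irreducibility and of the
  antichain property collected in \<open>forbidden\<close> were found by computer search; together with the
  signs of the exponents they form an infeasible system of linear integer inequalities.\<close>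

lemma (in four_gens) pattern_0001_false:
  assumes f: "f0 \<in> F" "f1 \<in> F" "f2 \<in> F" "f3 \<in> F"
    and ne: "distinct [f0, f1, f2, f3]"
    and t0: "\<And>f. f \<in> F \<Longrightarrow> f \<noteq> f0 \<Longrightarrow> f0 - f + n0 \<in> S"
    and t1: "\<And>f. f \<in> F \<Longrightarrow> f \<noteq> f0 \<Longrightarrow> f0 - f + n1 \<in> S"
    and t2: "\<And>f. f \<in> F \<Longrightarrow> f \<noteq> f0 \<Longrightarrow> f0 - f + n2 \<in> S"
    and t3: "\<And>f. f \<in> F \<Longrightarrow> f \<noteq> f1 \<Longrightarrow> f1 - f + n3 \<in> S"
  shows False
proof -
  have d01: "f0 - f1 \<notin> S"
    using f ne F_notin F_antichain by auto
  have d02: "f0 - f2 \<notin> S"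
    using f ne F_notin F_antichain by auto
  have d03: "f0 - f3 \<notin> S"
    using f ne F_notin F_antichain by auto
  have d0z: "f0 - 0 \<notin> S"
    using f ne F_notin F_antichain by auto
  have d12: "f1 - f2 \<notin> S"
    using f ne F_notin F_antichain by auto
  have d13: "f1 - f3 \<notin> S"
    using f ne F_notin F_antichain by auto
  have d1z: "f1 - 0 \<notin> S"
    using f ne F_notin F_antichain by auto
  have d21: "f2 - f1 \<notin> S"
    using f ne F_notin F_antichain by auto
  have d23: "f2 - f3 \<notin> S"
    using f ne F_notin F_antichain by auto
  have d2z: "f2 - 0 \<notin> S"
    using f ne F_notin F_antichain by auto
  have d31: "f3 - f1 \<notin> S"
    using f ne F_notin F_antichain by auto
  have d32: "f3 - f2 \<notin> S"
    using f ne F_notin F_antichain by auto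
  have d3z: "f3 - 0 \<notin> S"
    using f ne F_notin F_antichain by auto
  have dz2: "0 - f2 \<notin> S"
    using f ne F_notin F_antichain by auto
  have dz3: "0 - f3 \<notin> S"
    using f ne F_notin F_antichain by auto
  \<comment> \<open>A quadruple \<open>rij\<close> writes \<open>fi + nj\<close> in the other three
    generators: a row of a row-factorization matrix. A quadruple \<open>wij\<close> does the same
    for \<open>f - fj + ni\<close>, where \<open>f\<close> is the element attached to
    \<open>ni\<close>. The letters a to d refer to \<open>n0\<close> to \<open>n3\<close>.\<close>
  obtain r01a r01c r01d where r01: "0 \<le> r01a" "0 \<le> r01c" "0 \<le> r01d" "rel f0 0 (- r01a) 1 (- r01c) (- r01d)"
    using f F_notin[of f0] F_plus[of f0] by (auto intro: edge1[of f0 0])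
  obtain r02a r02b r02d where r02: "0 \<le> r02a" "0 \<le> r02b" "0 \<le> r02d" "rel f0 0 (- r02a) (- r02b) 1 (- r02d)"
    using f F_notin[of f0] F_plus[of f0] by (auto intro: edge2[of f0 0])
  obtain r10b r10c r10d where r10: "0 \<le> r10b" "0 \<le> r10c" "0 \<le> r10d" "rel f1 0 1 (- r10b) (- r10c) (- r10d)"
    using f F_notin[of f1] F_plus[of f1] by (auto intro: edge0[of f1 0])
  obtain r11a r11c r11d where r11: "0 \<le> r11a" "0 \<le> r11c" "0 \<le> r11d" "rel f1 0 (- r11a) 1 (- r11c) (- r11d)"
    using f F_notin[of f1] F_plus[of f1] by (auto intro: edge1[of f1 0])
  obtain r12a r12b r12d where r12: "0 \<le> r12a" "0 \<le> r12b" "0 \<le> r12d" "rel f1 0 (- r12a) (- r12b) 1 (- r12d)"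
    using f F_notin[of f1] F_plus[of f1] by (auto intro: edge2[of f1 0])
  obtain r13a r13b r13c where r13: "0 \<le> r13a" "0 \<le> r13b" "0 \<le> r13c" "rel f1 0 (- r13a) (- r13b) (- r13c) 1"
    using f F_notin[of f1] F_plus[of f1] by (auto intro: edge3[of f1 0])
  obtain r20b r20c r20d where r20: "0 \<le> r20b" "0 \<le> r20c" "0 \<le> r20d" "rel f2 0 1 (- r20b) (- r20c) (- r20d)"
    using f F_notin[of f2] F_plus[of f2] by (auto intro: edge0[of f2 0])
  obtain r21a r21c r21d where r21: "0 \<le> r21a" "0 \<le> r21c" "0 \<le> r21d" "rel f2 0 (- r21a) 1 (- r21c) (- r21d)"
    using f F_notin[of f2] F_plus[of f2] by (auto intro: edge1[of f2 0])
  obtain r22a r22b r22d where r22: "0 \<le> r22a" "0 \<le> r22b" "0 \<le> r22d" "rel f2 0 (- r22a) (- r22b) 1 (- r22d)"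
    using f F_notin[of f2] F_plus[of f2] by (auto intro: edge2[of f2 0])
  obtain r30b r30c r30d where r30: "0 \<le> r30b" "0 \<le> r30c" "0 \<le> r30d" "rel f3 0 1 (- r30b) (- r30c) (- r30d)"
    using f F_notin[of f3] F_plus[of f3] by (auto intro: edge0[of f3 0])
  obtain r31a r31c r31d where r31: "0 \<le> r31a" "0 \<le> r31c" "0 \<le> r31d" "rel f3 0 (- r31a) 1 (- r31c) (- r31d)"
    using f F_notin[of f3] F_plus[of f3] by (auto intro: edge1[of f3 0])
  obtain r32a r32b r32d where r32: "0 \<le> r32a" "0 \<le> r32b" "0 \<le> r32d" "rel f3 0 (- r32a) (- r32b) 1 (- r32d)"
    using f F_notin[of f3] F_plus[of f3] by (auto intro: edge2[of f3 0])
  obtain r33a r33b r33c where r33: "0 \<le> r33a" "0 \<le> r33b" "0 \<le> r33c" "rel f3 0 (- r33a) (- r33b) (- r33c) 1"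
    using f F_notin[of f3] F_plus[of f3] by (auto intro: edge3[of f3 0])
  obtain w01b w01c w01d where w01: "0 \<le> w01b" "0 \<le> w01c" "0 \<le> w01d" "rel f0 f1 1 (- w01b) (- w01c) (- w01d)"
    using f ne t0[of f1] F_antichain[of f0 f1] by (auto intro: edge0[of f0 f1])
  obtain w02b w02c w02d where w02: "0 \<le> w02b" "0 \<le> w02c" "0 \<le> w02d" "rel f0 f2 1 (- w02b) (- w02c) (- w02d)"
    using f ne t0[of f2] F_antichain[of f0 f2] by (auto intro: edge0[of f0 f2])
  obtain w03b w03c w03d where w03: "0 \<le> w03b" "0 \<le> w03c" "0 \<le> w03d" "rel f0 f3 1 (- w03b) (- w03c) (- w03d)"
    using f ne t0[of f3] F_antichain[of f0 f3] by (auto intro: edge0[of f0 f3])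
  obtain w11a w11c w11d where w11: "0 \<le> w11a" "0 \<le> w11c" "0 \<le> w11d" "rel f0 f1 (- w11a) 1 (- w11c) (- w11d)"
    using f ne t1[of f1] F_antichain[of f0 f1] by (auto intro: edge1[of f0 f1])
  obtain w12a w12c w12d where w12: "0 \<le> w12a" "0 \<le> w12c" "0 \<le> w12d" "rel f0 f2 (- w12a) 1 (- w12c) (- w12d)"
    using f ne t1[of f2] F_antichain[of f0 f2] by (auto intro: edge1[of f0 f2])
  obtain w13a w13c w13d where w13: "0 \<le> w13a" "0 \<le> w13c" "0 \<le> w13d" "rel f0 f3 (- w13a) 1 (- w13c) (- w13d)"
    using f ne t1[of f3] F_antichain[of f0 f3] by (auto intro: edge1[of f0 f3])
  obtain w21a w21b w21d where w21: "0 \<le> w21a" "0 \<le> w21b" "0 \<le> w21d" "rel f0 f1 (- w21a) (- w21b) 1 (- w21d)"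
    using f ne t2[of f1] F_antichain[of f0 f1] by (auto intro: edge2[of f0 f1])
  obtain w22a w22b w22d where w22: "0 \<le> w22a" "0 \<le> w22b" "0 \<le> w22d" "rel f0 f2 (- w22a) (- w22b) 1 (- w22d)"
    using f ne t2[of f2] F_antichain[of f0 f2] by (auto intro: edge2[of f0 f2])
  obtain w23a w23b w23d where w23: "0 \<le> w23a" "0 \<le> w23b" "0 \<le> w23d" "rel f0 f3 (- w23a) (- w23b) 1 (- w23d)"
    using f ne t2[of f3] F_antichain[of f0 f3] by (auto intro: edge2[of f0 f3])
  obtain w30a w30b w30c where w30: "0 \<le> w30a" "0 \<le> w30b" "0 \<le> w30c" "rel f1 f0 (- w30a) (- w30b) (- w30c) 1"
    using f ne t3[of f0] F_antichain[of f1 f0] by (auto intro: edge3[of f1 f0])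
  obtain w32a w32b w32c where w32: "0 \<le> w32a" "0 \<le> w32b" "0 \<le> w32c" "rel f1 f2 (- w32a) (- w32b) (- w32c) 1"
    using f ne t3[of f2] F_antichain[of f1 f2] by (auto intro: edge3[of f1 f2])
  obtain w33a w33b w33c where w33: "0 \<le> w33a" "0 \<le> w33b" "0 \<le> w33c" "rel f1 f3 (- w33a) (- w33b) (- w33c) 1"
    using f ne t3[of f3] F_antichain[of f1 f3] by (auto intro: edge3[of f1 f3])
  note forbidden =
      lt[OF tr[OF sy[OF w02(4)] w01(4)] d12]
      gt[OF tr[OF sy[OF w03(4)] w01(4)] d31]
      lt[OF tr[OF sy[OF w03(4)] w01(4)] d13]
      irr1[OF tr[OF w01(4) sy[OF w11(4)]]]
      pos[OF sy[OF tr[OF w01(4) w30(4)]]]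
      irr3[OF sy[OF tr[OF w01(4) w30(4)]]]
      gt[OF tr[OF sy[OF w03(4)] w02(4)] d32]
      irr0[OF sy[OF tr[OF w02(4) sy[OF w12(4)]]]]
      irr1[OF tr[OF w02(4) sy[OF w12(4)]]]
      irr0[OF sy[OF tr[OF w03(4) sy[OF w13(4)]]]]
      irr0[OF sy[OF tr[OF w03(4) sy[OF w23(4)]]]]
      irr2[OF tr[OF w03(4) sy[OF w23(4)]]]
      lt[OF tr[OF sy[OF w12(4)] w11(4)] d12]
      gt[OF tr[OF sy[OF w13(4)] w11(4)] d31]
      lt[OF tr[OF sy[OF w13(4)] w11(4)] d13]
      irr2[OF tr[OF w11(4) sy[OF w21(4)]]]
      pos[OF sy[OF tr[OF w11(4) w30(4)]]]
      irr3[OF sy[OF tr[OF w11(4) w30(4)]]]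
      gt[OF tr[OF w02(4) r22(4)] d0z]
      gt[OF tr[OF w03(4) r32(4)] d0z]
      gt[OF tr[OF w03(4) r33(4)] d0z]
      gt[OF tr[OF w11(4) w33(4)] d03]
      lt[OF tr[OF sy[OF r01(4)] w11(4)] d1z]
      gt[OF tr[OF w11(4) r13(4)] d0z]
      gt[OF tr[OF sy[OF w33(4)] w32(4)] d32]
      lt[OF tr[OF sy[OF w33(4)] w32(4)] d23]
      gt[OF tr[OF sy[OF r13(4)] w32(4)] dz2]
      lt[OF tr[OF sy[OF r13(4)] w32(4)] d2z]
      gt[OF tr[OF w03(4) r31(4)] d0z]
      gt[OF tr[OF w12(4) r20(4)] d0z]
      gt[OF tr[OF w13(4) r32(4)] d0z]
      gt[OF tr[OF sy[OF w22(4)] w21(4)] d21]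
      lt[OF tr[OF sy[OF w22(4)] w21(4)] d12]
      gt[OF tr[OF sy[OF w23(4)] w21(4)] d31]
      lt[OF tr[OF sy[OF w23(4)] w21(4)] d13]
      gt[OF tr[OF w12(4) r22(4)] d0z]
      gt[OF tr[OF w22(4) r21(4)] d0z]
      gt[OF tr[OF w23(4) r30(4)] d0z]
      gt[OF tr[OF w23(4) r31(4)] d0z]
      gt[OF tr[OF w32(4) r22(4)] d1z]
      gt[OF tr[OF w01(4) r11(4)] d0z]
      gt[OF tr[OF w21(4) r10(4)] d0z]
      gt[OF tr[OF w22(4) r20(4)] d0z]
      gt[OF tr[OF w32(4) r20(4)] d1z]
      gt[OF tr[OF w33(4) r32(4)] d1z]
      gt[OF tr[OF r02(4) sy[OF r22(4)]] d02]
      gt[OF tr[OF r02(4) sy[OF r12(4)]] d01]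
      gt[OF tr[OF r10(4) sy[OF r30(4)]] d13]
      lt[OF tr[OF r10(4) sy[OF r30(4)]] d31]
      gt[OF tr[OF r11(4) sy[OF r31(4)]] d13]
      lt[OF tr[OF r11(4) sy[OF r31(4)]] d31]
      gt[OF tr[OF r12(4) sy[OF r22(4)]] d12]
      lt[OF tr[OF r12(4) sy[OF r22(4)]] d21]
      gt[OF tr[OF r21(4) sy[OF r31(4)]] d23]
      lt[OF tr[OF r21(4) sy[OF r31(4)]] d32]
      gt[OF tr[OF w01(4) r12(4)] d0z]
      gt[OF tr[OF w13(4) r30(4)] d0z]
      gt[OF tr[OF w13(4) r33(4)] d0z]
      pos[OF sy[OF tr[OF w21(4) w30(4)]]]
      irr2[OF sy[OF tr[OF w21(4) w30(4)]]]
      irr3[OF sy[OF tr[OF w21(4) w30(4)]]]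
      gt[OF tr[OF w21(4) w33(4)] d03]
      gt[OF tr[OF w21(4) r13(4)] d0z]
      gt[OF tr[OF w02(4) r21(4)] d0z]
      gt[OF tr[OF w11(4) r10(4)] d0z]
      gt[OF tr[OF w11(4) r12(4)] d0z]
      gt[OF tr[OF w32(4) r21(4)] d1z]
      gt[OF tr[OF w33(4) r31(4)] d1z]
      gt[OF tr[OF r01(4) sy[OF r11(4)]] d01]
      gt[OF tr[OF w01(4) w33(4)] d03]
      gt[OF tr[OF r01(4) sy[OF r21(4)]] d02]
      gt[OF tr[OF r01(4) sy[OF r31(4)]] d03]
      gt[OF tr[OF r11(4) sy[OF r21(4)]] d12]
      lt[OF tr[OF r11(4) sy[OF r21(4)]] d21]
      gt[OF tr[OF r22(4) sy[OF r32(4)]] d23]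
      lt[OF tr[OF r22(4) sy[OF r32(4)]] d32]
      lt[OF tr[OF sy[OF w32(4)] w30(4)] d02]
      gt[OF tr[OF r12(4) sy[OF r32(4)]] d13]
      lt[OF tr[OF r12(4) sy[OF r32(4)]] d31]
      irr0[OF sy[OF tr[OF r20(4) sy[OF r22(4)]]]]
      irr2[OF tr[OF r20(4) sy[OF r22(4)]]]
      lt[OF tr[OF tr[OF sy[OF r21(4)] sy[OF w02(4)]] w01(4)] d1z]
      lt[OF tr[OF tr[OF sy[OF r32(4)] sy[OF w03(4)]] w01(4)] d1z]
      lt[OF tr[OF tr[OF sy[OF r20(4)] sy[OF w12(4)]] w01(4)] d1z]
      gt[OF tr[OF r10(4) sy[OF r20(4)]] d12]
      lt[OF tr[OF r10(4) sy[OF r20(4)]] d21]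
      irr0[OF sy[OF tr[OF r20(4) sy[OF r21(4)]]]]
      irr1[OF tr[OF r20(4) sy[OF r21(4)]]]
      gt[OF tr[OF r20(4) sy[OF r30(4)]] d23]
      lt[OF tr[OF r20(4) sy[OF r30(4)]] d32]
      lt[OF tr[OF tr[OF sy[OF r30(4)] sy[OF w23(4)]] w01(4)] d1z]
      pos[OF sy[OF tr[OF tr[OF w01(4) r12(4)] sy[OF r02(4)]]]]
      gt[OF tr[OF tr[OF w01(4) r11(4)] sy[OF r21(4)]] d02]
      gt[OF tr[OF tr[OF w01(4) r12(4)] sy[OF r32(4)]] d03]
      gt[OF tr[OF w30(4) r02(4)] d1z]
      gt[OF cy[OF w01(4) tr[OF sy[OF w02(4)] w22(4)]] d01]
      gt[OF tr[OF tr[OF sy[OF w02(4)] w01(4)] r12(4)] d2z]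
      gt[OF tr[OF tr[OF w01(4) w32(4)] r21(4)] d0z]
      gt[OF tr[OF tr[OF w01(4) w32(4)] r22(4)] d0z]
      lt[OF tr[OF tr[OF sy[OF r22(4)] sy[OF w02(4)]] w01(4)] d1z]
      lt[OF tr[OF tr[OF sy[OF r20(4)] sy[OF w22(4)]] w01(4)] d1z]
      gt[OF tr[OF tr[OF sy[OF w13(4)] w02(4)] r21(4)] d3z]
      gt[OF tr[OF tr[OF sy[OF w02(4)] w01(4)] r11(4)] d2z]
      lt[OF tr[OF tr[OF sy[OF w23(4)] w01(4)] sy[OF w11(4)]] d03]
      lt[OF cy[OF sy[OF r22(4)] tr[OF w01(4) sy[OF w11(4)]]] d2z]
      gt[OF tr[OF tr[OF w01(4) sy[OF w21(4)]] w12(4)] d02]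
      lt[OF tr[OF tr[OF sy[OF r30(4)] sy[OF w13(4)]] w01(4)] d1z]
      gt[OF tr[OF tr[OF w01(4) w33(4)] r31(4)] d0z]
      gt[OF tr[OF tr[OF w01(4) w33(4)] r32(4)] d0z]
      irr1[OF sy[OF tr[OF w13(4) sy[OF w23(4)]]]]
      irr2[OF tr[OF w13(4) sy[OF w23(4)]]]
      lt[OF tr[OF tr[OF sy[OF r32(4)] sy[OF w03(4)]] w02(4)] d2z]
      lt[OF tr[OF tr[OF sy[OF r10(4)] sy[OF w21(4)]] w02(4)] d2z]
      lt[OF tr[OF tr[OF sy[OF r31(4)] sy[OF w03(4)]] w02(4)] d2z]
      gt[OF tr[OF tr[OF sy[OF w11(4)] w03(4)] r31(4)] d1z]
      lt[OF tr[OF tr[OF sy[OF r20(4)] sy[OF w12(4)]] w03(4)] d3z]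
      gt[OF tr[OF tr[OF sy[OF w12(4)] w03(4)] r31(4)] d2z]
      lt[OF tr[OF tr[OF sy[OF r20(4)] sy[OF w22(4)]] w03(4)] d3z]
      gt[OF tr[OF tr[OF sy[OF w22(4)] w03(4)] r32(4)] d2z]
      gt[OF tr[OF tr[OF w01(4) sy[OF w11(4)]] w23(4)] d03]
      gt[OF tr[OF tr[OF sy[OF w23(4)] w12(4)] r22(4)] d3z]
      lt[OF tr[OF tr[OF sy[OF r31(4)] sy[OF w23(4)]] w12(4)] d2z]
      lt[OF cy[OF sy[OF r21(4)] tr[OF w01(4) sy[OF w21(4)]]] d2z]
      gt[OF tr[OF tr[OF sy[OF w03(4)] w01(4)] r11(4)] d3z]
      lt[OF tr[OF tr[OF sy[OF r31(4)] sy[OF w03(4)]] w01(4)] d1z]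
      pos[OF sy[OF tr[OF tr[OF w02(4) r21(4)] sy[OF r01(4)]]]]
      gt[OF tr[OF tr[OF w03(4) sy[OF w23(4)]] w11(4)] d01]
      gt[OF tr[OF tr[OF sy[OF w23(4)] w01(4)] r12(4)] d3z]
      lt[OF tr[OF tr[OF sy[OF w23(4)] w01(4)] r12(4)] dz3]
      gt[OF tr[OF tr[OF sy[OF w11(4)] w02(4)] r21(4)] d1z]
      lt[OF tr[OF tr[OF sy[OF w13(4)] w02(4)] sy[OF w22(4)]] d03]
      lt[OF tr[OF tr[OF sy[OF r30(4)] sy[OF w13(4)]] w02(4)] d2z]
      gt[OF tr[OF tr[OF w02(4) r21(4)] sy[OF r31(4)]] d03]
      gt[OF cy[OF w03(4) tr[OF w12(4) sy[OF w22(4)]]] d03]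
      irr3[OF sy[OF tr[OF tr[OF w01(4) w32(4)] sy[OF w02(4)]]]]
      gt[OF cy[OF w02(4) tr[OF sy[OF w13(4)] w23(4)]] d02]
      irr0[OF sy[OF tr[OF tr[OF w02(4) sy[OF w32(4)]] w30(4)]]]
      gt[OF cy[OF w01(4) tr[OF sy[OF w03(4)] w13(4)]] d01]
      gt[OF cy[OF w02(4) tr[OF sy[OF r11(4)] r13(4)]] d02]
      gt[OF cy[OF w01(4) tr[OF w13(4) sy[OF w23(4)]]] d01]
      gt[OF tr[OF tr[OF w01(4) w30(4)] w13(4)] d03]
      gt[OF cy[OF w02(4) tr[OF w11(4) sy[OF w21(4)]]] d02]
      lt[OF cy[OF sy[OF r32(4)] tr[OF w02(4) sy[OF w12(4)]]] d3z]
      gt[OF cy[OF w02(4) tr[OF sy[OF r12(4)] r13(4)]] d02]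
      gt[OF tr[OF tr[OF sy[OF w21(4)] w01(4)] r12(4)] d1z]
      gt[OF tr[OF tr[OF w30(4) w03(4)] r32(4)] d1z]
      pos[OF sy[OF tr[OF tr[OF w03(4) r31(4)] sy[OF r01(4)]]]]
      gt[OF cy[OF r22(4) tr[OF w11(4) sy[OF w21(4)]]] d2z]
      gt[OF cy[OF r32(4) tr[OF w11(4) sy[OF w21(4)]]] d3z]
      gt[OF tr[OF tr[OF w11(4) w32(4)] r22(4)] d0z]
      irr1[OF sy[OF tr[OF r31(4) sy[OF r33(4)]]]]
      irr3[OF tr[OF r31(4) sy[OF r33(4)]]]
      gt[OF cy[OF w01(4) tr[OF sy[OF r21(4)] r22(4)]] d01]
      gt[OF tr[OF tr[OF w02(4) r22(4)] sy[OF r12(4)]] d01]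
      lt[OF cy[OF sy[OF r11(4)] tr[OF w11(4) sy[OF w21(4)]]] d1z]
      lt[OF tr[OF tr[OF sy[OF r21(4)] sy[OF w22(4)]] w11(4)] d1z]
      lt[OF tr[OF tr[OF sy[OF r30(4)] sy[OF w13(4)]] w11(4)] d1z]
      gt[OF tr[OF tr[OF sy[OF w23(4)] w11(4)] r12(4)] d3z]
      lt[OF tr[OF tr[OF sy[OF w23(4)] w11(4)] r12(4)] dz3]
      lt[OF tr[OF tr[OF sy[OF r31(4)] sy[OF w23(4)]] w11(4)] d1z]
      gt[OF tr[OF tr[OF w11(4) w33(4)] r32(4)] d0z]
      lt[OF tr[OF tr[OF sy[OF w23(4)] w02(4)] sy[OF w12(4)]] d03]
      gt[OF tr[OF tr[OF sy[OF w21(4)] w11(4)] r12(4)] d1z]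
      irr3[OF sy[OF tr[OF tr[OF w11(4) w32(4)] sy[OF w22(4)]]]]
      gt[OF tr[OF tr[OF sy[OF w22(4)] w02(4)] r22(4)] d2z]
      gt[OF tr[OF tr[OF w30(4) w02(4)] r22(4)] d1z]
      gt[OF tr[OF tr[OF w02(4) r22(4)] sy[OF r32(4)]] d03]
  \<comment> \<open>Only the signs of the exponents and the collected instances are handed over; the
    vectors have disappeared.\<close>
  show False
    using r01(1-3) r02(1-3) r10(1-3) r11(1-3) r12(1-3) r13(1-3) r20(1-3) r21(1-3) r22(1-3) r30(1-3) r31(1-3) r32(1-3) r33(1-3) w01(1-3) w02(1-3) w03(1-3) w11(1-3) w12(1-3) w13(1-3) w21(1-3) w22(1-3) w23(1-3) w30(1-3) w32(1-3) w33(1-3) forbidden[simplified]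
    by (smt (z3))
qed

text \<open>Here \<open>f2\<close> and \<open>f3\<close> are attached to no generator. They occur as
  end points of edges from \<open>f0\<close> and \<open>f1\<close>, and through their own rows
  towards 0.\<close>

lemma (in four_gens) pattern_0011_false:
  assumes f: "f0 \<in> F" "f1 \<in> F" "f2 \<in> F" "f3 \<in> F"
    and ne: "distinct [f0, f1, f2, f3]"
    and t0: "\<And>f. f \<in> F \<Longrightarrow> f \<noteq> f0 \<Longrightarrow> f0 - f + n0 \<in> S"
    and t1: "\<And>f. f \<in> F \<Longrightarrow> f \<noteq> f0 \<Longrightarrow> f0 - f + n1 \<in> S"
    and t2: "\<And>f. f \<in> F \<Longrightarrow> f \<noteq> f1 \<Longrightarrow> f1 - f + n2 \<in> S"
    and t3: "\<And>f. f \<in> F \<Longrightarrow> f \<noteq> f1 \<Longrightarrow> f1 - f + n3 \<in> S"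
  shows False
proof -
  have d02: "f0 - f2 \<notin> S"
    using f ne F_notin F_antichain by auto
  have d03: "f0 - f3 \<notin> S"
    using f ne F_notin F_antichain by auto
  have d0z: "f0 - 0 \<notin> S"
    using f ne F_notin F_antichain by auto
  have d12: "f1 - f2 \<notin> S"
    using f ne F_notin F_antichain by auto
  have d13: "f1 - f3 \<notin> S"
    using f ne F_notin F_antichain by auto
  have d1z: "f1 - 0 \<notin> S"
    using f ne F_notin F_antichain by auto
  have d20: "f2 - f0 \<notin> S"
    using f ne F_notin F_antichain by auto
  have d21: "f2 - f1 \<notin> S"
    using f ne F_notin F_antichain by auto
  have d23: "f2 - f3 \<notin> S"
    using f ne F_notin F_antichain by auto
  have d2z: "f2 - 0 \<notin> S"
    using f ne F_notin F_antichain by auto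
  have d30: "f3 - f0 \<notin> S"
    using f ne F_notin F_antichain by auto
  have d32: "f3 - f2 \<notin> S"
    using f ne F_notin F_antichain by auto
  have d3z: "f3 - 0 \<notin> S"
    using f ne F_notin F_antichain by auto
  have dz2: "0 - f2 \<notin> S"
    using f ne F_notin F_antichain by auto
  have dz3: "0 - f3 \<notin> S"
    using f ne F_notin F_antichain by auto
  obtain r00b r00c r00d where r00: "0 \<le> r00b" "0 \<le> r00c" "0 \<le> r00d" "rel f0 0 1 (- r00b) (- r00c) (- r00d)"
    using f F_notin[of f0] F_plus[of f0] by (auto intro: edge0[of f0 0])
  obtain r01a r01c r01d where r01: "0 \<le> r01a" "0 \<le> r01c" "0 \<le> r01d" "rel f0 0 (- r01a) 1 (- r01c) (- r01d)"
    using f F_notin[of f0] F_plus[of f0] by (auto intro: edge1[of f0 0])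
  obtain r12a r12b r12d where r12: "0 \<le> r12a" "0 \<le> r12b" "0 \<le> r12d" "rel f1 0 (- r12a) (- r12b) 1 (- r12d)"
    using f F_notin[of f1] F_plus[of f1] by (auto intro: edge2[of f1 0])
  obtain r13a r13b r13c where r13: "0 \<le> r13a" "0 \<le> r13b" "0 \<le> r13c" "rel f1 0 (- r13a) (- r13b) (- r13c) 1"
    using f F_notin[of f1] F_plus[of f1] by (auto intro: edge3[of f1 0])
  obtain r20b r20c r20d where r20: "0 \<le> r20b" "0 \<le> r20c" "0 \<le> r20d" "rel f2 0 1 (- r20b) (- r20c) (- r20d)"
    using f F_notin[of f2] F_plus[of f2] by (auto intro: edge0[of f2 0])
  obtain r21a r21c r21d where r21: "0 \<le> r21a" "0 \<le> r21c" "0 \<le> r21d" "rel f2 0 (- r21a) 1 (- r21c) (- r21d)"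
    using f F_notin[of f2] F_plus[of f2] by (auto intro: edge1[of f2 0])
  obtain r22a r22b r22d where r22: "0 \<le> r22a" "0 \<le> r22b" "0 \<le> r22d" "rel f2 0 (- r22a) (- r22b) 1 (- r22d)"
    using f F_notin[of f2] F_plus[of f2] by (auto intro: edge2[of f2 0])
  obtain r23a r23b r23c where r23: "0 \<le> r23a" "0 \<le> r23b" "0 \<le> r23c" "rel f2 0 (- r23a) (- r23b) (- r23c) 1"
    using f F_notin[of f2] F_plus[of f2] by (auto intro: edge3[of f2 0])
  obtain r30b r30c r30d where r30: "0 \<le> r30b" "0 \<le> r30c" "0 \<le> r30d" "rel f3 0 1 (- r30b) (- r30c) (- r30d)"
    using f F_notin[of f3] F_plus[of f3] by (auto intro: edge0[of f3 0])
  obtain r31a r31c r31d where r31: "0 \<le> r31a" "0 \<le> r31c" "0 \<le> r31d" "rel f3 0 (- r31a) 1 (- r31c) (- r31d)"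
    using f F_notin[of f3] F_plus[of f3] by (auto intro: edge1[of f3 0])
  obtain r32a r32b r32d where r32: "0 \<le> r32a" "0 \<le> r32b" "0 \<le> r32d" "rel f3 0 (- r32a) (- r32b) 1 (- r32d)"
    using f F_notin[of f3] F_plus[of f3] by (auto intro: edge2[of f3 0])
  obtain r33a r33b r33c where r33: "0 \<le> r33a" "0 \<le> r33b" "0 \<le> r33c" "rel f3 0 (- r33a) (- r33b) (- r33c) 1"
    using f F_notin[of f3] F_plus[of f3] by (auto intro: edge3[of f3 0])
  obtain w01b w01c w01d where w01: "0 \<le> w01b" "0 \<le> w01c" "0 \<le> w01d" "rel f0 f1 1 (- w01b) (- w01c) (- w01d)"
    using f ne t0[of f1] F_antichain[of f0 f1] by (auto intro: edge0[of f0 f1])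
  obtain w02b w02c w02d where w02: "0 \<le> w02b" "0 \<le> w02c" "0 \<le> w02d" "rel f0 f2 1 (- w02b) (- w02c) (- w02d)"
    using f ne t0[of f2] F_antichain[of f0 f2] by (auto intro: edge0[of f0 f2])
  obtain w03b w03c w03d where w03: "0 \<le> w03b" "0 \<le> w03c" "0 \<le> w03d" "rel f0 f3 1 (- w03b) (- w03c) (- w03d)"
    using f ne t0[of f3] F_antichain[of f0 f3] by (auto intro: edge0[of f0 f3])
  obtain w11a w11c w11d where w11: "0 \<le> w11a" "0 \<le> w11c" "0 \<le> w11d" "rel f0 f1 (- w11a) 1 (- w11c) (- w11d)"
    using f ne t1[of f1] F_antichain[of f0 f1] by (auto intro: edge1[of f0 f1])
  obtain w12a w12c w12d where w12: "0 \<le> w12a" "0 \<le> w12c" "0 \<le> w12d" "rel f0 f2 (- w12a) 1 (- w12c) (- w12d)"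
    using f ne t1[of f2] F_antichain[of f0 f2] by (auto intro: edge1[of f0 f2])
  obtain w13a w13c w13d where w13: "0 \<le> w13a" "0 \<le> w13c" "0 \<le> w13d" "rel f0 f3 (- w13a) 1 (- w13c) (- w13d)"
    using f ne t1[of f3] F_antichain[of f0 f3] by (auto intro: edge1[of f0 f3])
  obtain w20a w20b w20d where w20: "0 \<le> w20a" "0 \<le> w20b" "0 \<le> w20d" "rel f1 f0 (- w20a) (- w20b) 1 (- w20d)"
    using f ne t2[of f0] F_antichain[of f1 f0] by (auto intro: edge2[of f1 f0])
  obtain w22a w22b w22d where w22: "0 \<le> w22a" "0 \<le> w22b" "0 \<le> w22d" "rel f1 f2 (- w22a) (- w22b) 1 (- w22d)"
    using f ne t2[of f2] F_antichain[of f1 f2] by (auto intro: edge2[of f1 f2])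
  obtain w23a w23b w23d where w23: "0 \<le> w23a" "0 \<le> w23b" "0 \<le> w23d" "rel f1 f3 (- w23a) (- w23b) 1 (- w23d)"
    using f ne t2[of f3] F_antichain[of f1 f3] by (auto intro: edge2[of f1 f3])
  obtain w30a w30b w30c where w30: "0 \<le> w30a" "0 \<le> w30b" "0 \<le> w30c" "rel f1 f0 (- w30a) (- w30b) (- w30c) 1"
    using f ne t3[of f0] F_antichain[of f1 f0] by (auto intro: edge3[of f1 f0])
  obtain w32a w32b w32c where w32: "0 \<le> w32a" "0 \<le> w32b" "0 \<le> w32c" "rel f1 f2 (- w32a) (- w32b) (- w32c) 1"
    using f ne t3[of f2] F_antichain[of f1 f2] by (auto intro: edge3[of f1 f2])
  obtain w33a w33b w33c where w33: "0 \<le> w33a" "0 \<le> w33b" "0 \<le> w33c" "rel f1 f3 (- w33a) (- w33b) (- w33c) 1"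
    using f ne t3[of f3] F_antichain[of f1 f3] by (auto intro: edge3[of f1 f3])
  note forbidden =
      lt[OF w12(4) d20]
      lt[OF tr[OF sy[OF w02(4)] w01(4)] d12]
      lt[OF tr[OF sy[OF w03(4)] w01(4)] d13]
      pos[OF sy[OF tr[OF w01(4) w30(4)]]]
      irr0[OF sy[OF tr[OF w01(4) w30(4)]]]
      irr3[OF sy[OF tr[OF w01(4) w30(4)]]]
      lt[OF tr[OF sy[OF r00(4)] w01(4)] d1z]
      gt[OF tr[OF sy[OF w03(4)] w02(4)] d32]
      lt[OF tr[OF sy[OF r00(4)] w02(4)] d2z]
      gt[OF tr[OF w02(4) r22(4)] d0z]
      gt[OF tr[OF sy[OF r00(4)] w03(4)] dz3]
      lt[OF tr[OF sy[OF r00(4)] w03(4)] d3z]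
      lt[OF tr[OF sy[OF w12(4)] w11(4)] d12]
      pos[OF sy[OF tr[OF w11(4) w30(4)]]]
      irr3[OF sy[OF tr[OF w11(4) w30(4)]]]
      lt[OF tr[OF sy[OF r01(4)] w11(4)] d1z]
      pos[OF sy[OF tr[OF w01(4) w20(4)]]]
      irr0[OF sy[OF tr[OF w01(4) w20(4)]]]
      irr2[OF sy[OF tr[OF w01(4) w20(4)]]]
      pos[OF sy[OF tr[OF w11(4) w20(4)]]]
      irr2[OF sy[OF tr[OF w11(4) w20(4)]]]
      gt[OF tr[OF sy[OF r01(4)] w13(4)] dz3]
      lt[OF tr[OF sy[OF r01(4)] w13(4)] d3z]
      gt[OF tr[OF sy[OF w22(4)] w20(4)] d20]
      lt[OF tr[OF sy[OF w22(4)] w20(4)] d02]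
      gt[OF tr[OF sy[OF w23(4)] w20(4)] d30]
      lt[OF tr[OF sy[OF w23(4)] w20(4)] d03]
      gt[OF tr[OF w03(4) r31(4)] d0z]
      gt[OF tr[OF w03(4) r33(4)] d0z]
      gt[OF tr[OF w12(4) r20(4)] d0z]
      gt[OF tr[OF w12(4) r22(4)] d0z]
      gt[OF tr[OF sy[OF r12(4)] w22(4)] dz2]
      lt[OF tr[OF sy[OF r12(4)] w22(4)] d2z]
      gt[OF tr[OF w22(4) r21(4)] d1z]
      gt[OF tr[OF w22(4) r23(4)] d1z]
      gt[OF tr[OF sy[OF r12(4)] w23(4)] dz3]
      lt[OF tr[OF sy[OF r12(4)] w23(4)] d3z]
      gt[OF tr[OF w23(4) r33(4)] d1z]
      gt[OF tr[OF sy[OF w33(4)] w32(4)] d32]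
      lt[OF tr[OF sy[OF w33(4)] w32(4)] d23]
      gt[OF tr[OF sy[OF r13(4)] w32(4)] dz2]
      lt[OF tr[OF sy[OF r13(4)] w32(4)] d2z]
      gt[OF tr[OF w13(4) r30(4)] d0z]
      gt[OF tr[OF w23(4) r31(4)] d1z]
      gt[OF tr[OF sy[OF w33(4)] w30(4)] d30]
      lt[OF tr[OF sy[OF w33(4)] w30(4)] d03]
      lt[OF tr[OF sy[OF r13(4)] w30(4)] d0z]
      gt[OF tr[OF w32(4) r20(4)] d1z]
      gt[OF tr[OF w32(4) r21(4)] d1z]
      lt[OF tr[OF sy[OF r12(4)] w20(4)] d0z]
      gt[OF tr[OF w32(4) r22(4)] d1z]
      gt[OF tr[OF sy[OF r13(4)] w33(4)] dz3]
      lt[OF tr[OF sy[OF r13(4)] w33(4)] d3z]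
      gt[OF tr[OF w33(4) r30(4)] d1z]
      gt[OF tr[OF w33(4) r31(4)] d1z]
      gt[OF tr[OF w12(4) r23(4)] d0z]
      gt[OF tr[OF r20(4) sy[OF r30(4)]] d23]
      lt[OF tr[OF r20(4) sy[OF r30(4)]] d32]
      lt[OF tr[OF sy[OF w13(4)] w11(4)] d13]
      gt[OF tr[OF r22(4) sy[OF r32(4)]] d23]
      lt[OF tr[OF r22(4) sy[OF r32(4)]] d32]
      gt[OF tr[OF tr[OF w01(4) w22(4)] r21(4)] d0z]
      gt[OF tr[OF tr[OF w01(4) w23(4)] r33(4)] d0z]
      gt[OF tr[OF w03(4) r32(4)] d0z]
      gt[OF tr[OF w23(4) r30(4)] d1z]
      gt[OF tr[OF sy[OF w32(4)] w30(4)] d20]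
      lt[OF tr[OF sy[OF w32(4)] w30(4)] d02]
      gt[OF tr[OF r21(4) sy[OF r31(4)]] d23]
      lt[OF tr[OF r21(4) sy[OF r31(4)]] d32]
      gt[OF tr[OF w22(4) r20(4)] d1z]
      gt[OF tr[OF w33(4) r32(4)] d1z]
      gt[OF tr[OF r23(4) sy[OF r33(4)]] d23]
      lt[OF tr[OF r23(4) sy[OF r33(4)]] d32]
      lt[OF tr[OF tr[OF sy[OF r33(4)] sy[OF w03(4)]] w01(4)] d1z]
      gt[OF tr[OF tr[OF w20(4) w01(4)] r13(4)] d1z]
      gt[OF tr[OF tr[OF w01(4) w23(4)] r31(4)] d0z]
      gt[OF tr[OF r01(4) sy[OF r21(4)]] d02]
      lt[OF tr[OF tr[OF sy[OF r22(4)] sy[OF w02(4)]] w01(4)] d1z]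
      lt[OF tr[OF tr[OF sy[OF r31(4)] sy[OF w03(4)]] w01(4)] d1z]
      gt[OF tr[OF tr[OF w01(4) w32(4)] r21(4)] d0z]
      gt[OF tr[OF tr[OF w01(4) w22(4)] r23(4)] d0z]
      lt[OF tr[OF tr[OF sy[OF r32(4)] sy[OF w03(4)]] w02(4)] d2z]
      gt[OF tr[OF tr[OF w20(4) w02(4)] r23(4)] d1z]
      gt[OF tr[OF tr[OF w20(4) w11(4)] r13(4)] d1z]
      lt[OF tr[OF tr[OF sy[OF r31(4)] sy[OF w03(4)]] w02(4)] d2z]
      lt[OF tr[OF tr[OF sy[OF r33(4)] sy[OF w03(4)]] w02(4)] d2z]
      irr3[OF sy[OF tr[OF tr[OF w03(4) r33(4)] sy[OF r00(4)]]]]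
      gt[OF tr[OF tr[OF r21(4) sy[OF r01(4)]] w01(4)] d21]
      gt[OF tr[OF tr[OF w01(4) w20(4)] r01(4)] d0z]
      gt[OF tr[OF tr[OF w30(4) w01(4)] r12(4)] d1z]
      gt[OF tr[OF tr[OF w01(4) w33(4)] r31(4)] d0z]
      irr0[OF sy[OF tr[OF r20(4) sy[OF r21(4)]]]]
      irr1[OF tr[OF r20(4) sy[OF r21(4)]]]
      gt[OF tr[OF tr[OF w02(4) r23(4)] sy[OF r33(4)]] d03]
      gt[OF tr[OF tr[OF w02(4) r22(4)] sy[OF r32(4)]] d03]
      lt[OF tr[OF tr[OF sy[OF r33(4)] sy[OF w13(4)]] w12(4)] d2z]
      gt[OF tr[OF tr[OF w12(4) r23(4)] sy[OF r33(4)]] d03]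
      gt[OF tr[OF tr[OF sy[OF w03(4)] w02(4)] r22(4)] d3z]
      gt[OF tr[OF tr[OF w03(4) r32(4)] sy[OF r22(4)]] d02]
      gt[OF cy[OF w02(4) tr[OF sy[OF r31(4)] r33(4)]] d02]
      gt[OF tr[OF tr[OF sy[OF r00(4)] w01(4)] w22(4)] dz2]
      lt[OF tr[OF tr[OF sy[OF r00(4)] w01(4)] w22(4)] d2z]
      gt[OF tr[OF tr[OF w11(4) w30(4)] r00(4)] d0z]
      gt[OF tr[OF tr[OF w11(4) w33(4)] r30(4)] d0z]
      gt[OF tr[OF tr[OF w11(4) w22(4)] r23(4)] d0z]
      lt[OF tr[OF tr[OF sy[OF r30(4)] sy[OF w13(4)]] w11(4)] d1z]
      gt[OF tr[OF tr[OF w11(4) w23(4)] r33(4)] d0z]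
      gt[OF tr[OF tr[OF w11(4) w33(4)] r32(4)] d0z]
  show False
    using r00(1-3) r01(1-3) r12(1-3) r13(1-3) r20(1-3) r21(1-3) r22(1-3) r23(1-3) r30(1-3) r31(1-3) r32(1-3) r33(1-3) w01(1-3) w02(1-3) w03(1-3) w11(1-3) w12(1-3) w13(1-3) w20(1-3) w22(1-3) w23(1-3) w30(1-3) w32(1-3) w33(1-3) forbidden[simplified]
    by (smt (z3))
qed

text \<open>Only \<open>f3\<close> is attached to no generator; it stands for any further element of
  \<open>F\<close>.\<close>

lemma (in four_gens) pattern_0012_false:
  assumes f: "f0 \<in> F" "f1 \<in> F" "f2 \<in> F" "f3 \<in> F"
    and ne: "distinct [f0, f1, f2, f3]"
    and t0: "\<And>f. f \<in> F \<Longrightarrow> f \<noteq> f0 \<Longrightarrow> f0 - f + n0 \<in> S"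
    and t1: "\<And>f. f \<in> F \<Longrightarrow> f \<noteq> f0 \<Longrightarrow> f0 - f + n1 \<in> S"
    and t2: "\<And>f. f \<in> F \<Longrightarrow> f \<noteq> f1 \<Longrightarrow> f1 - f + n2 \<in> S"
    and t3: "\<And>f. f \<in> F \<Longrightarrow> f \<noteq> f2 \<Longrightarrow> f2 - f + n3 \<in> S"
  shows False
proof -
  have d01: "f0 - f1 \<notin> S"
    using f ne F_notin F_antichain by auto
  have d03: "f0 - f3 \<notin> S"
    using f ne F_notin F_antichain by auto
  have d0z: "f0 - 0 \<notin> S"
    using f ne F_notin F_antichain by auto
  have d10: "f1 - f0 \<notin> S"
    using f ne F_notin F_antichain by auto
  have d12: "f1 - f2 \<notin> S"
    using f ne F_notin F_antichain by auto
  have d13: "f1 - f3 \<notin> S"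
    using f ne F_notin F_antichain by auto
  have d1z: "f1 - 0 \<notin> S"
    using f ne F_notin F_antichain by auto
  have d21: "f2 - f1 \<notin> S"
    using f ne F_notin F_antichain by auto
  have d23: "f2 - f3 \<notin> S"
    using f ne F_notin F_antichain by auto
  have d2z: "f2 - 0 \<notin> S"
    using f ne F_notin F_antichain by auto
  have d31: "f3 - f1 \<notin> S"
    using f ne F_notin F_antichain by auto
  have d32: "f3 - f2 \<notin> S"
    using f ne F_notin F_antichain by auto
  have d3z: "f3 - 0 \<notin> S"
    using f ne F_notin F_antichain by auto
  have dz0: "0 - f0 \<notin> S"
    using f ne F_notin F_antichain by auto
  have dz3: "0 - f3 \<notin> S"
    using f ne F_notin F_antichain by auto
  obtain r10b r10c r10d where r10: "0 \<le> r10b" "0 \<le> r10c" "0 \<le> r10d" "rel f1 0 1 (- r10b) (- r10c) (- r10d)"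
    using f F_notin[of f1] F_plus[of f1] by (auto intro: edge0[of f1 0])
  obtain r11a r11c r11d where r11: "0 \<le> r11a" "0 \<le> r11c" "0 \<le> r11d" "rel f1 0 (- r11a) 1 (- r11c) (- r11d)"
    using f F_notin[of f1] F_plus[of f1] by (auto intro: edge1[of f1 0])
  obtain r12a r12b r12d where r12: "0 \<le> r12a" "0 \<le> r12b" "0 \<le> r12d" "rel f1 0 (- r12a) (- r12b) 1 (- r12d)"
    using f F_notin[of f1] F_plus[of f1] by (auto intro: edge2[of f1 0])
  obtain r13a r13b r13c where r13: "0 \<le> r13a" "0 \<le> r13b" "0 \<le> r13c" "rel f1 0 (- r13a) (- r13b) (- r13c) 1"
    using f F_notin[of f1] F_plus[of f1] by (auto intro: edge3[of f1 0])
  obtain r20b r20c r20d where r20: "0 \<le> r20b" "0 \<le> r20c" "0 \<le> r20d" "rel f2 0 1 (- r20b) (- r20c) (- r20d)"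
    using f F_notin[of f2] F_plus[of f2] by (auto intro: edge0[of f2 0])
  obtain r23a r23b r23c where r23: "0 \<le> r23a" "0 \<le> r23b" "0 \<le> r23c" "rel f2 0 (- r23a) (- r23b) (- r23c) 1"
    using f F_notin[of f2] F_plus[of f2] by (auto intro: edge3[of f2 0])
  obtain r30b r30c r30d where r30: "0 \<le> r30b" "0 \<le> r30c" "0 \<le> r30d" "rel f3 0 1 (- r30b) (- r30c) (- r30d)"
    using f F_notin[of f3] F_plus[of f3] by (auto intro: edge0[of f3 0])
  obtain r32a r32b r32d where r32: "0 \<le> r32a" "0 \<le> r32b" "0 \<le> r32d" "rel f3 0 (- r32a) (- r32b) 1 (- r32d)"
    using f F_notin[of f3] F_plus[of f3] by (auto intro: edge2[of f3 0])
  obtain r33a r33b r33c where r33: "0 \<le> r33a" "0 \<le> r33b" "0 \<le> r33c" "rel f3 0 (- r33a) (- r33b) (- r33c) 1"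
    using f F_notin[of f3] F_plus[of f3] by (auto intro: edge3[of f3 0])
  obtain w01b w01c w01d where w01: "0 \<le> w01b" "0 \<le> w01c" "0 \<le> w01d" "rel f0 f1 1 (- w01b) (- w01c) (- w01d)"
    using f ne t0[of f1] F_antichain[of f0 f1] by (auto intro: edge0[of f0 f1])
  obtain w02b w02c w02d where w02: "0 \<le> w02b" "0 \<le> w02c" "0 \<le> w02d" "rel f0 f2 1 (- w02b) (- w02c) (- w02d)"
    using f ne t0[of f2] F_antichain[of f0 f2] by (auto intro: edge0[of f0 f2])
  obtain w03b w03c w03d where w03: "0 \<le> w03b" "0 \<le> w03c" "0 \<le> w03d" "rel f0 f3 1 (- w03b) (- w03c) (- w03d)"
    using f ne t0[of f3] F_antichain[of f0 f3] by (auto intro: edge0[of f0 f3])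
  obtain w11a w11c w11d where w11: "0 \<le> w11a" "0 \<le> w11c" "0 \<le> w11d" "rel f0 f1 (- w11a) 1 (- w11c) (- w11d)"
    using f ne t1[of f1] F_antichain[of f0 f1] by (auto intro: edge1[of f0 f1])
  obtain w12a w12c w12d where w12: "0 \<le> w12a" "0 \<le> w12c" "0 \<le> w12d" "rel f0 f2 (- w12a) 1 (- w12c) (- w12d)"
    using f ne t1[of f2] F_antichain[of f0 f2] by (auto intro: edge1[of f0 f2])
  obtain w13a w13c w13d where w13: "0 \<le> w13a" "0 \<le> w13c" "0 \<le> w13d" "rel f0 f3 (- w13a) 1 (- w13c) (- w13d)"
    using f ne t1[of f3] F_antichain[of f0 f3] by (auto intro: edge1[of f0 f3])
  obtain w20a w20b w20d where w20: "0 \<le> w20a" "0 \<le> w20b" "0 \<le> w20d" "rel f1 f0 (- w20a) (- w20b) 1 (- w20d)"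
    using f ne t2[of f0] F_antichain[of f1 f0] by (auto intro: edge2[of f1 f0])
  obtain w22a w22b w22d where w22: "0 \<le> w22a" "0 \<le> w22b" "0 \<le> w22d" "rel f1 f2 (- w22a) (- w22b) 1 (- w22d)"
    using f ne t2[of f2] F_antichain[of f1 f2] by (auto intro: edge2[of f1 f2])
  obtain w23a w23b w23d where w23: "0 \<le> w23a" "0 \<le> w23b" "0 \<le> w23d" "rel f1 f3 (- w23a) (- w23b) 1 (- w23d)"
    using f ne t2[of f3] F_antichain[of f1 f3] by (auto intro: edge2[of f1 f3])
  obtain w30a w30b w30c where w30: "0 \<le> w30a" "0 \<le> w30b" "0 \<le> w30c" "rel f2 f0 (- w30a) (- w30b) (- w30c) 1"
    using f ne t3[of f0] F_antichain[of f2 f0] by (auto intro: edge3[of f2 f0])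
  obtain w31a w31b w31c where w31: "0 \<le> w31a" "0 \<le> w31b" "0 \<le> w31c" "rel f2 f1 (- w31a) (- w31b) (- w31c) 1"
    using f ne t3[of f1] F_antichain[of f2 f1] by (auto intro: edge3[of f2 f1])
  obtain w33a w33b w33c where w33: "0 \<le> w33a" "0 \<le> w33b" "0 \<le> w33c" "rel f2 f3 (- w33a) (- w33b) (- w33c) 1"
    using f ne t3[of f3] F_antichain[of f2 f3] by (auto intro: edge3[of f2 f3])
  note forbidden =
      gt[OF tr[OF sy[OF w02(4)] w01(4)] d21]
      lt[OF tr[OF sy[OF w02(4)] w01(4)] d12]
      gt[OF tr[OF sy[OF w03(4)] w01(4)] d31]
      lt[OF tr[OF sy[OF w03(4)] w01(4)] d13]
      gt[OF tr[OF sy[OF w03(4)] w02(4)] d32]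
      lt[OF tr[OF sy[OF w03(4)] w02(4)] d23]
      pos[OF sy[OF tr[OF w02(4) w30(4)]]]
      irr0[OF sy[OF tr[OF w02(4) w30(4)]]]
      irr3[OF sy[OF tr[OF w02(4) w30(4)]]]
      pos[OF sy[OF tr[OF w01(4) w20(4)]]]
      irr0[OF sy[OF tr[OF w01(4) w20(4)]]]
      irr2[OF sy[OF tr[OF w01(4) w20(4)]]]
      gt[OF tr[OF w03(4) r32(4)] d0z]
      lt[OF tr[OF sy[OF w13(4)] w11(4)] d13]
      irr2[OF sy[OF tr[OF w11(4) w20(4)]]]
      gt[OF tr[OF w03(4) r33(4)] d0z]
      gt[OF tr[OF sy[OF w12(4)] w11(4)] d21]
      lt[OF tr[OF sy[OF w12(4)] w11(4)] d12]
      gt[OF tr[OF w11(4) w23(4)] d03]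
      gt[OF tr[OF sy[OF w13(4)] w12(4)] d32]
      lt[OF tr[OF sy[OF w13(4)] w12(4)] d23]
      gt[OF tr[OF w20(4) w12(4)] d12]
      pos[OF sy[OF tr[OF w12(4) w30(4)]]]
      irr1[OF sy[OF tr[OF w12(4) w30(4)]]]
      irr3[OF sy[OF tr[OF w12(4) w30(4)]]]
      gt[OF tr[OF w01(4) r11(4)] d0z]
      gt[OF tr[OF sy[OF w23(4)] w22(4)] d32]
      lt[OF tr[OF sy[OF w23(4)] w22(4)] d23]
      irr2[OF sy[OF tr[OF w22(4) w31(4)]]]
      gt[OF tr[OF w22(4) r20(4)] d1z]
      gt[OF tr[OF w11(4) r12(4)] d0z]
      gt[OF tr[OF w12(4) r20(4)] d0z]
      gt[OF tr[OF w13(4) r33(4)] d0z]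
      gt[OF tr[OF sy[OF r12(4)] w20(4)] dz0]
      lt[OF tr[OF sy[OF r12(4)] w20(4)] d0z]
      gt[OF tr[OF sy[OF r12(4)] w23(4)] dz3]
      lt[OF tr[OF sy[OF r12(4)] w23(4)] d3z]
      gt[OF tr[OF w23(4) r33(4)] d1z]
      lt[OF tr[OF sy[OF w33(4)] w30(4)] d03]
      lt[OF tr[OF sy[OF r23(4)] w30(4)] d0z]
      gt[OF tr[OF sy[OF w33(4)] w31(4)] d31]
      lt[OF tr[OF sy[OF w33(4)] w31(4)] d13]
      lt[OF tr[OF sy[OF r23(4)] w31(4)] d1z]
      gt[OF tr[OF sy[OF r23(4)] w33(4)] dz3]
      lt[OF tr[OF sy[OF r23(4)] w33(4)] d3z]
      gt[OF tr[OF w11(4) r10(4)] d0z]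
      gt[OF tr[OF w11(4) r13(4)] d0z]
      gt[OF tr[OF w13(4) r32(4)] d0z]
      gt[OF tr[OF w22(4) w30(4)] d10]
      lt[OF tr[OF sy[OF w31(4)] w30(4)] d01]
      gt[OF tr[OF w33(4) r30(4)] d2z]
      gt[OF tr[OF w23(4) r30(4)] d1z]
      gt[OF tr[OF w33(4) r32(4)] d2z]
      irr1[OF sy[OF tr[OF r11(4) sy[OF r13(4)]]]]
      irr3[OF tr[OF r11(4) sy[OF r13(4)]]]
      gt[OF tr[OF r12(4) sy[OF r32(4)]] d13]
      lt[OF tr[OF r12(4) sy[OF r32(4)]] d31]
      gt[OF tr[OF w31(4) r11(4)] d2z]
      gt[OF tr[OF r13(4) sy[OF r33(4)]] d13]
      lt[OF tr[OF r13(4) sy[OF r33(4)]] d31]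
      gt[OF tr[OF r10(4) sy[OF r30(4)]] d13]
      lt[OF tr[OF r10(4) sy[OF r30(4)]] d31]
      gt[OF tr[OF r20(4) sy[OF r30(4)]] d23]
      lt[OF tr[OF r20(4) sy[OF r30(4)]] d32]
      gt[OF tr[OF tr[OF w20(4) w01(4)] r13(4)] d1z]
      pos[OF sy[OF tr[OF tr[OF w01(4) w22(4)] w30(4)]]]
      irr3[OF sy[OF tr[OF tr[OF w01(4) w22(4)] w30(4)]]]
      lt[OF tr[OF sy[OF w23(4)] w20(4)] d03]
      irr0[OF sy[OF tr[OF r30(4) sy[OF r32(4)]]]]
      irr2[OF tr[OF r30(4) sy[OF r32(4)]]]
      gt[OF tr[OF tr[OF w30(4) w01(4)] r12(4)] d2z]
      lt[OF tr[OF tr[OF sy[OF r32(4)] sy[OF w03(4)]] w01(4)] d1z]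
      gt[OF tr[OF tr[OF w01(4) r12(4)] sy[OF r32(4)]] d03]
      lt[OF tr[OF tr[OF sy[OF r33(4)] sy[OF w03(4)]] w02(4)] d2z]
      pos[OF sy[OF tr[OF tr[OF w02(4) w31(4)] w20(4)]]]
      irr0[OF sy[OF tr[OF tr[OF w02(4) w31(4)] w20(4)]]]
      irr2[OF sy[OF tr[OF tr[OF w02(4) w31(4)] w20(4)]]]
      gt[OF tr[OF tr[OF w02(4) r23(4)] sy[OF r33(4)]] d03]
      pos[OF sy[OF tr[OF tr[OF w11(4) w22(4)] w30(4)]]]
      irr2[OF sy[OF tr[OF tr[OF w11(4) w22(4)] w30(4)]]]
      irr3[OF sy[OF tr[OF tr[OF w11(4) w22(4)] w30(4)]]]
      gt[OF tr[OF tr[OF w30(4) w11(4)] r12(4)] d2z]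
      lt[OF tr[OF tr[OF sy[OF r30(4)] sy[OF w13(4)]] w01(4)] d1z]
      lt[OF cy[OF sy[OF r30(4)] tr[OF w02(4) sy[OF w12(4)]]] d3z]
      lt[OF cy[OF sy[OF r12(4)] tr[OF w02(4) sy[OF w12(4)]]] d1z]
      gt[OF tr[OF tr[OF sy[OF w13(4)] w11(4)] r10(4)] d3z]
      gt[OF tr[OF tr[OF w11(4) w23(4)] r33(4)] d0z]
      gt[OF tr[OF tr[OF w30(4) w11(4)] r10(4)] d2z]
  show False
    using r10(1-3) r11(1-3) r12(1-3) r13(1-3) r20(1-3) r23(1-3) r30(1-3) r32(1-3) r33(1-3) w01(1-3) w02(1-3) w03(1-3) w11(1-3) w12(1-3) w13(1-3) w20(1-3) w22(1-3) w23(1-3) w30(1-3) w31(1-3) w33(1-3) forbidden[simplified]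
    by (smt (z3))
qed

lemma (in four_gens) pattern_0123_false:
  assumes f: "f0 \<in> F" "f1 \<in> F" "f2 \<in> F" "f3 \<in> F"
    and ne: "distinct [f0, f1, f2, f3]"
    and t0: "\<And>f. f \<in> F \<Longrightarrow> f \<noteq> f0 \<Longrightarrow> f0 - f + n0 \<in> S"
    and t1: "\<And>f. f \<in> F \<Longrightarrow> f \<noteq> f1 \<Longrightarrow> f1 - f + n1 \<in> S"
    and t2: "\<And>f. f \<in> F \<Longrightarrow> f \<noteq> f2 \<Longrightarrow> f2 - f + n2 \<in> S"
    and t3: "\<And>f. f \<in> F \<Longrightarrow> f \<noteq> f3 \<Longrightarrow> f3 - f + n3 \<in> S"
  shows False
proof -
  have d01: "f0 - f1 \<notin> S"
    using f ne F_notin F_antichain by auto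
  have d02: "f0 - f2 \<notin> S"
    using f ne F_notin F_antichain by auto
  have d03: "f0 - f3 \<notin> S"
    using f ne F_notin F_antichain by auto
  have d0z: "f0 - 0 \<notin> S"
    using f ne F_notin F_antichain by auto
  have d10: "f1 - f0 \<notin> S"
    using f ne F_notin F_antichain by auto
  have d12: "f1 - f2 \<notin> S"
    using f ne F_notin F_antichain by auto
  have d13: "f1 - f3 \<notin> S"
    using f ne F_notin F_antichain by auto
  have d1z: "f1 - 0 \<notin> S"
    using f ne F_notin F_antichain by auto
  have d20: "f2 - f0 \<notin> S"
    using f ne F_notin F_antichain by auto
  have d21: "f2 - f1 \<notin> S"
    using f ne F_notin F_antichain by auto
  have d23: "f2 - f3 \<notin> S"
    using f ne F_notin F_antichain by auto
  have d2z: "f2 - 0 \<notin> S"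
    using f ne F_notin F_antichain by auto
  have d30: "f3 - f0 \<notin> S"
    using f ne F_notin F_antichain by auto
  have d31: "f3 - f1 \<notin> S"
    using f ne F_notin F_antichain by auto
  have d32: "f3 - f2 \<notin> S"
    using f ne F_notin F_antichain by auto
  have d3z: "f3 - 0 \<notin> S"
    using f ne F_notin F_antichain by auto
  have dz0: "0 - f0 \<notin> S"
    using f ne F_notin F_antichain by auto
  have dz1: "0 - f1 \<notin> S"
    using f ne F_notin F_antichain by auto
  have dz2: "0 - f2 \<notin> S"
    using f ne F_notin F_antichain by auto
  have dz3: "0 - f3 \<notin> S"
    using f ne F_notin F_antichain by auto
  obtain r11a r11c r11d where r11: "0 \<le> r11a" "0 \<le> r11c" "0 \<le> r11d" "rel f1 0 (- r11a) 1 (- r11c) (- r11d)"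
    using f F_notin[of f1] F_plus[of f1] by (auto intro: edge1[of f1 0])
  obtain r12a r12b r12d where r12: "0 \<le> r12a" "0 \<le> r12b" "0 \<le> r12d" "rel f1 0 (- r12a) (- r12b) 1 (- r12d)"
    using f F_notin[of f1] F_plus[of f1] by (auto intro: edge2[of f1 0])
  obtain r13a r13b r13c where r13: "0 \<le> r13a" "0 \<le> r13b" "0 \<le> r13c" "rel f1 0 (- r13a) (- r13b) (- r13c) 1"
    using f F_notin[of f1] F_plus[of f1] by (auto intro: edge3[of f1 0])
  obtain r21a r21c r21d where r21: "0 \<le> r21a" "0 \<le> r21c" "0 \<le> r21d" "rel f2 0 (- r21a) 1 (- r21c) (- r21d)"
    using f F_notin[of f2] F_plus[of f2] by (auto intro: edge1[of f2 0])
  obtain r22a r22b r22d where r22: "0 \<le> r22a" "0 \<le> r22b" "0 \<le> r22d" "rel f2 0 (- r22a) (- r22b) 1 (- r22d)"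
    using f F_notin[of f2] F_plus[of f2] by (auto intro: edge2[of f2 0])
  obtain r23a r23b r23c where r23: "0 \<le> r23a" "0 \<le> r23b" "0 \<le> r23c" "rel f2 0 (- r23a) (- r23b) (- r23c) 1"
    using f F_notin[of f2] F_plus[of f2] by (auto intro: edge3[of f2 0])
  obtain r31a r31c r31d where r31: "0 \<le> r31a" "0 \<le> r31c" "0 \<le> r31d" "rel f3 0 (- r31a) 1 (- r31c) (- r31d)"
    using f F_notin[of f3] F_plus[of f3] by (auto intro: edge1[of f3 0])
  obtain r32a r32b r32d where r32: "0 \<le> r32a" "0 \<le> r32b" "0 \<le> r32d" "rel f3 0 (- r32a) (- r32b) 1 (- r32d)"
    using f F_notin[of f3] F_plus[of f3] by (auto intro: edge2[of f3 0])
  obtain r33a r33b r33c where r33: "0 \<le> r33a" "0 \<le> r33b" "0 \<le> r33c" "rel f3 0 (- r33a) (- r33b) (- r33c) 1"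
    using f F_notin[of f3] F_plus[of f3] by (auto intro: edge3[of f3 0])
  obtain w01b w01c w01d where w01: "0 \<le> w01b" "0 \<le> w01c" "0 \<le> w01d" "rel f0 f1 1 (- w01b) (- w01c) (- w01d)"
    using f ne t0[of f1] F_antichain[of f0 f1] by (auto intro: edge0[of f0 f1])
  obtain w02b w02c w02d where w02: "0 \<le> w02b" "0 \<le> w02c" "0 \<le> w02d" "rel f0 f2 1 (- w02b) (- w02c) (- w02d)"
    using f ne t0[of f2] F_antichain[of f0 f2] by (auto intro: edge0[of f0 f2])
  obtain w03b w03c w03d where w03: "0 \<le> w03b" "0 \<le> w03c" "0 \<le> w03d" "rel f0 f3 1 (- w03b) (- w03c) (- w03d)"
    using f ne t0[of f3] F_antichain[of f0 f3] by (auto intro: edge0[of f0 f3])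
  obtain w10a w10c w10d where w10: "0 \<le> w10a" "0 \<le> w10c" "0 \<le> w10d" "rel f1 f0 (- w10a) 1 (- w10c) (- w10d)"
    using f ne t1[of f0] F_antichain[of f1 f0] by (auto intro: edge1[of f1 f0])
  obtain w12a w12c w12d where w12: "0 \<le> w12a" "0 \<le> w12c" "0 \<le> w12d" "rel f1 f2 (- w12a) 1 (- w12c) (- w12d)"
    using f ne t1[of f2] F_antichain[of f1 f2] by (auto intro: edge1[of f1 f2])
  obtain w13a w13c w13d where w13: "0 \<le> w13a" "0 \<le> w13c" "0 \<le> w13d" "rel f1 f3 (- w13a) 1 (- w13c) (- w13d)"
    using f ne t1[of f3] F_antichain[of f1 f3] by (auto intro: edge1[of f1 f3])
  obtain w20a w20b w20d where w20: "0 \<le> w20a" "0 \<le> w20b" "0 \<le> w20d" "rel f2 f0 (- w20a) (- w20b) 1 (- w20d)"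
    using f ne t2[of f0] F_antichain[of f2 f0] by (auto intro: edge2[of f2 f0])
  obtain w21a w21b w21d where w21: "0 \<le> w21a" "0 \<le> w21b" "0 \<le> w21d" "rel f2 f1 (- w21a) (- w21b) 1 (- w21d)"
    using f ne t2[of f1] F_antichain[of f2 f1] by (auto intro: edge2[of f2 f1])
  obtain w23a w23b w23d where w23: "0 \<le> w23a" "0 \<le> w23b" "0 \<le> w23d" "rel f2 f3 (- w23a) (- w23b) 1 (- w23d)"
    using f ne t2[of f3] F_antichain[of f2 f3] by (auto intro: edge2[of f2 f3])
  obtain w30a w30b w30c where w30: "0 \<le> w30a" "0 \<le> w30b" "0 \<le> w30c" "rel f3 f0 (- w30a) (- w30b) (- w30c) 1"
    using f ne t3[of f0] F_antichain[of f3 f0] by (auto intro: edge3[of f3 f0])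
  obtain w31a w31b w31c where w31: "0 \<le> w31a" "0 \<le> w31b" "0 \<le> w31c" "rel f3 f1 (- w31a) (- w31b) (- w31c) 1"
    using f ne t3[of f1] F_antichain[of f3 f1] by (auto intro: edge3[of f3 f1])
  obtain w32a w32b w32c where w32: "0 \<le> w32a" "0 \<le> w32b" "0 \<le> w32c" "rel f3 f2 (- w32a) (- w32b) (- w32c) 1"
    using f ne t3[of f2] F_antichain[of f3 f2] by (auto intro: edge3[of f3 f2])
  note forbidden =
      lt[OF r21(4) dz2]
      lt[OF r31(4) dz3]
      lt[OF tr[OF sy[OF w03(4)] w01(4)] d13]
      gt[OF tr[OF sy[OF w03(4)] w02(4)] d32]
      lt[OF tr[OF sy[OF w03(4)] w02(4)] d23]
      pos[OF sy[OF tr[OF w03(4) w30(4)]]]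
      irr0[OF sy[OF tr[OF w03(4) w30(4)]]]
      irr3[OF sy[OF tr[OF w03(4) w30(4)]]]
      gt[OF tr[OF sy[OF w12(4)] w10(4)] d20]
      lt[OF tr[OF sy[OF w12(4)] w10(4)] d02]
      irr1[OF sy[OF tr[OF w01(4) w10(4)]]]
      gt[OF tr[OF w10(4) w02(4)] d12]
      irr0[OF sy[OF tr[OF w02(4) w20(4)]]]
      gt[OF tr[OF sy[OF w13(4)] w10(4)] d30]
      lt[OF tr[OF sy[OF w13(4)] w10(4)] d03]
      gt[OF tr[OF w01(4) r13(4)] d0z]
      gt[OF tr[OF sy[OF r11(4)] w10(4)] dz0]
      lt[OF tr[OF sy[OF r11(4)] w10(4)] d0z]
      lt[OF tr[OF sy[OF w13(4)] w12(4)] d23]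
      pos[OF sy[OF tr[OF w12(4) w21(4)]]]
      irr1[OF sy[OF tr[OF w12(4) w21(4)]]]
      gt[OF tr[OF w02(4) r21(4)] d0z]
      gt[OF tr[OF w02(4) r23(4)] d0z]
      pos[OF sy[OF tr[OF w13(4) w31(4)]]]
      irr1[OF sy[OF tr[OF w13(4) w31(4)]]]
      irr3[OF sy[OF tr[OF w13(4) w31(4)]]]
      gt[OF tr[OF w32(4) w20(4)] d30]
      gt[OF tr[OF w03(4) r31(4)] d0z]
      gt[OF tr[OF w12(4) r23(4)] d1z]
      gt[OF tr[OF sy[OF r22(4)] w20(4)] dz0]
      lt[OF tr[OF sy[OF r22(4)] w20(4)] d0z]
      gt[OF tr[OF sy[OF w23(4)] w21(4)] d31]
      lt[OF tr[OF sy[OF w23(4)] w21(4)] d13]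
      gt[OF tr[OF w21(4) r13(4)] d2z]
      lt[OF tr[OF sy[OF r11(4)] w13(4)] d3z]
      pos[OF sy[OF tr[OF w23(4) w32(4)]]]
      irr3[OF sy[OF tr[OF w23(4) w32(4)]]]
      lt[OF tr[OF sy[OF r22(4)] w23(4)] d3z]
      gt[OF tr[OF w23(4) r31(4)] d2z]
      gt[OF tr[OF w23(4) r33(4)] d2z]
      gt[OF tr[OF sy[OF w32(4)] w30(4)] d20]
      lt[OF tr[OF sy[OF w32(4)] w30(4)] d02]
      gt[OF tr[OF sy[OF r33(4)] w30(4)] dz0]
      lt[OF tr[OF sy[OF r33(4)] w30(4)] d0z]
      gt[OF tr[OF sy[OF w32(4)] w31(4)] d21]
      lt[OF tr[OF sy[OF w32(4)] w31(4)] d12]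
      gt[OF tr[OF sy[OF r33(4)] w31(4)] dz1]
      lt[OF tr[OF sy[OF r33(4)] w31(4)] d1z]
      gt[OF tr[OF sy[OF r33(4)] w32(4)] dz2]
      lt[OF tr[OF sy[OF r33(4)] w32(4)] d2z]
      gt[OF tr[OF w32(4) r21(4)] d3z]
      lt[OF tr[OF sy[OF r22(4)] w21(4)] d1z]
      irr1[OF sy[OF tr[OF r21(4) sy[OF r23(4)]]]]
      gt[OF tr[OF w02(4) w21(4)] d01]
      gt[OF tr[OF sy[OF w21(4)] w20(4)] d10]
      gt[OF tr[OF w03(4) r32(4)] d0z]
      gt[OF tr[OF tr[OF sy[OF r21(4)] sy[OF w02(4)]] w01(4)] dz1]
      lt[OF tr[OF tr[OF sy[OF r21(4)] sy[OF w02(4)]] w01(4)] d1z]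
      lt[OF tr[OF tr[OF sy[OF r31(4)] sy[OF w03(4)]] w01(4)] d1z]
      pos[OF sy[OF tr[OF tr[OF w01(4) w12(4)] w20(4)]]]
      irr1[OF sy[OF tr[OF tr[OF w01(4) w12(4)] w20(4)]]]
      irr2[OF sy[OF tr[OF tr[OF w01(4) w12(4)] w20(4)]]]
      pos[OF sy[OF tr[OF tr[OF w01(4) w13(4)] w30(4)]]]
      irr0[OF sy[OF tr[OF tr[OF w01(4) w13(4)] w30(4)]]]
      irr1[OF sy[OF tr[OF tr[OF w01(4) w13(4)] w30(4)]]]
      irr3[OF sy[OF tr[OF tr[OF w01(4) w13(4)] w30(4)]]]
      gt[OF tr[OF w13(4) r32(4)] d1z]
      gt[OF tr[OF sy[OF w31(4)] w30(4)] d10]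
      lt[OF tr[OF sy[OF w31(4)] w30(4)] d01]
      irr2[OF sy[OF tr[OF r12(4) sy[OF r13(4)]]]]
      gt[OF tr[OF tr[OF sy[OF w03(4)] w02(4)] r23(4)] d3z]
      lt[OF tr[OF tr[OF sy[OF w03(4)] w02(4)] r23(4)] dz3]
      pos[OF sy[OF tr[OF tr[OF w02(4) w23(4)] w30(4)]]]
      irr0[OF sy[OF tr[OF tr[OF w02(4) w23(4)] w30(4)]]]
      irr3[OF sy[OF tr[OF tr[OF w02(4) w23(4)] w30(4)]]]
      gt[OF tr[OF tr[OF sy[OF w03(4)] w01(4)] r13(4)] d3z]
      lt[OF tr[OF tr[OF sy[OF w03(4)] w01(4)] r13(4)] dz3]
      gt[OF cy[OF w01(4) tr[OF sy[OF r21(4)] r22(4)]] d01]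
      pos[OF sy[OF tr[OF tr[OF w02(4) w21(4)] w10(4)]]]
      irr0[OF sy[OF tr[OF tr[OF w02(4) w21(4)] w10(4)]]]
      lt[OF tr[OF tr[OF sy[OF r32(4)] sy[OF w03(4)]] w02(4)] d2z]
      gt[OF tr[OF tr[OF w02(4) r22(4)] sy[OF r32(4)]] d03]
      pos[OF sy[OF tr[OF tr[OF w03(4) w32(4)] w20(4)]]]
      irr3[OF sy[OF tr[OF tr[OF w03(4) w32(4)] w20(4)]]]
      gt[OF tr[OF tr[OF w01(4) r11(4)] sy[OF r31(4)]] d03]
      pos[OF sy[OF tr[OF tr[OF w03(4) w31(4)] w10(4)]]]
      irr0[OF sy[OF tr[OF tr[OF w03(4) w31(4)] w10(4)]]]
      irr1[OF sy[OF tr[OF tr[OF w03(4) w31(4)] w10(4)]]]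
      irr3[OF sy[OF tr[OF tr[OF w03(4) w31(4)] w10(4)]]]
  show False
    using r11(1-3) r12(1-3) r13(1-3) r21(1-3) r22(1-3) r23(1-3) r31(1-3) r32(1-3) r33(1-3) w01(1-3) w02(1-3) w03(1-3) w10(1-3) w12(1-3) w13(1-3) w20(1-3) w21(1-3) w23(1-3) w30(1-3) w31(1-3) w32(1-3) forbidden[simplified]
    by (smt (z3))
qed

text \<open>For the case that one element \<open>g\<close> is attached to all generators, when
  \<open>F\<close> without \<open>g\<close> is stable under subtraction from \<open>g\<close>.
  Equality of \<open>f3\<close> and \<open>f4\<close> is permitted, so an element with
  \<open>f3 + f3 = g\<close> may serve as the second pair.\<close>

lemma (in four_gens) symmetric_false:
  assumes f: "f1 \<in> F" "f2 \<in> F" "f3 \<in> F" "f4 \<in> F" "g \<in> F"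
    and ne: "f1 \<noteq> f2" "f1 \<noteq> f3" "f2 \<noteq> f3" "g \<notin> {f1, f2, f3, f4}"
    and g: "g = f1 + f2" "g = f3 + f4"
  shows False
proof -
  have e: "f4 = f1 + f2 - f3" "g = f1 + f2" using g by (simp_all add: eq_diff_eq add.commute)
  have d12: "f1 - f2 \<notin> S"
    using f ne F_antichain[of f1 f2] by (simp add: algebra_simps)
  have d13: "f1 - f3 \<notin> S"
    using f ne F_antichain[of f1 f3] by (simp add: algebra_simps)
  have d14: "f1 - f4 \<notin> S"
    using f ne F_antichain[of f3 f2] by (simp add: e algebra_simps)
  have d1z: "f1 - 0 \<notin> S"
    using f ne F_notin[of f1] by (simp add: algebra_simps)
  have d21: "f2 - f1 \<notin> S"
    using f ne F_antichain[of f2 f1] by (simp add: algebra_simps)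
  have d23: "f2 - f3 \<notin> S"
    using f ne F_antichain[of f2 f3] by (simp add: algebra_simps)
  have d24: "f2 - f4 \<notin> S"
    using f ne F_antichain[of f3 f1] by (simp add: e algebra_simps)
  have d31: "f3 - f1 \<notin> S"
    using f ne F_antichain[of f3 f1] by (simp add: algebra_simps)
  have d32: "f3 - f2 \<notin> S"
    using f ne F_antichain[of f3 f2] by (simp add: algebra_simps)
  have d3z: "f3 - 0 \<notin> S"
    using f ne F_notin[of f3] by (simp add: algebra_simps)
  have d41: "f4 - f1 \<notin> S"
    using f ne F_antichain[of f2 f3] by (simp add: e algebra_simps)
  have d42: "f4 - f2 \<notin> S"
    using f ne F_antichain[of f1 f3] by (simp add: e algebra_simps)
  have d4z: "f4 - 0 \<notin> S"
    using f ne F_notin[of f4] by (simp add: algebra_simps)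
  have dF1: "g - f1 \<notin> S"
    using f ne F_notin[of f2] by (simp add: e algebra_simps)
  have dF2: "g - f2 \<notin> S"
    using f ne F_notin[of f1] by (simp add: e algebra_simps)
  have dF3: "g - f3 \<notin> S"
    using f ne F_notin[of f4] by (simp add: e algebra_simps)
  have dF4: "g - f4 \<notin> S"
    using f ne F_notin[of f3] by (simp add: e algebra_simps)
  have dFz: "g - 0 \<notin> S"
    using f ne F_notin[of g] by (simp add: algebra_simps)
  obtain r10b r10c r10d where r10: "0 \<le> r10b" "0 \<le> r10c" "0 \<le> r10d" "rel f1 0 1 (- r10b) (- r10c) (- r10d)"
    using f F_notin[of f1] F_plus[of f1] by (auto intro: edge0[of f1 0])
  obtain r11a r11c r11d where r11: "0 \<le> r11a" "0 \<le> r11c" "0 \<le> r11d" "rel f1 0 (- r11a) 1 (- r11c) (- r11d)"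
    using f F_notin[of f1] F_plus[of f1] by (auto intro: edge1[of f1 0])
  obtain r12a r12b r12d where r12: "0 \<le> r12a" "0 \<le> r12b" "0 \<le> r12d" "rel f1 0 (- r12a) (- r12b) 1 (- r12d)"
    using f F_notin[of f1] F_plus[of f1] by (auto intro: edge2[of f1 0])
  obtain r13a r13b r13c where r13: "0 \<le> r13a" "0 \<le> r13b" "0 \<le> r13c" "rel f1 0 (- r13a) (- r13b) (- r13c) 1"
    using f F_notin[of f1] F_plus[of f1] by (auto intro: edge3[of f1 0])
  obtain r20b r20c r20d where r20: "0 \<le> r20b" "0 \<le> r20c" "0 \<le> r20d" "rel f2 0 1 (- r20b) (- r20c) (- r20d)"
    using f F_notin[of f2] F_plus[of f2] by (auto intro: edge0[of f2 0])
  obtain r21a r21c r21d where r21: "0 \<le> r21a" "0 \<le> r21c" "0 \<le> r21d" "rel f2 0 (- r21a) 1 (- r21c) (- r21d)"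
    using f F_notin[of f2] F_plus[of f2] by (auto intro: edge1[of f2 0])
  obtain r22a r22b r22d where r22: "0 \<le> r22a" "0 \<le> r22b" "0 \<le> r22d" "rel f2 0 (- r22a) (- r22b) 1 (- r22d)"
    using f F_notin[of f2] F_plus[of f2] by (auto intro: edge2[of f2 0])
  obtain r23a r23b r23c where r23: "0 \<le> r23a" "0 \<le> r23b" "0 \<le> r23c" "rel f2 0 (- r23a) (- r23b) (- r23c) 1"
    using f F_notin[of f2] F_plus[of f2] by (auto intro: edge3[of f2 0])
  obtain r30b r30c r30d where r30: "0 \<le> r30b" "0 \<le> r30c" "0 \<le> r30d" "rel f3 0 1 (- r30b) (- r30c) (- r30d)"
    using f F_notin[of f3] F_plus[of f3] by (auto intro: edge0[of f3 0])
  obtain r31a r31c r31d where r31: "0 \<le> r31a" "0 \<le> r31c" "0 \<le> r31d" "rel f3 0 (- r31a) 1 (- r31c) (- r31d)"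
    using f F_notin[of f3] F_plus[of f3] by (auto intro: edge1[of f3 0])
  obtain r32a r32b r32d where r32: "0 \<le> r32a" "0 \<le> r32b" "0 \<le> r32d" "rel f3 0 (- r32a) (- r32b) 1 (- r32d)"
    using f F_notin[of f3] F_plus[of f3] by (auto intro: edge2[of f3 0])
  obtain r33a r33b r33c where r33: "0 \<le> r33a" "0 \<le> r33b" "0 \<le> r33c" "rel f3 0 (- r33a) (- r33b) (- r33c) 1"
    using f F_notin[of f3] F_plus[of f3] by (auto intro: edge3[of f3 0])
  obtain r40b r40c r40d where r40: "0 \<le> r40b" "0 \<le> r40c" "0 \<le> r40d" "rel f4 0 1 (- r40b) (- r40c) (- r40d)"
    using f F_notin[of f4] F_plus[of f4] by (auto intro: edge0[of f4 0])
  obtain r41a r41c r41d where r41: "0 \<le> r41a" "0 \<le> r41c" "0 \<le> r41d" "rel f4 0 (- r41a) 1 (- r41c) (- r41d)"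
    using f F_notin[of f4] F_plus[of f4] by (auto intro: edge1[of f4 0])
  obtain r42a r42b r42d where r42: "0 \<le> r42a" "0 \<le> r42b" "0 \<le> r42d" "rel f4 0 (- r42a) (- r42b) 1 (- r42d)"
    using f F_notin[of f4] F_plus[of f4] by (auto intro: edge2[of f4 0])
  obtain r43a r43b r43c where r43: "0 \<le> r43a" "0 \<le> r43b" "0 \<le> r43c" "rel f4 0 (- r43a) (- r43b) (- r43c) 1"
    using f F_notin[of f4] F_plus[of f4] by (auto intro: edge3[of f4 0])
  \<comment> \<open>A row of \<open>f1\<close>, an edge from \<open>f1\<close> to 0, is also an edge
    from \<open>g\<close> to \<open>f2\<close>, and similarly for the others. So two rows compose to
    a path from \<open>g\<close> to 0.\<close>
  have q1: "g - f2 = f1 - 0" and q2: "g - f1 = f2 - 0" and q3: "g - f4 = f3 - 0" and q4: "g - f3 = f4 - 0"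
    using g by (simp_all add: algebra_simps)
  note forbidden =
      irr0[OF sy[OF tr[OF r10(4) sy[OF r11(4)]]]]
      irr1[OF tr[OF r10(4) sy[OF r11(4)]]]
      irr0[OF sy[OF tr[OF r10(4) sy[OF r12(4)]]]]
      irr2[OF tr[OF r10(4) sy[OF r12(4)]]]
      gt[OF tr[OF r10(4) sy[OF r20(4)]] d12]
      lt[OF tr[OF r10(4) sy[OF r20(4)]] d21]
      gt[OF tr[OF r10(4) sy[OF r30(4)]] d13]
      lt[OF tr[OF r10(4) sy[OF r30(4)]] d31]
      gt[OF tr[OF r10(4) sy[OF r40(4)]] d14]
      lt[OF tr[OF r10(4) sy[OF r40(4)]] d41]
      irr1[OF sy[OF tr[OF r11(4) sy[OF r12(4)]]]]
      irr2[OF tr[OF r11(4) sy[OF r12(4)]]]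
      gt[OF tr[OF r11(4) sy[OF r21(4)]] d12]
      lt[OF tr[OF r11(4) sy[OF r21(4)]] d21]
      lt[OF tr[OF r11(4) sy[OF r31(4)]] d31]
      irr0[OF sy[OF tr[OF r10(4) sy[OF r13(4)]]]]
      irr3[OF tr[OF r10(4) sy[OF r13(4)]]]
      irr1[OF sy[OF tr[OF r11(4) sy[OF r13(4)]]]]
      irr3[OF tr[OF r11(4) sy[OF r13(4)]]]
      gt[OF tr[OF r11(4) sy[OF r41(4)]] d14]
      lt[OF tr[OF r11(4) sy[OF r41(4)]] d41]
      gt[OF tr[OF r12(4) sy[OF r22(4)]] d12]
      lt[OF tr[OF r12(4) sy[OF r22(4)]] d21]
      gt[OF tr[OF re[OF r12(4) q1] r23(4)] dFz]
      lt[OF tr[OF r12(4) sy[OF r32(4)]] d31]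
      lt[OF tr[OF r12(4) sy[OF r42(4)]] d41]
      gt[OF tr[OF re[OF r13(4) q1] r22(4)] dFz]
      gt[OF tr[OF re[OF r10(4) q1] r22(4)] dFz]
      gt[OF tr[OF re[OF r11(4) q1] r22(4)] dFz]
      gt[OF tr[OF r13(4) sy[OF r23(4)]] d12]
      lt[OF tr[OF r13(4) sy[OF r23(4)]] d21]
      lt[OF tr[OF r13(4) sy[OF r33(4)]] d31]
      irr0[OF sy[OF tr[OF r20(4) sy[OF r21(4)]]]]
      irr1[OF tr[OF r20(4) sy[OF r21(4)]]]
      gt[OF tr[OF r20(4) sy[OF r30(4)]] d23]
      lt[OF tr[OF r20(4) sy[OF r30(4)]] d32]
      lt[OF tr[OF r20(4) sy[OF r40(4)]] d42]
      gt[OF tr[OF re[OF r10(4) q1] r23(4)] dFz]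
      gt[OF tr[OF re[OF r11(4) q1] r20(4)] dFz]
      irr2[OF sy[OF tr[OF r12(4) sy[OF r13(4)]]]]
      irr3[OF tr[OF r12(4) sy[OF r13(4)]]]
      gt[OF tr[OF re[OF r12(4) q1] r20(4)] dFz]
      gt[OF tr[OF re[OF r13(4) q1] r20(4)] dFz]
      lt[OF tr[OF r21(4) sy[OF r31(4)]] d32]
      gt[OF tr[OF r21(4) sy[OF r41(4)]] d24]
      lt[OF tr[OF r23(4) sy[OF r33(4)]] d32]
      gt[OF tr[OF re[OF r10(4) q1] r21(4)] dFz]
      gt[OF tr[OF re[OF r11(4) q1] r23(4)] dFz]
      irr0[OF sy[OF tr[OF r20(4) sy[OF r22(4)]]]]
      irr2[OF tr[OF r20(4) sy[OF r22(4)]]]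
      irr0[OF sy[OF tr[OF r20(4) sy[OF r23(4)]]]]
      irr3[OF tr[OF r20(4) sy[OF r23(4)]]]
      irr1[OF sy[OF tr[OF r21(4) sy[OF r23(4)]]]]
      irr3[OF tr[OF r21(4) sy[OF r23(4)]]]
      irr2[OF sy[OF tr[OF r22(4) sy[OF r23(4)]]]]
      irr3[OF tr[OF r22(4) sy[OF r23(4)]]]
      gt[OF tr[OF re[OF r13(4) q1] r21(4)] dFz]
      irr1[OF sy[OF tr[OF r31(4) sy[OF r32(4)]]]]
      gt[OF tr[OF re[OF r32(4) q3] r43(4)] dFz]
      gt[OF tr[OF re[OF r33(4) q3] r42(4)] dFz]
      gt[OF tr[OF re[OF r12(4) q1] r21(4)] dFz]
      gt[OF tr[OF r22(4) sy[OF r32(4)]] d23]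
      lt[OF tr[OF r22(4) sy[OF r32(4)]] d32]
      gt[OF tr[OF re[OF r32(4) q3] r40(4)] dFz]
      gt[OF tr[OF re[OF r32(4) q3] r41(4)] dFz]
      gt[OF tr[OF re[OF r33(4) q3] r41(4)] dFz]
      lt[OF tr[OF r22(4) sy[OF r42(4)]] d42]
      gt[OF tr[OF re[OF r30(4) q3] r42(4)] dFz]
      gt[OF tr[OF re[OF r30(4) q3] r41(4)] dFz]
      gt[OF tr[OF re[OF r30(4) q3] r43(4)] dFz]
      gt[OF tr[OF re[OF r31(4) q3] r42(4)] dFz]
      gt[OF tr[OF re[OF r33(4) q3] r40(4)] dFz]
      irr1[OF sy[OF tr[OF r41(4) sy[OF r43(4)]]]]
      irr3[OF tr[OF r41(4) sy[OF r43(4)]]]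
      irr1[OF sy[OF tr[OF r21(4) sy[OF r22(4)]]]]
      irr2[OF tr[OF r21(4) sy[OF r22(4)]]]
      lt[OF tr[OF r23(4) sy[OF r43(4)]] d42]
      gt[OF tr[OF re[OF r31(4) q3] r43(4)] dFz]
      gt[OF tr[OF tr[OF re[OF r10(4) q1] r22(4)] sy[OF r42(4)]] dF4]
      gt[OF tr[OF tr[OF re[OF r10(4) q1] r23(4)] sy[OF r30(4)]] dF3]
      gt[OF tr[OF tr[OF re[OF r10(4) q1] r23(4)] sy[OF r40(4)]] dF4]
      lt[OF tr[OF tr[OF r10(4) sy[OF r31(4)]] sy[OF re[OF r40(4) q4]]] dF1]
      gt[OF tr[OF re[OF r31(4) q3] r40(4)] dFz]
      gt[OF tr[OF tr[OF re[OF r11(4) q1] r23(4)] sy[OF r33(4)]] dF3]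
      lt[OF tr[OF tr[OF r11(4) sy[OF r33(4)]] sy[OF re[OF r41(4) q4]]] dF1]
      gt[OF tr[OF tr[OF re[OF r13(4) q1] r20(4)] sy[OF r30(4)]] dF3]
      lt[OF tr[OF tr[OF r10(4) sy[OF r30(4)]] sy[OF re[OF r42(4) q4]]] dF1]
      gt[OF tr[OF tr[OF re[OF r11(4) q1] r23(4)] sy[OF r43(4)]] dF4]
      gt[OF tr[OF tr[OF re[OF r10(4) q1] r21(4)] sy[OF r40(4)]] dF4]
      gt[OF tr[OF tr[OF re[OF r10(4) q1] r23(4)] sy[OF r43(4)]] dF4]
      gt[OF tr[OF tr[OF re[OF r11(4) q1] r20(4)] sy[OF r31(4)]] dF3]
      gt[OF tr[OF tr[OF re[OF r11(4) q1] r22(4)] sy[OF r42(4)]] dF4]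
      gt[OF tr[OF tr[OF re[OF r10(4) q1] r21(4)] sy[OF r31(4)]] dF3]
      gt[OF tr[OF tr[OF re[OF r11(4) q1] r20(4)] sy[OF r40(4)]] dF4]
      gt[OF tr[OF tr[OF re[OF r11(4) q1] r23(4)] sy[OF r41(4)]] dF4]
      lt[OF tr[OF tr[OF r10(4) sy[OF r33(4)]] sy[OF re[OF r40(4) q4]]] dF1]
      gt[OF cy[OF r42(4) tr[OF r10(4) sy[OF r11(4)]]] d4z]
      lt[OF tr[OF tr[OF r11(4) sy[OF r31(4)]] sy[OF re[OF r40(4) q4]]] dF1]
      lt[OF tr[OF tr[OF r11(4) sy[OF r31(4)]] sy[OF re[OF r42(4) q4]]] dF1]
      lt[OF tr[OF tr[OF r11(4) sy[OF r32(4)]] sy[OF re[OF r41(4) q4]]] dF1]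
      gt[OF tr[OF tr[OF re[OF r11(4) q1] r22(4)] sy[OF r31(4)]] dF3]
      gt[OF tr[OF tr[OF re[OF r11(4) q1] r22(4)] sy[OF r41(4)]] dF4]
      gt[OF tr[OF tr[OF r11(4) sy[OF r31(4)]] r32(4)] d1z]
      gt[OF tr[OF tr[OF re[OF r12(4) q1] r20(4)] sy[OF r30(4)]] dF3]
      gt[OF tr[OF tr[OF re[OF r12(4) q1] r20(4)] sy[OF r40(4)]] dF4]
      gt[OF tr[OF tr[OF re[OF r12(4) q1] r20(4)] sy[OF r42(4)]] dF4]
      gt[OF tr[OF tr[OF re[OF r12(4) q1] r23(4)] sy[OF r43(4)]] dF4]
      lt[OF tr[OF tr[OF r12(4) sy[OF r31(4)]] sy[OF re[OF r42(4) q4]]] dF1]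
      lt[OF tr[OF tr[OF r12(4) sy[OF r32(4)]] sy[OF re[OF r43(4) q4]]] dF1]
      gt[OF tr[OF tr[OF re[OF r13(4) q1] r20(4)] sy[OF r33(4)]] dF3]
      gt[OF tr[OF tr[OF re[OF r13(4) q1] r20(4)] sy[OF r43(4)]] dF4]
      gt[OF tr[OF tr[OF re[OF r10(4) q1] r23(4)] sy[OF r33(4)]] dF3]
      gt[OF tr[OF tr[OF re[OF r11(4) q1] r22(4)] sy[OF r32(4)]] dF3]
      gt[OF tr[OF tr[OF re[OF r12(4) q1] r23(4)] sy[OF r32(4)]] dF3]
      gt[OF tr[OF tr[OF re[OF r13(4) q1] r21(4)] sy[OF r31(4)]] dF3]
      gt[OF tr[OF tr[OF re[OF r13(4) q1] r22(4)] sy[OF r33(4)]] dF3]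
      lt[OF tr[OF tr[OF sy[OF r11(4)] r10(4)] sy[OF r43(4)]] d4z]
      gt[OF tr[OF tr[OF re[OF r11(4) q1] r23(4)] sy[OF r31(4)]] dF3]
      gt[OF tr[OF tr[OF re[OF r12(4) q1] r21(4)] sy[OF r31(4)]] dF3]
      gt[OF tr[OF tr[OF re[OF r12(4) q1] r21(4)] sy[OF r41(4)]] dF4]
      lt[OF tr[OF tr[OF r12(4) sy[OF r32(4)]] sy[OF re[OF r41(4) q4]]] dF1]
      gt[OF tr[OF tr[OF re[OF r13(4) q1] r21(4)] sy[OF r33(4)]] dF3]
      gt[OF tr[OF tr[OF re[OF r13(4) q1] r21(4)] sy[OF r43(4)]] dF4]
      lt[OF tr[OF tr[OF r11(4) sy[OF r31(4)]] sy[OF re[OF r43(4) q4]]] dF1]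
      gt[OF tr[OF tr[OF re[OF r12(4) q1] r20(4)] sy[OF r32(4)]] dF3]
      gt[OF tr[OF tr[OF re[OF r12(4) q1] r23(4)] sy[OF r33(4)]] dF3]
      gt[OF tr[OF tr[OF re[OF r13(4) q1] r22(4)] sy[OF r42(4)]] dF4]
      lt[OF tr[OF tr[OF r20(4) sy[OF r30(4)]] sy[OF re[OF r42(4) q4]]] dF2]
      lt[OF tr[OF tr[OF r20(4) sy[OF r32(4)]] sy[OF re[OF r40(4) q4]]] dF2]
      lt[OF tr[OF tr[OF r21(4) sy[OF r31(4)]] sy[OF re[OF r43(4) q4]]] dF2]
      lt[OF tr[OF tr[OF r21(4) sy[OF r33(4)]] sy[OF re[OF r41(4) q4]]] dF2]
      gt[OF cy[OF r31(4) tr[OF r10(4) sy[OF r13(4)]]] d3z]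
      gt[OF tr[OF tr[OF re[OF r10(4) q1] r22(4)] sy[OF r30(4)]] dF3]
      gt[OF cy[OF r40(4) tr[OF r11(4) sy[OF r12(4)]]] d4z]
      gt[OF tr[OF tr[OF re[OF r12(4) q1] r21(4)] sy[OF r32(4)]] dF3]
      gt[OF tr[OF tr[OF re[OF r12(4) q1] r21(4)] sy[OF r42(4)]] dF4]
      lt[OF tr[OF tr[OF r12(4) sy[OF r30(4)]] sy[OF re[OF r42(4) q4]]] dF1]
      gt[OF cy[OF r42(4) tr[OF r10(4) sy[OF r13(4)]]] d4z]
      lt[OF tr[OF tr[OF r13(4) sy[OF r33(4)]] sy[OF re[OF r42(4) q4]]] dF1]
      lt[OF tr[OF tr[OF r13(4) sy[OF r30(4)]] sy[OF re[OF r43(4) q4]]] dF1]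
      lt[OF tr[OF tr[OF r13(4) sy[OF r33(4)]] sy[OF re[OF r40(4) q4]]] dF1]
      gt[OF cy[OF r31(4) tr[OF r12(4) sy[OF r13(4)]]] d3z]
      gt[OF cy[OF r33(4) tr[OF r20(4) sy[OF r22(4)]]] d3z]
      gt[OF cy[OF r33(4) tr[OF r10(4) sy[OF r12(4)]]] d3z]
      lt[OF tr[OF tr[OF r12(4) sy[OF r33(4)]] sy[OF re[OF r42(4) q4]]] dF1]
      gt[OF cy[OF r33(4) tr[OF r20(4) sy[OF r21(4)]]] d3z]
      gt[OF tr[OF tr[OF re[OF r12(4) q1] r23(4)] sy[OF r42(4)]] dF4]
      gt[OF cy[OF r32(4) tr[OF r20(4) sy[OF r21(4)]]] d3z]
      gt[OF cy[OF r33(4) tr[OF r21(4) sy[OF r22(4)]]] d3z]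
      lt[OF tr[OF tr[OF r20(4) sy[OF r30(4)]] sy[OF re[OF r43(4) q4]]] dF2]
      lt[OF tr[OF tr[OF r20(4) sy[OF r33(4)]] sy[OF re[OF r40(4) q4]]] dF2]
      lt[OF tr[OF tr[OF r21(4) sy[OF r30(4)]] sy[OF re[OF r41(4) q4]]] dF2]
      lt[OF tr[OF tr[OF r21(4) sy[OF r31(4)]] sy[OF re[OF r40(4) q4]]] dF2]
      lt[OF tr[OF tr[OF r22(4) sy[OF r31(4)]] sy[OF re[OF r42(4) q4]]] dF2]
      lt[OF tr[OF tr[OF r22(4) sy[OF r32(4)]] sy[OF re[OF r41(4) q4]]] dF2]
      lt[OF tr[OF tr[OF r23(4) sy[OF r32(4)]] sy[OF re[OF r43(4) q4]]] dF2]
      lt[OF tr[OF tr[OF r23(4) sy[OF r33(4)]] sy[OF re[OF r42(4) q4]]] dF2]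
      lt[OF tr[OF tr[OF sy[OF r21(4)] r20(4)] sy[OF r33(4)]] d3z]
      gt[OF cy[OF r41(4) tr[OF r20(4) sy[OF r23(4)]]] d4z]
      lt[OF tr[OF tr[OF r20(4) sy[OF r31(4)]] sy[OF re[OF r40(4) q4]]] dF2]
      lt[OF tr[OF tr[OF r21(4) sy[OF r31(4)]] sy[OF re[OF r42(4) q4]]] dF2]
      lt[OF tr[OF tr[OF r21(4) sy[OF r32(4)]] sy[OF re[OF r41(4) q4]]] dF2]
      lt[OF tr[OF tr[OF r22(4) sy[OF r33(4)]] sy[OF re[OF r42(4) q4]]] dF2]
      lt[OF tr[OF tr[OF r23(4) sy[OF r30(4)]] sy[OF re[OF r43(4) q4]]] dF2]
      lt[OF tr[OF tr[OF r23(4) sy[OF r33(4)]] sy[OF re[OF r40(4) q4]]] dF2]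
      gt[OF tr[OF tr[OF re[OF r13(4) q1] r20(4)] sy[OF r40(4)]] dF4]
      lt[OF tr[OF tr[OF r23(4) sy[OF r31(4)]] sy[OF re[OF r43(4) q4]]] dF2]
      lt[OF tr[OF tr[OF r23(4) sy[OF r33(4)]] sy[OF re[OF r41(4) q4]]] dF2]
  note nonneg = r10(1-3) r11(1-3) r12(1-3) r13(1-3) r20(1-3) r21(1-3) r22(1-3) r23(1-3) r30(1-3) r31(1-3) r32(1-3) r33(1-3) r40(1-3) r41(1-3) r42(1-3) r43(1-3)
  \<comment> \<open>Splitting on three exponents replaces one large infeasible system by eight
    smaller ones, each with its own selection of instances.\<close>
  have split: "r42b = 0 \<or> r42b > 0" "r33a = 0 \<or> r33a > 0" "r13b = 0 \<or> r13b > 0"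
    using r42(1-3) r33(1-3) r13(1-3) by auto
  consider (c0) "r42b = 0" "r33a = 0" "r13b = 0"
    | (c1) "r42b = 0" "r33a = 0" "r13b > 0"
    | (c2) "r42b = 0" "r33a > 0" "r13b = 0"
    | (c3) "r42b = 0" "r33a > 0" "r13b > 0"
    | (c4) "r42b > 0" "r33a = 0" "r13b = 0"
    | (c5) "r42b > 0" "r33a = 0" "r13b > 0"
    | (c6) "r42b > 0" "r33a > 0" "r13b = 0"
    | (c7) "r42b > 0" "r33a > 0" "r13b > 0"
    using split by blast
  then show False
  proof cases
    case c0
    then show False using nonneg forbidden(3-6,9-15,17-33,35-39,42-50,53-54,56,59-61,64-70,77-79,83-84,86-88,90-92,94-96,98-102,104-107,109-114,116-121,124-127,129,135-140,145,147,149-150,152,156-158,160,162-163,167-168)[simplified] by (smt (z3))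
  next
    case c1
    then show False using nonneg forbidden(2-9,11,13-14,20-32,35-39,42-54,57,59-61,64-70,73-74,77-79,82-85,87,89-90,92-97,100,102,104,106,110-114,116,119-123,125-127,129-131,135-137,145,147-148,150-153,155-157,161-163,166,168)[simplified] by (smt (z3))
  next
    case c2
    then show False using nonneg forbidden(2-20,22-32,35-50,52,55-56,59-61,64-70,72,75-85,87-88,90-95,97-101,104-107,110-116,118-121,124-129,134-137,141-142,145,147,150,156-157,159-168)[simplified] by (smt (z3))
  next
    case c3
    then show False using nonneg forbidden(1-2,5-10,12-15,20,22-31,35-52,57,59-66,68-70,72,75-90,92-95,97,100-101,104-107,109,112-114,118-126,128,130-131,134-137,141,145-147,152-153,156-157,161-168)[simplified] by (smt (z3))
  next
    case c4
    then show False using nonneg forbidden(1-10,13-36,38-48,51-52,55-56,58-66,68-71,73-75,77-80,82-85,87-88,90-91,93-96,98,100-104,106-116,118-121,124-128,132-133,135-138,145,147,149-152,154-158,162,164,166-168)[simplified] by (smt (z3))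
  next
    case c5
    then show False using nonneg forbidden(1-2,5-6,9-17,20-25,27-31,33-39,42-50,52-57,59-61,63-66,68-71,77-79,82-85,87-88,90-91,93,95-96,100-102,104-105,107-110,112-114,118-127,130-131,135,137,139,147,151-152,154,156-157,159-160,162,166-168)[simplified] by (smt (z3))
  next
    case c6
    then show False using nonneg forbidden(5-6,9-19,22-30,32,35-44,47-52,55-56,58-61,64-66,68,70-74,78,80-83,91,93-94,98,101,103-106,108,110,114-116,118-119,125,128-129,132,135-137,141,147,154,160,164-166)[simplified] by (smt (z3))
  next
    case c7
    then show False using nonneg forbidden(4-17,20-25,27-31,37-43,45-48,50-54,57-62,64-66,68,70-72,75-79,81-91,93-95,98,101-103,105,107-109,112,114,116,118-127,129-131,135,139-140,143-144,147,152-155,157,160,165,168)[simplified] by (smt (z3))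
  qed
qed

section \<open>Linear inequalities for two extremal rays\<close>

text \<open>Further rays of the semigroup are invisible here, so \<open>in_S\<close> is only a
  sufficient condition for membership. The edges leaving the tops are nevertheless combinations of
  \<open>b0\<close>, \<open>b1\<close>, \<open>b2\<close> alone, because they are Apery elements. By
  \<open>split\<close>, no \<open>b\<close> is contained in both edges that lead to the same
  \<open>m\<close>.\<close>

locale two_rays =
  fixes S M :: "(int ^ 'd) set" and a0 a1 b0 b1 b2 m0 m1 :: "int ^ 'd"
  assumes in_S: "0 \<le> x0 \<Longrightarrow> 0 \<le> x1 \<Longrightarrow> 0 \<le> x2 \<Longrightarrow> 0 \<le> x3 \<Longrightarrow> 0 \<le> x4 \<Longrightarrow>
      x0 *s a0 + x1 *s a1 + x2 *s b0 + x3 *s b1 + x4 *s b2 \<in> S"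
    and S_add: "s \<in> S \<Longrightarrow> t \<in> S \<Longrightarrow> s + t \<in> S"
    and pointed: "0 \<le> x0 \<Longrightarrow> 0 \<le> x1 \<Longrightarrow> 0 \<le> x2 \<Longrightarrow> 0 \<le> x3 \<Longrightarrow> 0 \<le> x4 \<Longrightarrow>
      x0 *s a0 + x1 *s a1 + x2 *s b0 + x3 *s b1 + x4 *s b2 = 0 \<Longrightarrow>
      x0 = 0 \<and> x1 = 0 \<and> x2 = 0 \<and> x3 = 0 \<and> x4 = 0"
    and min0: "0 \<le> x1 \<Longrightarrow> 0 \<le> x2 \<Longrightarrow> 0 \<le> x3 \<Longrightarrow> 0 \<le> x4 \<Longrightarrow> a0 \<noteq> x1 *s a1 + x2 *s b0 + x3 *s b1 + x4 *s b2"
    and min1: "0 \<le> x0 \<Longrightarrow> 0 \<le> x2 \<Longrightarrow> 0 \<le> x3 \<Longrightarrow> 0 \<le> x4 \<Longrightarrow> a1 \<noteq> x0 *s a0 + x2 *s b0 + x3 *s b1 + x4 *s b2"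
    and min2: "0 \<le> x0 \<Longrightarrow> 0 \<le> x1 \<Longrightarrow> 0 \<le> x3 \<Longrightarrow> 0 \<le> x4 \<Longrightarrow> b0 \<noteq> x0 *s a0 + x1 *s a1 + x3 *s b1 + x4 *s b2"
    and min3: "0 \<le> x0 \<Longrightarrow> 0 \<le> x1 \<Longrightarrow> 0 \<le> x2 \<Longrightarrow> 0 \<le> x4 \<Longrightarrow> b1 \<noteq> x0 *s a0 + x1 *s a1 + x2 *s b0 + x4 *s b2"
    and min4: "0 \<le> x0 \<Longrightarrow> 0 \<le> x1 \<Longrightarrow> 0 \<le> x2 \<Longrightarrow> 0 \<le> x3 \<Longrightarrow> b2 \<noteq> x0 *s a0 + x1 *s a1 + x2 *s b0 + x3 *s b1"
    and CM: "z + a0 \<in> S \<Longrightarrow> z + a1 \<in> S \<Longrightarrow> z \<in> S"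
    and M_apery: "m \<in> M \<Longrightarrow> m \<in> S" "m \<in> M \<Longrightarrow> m - a0 \<notin> S" "m \<in> M \<Longrightarrow> m - a1 \<notin> S"
    and M_antichain: "m \<in> M \<Longrightarrow> m' \<in> M \<Longrightarrow> m \<noteq> m' \<Longrightarrow> m - m' \<notin> S"
    and tops: "m0 \<in> M" "m1 \<in> M" "m0 \<noteq> m1"
    and edge0: "m \<in> M \<Longrightarrow> m \<noteq> m0 \<Longrightarrow> \<exists>x y z. 0 \<le> x \<and> 0 \<le> y \<and> 0 \<le> z \<and>
      m0 + a0 = m + (x *s b0 + y *s b1 + z *s b2)"
    and edge1: "m \<in> M \<Longrightarrow> m \<noteq> m1 \<Longrightarrow> \<exists>x y z. 0 \<le> x \<and> 0 \<le> y \<and> 0 \<le> z \<and>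
      m1 + a1 = m + (x *s b0 + y *s b1 + z *s b2)"
    and back0: "m \<in> M \<Longrightarrow> m \<noteq> m0 \<Longrightarrow> b \<in> {b0, b1, b2} \<Longrightarrow> m0 + a0 - m - b \<in> S \<Longrightarrow>
      \<exists>x y z. 0 \<le> x \<and> 0 \<le> y \<and> 0 \<le> z \<and> m + b = a0 + (x *s b0 + y *s b1 + z *s b2)"
    and back1: "m \<in> M \<Longrightarrow> m \<noteq> m1 \<Longrightarrow> b \<in> {b0, b1, b2} \<Longrightarrow> m1 + a1 - m - b \<in> S \<Longrightarrow>
      \<exists>x y z. 0 \<le> x \<and> 0 \<le> y \<and> 0 \<le> z \<and> m + b = a1 + (x *s b0 + y *s b1 + z *s b2)"
    and split: "m \<in> M \<Longrightarrow> m \<noteq> m0 \<Longrightarrow> m \<noteq> m1 \<Longrightarrow> b \<in> {b0, b1, b2} \<Longrightarrow>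
      m0 + a0 - m - b \<notin> S \<or> m1 + a1 - m - b \<notin> S"
begin

text \<open>The guard \<open>P\<close> carries the case assumption under which the relation is available.\<close>

definition rel :: "bool \<Rightarrow> int ^ 'd \<Rightarrow> int ^ 'd \<Rightarrow> int \<Rightarrow> int \<Rightarrow> int \<Rightarrow> int \<Rightarrow> int \<Rightarrow> bool" where
  "rel P u v x0 x1 x2 x3 x4 \<longleftrightarrow>
     (P \<longrightarrow> u - v + (x0 *s a0 + x1 *s a1 + x2 *s b0 + x3 *s b1 + x4 *s b2) = 0)"

lemma tr: "rel P u v x0 x1 x2 x3 x4 \<Longrightarrow> rel Q v w y0 y1 y2 y3 y4 \<Longrightarrow>
    rel (P \<and> Q) u w (x0 + y0) (x1 + y1) (x2 + y2) (x3 + y3) (x4 + y4)"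
  by (simp add: rel_def vec_eq_iff algebra_simps) smt

lemma cy: "rel P u v x0 x1 x2 x3 x4 \<Longrightarrow> rel Q w w y0 y1 y2 y3 y4 \<Longrightarrow>
    rel (P \<and> Q) u v (x0 + y0) (x1 + y1) (x2 + y2) (x3 + y3) (x4 + y4)"
  by (simp add: rel_def vec_eq_iff algebra_simps) 

lemma sy: "rel P u v x0 x1 x2 x3 x4 \<Longrightarrow> rel P v u (- x0) (- x1) (- x2) (- x3) (- x4)"
  by (simp add: rel_def vec_eq_iff algebra_simps) 

text \<open>Saturation for multiples of the two rays. The inner induction removes one
  \<open>a1\<close> at a time; the outer hypothesis, applied to \<open>z + l' * a1 + a0\<close>,
  provides the second premise of \<open>CM\<close>.\<close>

lemma CM_mult: "z + int k *s a0 \<in> S \<Longrightarrow> z + int l *s a1 \<in> S \<Longrightarrow> z \<in> S"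
proof (induction k arbitrary: z l)
  case 0
  then show ?case by simp
next
  case (Suc k)
  note outer = Suc.IH and p = Suc.prems
  have "z + int l' *s a1 \<in> S \<Longrightarrow> z \<in> S" for l'
  proof (induction l')
    case 0
    then show ?case by simp
  next
    case (Suc l')
    have a: "(z + int l' *s a1) + a0 + int k *s a0 \<in> S"
      using S_add[OF p(1) in_S[of 0 "int l'" 0 0 0]] by (simp add: vec_eq_iff algebra_simps vector_sadd_rdistrib)
    have b: "(z + int l' *s a1) + a0 + int 1 *s a1 \<in> S"
      using S_add[OF Suc.prems in_S[of 1 0 0 0 0]] by (simp add: vec_eq_iff algebra_simps vector_sadd_rdistrib)
    have "(z + int l' *s a1) + a0 \<in> S" by (rule outer[OF a b])
    moreover have "(z + int l' *s a1) + a1 \<in> S"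
      using Suc.prems by (simp add: vec_eq_iff algebra_simps vector_sadd_rdistrib)
    ultimately show ?case using CM Suc.IH by blast
  qed
  then show ?case using p(2) .
qed

lemma gt: assumes "rel P u v x0 x1 x2 x3 x4" "u - v \<notin> S"
  shows "P \<longrightarrow> x0 > 0 \<or> x1 > 0 \<or> x2 > 0 \<or> x3 > 0 \<or> x4 > 0"
proof (rule ccontr)
  assume *: "\<not> ?thesis"
  moreover from this have "u - v = (- x0) *s a0 + (- x1) *s a1 + (- x2) *s b0 + (- x3) *s b1 + (- x4) *s b2"
    using assms(1) by (simp add: rel_def vec_eq_iff algebra_simps)
  ultimately show False using assms(2) in_S[of "- x0" "- x1" "- x2" "- x3" "- x4"] by auto
qed

lemma pos: "rel P u u x0 x1 x2 x3 x4 \<Longrightarrow> P \<longrightarrow>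
    x0 < 0 \<or> x1 < 0 \<or> x2 < 0 \<or> x3 < 0 \<or> x4 < 0 \<or> (x0 = 0 \<and> x1 = 0 \<and> x2 = 0 \<and> x3 = 0 \<and> x4 = 0)"
  using pointed[of x0 x1 x2 x3 x4] by (simp add: rel_def) linarith

lemma irr0: assumes "rel P u u x0 x1 x2 x3 x4" shows "P \<longrightarrow> x0 \<noteq> - 1 \<or> x1 < 0 \<or> x2 < 0 \<or> x3 < 0 \<or> x4 < 0"
proof (rule ccontr)
  assume *: "\<not> ?thesis"
  then have "a0 = x1 *s a1 + x2 *s b0 + x3 *s b1 + x4 *s b2"
    using assms by (simp add: rel_def vec_eq_iff algebra_simps)
  then show False using * min0[of x1 x2 x3 x4] by auto
qed

lemma irr1: assumes "rel P u u x0 x1 x2 x3 x4" shows "P \<longrightarrow> x1 \<noteq> - 1 \<or> x0 < 0 \<or> x2 < 0 \<or> x3 < 0 \<or> x4 < 0"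
proof (rule ccontr)
  assume *: "\<not> ?thesis"
  then have "a1 = x0 *s a0 + x2 *s b0 + x3 *s b1 + x4 *s b2"
    using assms by (simp add: rel_def vec_eq_iff algebra_simps)
  then show False using * min1[of x0 x2 x3 x4] by auto
qed

lemma irr2: assumes "rel P u u x0 x1 x2 x3 x4" shows "P \<longrightarrow> x2 \<noteq> - 1 \<or> x0 < 0 \<or> x1 < 0 \<or> x3 < 0 \<or> x4 < 0"
proof (rule ccontr)
  assume *: "\<not> ?thesis"
  then have "b0 = x0 *s a0 + x1 *s a1 + x3 *s b1 + x4 *s b2"
    using assms by (simp add: rel_def vec_eq_iff algebra_simps)
  then show False using * min2[of x0 x1 x3 x4] by auto
qed

lemma irr3: assumes "rel P u u x0 x1 x2 x3 x4" shows "P \<longrightarrow> x3 \<noteq> - 1 \<or> x0 < 0 \<or> x1 < 0 \<or> x2 < 0 \<or> x4 < 0"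
proof (rule ccontr)
  assume *: "\<not> ?thesis"
  then have "b1 = x0 *s a0 + x1 *s a1 + x2 *s b0 + x4 *s b2"
    using assms by (simp add: rel_def vec_eq_iff algebra_simps)
  then show False using * min3[of x0 x1 x2 x4] by auto
qed

text \<open>If \<open>m = - (x0 *s a0 + \<dots>)\<close> with only the coefficient of one ray negative, then the
  Cohen-Macaulay property strips the other ray from \<open>m\<close>.\<close>

lemma ap0: assumes "rel P m 0 x0 x1 x2 x3 x4" "m \<in> M"
  shows "P \<longrightarrow> x0 > - 1 \<or> x2 > 0 \<or> x3 > 0 \<or> x4 > 0"
proof (rule ccontr)
  assume *: "\<not> ?thesis"
  have eq: "m = (- x0) *s a0 + (- x1) *s a1 + (- x2) *s b0 + (- x3) *s b1 + (- x4) *s b2"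
    using assms(1) * by (simp add: rel_def vec_eq_iff algebra_simps) smt
  have "m - a0 + int 1 *s a0 \<in> S" using M_apery(1)[OF assms(2)] by simp
  \<comment> \<open>Adding \<open>\<bar>x1\<bar>\<close> copies of \<open>a1\<close> makes its
    coefficient nonnegative whatever the sign of \<open>x1\<close>; the conclusion therefore imposes
    nothing on \<open>x1\<close>.\<close>
  moreover have "m - a0 + int (nat \<bar>x1\<bar>) *s a1 =
      (- x0 - 1) *s a0 + (\<bar>x1\<bar> - x1) *s a1 + (- x2) *s b0 + (- x3) *s b1 + (- x4) *s b2"
    by (subst eq) (simp add: vec_eq_iff algebra_simps)
  then have "m - a0 + int (nat \<bar>x1\<bar>) *s a1 \<in> S" using * in_S[of "- x0 - 1" "\<bar>x1\<bar> - x1" "- x2" "- x3" "- x4"] by auto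
  ultimately show False using CM_mult M_apery(2)[OF assms(2)] by blast
qed

lemma ap1: assumes "rel P m 0 x0 x1 x2 x3 x4" "m \<in> M"
  shows "P \<longrightarrow> x1 > - 1 \<or> x2 > 0 \<or> x3 > 0 \<or> x4 > 0"
proof (rule ccontr)
  assume *: "\<not> ?thesis"
  have eq: "m = (- x0) *s a0 + (- x1) *s a1 + (- x2) *s b0 + (- x3) *s b1 + (- x4) *s b2"
    using assms(1) * by (simp add: rel_def vec_eq_iff algebra_simps) smt
  have "m - a1 + int 1 *s a1 \<in> S" using M_apery(1)[OF assms(2)] by simp
  moreover have "m - a1 + int (nat \<bar>x0\<bar>) *s a0 =
      (\<bar>x0\<bar> - x0) *s a0 + (- x1 - 1) *s a1 + (- x2) *s b0 + (- x3) *s b1 + (- x4) *s b2"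
    by (subst eq) (simp add: vec_eq_iff algebra_simps)
  then have "m - a1 + int (nat \<bar>x0\<bar>) *s a0 \<in> S" using * in_S[of "\<bar>x0\<bar> - x0" "- x1 - 1" "- x2" "- x3" "- x4"] by auto
  ultimately show False using CM_mult M_apery(3)[OF assms(2)] by blast
qed

lemma b_sum_in_S: "0 \<le> x \<Longrightarrow> 0 \<le> y \<Longrightarrow> 0 \<le> z \<Longrightarrow> x *s b0 + y *s b1 + z *s b2 \<in> S"
  using in_S[of 0 0 x y z] by simp

lemma top0_S: assumes "m \<in> M" "m \<noteq> m0" shows "m0 - m + a0 \<in> S"
proof -
  obtain x y z where "0 \<le> x" "0 \<le> y" "0 \<le> z" "m0 + a0 = m + (x *s b0 + y *s b1 + z *s b2)"
    using edge0[OF assms] by blast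
  then show ?thesis using b_sum_in_S by (metis add_diff_cancel_left' diff_add_eq)
qed

lemma top1_S: assumes "m \<in> M" "m \<noteq> m1" shows "m1 - m + a1 \<in> S"
proof -
  obtain x y z where "0 \<le> x" "0 \<le> y" "0 \<le> z" "m1 + a1 = m + (x *s b0 + y *s b1 + z *s b2)"
    using edge1[OF assms] by blast
  then show ?thesis using b_sum_in_S by (metis add_diff_cancel_left' diff_add_eq)
qed

text \<open>Without a positive entry off \<open>a1\<close>, a multiple of \<open>a1\<close> brings
  \<open>m0 - m\<close> into \<open>S\<close>. So does \<open>a0\<close>, by the choice of the top.
  Saturation would give \<open>m0 - m\<close> in \<open>S\<close>, against the antichain
  property.\<close>

lemma top00: assumes "rel P m0 m x0 x1 x2 x3 x4" "m \<in> M" "m \<noteq> m0"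
  shows "P \<longrightarrow> x0 > 0 \<or> x2 > 0 \<or> x3 > 0 \<or> x4 > 0"
proof (rule ccontr)
  assume *: "\<not> ?thesis"
  have eq: "m0 - m = (- x0) *s a0 + (- x1) *s a1 + (- x2) *s b0 + (- x3) *s b1 + (- x4) *s b2"
    using assms(1) * by (simp add: rel_def vec_eq_iff algebra_simps)
  have "m0 - m + int 1 *s a0 \<in> S" using top0_S assms by simp
  moreover have "m0 - m + int (nat \<bar>x1\<bar>) *s a1 =
      (- x0) *s a0 + (\<bar>x1\<bar> - x1) *s a1 + (- x2) *s b0 + (- x3) *s b1 + (- x4) *s b2"
    by (subst eq) (simp add: vec_eq_iff algebra_simps)
  then have "m0 - m + int (nat \<bar>x1\<bar>) *s a1 \<in> S" using * in_S[of "- x0" "\<bar>x1\<bar> - x1" "- x2" "- x3" "- x4"] by auto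
  ultimately show False using CM_mult M_antichain tops assms by metis
qed

lemma top11: assumes "rel P m1 m x0 x1 x2 x3 x4" "m \<in> M" "m \<noteq> m1"
  shows "P \<longrightarrow> x1 > 0 \<or> x2 > 0 \<or> x3 > 0 \<or> x4 > 0"
proof (rule ccontr)
  assume *: "\<not> ?thesis"
  have eq: "m1 - m = (- x0) *s a0 + (- x1) *s a1 + (- x2) *s b0 + (- x3) *s b1 + (- x4) *s b2"
    using assms(1) * by (simp add: rel_def vec_eq_iff algebra_simps)
  have "m1 - m + int 1 *s a1 \<in> S" using top1_S assms by simp
  moreover have "m1 - m + int (nat \<bar>x0\<bar>) *s a0 =
      (\<bar>x0\<bar> - x0) *s a0 + (- x1) *s a1 + (- x2) *s b0 + (- x3) *s b1 + (- x4) *s b2"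
    by (subst eq) (simp add: vec_eq_iff algebra_simps)
  then have "m1 - m + int (nat \<bar>x0\<bar>) *s a0 \<in> S" using * in_S[of "\<bar>x0\<bar> - x0" "- x1" "- x2" "- x3" "- x4"] by auto
  ultimately show False using CM_mult M_antichain tops assms by metis
qed

text \<open>If \<open>x1\<close> were negative and no entry of a \<open>b\<close> positive,
  saturation would give \<open>m0 - m + a0 - a1\<close> in \<open>S\<close>. Adding \<open>m\<close>
  shows that \<open>m0 - a1\<close> is brought into \<open>S\<close> by \<open>a0\<close> as well as
  by \<open>a1\<close>, so a second saturation contradicts that \<open>m0\<close> is Apery.\<close>

lemma top01: assumes "rel P m0 m x0 x1 x2 x3 x4" "m \<in> M" "m \<noteq> m0"
  shows "P \<longrightarrow> x1 > - 1 \<or> x2 > 0 \<or> x3 > 0 \<or> x4 > 0"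
proof (rule ccontr)
  assume *: "\<not> ?thesis"
  have eq: "m0 - m = (- x0) *s a0 + (- x1) *s a1 + (- x2) *s b0 + (- x3) *s b1 + (- x4) *s b2"
    using assms(1) * by (simp add: rel_def vec_eq_iff algebra_simps)
  let ?w = "m0 - m + a0 - a1"
  have "?w + int 1 *s a1 \<in> S" using top0_S assms by simp
  moreover have "?w + int (nat \<bar>x0\<bar>) *s a0 =
      (\<bar>x0\<bar> - x0 + 1) *s a0 + (- x1 - 1) *s a1 + (- x2) *s b0 + (- x3) *s b1 + (- x4) *s b2"
    by (subst eq) (simp add: vec_eq_iff algebra_simps)
  then have "?w + int (nat \<bar>x0\<bar>) *s a0 \<in> S" using * in_S[of "\<bar>x0\<bar> - x0 + 1" "- x1 - 1" "- x2" "- x3" "- x4"] by auto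
  ultimately have "?w \<in> S" using CM_mult by blast
  from S_add[OF this M_apery(1)[OF assms(2)]] have "(m0 - a1) + a0 \<in> S" by (simp add: algebra_simps)
  moreover have "(m0 - a1) + a1 \<in> S" using M_apery(1) tops by simp
  ultimately show False using CM M_apery(3) tops by blast
qed

lemma top10: assumes "rel P m1 m x0 x1 x2 x3 x4" "m \<in> M" "m \<noteq> m1"
  shows "P \<longrightarrow> x0 > - 1 \<or> x2 > 0 \<or> x3 > 0 \<or> x4 > 0"
proof (rule ccontr)
  assume *: "\<not> ?thesis"
  have eq: "m1 - m = (- x0) *s a0 + (- x1) *s a1 + (- x2) *s b0 + (- x3) *s b1 + (- x4) *s b2"
    using assms(1) * by (simp add: rel_def vec_eq_iff algebra_simps)
  let ?w = "m1 - m + a1 - a0"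
  have "?w + int 1 *s a0 \<in> S" using top1_S assms by simp
  moreover have "?w + int (nat \<bar>x1\<bar>) *s a1 =
      (- x0 - 1) *s a0 + (\<bar>x1\<bar> - x1 + 1) *s a1 + (- x2) *s b0 + (- x3) *s b1 + (- x4) *s b2"
    by (subst eq) (simp add: vec_eq_iff algebra_simps)
  then have "?w + int (nat \<bar>x1\<bar>) *s a1 \<in> S" using * in_S[of "- x0 - 1" "\<bar>x1\<bar> - x1 + 1" "- x2" "- x3" "- x4"] by auto
  ultimately have "?w \<in> S" using CM_mult by blast
  from S_add[OF this M_apery(1)[OF assms(2)]] have "(m1 - a0) + a1 \<in> S" by (simp add: algebra_simps)
  moreover have "(m1 - a0) + a0 \<in> S" using M_apery(1) tops by simp
  ultimately show False using CM M_apery(2) tops by blast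
qed

lemma edge_rel0: assumes "m \<in> M" "m \<noteq> m0"
  shows "\<exists>x y z. 0 \<le> x \<and> 0 \<le> y \<and> 0 \<le> z \<and> rel True m0 m 1 0 (- x) (- y) (- z) \<and>
    m0 + a0 - m = x *s b0 + y *s b1 + z *s b2"
proof -
  obtain x y z where n: "0 \<le> x" "0 \<le> y" "0 \<le> z" and e: "m0 + a0 = m + (x *s b0 + y *s b1 + z *s b2)"
    using edge0[OF assms] by blast
  have "rel True m0 m 1 0 (- x) (- y) (- z)"
    using e by (simp add: rel_def vec_eq_iff algebra_simps)
  then show ?thesis using n e by (metis add_diff_cancel_left')
qed

lemma edge_rel1: assumes "m \<in> M" "m \<noteq> m1"
  shows "\<exists>x y z. 0 \<le> x \<and> 0 \<le> y \<and> 0 \<le> z \<and> rel True m1 m 0 1 (- x) (- y) (- z) \<and>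
    m1 + a1 - m = x *s b0 + y *s b1 + z *s b2"
proof -
  obtain x y z where n: "0 \<le> x" "0 \<le> y" "0 \<le> z" and e: "m1 + a1 = m + (x *s b0 + y *s b1 + z *s b2)"
    using edge1[OF assms] by blast
  have "rel True m1 m 0 1 (- x) (- y) (- z)"
    using e by (simp add: rel_def vec_eq_iff algebra_simps)
  then show ?thesis using n e by (metis add_diff_cancel_left')
qed

text \<open>If \<open>b0\<close> occurs in the edge from \<open>m0\<close> to \<open>m\<close>, then
  \<open>back0\<close> rewrites \<open>m + b0\<close> as \<open>a0\<close> plus a combination of the
  \<open>b\<close>; by \<open>ap0\<close> this combination does not use \<open>b0\<close>. The guard
  \<open>x \<noteq> 0\<close> remembers the assumption, and for \<open>x = 0\<close> any values will
  do.\<close>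

lemma row00: assumes "m \<in> M" "m \<noteq> m0" "0 \<le> x" "0 \<le> y" "0 \<le> z"
    "m0 + a0 - m = x *s b0 + y *s b1 + z *s b2"
  shows "\<exists>y' z'. 0 \<le> y' \<and> 0 \<le> z' \<and> rel (x \<noteq> 0) m 0 (- 1) 0 1 (- y') (- z')"
proof (cases "x = 0")
  case True
  then show ?thesis by (intro exI[of _ 0]) (simp add: rel_def)
next
  case False
  have eq: "m0 + a0 - m - b0 = (x - 1) *s b0 + (y) *s b1 + (z) *s b2"
    using assms(6) by (simp add: vec_eq_iff algebra_simps)
  have "m0 + a0 - m - b0 \<in> S" unfolding eq using assms(3-5) False by (intro b_sum_in_S) auto
  then obtain x' y' z' where n: "0 \<le> x'" "0 \<le> y'" "0 \<le> z'" and
    e: "m + b0 = a0 + (x' *s b0 + y' *s b1 + z' *s b2)" using back0[OF assms(1,2), of b0] by auto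
  have r: "rel True m 0 (- 1) 0 (1 - x') (- y') (- z')" using e by (simp add: rel_def vec_eq_iff algebra_simps)
  have "x' = 0" using ap0[OF r assms(1)] n by auto
  then show ?thesis using r n by (auto simp: rel_def)
qed

lemma row01: assumes "m \<in> M" "m \<noteq> m0" "0 \<le> x" "0 \<le> y" "0 \<le> z"
    "m0 + a0 - m = x *s b0 + y *s b1 + z *s b2"
  shows "\<exists>x' z'. 0 \<le> x' \<and> 0 \<le> z' \<and> rel (y \<noteq> 0) m 0 (- 1) 0 (- x') 1 (- z')"
proof (cases "y = 0")
  case True
  then show ?thesis by (intro exI[of _ 0]) (simp add: rel_def)
next
  case False
  have eq: "m0 + a0 - m - b1 = (x) *s b0 + (y - 1) *s b1 + (z) *s b2"
    using assms(6) by (simp add: vec_eq_iff algebra_simps)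
  have "m0 + a0 - m - b1 \<in> S" unfolding eq using assms(3-5) False by (intro b_sum_in_S) auto
  then obtain x' y' z' where n: "0 \<le> x'" "0 \<le> y'" "0 \<le> z'" and
    e: "m + b1 = a0 + (x' *s b0 + y' *s b1 + z' *s b2)" using back0[OF assms(1,2), of b1] by auto
  have r: "rel True m 0 (- 1) 0 (- x') (1 - y') (- z')" using e by (simp add: rel_def vec_eq_iff algebra_simps)
  have "y' = 0" using ap0[OF r assms(1)] n by auto
  then show ?thesis using r n by (auto simp: rel_def)
qed

lemma row02: assumes "m \<in> M" "m \<noteq> m0" "0 \<le> x" "0 \<le> y" "0 \<le> z"
    "m0 + a0 - m = x *s b0 + y *s b1 + z *s b2"
  shows "\<exists>x' y'. 0 \<le> x' \<and> 0 \<le> y' \<and> rel (z \<noteq> 0) m 0 (- 1) 0 (- x') (- y') 1"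
proof (cases "z = 0")
  case True
  then show ?thesis by (intro exI[of _ 0]) (simp add: rel_def)
next
  case False
  have eq: "m0 + a0 - m - b2 = (x) *s b0 + (y) *s b1 + (z - 1) *s b2"
    using assms(6) by (simp add: vec_eq_iff algebra_simps)
  have "m0 + a0 - m - b2 \<in> S" unfolding eq using assms(3-5) False by (intro b_sum_in_S) auto
  then obtain x' y' z' where n: "0 \<le> x'" "0 \<le> y'" "0 \<le> z'" and
    e: "m + b2 = a0 + (x' *s b0 + y' *s b1 + z' *s b2)" using back0[OF assms(1,2), of b2] by auto
  have r: "rel True m 0 (- 1) 0 (- x') (- y') (1 - z')" using e by (simp add: rel_def vec_eq_iff algebra_simps)
  have "z' = 0" using ap0[OF r assms(1)] n by auto
  then show ?thesis using r n by (auto simp: rel_def)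
qed

lemma row10: assumes "m \<in> M" "m \<noteq> m1" "0 \<le> x" "0 \<le> y" "0 \<le> z"
    "m1 + a1 - m = x *s b0 + y *s b1 + z *s b2"
  shows "\<exists>y' z'. 0 \<le> y' \<and> 0 \<le> z' \<and> rel (x \<noteq> 0) m 0 0 (- 1) 1 (- y') (- z')"
proof (cases "x = 0")
  case True
  then show ?thesis by (intro exI[of _ 0]) (simp add: rel_def)
next
  case False
  have eq: "m1 + a1 - m - b0 = (x - 1) *s b0 + (y) *s b1 + (z) *s b2"
    using assms(6) by (simp add: vec_eq_iff algebra_simps)
  have "m1 + a1 - m - b0 \<in> S" unfolding eq using assms(3-5) False by (intro b_sum_in_S) auto
  then obtain x' y' z' where n: "0 \<le> x'" "0 \<le> y'" "0 \<le> z'" and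
    e: "m + b0 = a1 + (x' *s b0 + y' *s b1 + z' *s b2)" using back1[OF assms(1,2), of b0] by auto
  have r: "rel True m 0 0 (- 1) (1 - x') (- y') (- z')" using e by (simp add: rel_def vec_eq_iff algebra_simps)
  have "x' = 0" using ap1[OF r assms(1)] n by auto
  then show ?thesis using r n by (auto simp: rel_def)
qed

lemma row11: assumes "m \<in> M" "m \<noteq> m1" "0 \<le> x" "0 \<le> y" "0 \<le> z"
    "m1 + a1 - m = x *s b0 + y *s b1 + z *s b2"
  shows "\<exists>x' z'. 0 \<le> x' \<and> 0 \<le> z' \<and> rel (y \<noteq> 0) m 0 0 (- 1) (- x') 1 (- z')"
proof (cases "y = 0")
  case True
  then show ?thesis by (intro exI[of _ 0]) (simp add: rel_def)
next
  case False
  have eq: "m1 + a1 - m - b1 = (x) *s b0 + (y - 1) *s b1 + (z) *s b2"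
    using assms(6) by (simp add: vec_eq_iff algebra_simps)
  have "m1 + a1 - m - b1 \<in> S" unfolding eq using assms(3-5) False by (intro b_sum_in_S) auto
  then obtain x' y' z' where n: "0 \<le> x'" "0 \<le> y'" "0 \<le> z'" and
    e: "m + b1 = a1 + (x' *s b0 + y' *s b1 + z' *s b2)" using back1[OF assms(1,2), of b1] by auto
  have r: "rel True m 0 0 (- 1) (- x') (1 - y') (- z')" using e by (simp add: rel_def vec_eq_iff algebra_simps)
  have "y' = 0" using ap1[OF r assms(1)] n by auto
  then show ?thesis using r n by (auto simp: rel_def)
qed

lemma row12: assumes "m \<in> M" "m \<noteq> m1" "0 \<le> x" "0 \<le> y" "0 \<le> z"
    "m1 + a1 - m = x *s b0 + y *s b1 + z *s b2"
  shows "\<exists>x' y'. 0 \<le> x' \<and> 0 \<le> y' \<and> rel (z \<noteq> 0) m 0 0 (- 1) (- x') (- y') 1"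
proof (cases "z = 0")
  case True
  then show ?thesis by (intro exI[of _ 0]) (simp add: rel_def)
next
  case False
  have eq: "m1 + a1 - m - b2 = (x) *s b0 + (y) *s b1 + (z - 1) *s b2"
    using assms(6) by (simp add: vec_eq_iff algebra_simps)
  have "m1 + a1 - m - b2 \<in> S" unfolding eq using assms(3-5) False by (intro b_sum_in_S) auto
  then obtain x' y' z' where n: "0 \<le> x'" "0 \<le> y'" "0 \<le> z'" and
    e: "m + b2 = a1 + (x' *s b0 + y' *s b1 + z' *s b2)" using back1[OF assms(1,2), of b2] by auto
  have r: "rel True m 0 0 (- 1) (- x') (- y') (1 - z')" using e by (simp add: rel_def vec_eq_iff algebra_simps)
  have "z' = 0" using ap1[OF r assms(1)] n by auto
  then show ?thesis using r n by (auto simp: rel_def)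
qed

lemma disj0: assumes "m \<in> M" "m \<noteq> m0" "m \<noteq> m1" "0 \<le> x" "0 \<le> y" "0 \<le> z"
    "m0 + a0 - m = x *s b0 + y *s b1 + z *s b2" "0 \<le> x'" "0 \<le> y'" "0 \<le> z'"
    "m1 + a1 - m = x' *s b0 + y' *s b1 + z' *s b2"
  shows "x = 0 \<or> x' = 0"
proof (rule ccontr)
  assume *: "\<not> ?thesis"
  have e: "m0 + a0 - m - b0 = (x - 1) *s b0 + (y) *s b1 + (z) *s b2" "m1 + a1 - m - b0 = (x' - 1) *s b0 + (y') *s b1 + (z') *s b2"
    using assms(7,11) by (simp_all add: vec_eq_iff algebra_simps)
  have "m0 + a0 - m - b0 \<in> S" "m1 + a1 - m - b0 \<in> S"
    unfolding e using assms(4-6,8-10) * by (auto intro!: b_sum_in_S)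
  then show False using split[OF assms(1-3), of b0] by auto
qed

lemma disj1: assumes "m \<in> M" "m \<noteq> m0" "m \<noteq> m1" "0 \<le> x" "0 \<le> y" "0 \<le> z"
    "m0 + a0 - m = x *s b0 + y *s b1 + z *s b2" "0 \<le> x'" "0 \<le> y'" "0 \<le> z'"
    "m1 + a1 - m = x' *s b0 + y' *s b1 + z' *s b2"
  shows "y = 0 \<or> y' = 0"
proof (rule ccontr)
  assume *: "\<not> ?thesis"
  have e: "m0 + a0 - m - b1 = (x) *s b0 + (y - 1) *s b1 + (z) *s b2" "m1 + a1 - m - b1 = (x') *s b0 + (y' - 1) *s b1 + (z') *s b2"
    using assms(7,11) by (simp_all add: vec_eq_iff algebra_simps)
  have "m0 + a0 - m - b1 \<in> S" "m1 + a1 - m - b1 \<in> S"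
    unfolding e using assms(4-6,8-10) * by (auto intro!: b_sum_in_S)
  then show False using split[OF assms(1-3), of b1] by auto
qed

lemma disj2: assumes "m \<in> M" "m \<noteq> m0" "m \<noteq> m1" "0 \<le> x" "0 \<le> y" "0 \<le> z"
    "m0 + a0 - m = x *s b0 + y *s b1 + z *s b2" "0 \<le> x'" "0 \<le> y'" "0 \<le> z'"
    "m1 + a1 - m = x' *s b0 + y' *s b1 + z' *s b2"
  shows "z = 0 \<or> z' = 0"
proof (rule ccontr)
  assume *: "\<not> ?thesis"
  have e: "m0 + a0 - m - b2 = (x) *s b0 + (y) *s b1 + (z - 1) *s b2" "m1 + a1 - m - b2 = (x') *s b0 + (y') *s b1 + (z' - 1) *s b2"
    using assms(7,11) by (simp_all add: vec_eq_iff algebra_simps)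
  have "m0 + a0 - m - b2 \<in> S" "m1 + a1 - m - b2 \<in> S"
    unfolding e using assms(4-6,8-10) * by (auto intro!: b_sum_in_S)
  then show False using split[OF assms(1-3), of b2] by auto
qed

end

text \<open>\<open>wki\<close> is the edge from \<open>mk\<close> to \<open>mi\<close>.
  \<open>rkij\<close> is the relation for \<open>mi + bj\<close> with respect to ray
  \<open>k\<close>, available only if \<open>bj\<close> occurs in \<open>wki\<close>. The guards and
  the alternatives \<open>c2a\<close> to \<open>c3c\<close> are resolved together with the linear
  constraints.\<close>

lemma (in two_rays) no_four_max:
  assumes M2: "m2 \<in> M" and M3: "m3 \<in> M"
    and ne: "m2 \<noteq> m3" "m2 \<noteq> m0" "m2 \<noteq> m1" "m3 \<noteq> m0" "m3 \<noteq> m1"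
  shows False
proof -
  note M0 = tops(1) and M1 = tops(2)
  have e01: "m0 \<noteq> m1" using ne tops by auto
  have e10: "m1 \<noteq> m0" using ne tops by auto
  have e20: "m2 \<noteq> m0" using ne tops by auto
  have e21: "m2 \<noteq> m1" using ne tops by auto
  have e30: "m3 \<noteq> m0" using ne tops by auto
  have e31: "m3 \<noteq> m1" using ne tops by auto
  have n02: "m0 - m2 \<notin> S" using M_antichain M0 M1 M2 M3 ne tops by auto
  have n12: "m1 - m2 \<notin> S" using M_antichain M0 M1 M2 M3 ne tops by auto
  have n13: "m1 - m3 \<notin> S" using M_antichain M0 M1 M2 M3 ne tops by auto
  have n23: "m2 - m3 \<notin> S" using M_antichain M0 M1 M2 M3 ne tops by auto
  have n32: "m3 - m2 \<notin> S" using M_antichain M0 M1 M2 M3 ne tops by auto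
  obtain w01a w01b w01c where w01: "0 \<le> w01a" "0 \<le> w01b" "0 \<le> w01c" "rel True m0 m1 1 0 (- w01a) (- w01b) (- w01c)"
    and s01: "m0 + a0 - m1 = w01a *s b0 + w01b *s b1 + w01c *s b2"
    using edge_rel0[of m1] M1 ne tops by metis
  obtain w02a w02b w02c where w02: "0 \<le> w02a" "0 \<le> w02b" "0 \<le> w02c" "rel True m0 m2 1 0 (- w02a) (- w02b) (- w02c)"
    and s02: "m0 + a0 - m2 = w02a *s b0 + w02b *s b1 + w02c *s b2"
    using edge_rel0[of m2] M2 ne tops by metis
  obtain w03a w03b w03c where w03: "0 \<le> w03a" "0 \<le> w03b" "0 \<le> w03c" "rel True m0 m3 1 0 (- w03a) (- w03b) (- w03c)"
    and s03: "m0 + a0 - m3 = w03a *s b0 + w03b *s b1 + w03c *s b2"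
    using edge_rel0[of m3] M3 ne tops by metis
  obtain w10a w10b w10c where w10: "0 \<le> w10a" "0 \<le> w10b" "0 \<le> w10c" "rel True m1 m0 0 1 (- w10a) (- w10b) (- w10c)"
    and s10: "m1 + a1 - m0 = w10a *s b0 + w10b *s b1 + w10c *s b2"
    using edge_rel1[of m0] M0 ne tops by metis
  obtain w12a w12b w12c where w12: "0 \<le> w12a" "0 \<le> w12b" "0 \<le> w12c" "rel True m1 m2 0 1 (- w12a) (- w12b) (- w12c)"
    and s12: "m1 + a1 - m2 = w12a *s b0 + w12b *s b1 + w12c *s b2"
    using edge_rel1[of m2] M2 ne tops by metis
  obtain w13a w13b w13c where w13: "0 \<le> w13a" "0 \<le> w13b" "0 \<le> w13c" "rel True m1 m3 0 1 (- w13a) (- w13b) (- w13c)"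
    and s13: "m1 + a1 - m3 = w13a *s b0 + w13b *s b1 + w13c *s b2"
    using edge_rel1[of m3] M3 ne tops by metis
  obtain r010b r010c where r010: "0 \<le> r010b" "0 \<le> r010c" "rel (w01a \<noteq> 0) m1 0 (- 1) 0 1 (- r010b) (- r010c)"
    using row00[OF M1 _ w01(1-3) s01] ne tops by metis
  obtain r011a r011c where r011: "0 \<le> r011a" "0 \<le> r011c" "rel (w01b \<noteq> 0) m1 0 (- 1) 0 (- r011a) 1 (- r011c)"
    using row01[OF M1 _ w01(1-3) s01] ne tops by metis
  obtain r012a r012b where r012: "0 \<le> r012a" "0 \<le> r012b" "rel (w01c \<noteq> 0) m1 0 (- 1) 0 (- r012a) (- r012b) 1"
    using row02[OF M1 _ w01(1-3) s01] ne tops by metis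
  obtain r020b r020c where r020: "0 \<le> r020b" "0 \<le> r020c" "rel (w02a \<noteq> 0) m2 0 (- 1) 0 1 (- r020b) (- r020c)"
    using row00[OF M2 _ w02(1-3) s02] ne tops by metis
  obtain r021a r021c where r021: "0 \<le> r021a" "0 \<le> r021c" "rel (w02b \<noteq> 0) m2 0 (- 1) 0 (- r021a) 1 (- r021c)"
    using row01[OF M2 _ w02(1-3) s02] ne tops by metis
  obtain r022a r022b where r022: "0 \<le> r022a" "0 \<le> r022b" "rel (w02c \<noteq> 0) m2 0 (- 1) 0 (- r022a) (- r022b) 1"
    using row02[OF M2 _ w02(1-3) s02] ne tops by metis
  obtain r030b r030c where r030: "0 \<le> r030b" "0 \<le> r030c" "rel (w03a \<noteq> 0) m3 0 (- 1) 0 1 (- r030b) (- r030c)"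
    using row00[OF M3 _ w03(1-3) s03] ne tops by metis
  obtain r031a r031c where r031: "0 \<le> r031a" "0 \<le> r031c" "rel (w03b \<noteq> 0) m3 0 (- 1) 0 (- r031a) 1 (- r031c)"
    using row01[OF M3 _ w03(1-3) s03] ne tops by metis
  obtain r032a r032b where r032: "0 \<le> r032a" "0 \<le> r032b" "rel (w03c \<noteq> 0) m3 0 (- 1) 0 (- r032a) (- r032b) 1"
    using row02[OF M3 _ w03(1-3) s03] ne tops by metis
  obtain r100b r100c where r100: "0 \<le> r100b" "0 \<le> r100c" "rel (w10a \<noteq> 0) m0 0 0 (- 1) 1 (- r100b) (- r100c)"
    using row10[OF M0 _ w10(1-3) s10] ne tops by metis
  obtain r101a r101c where r101: "0 \<le> r101a" "0 \<le> r101c" "rel (w10b \<noteq> 0) m0 0 0 (- 1) (- r101a) 1 (- r101c)"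
    using row11[OF M0 _ w10(1-3) s10] ne tops by metis
  obtain r102a r102b where r102: "0 \<le> r102a" "0 \<le> r102b" "rel (w10c \<noteq> 0) m0 0 0 (- 1) (- r102a) (- r102b) 1"
    using row12[OF M0 _ w10(1-3) s10] ne tops by metis
  obtain r120b r120c where r120: "0 \<le> r120b" "0 \<le> r120c" "rel (w12a \<noteq> 0) m2 0 0 (- 1) 1 (- r120b) (- r120c)"
    using row10[OF M2 _ w12(1-3) s12] ne tops by metis
  obtain r121a r121c where r121: "0 \<le> r121a" "0 \<le> r121c" "rel (w12b \<noteq> 0) m2 0 0 (- 1) (- r121a) 1 (- r121c)"
    using row11[OF M2 _ w12(1-3) s12] ne tops by metis
  obtain r122a r122b where r122: "0 \<le> r122a" "0 \<le> r122b" "rel (w12c \<noteq> 0) m2 0 0 (- 1) (- r122a) (- r122b) 1"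
    using row12[OF M2 _ w12(1-3) s12] ne tops by metis
  obtain r130b r130c where r130: "0 \<le> r130b" "0 \<le> r130c" "rel (w13a \<noteq> 0) m3 0 0 (- 1) 1 (- r130b) (- r130c)"
    using row10[OF M3 _ w13(1-3) s13] ne tops by metis
  obtain r131a r131c where r131: "0 \<le> r131a" "0 \<le> r131c" "rel (w13b \<noteq> 0) m3 0 0 (- 1) (- r131a) 1 (- r131c)"
    using row11[OF M3 _ w13(1-3) s13] ne tops by metis
  obtain r132a r132b where r132: "0 \<le> r132a" "0 \<le> r132b" "rel (w13c \<noteq> 0) m3 0 0 (- 1) (- r132a) (- r132b) 1"
    using row12[OF M3 _ w13(1-3) s13] ne tops by metis
  have c2a: "w02a = 0 \<or> w12a = 0" using disj0[OF M2 _ _ w02(1-3) s02 w12(1-3) s12] ne by blast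
  have c2b: "w02b = 0 \<or> w12b = 0" using disj1[OF M2 _ _ w02(1-3) s02 w12(1-3) s12] ne by blast
  have c2c: "w02c = 0 \<or> w12c = 0" using disj2[OF M2 _ _ w02(1-3) s02 w12(1-3) s12] ne by blast
  have c3a: "w03a = 0 \<or> w13a = 0" using disj0[OF M3 _ _ w03(1-3) s03 w13(1-3) s13] ne by blast
  have c3b: "w03b = 0 \<or> w13b = 0" using disj1[OF M3 _ _ w03(1-3) s03 w13(1-3) s13] ne by blast
  have c3c: "w03c = 0 \<or> w13c = 0" using disj2[OF M3 _ _ w03(1-3) s03 w13(1-3) s13] ne by blast
  note forbidden =
      top10[OF tr[OF r012(3) sy[OF r122(3)]] M2 e21]
      top10[OF tr[OF r012(3) sy[OF r132(3)]] M3 e31]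
      gt[OF sy[OF tr[OF sy[OF w03(4)] w02(4)]] n23]
      gt[OF sy[OF tr[OF sy[OF w12(4)] w10(4)]] n02]
      top00[OF sy[OF tr[OF sy[OF w13(4)] w10(4)]] M3 e30]
      top11[OF sy[OF tr[OF sy[OF w02(4)] w01(4)]] M2 e21]
      top11[OF sy[OF tr[OF sy[OF w03(4)] w01(4)]] M3 e31]
      top10[OF tr[OF r011(3) sy[OF r121(3)]] M2 e21]
      top10[OF tr[OF r011(3) sy[OF r131(3)]] M3 e31]
      gt[OF tr[OF r012(3) sy[OF r032(3)]] n13]
      gt[OF tr[OF r011(3) sy[OF r021(3)]] n12]
      gt[OF sy[OF tr[OF sy[OF w13(4)] w12(4)]] n23]
      ap0[OF sy[OF tr[OF tr[OF sy[OF r020(3)] sy[OF w02(4)]] w01(4)]] M1]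
      ap0[OF sy[OF tr[OF tr[OF sy[OF r032(3)] sy[OF w03(4)]] w01(4)]] M1]
      top01[OF cy[OF w01(4) tr[OF sy[OF r030(3)] r131(3)]] M1 e10]
      top01[OF sy[OF tr[OF tr[OF r011(3) sy[OF r131(3)]] sy[OF w03(4)]]] M1 e10]
      top10[OF tr[OF r010(3) sy[OF r120(3)]] M2 e21]
      ap0[OF tr[OF tr[OF sy[OF w02(4)] w01(4)] r010(3)] M2]
      ap0[OF tr[OF tr[OF sy[OF w03(4)] w01(4)] r012(3)] M3]
      top00[OF tr[OF tr[OF w01(4) r012(3)] sy[OF r131(3)]] M3 e30]
      ap0[OF sy[OF tr[OF tr[OF sy[OF r030(3)] sy[OF w03(4)]] w01(4)]] M1]
      ap1[OF tr[OF tr[OF w03(4) sy[OF w13(4)]] r010(3)] M0]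
      ap0[OF sy[OF tr[OF tr[OF sy[OF r021(3)] sy[OF w02(4)]] w01(4)]] M1]
      irr0[OF tr[OF tr[OF r012(3) sy[OF r131(3)]] sy[OF w13(4)]]]
      ap0[OF sy[OF tr[OF tr[OF sy[OF r030(3)] sy[OF w03(4)]] w02(4)]] M2]
      top01[OF tr[OF tr[OF w02(4) r120(3)] sy[OF r030(3)]] M3 e30]
      top01[OF sy[OF tr[OF tr[OF r021(3) sy[OF r131(3)]] sy[OF w03(4)]]] M2 e20]
      top10[OF tr[OF tr[OF w12(4) r021(3)] sy[OF r131(3)]] M3 e31]
      top01[OF cy[OF w01(4) tr[OF sy[OF r030(3)] r132(3)]] M1 e10]
      top01[OF sy[OF tr[OF tr[OF r012(3) sy[OF r122(3)]] sy[OF w02(4)]]] M1 e10]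
      top01[OF sy[OF tr[OF tr[OF r012(3) sy[OF r132(3)]] sy[OF w03(4)]]] M1 e10]
      ap0[OF tr[OF tr[OF sy[OF w03(4)] w02(4)] r021(3)] M3]
      irr0[OF tr[OF tr[OF r012(3) sy[OF r120(3)]] sy[OF w12(4)]]]
      top10[OF tr[OF tr[OF w13(4) r030(3)] sy[OF r120(3)]] M2 e21]
      ap1[OF tr[OF tr[OF sy[OF w12(4)] w10(4)] r102(3)] M2]
      ap1[OF tr[OF tr[OF sy[OF w13(4)] w12(4)] r120(3)] M3]
      ap1[OF sy[OF tr[OF tr[OF sy[OF r131(3)] sy[OF w13(4)]] w12(4)]] M2]
      top11[OF sy[OF tr[OF tr[OF r030(3) sy[OF r122(3)]] sy[OF w12(4)]]] M3 e31]
      ap1[OF tr[OF tr[OF sy[OF w12(4)] w10(4)] r100(3)] M2]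
      ap1[OF tr[OF tr[OF sy[OF w13(4)] w12(4)] r122(3)] M3]
      top01[OF cy[OF w01(4) tr[OF sy[OF r020(3)] r122(3)]] M1 e10]
      top01[OF cy[OF w01(4) tr[OF sy[OF r032(3)] r131(3)]] M1 e10]
      ap1[OF tr[OF tr[OF w03(4) sy[OF w13(4)]] r012(3)] M0]
      irr1[OF tr[OF tr[OF r012(3) sy[OF r032(3)]] sy[OF w13(4)]]]
      ap1[OF tr[OF tr[OF r012(3) sy[OF r032(3)]] r131(3)] M1]
      ap0[OF tr[OF tr[OF sy[OF w03(4)] w01(4)] r011(3)] M3]
      ap0[OF sy[OF tr[OF tr[OF sy[OF r022(3)] sy[OF w02(4)]] w01(4)]] M1]
      ap0[OF cy[OF r011(3) tr[OF r030(3) sy[OF r132(3)]]] M1]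
      ap0[OF tr[OF tr[OF sy[OF w03(4)] w02(4)] r022(3)] M3]
      irr1[OF sy[OF tr[OF tr[OF w02(4) r022(3)] sy[OF r101(3)]]]]
      top01[OF cy[OF w01(4) tr[OF sy[OF r022(3)] r121(3)]] M1 e10]
      top01[OF sy[OF tr[OF tr[OF r011(3) sy[OF r121(3)]] sy[OF w02(4)]]] M1 e10]
      irr0[OF tr[OF tr[OF r011(3) sy[OF r132(3)]] sy[OF w13(4)]]]
      ap1[OF tr[OF tr[OF w02(4) sy[OF w12(4)]] r012(3)] M0]
      irr1[OF tr[OF tr[OF r012(3) sy[OF r022(3)]] sy[OF w12(4)]]]
      ap1[OF tr[OF tr[OF r012(3) sy[OF r022(3)]] r121(3)] M1]
      top10[OF tr[OF r010(3) sy[OF r130(3)]] M3 e31]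
      top01[OF cy[OF w01(4) tr[OF sy[OF r032(3)] r130(3)]] M1 e10]
      top01[OF sy[OF tr[OF tr[OF r010(3) sy[OF r130(3)]] sy[OF w03(4)]]] M1 e10]
      irr0[OF tr[OF tr[OF r010(3) sy[OF r121(3)]] sy[OF w12(4)]]]
      irr1[OF sy[OF tr[OF tr[OF w02(4) r022(3)] sy[OF r100(3)]]]]
      ap0[OF sy[OF tr[OF tr[OF sy[OF r031(3)] sy[OF w03(4)]] w02(4)]] M2]
      top01[OF tr[OF tr[OF w02(4) r121(3)] sy[OF r031(3)]] M3 e30]
      top00[OF tr[OF tr[OF w01(4) r010(3)] sy[OF r121(3)]] M2 e20]
      ap0[OF sy[OF tr[OF tr[OF sy[OF r031(3)] sy[OF w03(4)]] w01(4)]] M1]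
      top01[OF sy[OF cy[OF sy[OF w03(4)] tr[OF r022(3) sy[OF r121(3)]]]] M3 e30]
      top01[OF cy[OF w01(4) tr[OF sy[OF r022(3)] r120(3)]] M1 e10]
      top01[OF sy[OF tr[OF tr[OF r010(3) sy[OF r120(3)]] sy[OF w02(4)]]] M1 e10]
      top01[OF cy[OF w02(4) tr[OF sy[OF r031(3)] r132(3)]] M2 e20]
      ap0[OF sy[OF tr[OF tr[OF sy[OF r100(3)] w02(4)] sy[OF w12(4)]]] M1]
      top11[OF sy[OF tr[OF tr[OF r022(3) sy[OF r100(3)]] sy[OF w10(4)]]] M2 e21]
      irr0[OF tr[OF tr[OF r010(3) sy[OF r132(3)]] sy[OF w13(4)]]]
      top00[OF tr[OF tr[OF w03(4) r031(3)] sy[OF r132(3)]] M3 e30]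
      top10[OF tr[OF tr[OF w13(4) r031(3)] sy[OF r121(3)]] M2 e21]
      ap1[OF tr[OF tr[OF sy[OF w13(4)] w10(4)] r100(3)] M3]
      ap1[OF tr[OF tr[OF sy[OF w13(4)] w12(4)] r121(3)] M3]
      ap1[OF sy[OF tr[OF tr[OF sy[OF r132(3)] sy[OF w13(4)]] w12(4)]] M2]
      ap0[OF tr[OF tr[OF sy[OF w03(4)] w01(4)] r010(3)] M3]
      irr0[OF tr[OF tr[OF r011(3) sy[OF r130(3)]] sy[OF w13(4)]]]
      top10[OF tr[OF tr[OF w12(4) r022(3)] sy[OF r102(3)]] M0 e01]
      top10[OF tr[OF tr[OF w13(4) r032(3)] sy[OF r102(3)]] M0 e01]
      ap1[OF sy[OF tr[OF tr[OF sy[OF r121(3)] sy[OF w12(4)]] w10(4)]] M0]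
      ap1[OF sy[OF tr[OF tr[OF sy[OF r130(3)] sy[OF w13(4)]] w10(4)]] M0]
      gt[OF tr[OF r021(3) sy[OF r031(3)]] n23]
      gt[OF sy[OF tr[OF r021(3) sy[OF r031(3)]]] n32]
      top01[OF cy[OF w01(4) tr[OF sy[OF r031(3)] r130(3)]] M1 e10]
      top11[OF sy[OF tr[OF tr[OF r022(3) sy[OF r130(3)]] sy[OF w13(4)]]] M2 e21]
      top11[OF sy[OF tr[OF tr[OF r031(3) sy[OF r130(3)]] sy[OF w13(4)]]] M3 e31]
      ap1[OF tr[OF tr[OF sy[OF w13(4)] w10(4)] r102(3)] M3]
      ap1[OF sy[OF tr[OF tr[OF sy[OF r130(3)] sy[OF w13(4)]] w12(4)]] M2]
      ap1[OF tr[OF tr[OF w02(4) sy[OF w12(4)]] r010(3)] M0]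
      ap0[OF tr[OF tr[OF sy[OF w03(4)] w02(4)] r020(3)] M3]
      top00[OF tr[OF tr[OF w02(4) r021(3)] sy[OF r130(3)]] M3 e30]
      top00[OF tr[OF tr[OF w01(4) r011(3)] sy[OF r122(3)]] M2 e20]
      top10[OF tr[OF tr[OF w12(4) r020(3)] sy[OF r130(3)]] M3 e31]
      top01[OF cy[OF w01(4) tr[OF sy[OF r021(3)] r122(3)]] M1 e10]
      irr1[OF sy[OF tr[OF tr[OF w02(4) r021(3)] sy[OF r100(3)]]]]
      top10[OF tr[OF tr[OF w12(4) r020(3)] sy[OF r100(3)]] M0 e01]
      top10[OF tr[OF tr[OF w13(4) r030(3)] sy[OF r100(3)]] M0 e01]
      top01[OF cy[OF w01(4) tr[OF sy[OF r021(3)] r120(3)]] M1 e10]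
      irr0[OF tr[OF tr[OF r010(3) sy[OF r120(3)]] sy[OF w12(4)]]]
      irr0[OF tr[OF tr[OF r010(3) sy[OF r131(3)]] sy[OF w13(4)]]]
      irr1[OF sy[OF tr[OF tr[OF w02(4) r021(3)] sy[OF r102(3)]]]]
      ap0[OF sy[OF tr[OF tr[OF sy[OF r032(3)] sy[OF w03(4)]] w02(4)]] M2]
      ap0[OF sy[OF tr[OF tr[OF sy[OF r102(3)] w02(4)] sy[OF w12(4)]]] M1]
      ap0[OF tr[OF tr[OF sy[OF w02(4)] w01(4)] r012(3)] M2]
      top00[OF tr[OF tr[OF w01(4) r012(3)] sy[OF r120(3)]] M2 e20]
      top00[OF tr[OF tr[OF w02(4) r021(3)] sy[OF r132(3)]] M3 e30]
      top10[OF cy[OF w10(4) tr[OF r021(3) sy[OF r120(3)]]] M0 e01]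
      top10[OF tr[OF tr[OF w12(4) r021(3)] sy[OF r101(3)]] M0 e01]
      ap1[OF tr[OF tr[OF sy[OF w12(4)] w10(4)] r101(3)] M2]
      top00[OF tr[OF tr[OF w01(4) r011(3)] sy[OF r130(3)]] M3 e30]
      irr1[OF sy[OF tr[OF tr[OF w02(4) r020(3)] sy[OF r101(3)]]]]
      top01[OF cy[OF w02(4) tr[OF sy[OF r032(3)] r130(3)]] M2 e20]
      top01[OF sy[OF cy[OF sy[OF w03(4)] tr[OF r020(3) sy[OF r122(3)]]]] M3 e30]
      top01[OF sy[OF tr[OF tr[OF r020(3) sy[OF r130(3)]] sy[OF w03(4)]]] M2 e20]
      ap0[OF tr[OF tr[OF sy[OF w02(4)] w01(4)] r011(3)] M2]
      top00[OF tr[OF tr[OF w01(4) r011(3)] sy[OF r120(3)]] M2 e20]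
      irr0[OF tr[OF tr[OF r011(3) sy[OF r120(3)]] sy[OF w12(4)]]]
      top00[OF tr[OF tr[OF w02(4) r022(3)] sy[OF r131(3)]] M3 e30]
      top11[OF sy[OF tr[OF tr[OF r022(3) sy[OF r131(3)]] sy[OF w13(4)]]] M2 e21]
      top10[OF cy[OF w10(4) tr[OF r031(3) sy[OF r130(3)]]] M0 e01]
      top10[OF tr[OF tr[OF w13(4) r031(3)] sy[OF r101(3)]] M0 e01]
      top01[OF cy[OF w01(4) tr[OF sy[OF r020(3)] r121(3)]] M1 e10]
      irr0[OF tr[OF tr[OF r010(3) sy[OF r122(3)]] sy[OF w12(4)]]]
      top11[OF sy[OF tr[OF tr[OF r021(3) sy[OF r130(3)]] sy[OF w13(4)]]] M2 e21]
      top10[OF cy[OF w12(4) tr[OF r032(3) sy[OF r130(3)]]] M2 e21]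
      ap1[OF tr[OF tr[OF sy[OF w13(4)] w10(4)] r101(3)] M3]
      ap1[OF sy[OF tr[OF tr[OF sy[OF r122(3)] sy[OF w12(4)]] w10(4)]] M0]
      irr1[OF tr[OF tr[OF r010(3) sy[OF r030(3)]] sy[OF w13(4)]]]
      ap1[OF tr[OF tr[OF w02(4) sy[OF w12(4)]] r011(3)] M0]
      irr1[OF tr[OF tr[OF r011(3) sy[OF r021(3)]] sy[OF w12(4)]]]
      top00[OF tr[OF tr[OF w01(4) r012(3)] sy[OF r121(3)]] M2 e20]
      ap1[OF cy[OF r102(3) tr[OF r010(3) sy[OF r012(3)]]] M0]
      ap1[OF cy[OF r132(3) tr[OF r010(3) sy[OF r012(3)]]] M3]
      ap1[OF tr[OF tr[OF w03(4) sy[OF w13(4)]] r011(3)] M0]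
      ap0[OF sy[OF tr[OF tr[OF sy[OF r101(3)] w02(4)] sy[OF w12(4)]]] M1]
      top01[OF cy[OF w01(4) tr[OF sy[OF r031(3)] r132(3)]] M1 e10]
      irr0[OF tr[OF tr[OF r012(3) sy[OF r121(3)]] sy[OF w12(4)]]]
      top10[OF cy[OF w10(4) tr[OF r020(3) sy[OF r121(3)]]] M0 e01]
      top11[OF sy[OF tr[OF tr[OF r020(3) sy[OF r132(3)]] sy[OF w13(4)]]] M2 e21]
      top10[OF cy[OF w12(4) tr[OF r031(3) sy[OF r132(3)]]] M2 e21]
      irr0[OF tr[OF tr[OF r011(3) sy[OF r122(3)]] sy[OF w12(4)]]]
      top10[OF cy[OF w10(4) tr[OF r020(3) sy[OF r122(3)]]] M0 e01]
      top11[OF sy[OF tr[OF tr[OF r020(3) sy[OF r131(3)]] sy[OF w13(4)]]] M2 e21]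
      top10[OF cy[OF w12(4) tr[OF r032(3) sy[OF r131(3)]]] M2 e21]
      irr0[OF tr[OF tr[OF r012(3) sy[OF r102(3)]] sy[OF w10(4)]]]
      ap1[OF sy[OF cy[OF sy[OF r031(3)] tr[OF r021(3) sy[OF r120(3)]]]] M3]
      top00[OF tr[OF tr[OF w02(4) r020(3)] sy[OF r132(3)]] M3 e30]
      top01[OF sy[OF cy[OF sy[OF w03(4)] tr[OF r020(3) sy[OF r121(3)]]]] M3 e30]
      irr1[OF sy[OF tr[OF tr[OF w03(4) r031(3)] sy[OF r100(3)]]]]
      top00[OF tr[OF tr[OF w01(4) r010(3)] sy[OF r122(3)]] M2 e20]
      ap0[OF tr[OF tr[OF r010(3) sy[OF r030(3)]] r032(3)] M1]
      top01[OF cy[OF w02(4) tr[OF sy[OF r032(3)] r131(3)]] M2 e20]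
      top00[OF tr[OF tr[OF w03(4) r032(3)] sy[OF r131(3)]] M3 e30]
      ap1[OF cy[OF r102(3) tr[OF r030(3) sy[OF r032(3)]]] M0]
      irr0[OF tr[OF tr[OF r012(3) sy[OF r130(3)]] sy[OF w13(4)]]]
      irr0[OF sy[OF tr[OF tr[OF w03(4) r130(3)] sy[OF r100(3)]]]]
      ap0[OF cy[OF r032(3) tr[OF r011(3) sy[OF r012(3)]]] M3]
      ap1[OF sy[OF tr[OF tr[OF sy[OF r012(3)] r011(3)] sy[OF r101(3)]]] M0]
      ap1[OF sy[OF tr[OF tr[OF sy[OF r012(3)] r011(3)] sy[OF r131(3)]]] M3]
      ap0[OF cy[OF r011(3) tr[OF r130(3) sy[OF r131(3)]]] M1]
      irr1[OF sy[OF tr[OF tr[OF w02(4) r020(3)] sy[OF r102(3)]]]]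
      ap0[OF sy[OF tr[OF tr[OF sy[OF r101(3)] w03(4)] sy[OF w13(4)]]] M1]
      top11[OF sy[OF tr[OF tr[OF r030(3) sy[OF r102(3)]] sy[OF w10(4)]]] M3 e31]
      top00[OF cy[OF w03(4) tr[OF r022(3) sy[OF r120(3)]]] M3 e30]
      irr1[OF sy[OF tr[OF tr[OF w03(4) r032(3)] sy[OF r101(3)]]]]
      ap1[OF cy[OF r102(3) tr[OF r011(3) sy[OF r012(3)]]] M0]
      ap1[OF cy[OF r132(3) tr[OF r011(3) sy[OF r012(3)]]] M3]
      top10[OF cy[OF w13(4) tr[OF r022(3) sy[OF r120(3)]]] M3 e31]
      irr1[OF sy[OF tr[OF tr[OF w03(4) r031(3)] sy[OF r102(3)]]]]
      top11[OF sy[OF tr[OF tr[OF r031(3) sy[OF r120(3)]] sy[OF w12(4)]]] M3 e31]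
      ap1[OF sy[OF tr[OF tr[OF sy[OF r120(3)] sy[OF w12(4)]] w10(4)]] M0]
      top10[OF cy[OF w13(4) tr[OF r020(3) sy[OF r122(3)]]] M3 e31]
      top00[OF tr[OF tr[OF w03(4) r031(3)] sy[OF r130(3)]] M3 e30]
      top11[OF sy[OF tr[OF tr[OF r031(3) sy[OF r122(3)]] sy[OF w12(4)]]] M3 e31]
      top11[OF sy[OF tr[OF tr[OF r020(3) sy[OF r122(3)]] sy[OF w12(4)]]] M2 e21]
      irr0[OF tr[OF tr[OF r012(3) sy[OF r132(3)]] sy[OF w13(4)]]]
      ap1[OF sy[OF tr[OF tr[OF sy[OF r022(3)] r020(3)] sy[OF r121(3)]]] M2]
      ap1[OF cy[OF r132(3) tr[OF r020(3) sy[OF r022(3)]]] M3]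
      irr0[OF tr[OF tr[OF r011(3) sy[OF r102(3)]] sy[OF w10(4)]]]
      ap1[OF cy[OF r102(3) tr[OF r020(3) sy[OF r022(3)]]] M0]
      ap1[OF sy[OF tr[OF tr[OF sy[OF r022(3)] r020(3)] sy[OF r130(3)]]] M3]
      ap0[OF tr[OF tr[OF r020(3) sy[OF r130(3)]] r131(3)] M2]
      top01[OF cy[OF w02(4) tr[OF sy[OF r030(3)] r132(3)]] M2 e20]
      irr1[OF sy[OF tr[OF tr[OF w03(4) r030(3)] sy[OF r101(3)]]]]
      ap0[OF tr[OF tr[OF r011(3) sy[OF r021(3)]] r022(3)] M1]
      ap1[OF tr[OF tr[OF r021(3) sy[OF r022(3)]] r120(3)] M2]
      ap1[OF sy[OF tr[OF tr[OF sy[OF r131(3)] sy[OF w13(4)]] w10(4)]] M0]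
      top10[OF cy[OF w10(4) tr[OF r022(3) sy[OF r121(3)]]] M0 e01]
      top11[OF sy[OF tr[OF tr[OF r032(3) sy[OF r130(3)]] sy[OF w13(4)]]] M3 e31]
      top11[OF sy[OF tr[OF tr[OF r021(3) sy[OF r132(3)]] sy[OF w13(4)]]] M2 e21]
      ap0[OF sy[OF tr[OF tr[OF sy[OF r102(3)] w03(4)] sy[OF w13(4)]]] M1]
      top10[OF cy[OF w12(4) tr[OF r030(3) sy[OF r132(3)]]] M2 e21]
      top10[OF cy[OF w10(4) tr[OF r030(3) sy[OF r131(3)]]] M0 e01]
      ap1[OF tr[OF tr[OF r021(3) sy[OF r031(3)]] r130(3)] M2]
      top10[OF cy[OF w10(4) tr[OF r021(3) sy[OF r122(3)]]] M0 e01]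
      ap1[OF sy[OF tr[OF tr[OF sy[OF r012(3)] r010(3)] sy[OF r100(3)]]] M0]
      ap0[OF sy[OF tr[OF tr[OF sy[OF r100(3)] w03(4)] sy[OF w13(4)]]] M1]
      top11[OF sy[OF tr[OF tr[OF r032(3) sy[OF r121(3)]] sy[OF w12(4)]]] M3 e31]
      top01[OF cy[OF w02(4) tr[OF sy[OF r030(3)] r131(3)]] M2 e20]
      irr1[OF sy[OF tr[OF tr[OF w03(4) r030(3)] sy[OF r102(3)]]]]
      ap0[OF cy[OF r012(3) tr[OF r130(3) sy[OF r131(3)]]] M1]
      irr1[OF sy[OF tr[OF tr[OF w03(4) r032(3)] sy[OF r100(3)]]]]
      ap1[OF tr[OF tr[OF r100(3) sy[OF r130(3)]] r131(3)] M0]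
      ap1[OF cy[OF r121(3) tr[OF r130(3) sy[OF r131(3)]]] M2]
  show False
    using w01(1-3) w02(1-3) w03(1-3) w10(1-3) w12(1-3) w13(1-3) r010(1-2) r011(1-2) r012(1-2) r020(1-2) r021(1-2) r022(1-2) r030(1-2) r031(1-2) r032(1-2) r100(1-2) r101(1-2) r102(1-2) r120(1-2) r121(1-2) r122(1-2) r130(1-2) r131(1-2) r132(1-2)
      c2a c2b c2c c3a c3b c3c forbidden[simplified]
    by (smt (z3))
qed

section \<open>Nearly Gorenstein simplicial semigroups\<close>

context simplicial
begin

lemma mult_S_int: "0 \<le> x \<Longrightarrow> s \<in> S \<Longrightarrow> x *s s \<in> S"
  using mult_S[of s "nat x"] by simp

lemma gen_mult:
  assumes "finite H" "h \<in> H" "0 \<le> x"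
  shows "x *s h \<in> generated_semigroup H"
proof -
  have "int n *s h \<in> generated_semigroup H" for n
    by (induction n) (auto simp: gen_zero vector_sadd_rdistrib intro: gen_add gen_base assms)
  from this[of "nat x"] assms(3) show ?thesis by simp
qed

lemma gen_remove_ne: "g \<in> G \<Longrightarrow> v \<in> generated_semigroup (G - {g}) \<Longrightarrow> g \<noteq> v"
  using gen_remove by blast

lemma wt_mult_G: "g \<in> G \<Longrightarrow> 0 \<le> x \<Longrightarrow> x \<le> x * wt g"
  using wt_pos[of g] G_S zero_notin_G by (metis mult_le_cancel_left1 order_antisym_conv order_less_le)

lemma sub_generator:
  assumes "s \<in> S" "s \<noteq> 0"
  shows "\<exists>g\<in>G. s - g \<in> S"
proof -
  obtain n where n: "s = (\<Sum>g\<in>G. int (n g) *s g)" using S_sum[OF assms(1)] by blast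
  have "\<exists>g\<in>G. n g \<noteq> 0"
  proof (rule ccontr)
    assume "\<not> ?thesis"
    then show False using n assms(2) by simp
  qed
  then obtain g where g: "g \<in> G" "n g \<noteq> 0" by blast
  have "s - g = (\<Sum>h\<in>G. int (if h = g then n h - 1 else n h) *s h)"
    using sum_scale_split[of G g 1 n "\<lambda>h. h"] finite_G g n by simp
  also have "\<dots> \<in> S" by (intro sum_S mult_S G_S)
  finally show ?thesis using g by blast
qed

lemma apery_off_rays:
  assumes w: "w \<in> apery S a"
  shows "\<exists>n. w = (\<Sum>h\<in>G - range a. int (n h) *s h)"
proof -
  obtain n where n: "w = (\<Sum>g\<in>G. int (n g) *s g)" using S_sum apery_S[OF w] by blast
  have "n (a l) = 0" for l
  proof (rule ccontr)
    assume "n (a l) \<noteq> 0"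
    then have "w - a l = (\<Sum>h\<in>G. int (if h = a l then n h - 1 else n h) *s h)"
      using sum_scale_split[of G "a l" 1 n "\<lambda>h. h"] finite_G a_G n by simp
    also have "\<dots> \<in> S" by (intro sum_S mult_S G_S)
    finally show False using apery_not[OF w] by blast
  qed
  then have "w = (\<Sum>h\<in>G - range a. int (n h) *s h)" unfolding n
    by (intro sum.mono_neutral_right finite_G) auto
  then show ?thesis by blast
qed

lemma apery_three:
  assumes "w \<in> apery S a" and "G - range a = {b0, b1, b2}" and "b0 \<noteq> b1" "b1 \<noteq> b2" "b0 \<noteq> b2"
  shows "\<exists>x y z. 0 \<le> x \<and> 0 \<le> y \<and> 0 \<le> z \<and> w = x *s b0 + y *s b1 + z *s b2"
proof -
  obtain n where "w = (\<Sum>h\<in>{b0, b1, b2}. int (n h) *s h)"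
    using apery_off_rays[OF assms(1)] unfolding assms(2) by blast
  then have "w = int (n b0) *s b0 + int (n b1) *s b1 + int (n b2) *s b2"
    using assms(3-5) by (simp add: add.assoc)
  then show ?thesis by (intro exI[of _ "int (n b0)"] exI[of _ "int (n b1)"] exI[of _ "int (n b2)"]) simp
qed

text \<open>\<open>m + g\<close> lies strictly above the maximal element \<open>m\<close>, so it
  cannot be Apery and some ray can be subtracted.\<close>

lemma max_add_generator:
  assumes m: "m \<in> max_apery S a" and g: "g \<in> G"
  shows "\<exists>i. m + g - a i \<in> S"
proof (rule ccontr)
  assume n: "\<not> ?thesis"
  have "m + g \<in> S" using add_S G_S[OF g] apery_S max_apery_sub[OF m] by blast
  then have "m + g \<in> apery S a" using n by (auto simp: apery_def)
  moreover have "semigroup_le S m (m + g)" using G_S[OF g] by (simp add: semigroup_le_def)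
  ultimately have "m + g = m" using m by (auto simp: max_apery_def)
  then show False using g zero_notin_G by simp
qed

lemma finite_max: "finite (max_apery S a)"
  using finite_apery by (rule finite_subset[rotated]) (auto simp: max_apery_def)

lemma max_nonempty: "max_apery S a \<noteq> {}"
  using below_max[OF zero_apery] by blast

lemma type_card: "semigroup_type S a = card (max_apery S a)"
proof -
  have "quasi_frobenius S a = (\<lambda>m. m - (\<Sum>i\<in>UNIV. a i)) ` max_apery S a"
    by (auto simp: quasi_frobenius_def)
  then show ?thesis unfolding semigroup_type_def by (simp add: card_image inj_on_def)
qed

end

text \<open>\<open>top g\<close> is the maximal Apery element \<open>m\<close> with \<open>g + m - m' \<in> S\<close> for all maximal \<open>m'\<close>: writing
  \<open>g = (s - f) + z\<close> with \<open>z \<in> canonical_inverse S a\<close>, irreducibility of \<open>g\<close> forces \<open>s = 0\<close>.\<close>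

locale nearly_gorenstein_semigroup = simplicial S G a for S G :: "(int ^ 'd) set" and a +
  assumes trace: "S - {0} \<subseteq> canonical_trace S a"
    and several: "\<exists>m\<in>max_apery S a. \<exists>m'\<in>max_apery S a. m \<noteq> m'"
    and saturated: "i \<noteq> j \<Longrightarrow> s + a i \<in> S \<Longrightarrow> s + a j \<in> S \<Longrightarrow> s \<in> S"
begin

abbreviation "M \<equiv> max_apery S a"

lemma M_S: "m \<in> M \<Longrightarrow> m \<in> S" using max_apery_sub apery_S by blast
lemma M_not: "m \<in> M \<Longrightarrow> m - a i \<notin> S" using max_apery_sub apery_not by blast

lemma top_exists:
  assumes g: "g \<in> G"
  shows "\<exists>m\<in>M. \<forall>m'\<in>M. g + m - m' \<in> S"
proof -
  let ?e = "\<Sum>i\<in>UNIV. a i"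
  have "g \<in> canonical_trace S a" using g G_S zero_notin_G trace by blast
  then obtain w z where wz: "w \<in> canonical S a" "z \<in> canonical_inverse S a" "g = w + z"
    by (auto simp: canonical_trace_def)
  obtain m s where ms: "m \<in> M" "s \<in> S" "w = - (m - ?e) + s"
    using wz(1) by (auto simp: canonical_def quasi_frobenius_def)
  have z: "z - (m' - ?e) \<in> S" if "m' \<in> M" for m'
  proof -
    have "- (m' - ?e) + 0 \<in> canonical S a"
      unfolding canonical_def quasi_frobenius_def using that zero_S by blast
    then have "z + (- (m' - ?e) + 0) \<in> S" using wz(2) unfolding canonical_inverse_def by blast
    then show ?thesis by (simp add: algebra_simps)
  qed
  have "g = s + (z - (m - ?e))" using wz ms by (simp add: algebra_simps)
  from irreducible[OF g ms(2) z[OF ms(1)] this] have "s = 0"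
  proof
    \<comment> \<open>In this case \<open>m\<close> would lie above every maximal Apery element, so
      it would be the only one.\<close>
    assume "z - (m - ?e) = 0"
    then have "z = m - ?e" by simp
    then have "m - m' \<in> S" if "m' \<in> M" for m' using z[OF that] by simp
    then have "m' = m" if "m' \<in> M" for m' using max_antichain[OF that ms(1)] that by blast
    then show ?thesis using several by metis
  qed
  then have "g + m - m' \<in> S" if "m' \<in> M" for m' using z[OF that] wz ms by (simp add: algebra_simps)
  then show ?thesis using ms(1) by blast
qed

definition top :: "int ^ 'd \<Rightarrow> int ^ 'd" where
  "top g = (SOME m. m \<in> M \<and> (\<forall>m'\<in>M. g + m - m' \<in> S))"

lemma top: "g \<in> G \<Longrightarrow> top g \<in> M" "g \<in> G \<Longrightarrow> m \<in> M \<Longrightarrow> g + top g - m \<in> S"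
proof -
  assume g: "g \<in> G"
  have "\<exists>m. m \<in> M \<and> (\<forall>m'\<in>M. g + m - m' \<in> S)" using top_exists[OF g] by blast
  then have *: "top g \<in> M \<and> (\<forall>m'\<in>M. g + top g - m' \<in> S)" unfolding top_def by (rule someI_ex)
  then show "top g \<in> M" by blast
  show "g + top g - m \<in> S" if "m \<in> M" using * that by blast
qed

lemma top_a: "m \<in> M \<Longrightarrow> top (a i) + a i - m \<in> S"
  using top(2)[OF a_G, of m i] by (simp add: add.commute)

lemma M_antichain: "m \<in> M \<Longrightarrow> m' \<in> M \<Longrightarrow> m \<noteq> m' \<Longrightarrow> m - m' \<notin> S"
  using max_antichain by blast

lemma tops_distinct:
  assumes "i \<noteq> j"
  shows "top (a i) \<noteq> top (a j)"
proof
  assume eq: "top (a i) = top (a j)"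
  let ?m = "top (a i)"
  have mM: "?m \<in> M" using top a_G by blast
  obtain m' where m': "m' \<in> M" "m' \<noteq> ?m" using several by metis
  have "(?m - m') + a i \<in> S" "(?m - m') + a j \<in> S" using top_a[OF m'(1), of i] top_a[OF m'(1), of j] eq
    by (simp_all add: algebra_simps)
  then have "?m - m' \<in> S" using saturated[OF assms] by blast
  then show False using M_antichain mM m' by metis
qed

lemma rank_le_card: "CARD('d) \<le> card M"
proof -
  have "inj (\<lambda>i. top (a i))" using tops_distinct by (auto simp: inj_def)
  moreover have "range (\<lambda>i. top (a i)) \<subseteq> M" using top a_G by blast
  ultimately show ?thesis using card_inj_on_le[OF _ _ finite_max] by blast
qed

text \<open>Both \<open>a i\<close> and \<open>a l\<close> bring \<open>m - a l\<close> into
  \<open>S\<close>; for distinct rays saturation contradicts that \<open>m\<close> is Apery.\<close>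

lemma unique_ray:
  assumes m: "m \<in> M" "m' \<in> M" "m' \<noteq> m" and l: "m + a i - a l \<in> S"
  shows "l = i"
proof (rule ccontr)
  assume "l \<noteq> i"
  have "m - a l \<in> S"
    by (rule saturated[OF \<open>l \<noteq> i\<close>]) (use l M_S[OF m(1)] in \<open>simp_all add: algebra_simps\<close>)
  then show False using M_not m by blast
qed

text \<open>If a ray \<open>a l\<close> could be subtracted from the difference, adding
  \<open>m\<close> would make it subtractable from \<open>top (a i) + a i\<close>, so
  \<open>l = i\<close>. Then \<open>top (a i) - m\<close> would be in \<open>S\<close>, against the
  antichain property.\<close>

lemma edge_apery:
  assumes m: "m \<in> M" "m \<noteq> top (a i)"
  shows "top (a i) + a i - m \<in> apery S a"
proof -
  have t: "top (a i) \<in> M" using top a_G by blast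
  have "top (a i) + a i - m - a l \<notin> S" for l
  proof
    assume w: "top (a i) + a i - m - a l \<in> S"
    from add_S[OF w M_S[OF m(1)]] have "top (a i) + a i - a l \<in> S" by (simp add: algebra_simps)
    then have "l = i" using unique_ray[OF t m] by blast
    then have "top (a i) - m \<in> S" using w by (simp add: algebra_simps)
    then show False using M_antichain[OF t m(1)] m(2) by blast
  qed
  then show ?thesis using top_a[OF m(1)] by (auto simp: apery_def)
qed

text \<open>Some ray can be subtracted from \<open>m + b\<close>; adding the rest of the edge to the
  result shows that this ray is \<open>a i\<close>. If a ray could be subtracted once more, it would
  again be \<open>a i\<close>, and the rest of the edge would produce \<open>top (a i) - a i\<close>
  in \<open>S\<close>.\<close>

lemma back_apery:
  assumes m: "m \<in> M" "m \<noteq> top (a i)" and b: "b \<in> G" and t: "top (a i) + a i - m - b \<in> S"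
  shows "m + b - a i \<in> apery S a" and "m + b - a l \<in> S \<Longrightarrow> l = i"
proof -
  have T: "top (a i) \<in> M" using top a_G by blast
  have l: "l = i" if "m + b - a l \<in> S" for l
  proof -
    from add_S[OF that t] have "top (a i) + a i - a l \<in> S" by (simp add: algebra_simps)
    then show ?thesis using unique_ray[OF T m] by blast
  qed
  show "m + b - a l \<in> S \<Longrightarrow> l = i" using l .
  obtain k where "m + b - a k \<in> S" using max_add_generator[OF m(1) b] by blast
  then have S: "m + b - a i \<in> S" using l by metis
  have "m + b - a i - a l \<notin> S" for l
  proof
    assume w: "m + b - a i - a l \<in> S"
    from add_S[OF this a_S[of i]] have "m + b - a l \<in> S" by (simp add: algebra_simps)
    then have li: "l = i" using l by blast
    from add_S[OF w t] have "top (a i) - a i \<in> S" by (simp add: li algebra_simps)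
    then show False using M_not[OF T] by blast
  qed
  then show "m + b - a i \<in> apery S a" using S by (auto simp: apery_def)
qed

lemma two_elements:
  assumes "finite A" "2 \<le> card A"
  shows "\<exists>x\<in>A. \<exists>y\<in>A. x \<noteq> y"
  using card_le_Suc0_iff_eq[OF assms(1)] assms(2) by fastforce

lemma card_le_three_rank:
  fixes i j :: 'd
  assumes ij: "i \<noteq> j" and cG: "card G = CARD('d) + 3"
  shows "card M \<le> 3"
proof (rule ccontr)
  assume c: "\<not> card M \<le> 3"
  have "card {top (a i), top (a j)} = 2" using tops_distinct[OF ij] by simp
  moreover have "card M - card {top (a i), top (a j)} \<le> card (M - {top (a i), top (a j)})"
    by (rule diff_card_le_card_Diff) simp
  ultimately have "2 \<le> card (M - {top (a i), top (a j)})" using c by linarith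
  then obtain m2 m3 where m: "m2 \<in> M - {top (a i), top (a j)}" "m3 \<in> M - {top (a i), top (a j)}" "m2 \<noteq> m3"
    using two_elements finite_max by (metis finite_Diff)
  have "card (range a) = CARD('d)" by (simp add: card_image inj_a)
  then have "card (G - range a) = 3" using cG a_G finite_G by (subst card_Diff_subset) auto
  then obtain b0 b1 b2 where b: "G - range a = {b0, b1, b2}" "b0 \<noteq> b1" "b1 \<noteq> b2" "b0 \<noteq> b2"
    unfolding card_3_iff by blast
  have bG: "b0 \<in> G" "b1 \<in> G" "b2 \<in> G" "b0 \<noteq> a k" "b1 \<noteq> a k" "b2 \<noteq> a k" for k using b(1) by blast+
  have aij: "a i \<noteq> a j" using inj_a ij by (auto dest: injD)
  note ne = bG(4-6) aij b(2-4) bG(4-6)[symmetric] aij[symmetric] b(2-4)[symmetric]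
  have three: "\<exists>x y z. 0 \<le> x \<and> 0 \<le> y \<and> 0 \<le> z \<and> w = x *s b0 + y *s b1 + z *s b2" if "w \<in> apery S a" for w
    using apery_three[OF that b] .
  have tM: "top (a i) \<in> M" "top (a j) \<in> M" using top a_G by blast+
  have edge: "\<exists>x y z. 0 \<le> x \<and> 0 \<le> y \<and> 0 \<le> z \<and> top (a k) + a k = m + (x *s b0 + y *s b1 + z *s b2)"
    if "m \<in> M" "m \<noteq> top (a k)" for m k
    using three[OF edge_apery[OF that]] by (simp add: diff_eq_eq add.commute)
  have backward: "\<exists>x y z. 0 \<le> x \<and> 0 \<le> y \<and> 0 \<le> z \<and> m + b = a k + (x *s b0 + y *s b1 + z *s b2)"
    if "m \<in> M" "m \<noteq> top (a k)" "b \<in> {b0, b1, b2}" "top (a k) + a k - m - b \<in> S" for m k b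
    using three[OF back_apery(1)[OF that(1,2) _ that(4)]] that(3) bG by (auto simp: diff_eq_eq add.commute)
  interpret two_rays S M "a i" "a j" b0 b1 b2 "top (a i)" "top (a j)"
  proof
    fix x0 x1 x2 x3 x4 :: int
    assume x: "0 \<le> x0" "0 \<le> x1" "0 \<le> x2" "0 \<le> x3" "0 \<le> x4"
    show "x0 *s a i + x1 *s a j + x2 *s b0 + x3 *s b1 + x4 *s b2 \<in> S"
      using x by (intro add_S mult_S_int a_S G_S bG)
    assume "x0 *s a i + x1 *s a j + x2 *s b0 + x3 *s b1 + x4 *s b2 = 0"
    then have "wt (x0 *s a i + x1 *s a j + x2 *s b0 + x3 *s b1 + x4 *s b2) = 0" by (simp add: wt_zero)
    then have "x0 * wt (a i) + x1 * wt (a j) + x2 * wt b0 + x3 * wt b1 + x4 * wt b2 = 0"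
      by (simp add: wt_add wt_mult)
    then show "x0 = 0 \<and> x1 = 0 \<and> x2 = 0 \<and> x3 = 0 \<and> x4 = 0"
      using wt_mult_G[OF a_G x(1), of i] wt_mult_G[OF a_G x(2), of j] wt_mult_G[OF bG(1) x(3)]
        wt_mult_G[OF bG(2) x(4)] wt_mult_G[OF bG(3) x(5)] x by linarith
  next
    fix x1 x2 x3 x4 :: int
    assume x: "0 \<le> x1" "0 \<le> x2" "0 \<le> x3" "0 \<le> x4"
    show "a i \<noteq> x1 *s a j + x2 *s b0 + x3 *s b1 + x4 *s b2"
      using x finite_G a_G bG ne by (intro gen_remove_ne a_G gen_add gen_mult) auto
    show "a j \<noteq> x1 *s a i + x2 *s b0 + x3 *s b1 + x4 *s b2"
      using x finite_G a_G bG ne by (intro gen_remove_ne a_G gen_add gen_mult) auto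
    show "b0 \<noteq> x1 *s a i + x2 *s a j + x3 *s b1 + x4 *s b2"
      using x finite_G a_G bG ne by (intro gen_remove_ne bG gen_add gen_mult) auto
    show "b1 \<noteq> x1 *s a i + x2 *s a j + x3 *s b0 + x4 *s b2"
      using x finite_G a_G bG ne by (intro gen_remove_ne bG gen_add gen_mult) auto
    show "b2 \<noteq> x1 *s a i + x2 *s a j + x3 *s b0 + x4 *s b1"
      using x finite_G a_G bG ne by (intro gen_remove_ne bG gen_add gen_mult) auto
  next
    fix m b
    assume m: "m \<in> M" "m \<noteq> top (a i)" "m \<noteq> top (a j)" and bb: "b \<in> {b0, b1, b2}"
    then have bG': "b \<in> G" using bG by blast
    show "top (a i) + a i - m - b \<notin> S \<or> top (a j) + a j - m - b \<notin> S"
    \<comment> \<open>If \<open>b\<close> were contained in both edges, the first would put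
      \<open>m + b - a i\<close> into \<open>S\<close>, and the second would then identify ray
      \<open>i\<close> with ray \<open>j\<close>.\<close>
    proof (rule ccontr)
      assume "\<not> ?thesis"
      then have t: "top (a i) + a i - m - b \<in> S" "top (a j) + a j - m - b \<in> S" by auto
      have "m + b - a i \<in> S" using back_apery(1)[OF m(1,2) bG' t(1)] apery_S by blast
      then show False using back_apery(2)[OF m(1,3) bG' t(2)] ij by blast
    qed
  next
    show "s + t \<in> S" if "s \<in> S" "t \<in> S" for s t using add_S[OF that] .
    show "z \<in> S" if "z + a i \<in> S" "z + a j \<in> S" for z using saturated[OF ij that] .
    show "m \<in> S" "m - a i \<notin> S" "m - a j \<notin> S" if "m \<in> M" for m using M_S[OF that] M_not[OF that, of i] M_not[OF that, of j] .
    show "m - m' \<notin> S" if "m \<in> M" "m' \<in> M" "m \<noteq> m'" for m m' using M_antichain[OF that] .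
    show "top (a i) \<in> M" "top (a j) \<in> M" "top (a i) \<noteq> top (a j)" using tM tops_distinct[OF ij] .
    show "\<exists>x y z. 0 \<le> x \<and> 0 \<le> y \<and> 0 \<le> z \<and> top (a i) + a i = m + (x *s b0 + y *s b1 + z *s b2)" if "m \<in> M" "m \<noteq> top (a i)" for m
      using edge[OF that] .
    show "\<exists>x y z. 0 \<le> x \<and> 0 \<le> y \<and> 0 \<le> z \<and> m + b = a i + (x *s b0 + y *s b1 + z *s b2)"
      if "m \<in> M" "m \<noteq> top (a i)" "b \<in> {b0, b1, b2}" "top (a i) + a i - m - b \<in> S" for m b
      using backward[OF that] .
    show "\<exists>x y z. 0 \<le> x \<and> 0 \<le> y \<and> 0 \<le> z \<and> top (a j) + a j = m + (x *s b0 + y *s b1 + z *s b2)" if "m \<in> M" "m \<noteq> top (a j)" for m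
      using edge[OF that] .
    show "\<exists>x y z. 0 \<le> x \<and> 0 \<le> y \<and> 0 \<le> z \<and> m + b = a j + (x *s b0 + y *s b1 + z *s b2)"
      if "m \<in> M" "m \<noteq> top (a j)" "b \<in> {b0, b1, b2}" "top (a j) + a j - m - b \<in> S" for m b
      using backward[OF that] .
  qed
  show False using no_four_max[of m2 m3] m by blast
qed

end

subsection \<open>Numerical semigroups with four generators\<close>

locale four_generated = nearly_gorenstein_semigroup S G a for S G :: "(int ^ 'd) set" and a +
  fixes e :: "int ^ 'd"
  assumes rank_one: "range a = {e}" and card_G: "card G = 4" and card_M: "4 \<le> card M"
begin

text \<open>The pseudo-Frobenius elements: with \<open>e\<close> as the only ray these are the
  elements of \<open>quasi_frobenius\<close>.\<close>

definition "F = (\<lambda>m. m - e) ` M"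
definition "nu g = top g - e"

lemma a_e: "a i = e" using rank_one by blast
lemma e_G: "e \<in> G" using a_G a_e by metis
lemma nu_F: "g \<in> G \<Longrightarrow> nu g \<in> F" using top by (auto simp: F_def nu_def)
lemma nu_top: "g \<in> G \<Longrightarrow> f \<in> F \<Longrightarrow> nu g - f + g \<in> S"
  using top(2)[of g] by (auto simp: F_def nu_def algebra_simps)

lemma card_F: "4 \<le> card F" "finite F"
  using card_M finite_max by (auto simp: F_def card_image inj_on_def)

lemma F_new:
  assumes "card X < 4" "finite X"
  shows "\<exists>f\<in>F. f \<notin> X"
  using card_mono[OF assms(2), of F] assms(1) card_F(1) by fastforce

lemma F_notin_S: "f \<in> F \<Longrightarrow> f \<notin> S"
  using M_not a_e by (auto simp: F_def)

lemma F_anti: "f \<in> F \<Longrightarrow> g \<in> F \<Longrightarrow> f \<noteq> g \<Longrightarrow> f - g \<notin> S"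
  using M_antichain by (auto simp: F_def)

lemma F_add: "f \<in> F \<Longrightarrow> g \<in> G \<Longrightarrow> f + g \<in> S"
  using max_add_generator a_e by (auto simp: F_def algebra_simps)

text \<open>Otherwise the generator \<open>e\<close> would be the sum of \<open>m\<close> and
  \<open>- f\<close>. Irreducibility leaves \<open>f = 0\<close>, impossible as \<open>f\<close> is
  not in \<open>S\<close>, or \<open>m = 0\<close>, impossible as 0 lies below every other maximal
  element.\<close>

lemma F_uminus:
  assumes "f \<in> F"
  shows "- f \<notin> S"
proof
  assume f: "- f \<in> S"
  obtain m where m: "m \<in> M" "f = m - e" using assms by (auto simp: F_def)
  have "e = m + (- f)" using m by simp
  from irreducible[OF e_G M_S[OF m(1)] f this] show False
  proof
    assume m0: "m = 0"
    obtain m' where "m' \<in> M" "m' \<noteq> m" using several by metis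
    then show False using M_antichain[of m' m] M_S m m0 by auto
  next
    assume "- f = 0"
    then show False using F_notin_S[OF assms] zero_S by simp
  qed
qed

text \<open>An ordering of the generators; each partition type of the values of \<open>nu\<close> is
  treated in one fixed order.\<close>

definition enum :: "int ^ 'd \<Rightarrow> int ^ 'd \<Rightarrow> int ^ 'd \<Rightarrow> int ^ 'd \<Rightarrow> bool" where
  "enum n0 n1 n2 n3 \<longleftrightarrow> G = {n0, n1, n2, n3} \<and> distinct [n0, n1, n2, n3]"

lemma enum_four:
  assumes "enum n0 n1 n2 n3"
  shows "four_gens S F n0 n1 n2 n3"
proof -
  have G: "G = {n0, n1, n2, n3}" and nG: "n0 \<in> G" "n1 \<in> G" "n2 \<in> G" "n3 \<in> G"
    and ne: "n0 \<noteq> n1" "n0 \<noteq> n2" "n0 \<noteq> n3" "n1 \<noteq> n2" "n1 \<noteq> n3" "n2 \<noteq> n3"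
    "n1 \<noteq> n0" "n2 \<noteq> n0" "n3 \<noteq> n0" "n2 \<noteq> n1" "n3 \<noteq> n1" "n3 \<noteq> n2"
    using assms by (auto simp: enum_def)
  show ?thesis
  proof
    fix s
    show "s \<in> S \<longleftrightarrow> (\<exists>x0 x1 x2 x3. 0 \<le> x0 \<and> 0 \<le> x1 \<and> 0 \<le> x2 \<and> 0 \<le> x3 \<and>
      s = x0 *s n0 + x1 *s n1 + x2 *s n2 + x3 *s n3)"
    proof
      assume "s \<in> S"
      then obtain n where "s = (\<Sum>h\<in>{n0, n1, n2, n3}. int (n h) *s h)" using S_sum unfolding G by blast
      then have "s = int (n n0) *s n0 + int (n n1) *s n1 + int (n n2) *s n2 + int (n n3) *s n3"
        using ne by (simp add: add.assoc)
      then show "\<exists>x0 x1 x2 x3. 0 \<le> x0 \<and> 0 \<le> x1 \<and> 0 \<le> x2 \<and> 0 \<le> x3 \<and>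
        s = x0 *s n0 + x1 *s n1 + x2 *s n2 + x3 *s n3"
        by (intro exI[of _ "int (n n0)"] exI[of _ "int (n n1)"] exI[of _ "int (n n2)"] exI[of _ "int (n n3)"]) simp
    next
      assume "\<exists>x0 x1 x2 x3. 0 \<le> x0 \<and> 0 \<le> x1 \<and> 0 \<le> x2 \<and> 0 \<le> x3 \<and>
        s = x0 *s n0 + x1 *s n1 + x2 *s n2 + x3 *s n3"
      then show "s \<in> S" by (elim exE conjE) (simp add: add_S mult_S_int G_S nG)
    qed
  next
    fix x0 x1 x2 x3 :: int
    assume x: "0 \<le> x0" "0 \<le> x1" "0 \<le> x2" "0 \<le> x3"
      and "x0 *s n0 + x1 *s n1 + x2 *s n2 + x3 *s n3 = 0"
    then have "wt (x0 *s n0 + x1 *s n1 + x2 *s n2 + x3 *s n3) = 0" by (simp add: wt_zero)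
    then have "x0 * wt n0 + x1 * wt n1 + x2 * wt n2 + x3 * wt n3 = 0" by (simp add: wt_add wt_mult)
    then show "x0 = 0 \<and> x1 = 0 \<and> x2 = 0 \<and> x3 = 0"
      using wt_mult_G[OF nG(1) x(1)] wt_mult_G[OF nG(2) x(2)] wt_mult_G[OF nG(3) x(3)] wt_mult_G[OF nG(4) x(4)] x
      by linarith
  next
    fix x1 x2 x3 :: int
    assume x: "0 \<le> x1" "0 \<le> x2" "0 \<le> x3"
    show "n0 \<noteq> x1 *s n1 + x2 *s n2 + x3 *s n3"
      using x finite_G nG ne by (intro gen_remove_ne nG gen_add gen_mult) auto
    show "n1 \<noteq> x1 *s n0 + x2 *s n2 + x3 *s n3"
      using x finite_G nG ne by (intro gen_remove_ne nG gen_add gen_mult) auto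
    show "n2 \<noteq> x1 *s n0 + x2 *s n1 + x3 *s n3"
      using x finite_G nG ne by (intro gen_remove_ne nG gen_add gen_mult) auto
    show "n3 \<noteq> x1 *s n0 + x2 *s n1 + x3 *s n2"
      using x finite_G nG ne by (intro gen_remove_ne nG gen_add gen_mult) auto
  next
    show "f \<notin> S" "- f \<notin> S" "f + n0 \<in> S" "f + n1 \<in> S" "f + n2 \<in> S" "f + n3 \<in> S" if "f \<in> F" for f
      using F_notin_S[OF that] F_uminus[OF that] F_add[OF that nG(1)] F_add[OF that nG(2)]
        F_add[OF that nG(3)] F_add[OF that nG(4)] .
    show "f - g \<notin> S" if "f \<in> F" "g \<in> F" "f \<noteq> g" for f g using F_anti[OF that] .
  qed
qed

lemma enum_distinct:
  assumes "enum n0 n1 n2 n3" "distinct [nu n0, nu n1, nu n2, nu n3]"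
  shows False
proof -
  have n: "n0 \<in> G" "n1 \<in> G" "n2 \<in> G" "n3 \<in> G" using assms(1) by (auto simp: enum_def)
  show False
    by (rule four_gens.pattern_0123_false[OF enum_four[OF assms(1)] _ _ _ _ assms(2)])
      (use n in \<open>auto intro: nu_F nu_top\<close>)
qed

text \<open>Partition type 2 + 1 + 1; a fourth element of \<open>F\<close> fills the last place of
  the pattern.\<close>

lemma enum_one_pair:
  assumes e: "enum n0 n1 n2 n3" and eq: "nu n0 = nu n1" and d: "distinct [nu n0, nu n2, nu n3]"
  shows False
proof -
  have n: "n0 \<in> G" "n1 \<in> G" "n2 \<in> G" "n3 \<in> G" using e by (auto simp: enum_def)
  have "card {nu n0, nu n2, nu n3} < 4" using d by simp
  then obtain f where f: "f \<in> F" "f \<notin> {nu n0, nu n2, nu n3}" using F_new by blast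
  show False
    by (rule four_gens.pattern_0012_false[OF enum_four[OF e], of "nu n0" "nu n2" "nu n3" f])
      (use n f d eq nu_top[of n0] nu_top[of n1] nu_top[of n2] nu_top[of n3] in \<open>auto intro: nu_F nu_top\<close>)
qed

text \<open>Partition types 2 + 2 and 3 + 1; two further elements of \<open>F\<close> complete the
  patterns.\<close>

lemma enum_two_values:
  assumes e: "enum n0 n1 n2 n3" and eq: "nu n0 = nu n1" and d: "nu n0 \<noteq> nu n3" "nu n2 = nu n3 \<or> nu n2 = nu n0"
  shows False
proof -
  have n: "n0 \<in> G" "n1 \<in> G" "n2 \<in> G" "n3 \<in> G" using e by (auto simp: enum_def)
  have "card {nu n0, nu n3} < 4" using d by simp
  then obtain f where f: "f \<in> F" "f \<notin> {nu n0, nu n3}" using F_new by blast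
  have "card {nu n0, nu n3, f} < 4" by (simp add: card_insert_if)
  then obtain f' where f': "f' \<in> F" "f' \<notin> {nu n0, nu n3, f}" using F_new by blast
  have ds: "distinct [nu n0, nu n3, f, f']" using d f f' by auto
  from d(2) show False
  proof
    assume e2: "nu n2 = nu n3"
    show False
      by (rule four_gens.pattern_0011_false[OF enum_four[OF e], OF _ _ _ _ ds])
        (use n f f' eq e2 nu_top[of n0] nu_top[of n1] nu_top[of n2] nu_top[of n3] in \<open>auto intro: nu_F nu_top\<close>)
  next
    assume e2: "nu n2 = nu n0"
    show False
      by (rule four_gens.pattern_0001_false[OF enum_four[OF e], OF _ _ _ _ ds])
        (use n f f' eq e2 nu_top[of n0] nu_top[of n1] nu_top[of n2] nu_top[of n3] in \<open>auto intro: nu_F nu_top\<close>)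
  qed
qed

text \<open>If all the \<open>nu g\<close> coincide, \<open>f \<mapsto> f0 - f\<close> is an involution of \<open>F - {f0}\<close>.\<close>

lemma enum_constant:
  assumes c: "\<And>g. g \<in> G \<Longrightarrow> nu g = f0"
  shows False
proof -
  have f0: "f0 \<in> F" using nu_F[OF e_G] c[OF e_G] by simp
  have inv: "f0 - f \<in> F" if f: "f \<in> F" "f \<noteq> f0" for f
  proof -
    have nS: "f0 - f \<notin> S" using F_anti[OF f0 f(1)] f(2) by blast
    have pS: "f0 - f + g \<in> S" if "g \<in> G" for g using nu_top[OF that f(1)] c[OF that] by simp
    let ?m = "f0 - f + e"
    have m: "?m \<in> apery S a" using pS[OF e_G] nS by (auto simp: apery_def a_e)
    obtain m' where m': "m' \<in> M" "m' - ?m \<in> S" using below_max[OF m] by blast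
    \<comment> \<open>If \<open>m'\<close> were strictly above \<open>?m\<close>, a generator could
      be subtracted from the difference, and \<open>pS\<close> for this generator would give
      \<open>m' - e\<close> in \<open>S\<close>.\<close>
    have "m' = ?m"
    proof (rule ccontr)
      assume "m' \<noteq> ?m"
      then obtain g where g: "g \<in> G" "m' - ?m - g \<in> S" using sub_generator[OF m'(2)] by auto
      from add_S[OF pS[OF g(1)] g(2)] have "m' - e \<in> S" by (simp add: algebra_simps)
      then show False using M_not[OF m'(1)] a_e by metis
    qed
    then show ?thesis using m'(1) by (auto simp: F_def image_iff intro!: bexI[of _ m'])
  qed
  \<comment> \<open>The involution has at most one fixed point, so one of the two elements
    \<open>x\<close>, \<open>y\<close> below is not fixed.\<close>
  have half: "x = y" if "x + x = f0" "y + y = f0" for x y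
  proof -
    have "x $ i = y $ i" for i
      using arg_cong[OF that(1), of "\<lambda>v. v $ i"] arg_cong[OF that(2), of "\<lambda>v. v $ i"] by simp
    then show ?thesis by (simp add: vec_eq_iff)
  qed
  obtain x where x: "x \<in> F" "x \<notin> {f0}" using F_new[of "{f0}"] by auto
  have "card {f0, x} < 4" using x by simp
  then obtain y where y: "y \<in> F" "y \<notin> {f0, x}" using F_new by blast
  have "\<exists>f1\<in>F. f1 \<noteq> f0 \<and> f1 + f1 \<noteq> f0" using half[of x y] x y by blast
  then obtain f1 where f1: "f1 \<in> F" "f1 \<noteq> f0" "f1 + f1 \<noteq> f0" by blast
  have ne: "f1 \<noteq> f0 - f1" using f1(3) by (auto simp: eq_diff_eq)
  have "card {f0, f1, f0 - f1} \<le> 3" using card_insert_le_m1[of 3 "{f1, f0 - f1}" f0] by (simp add: card_insert_if)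
  \<comment> \<open>\<open>f3\<close> may be the fixed point; \<open>symmetric_false\<close> allows
    this.\<close>
  then obtain f3 where f3: "f3 \<in> F" "f3 \<notin> {f0, f1, f0 - f1}" using F_new[of "{f0, f1, f0 - f1}"] by auto
  have z: "f \<noteq> 0" if "f \<in> F" for f using F_notin_S[OF that] zero_S by metis
  obtain n0 n1 n2 n3 where "enum n0 n1 n2 n3"
  proof -
    have "card (G - {e}) = 3" using card_G finite_G e_G by simp
    then obtain x y z where "G - {e} = {x, y, z}" "x \<noteq> y" "y \<noteq> z" "x \<noteq> z" unfolding card_3_iff by blast
    then have "enum e x y z" using e_G by (auto simp: enum_def)
    then show thesis using that by blast
  qed
  then have fg: "four_gens S F n0 n1 n2 n3" by (rule enum_four)
  show False
  proof (rule four_gens.symmetric_false[OF fg f1(1) inv[OF f1(1,2)] f3(1) inv[OF f3(1)] f0])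
    show "f3 \<noteq> f0" "f1 \<noteq> f0 - f1" "f1 \<noteq> f3" "f0 - f1 \<noteq> f3" using f3 ne by auto
    show "f0 \<notin> {f1, f0 - f1, f3, f0 - f3}" using f1 f3 z[OF f1(1)] z[OF f3(1)] by auto
  qed simp_all
qed

text \<open>The values of \<open>nu\<close> on the four generators realize one of the partition
  types 1+1+1+1, 2+1+1, 2+2, 3+1 and 4. The first six orderings bring every pair of generators to
  the front. The other six exchange the last two entries, because \<open>two\<close> treats these
  asymmetrically.\<close>

lemma four_generated_false: False
proof -
  have "card (G - {e}) = 3" using card_G finite_G e_G by simp
  then obtain x y z where G: "G - {e} = {x, y, z}" "x \<noteq> y" "y \<noteq> z" "x \<noteq> z" unfolding card_3_iff by blast
  then have ex: "enum e x y z" using e_G by (auto simp: enum_def)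
  have Gs: "G = {e, x, y, z}" and ne: "e \<noteq> x" "e \<noteq> y" "e \<noteq> z" "x \<noteq> y" "x \<noteq> z" "y \<noteq> z"
    using ex by (simp_all add: enum_def)
  have all: "enum e x y z" "enum e y x z" "enum e z x y" "enum x y e z" "enum x z e y" "enum y z e x"
    "enum e x z y" "enum e y z x" "enum e z y x" "enum x y z e" "enum x z y e" "enum y z x e"
    unfolding enum_def unfolding Gs using ne ne[symmetric] by (simp_all add: insert_commute)
  have pair: "\<not> (nu n0 = nu n1 \<and> nu n0 \<noteq> nu n2 \<and> nu n0 \<noteq> nu n3 \<and> nu n2 \<noteq> nu n3)"
    and two: "\<not> (nu n0 = nu n1 \<and> nu n0 \<noteq> nu n3 \<and> (nu n2 = nu n3 \<or> nu n2 = nu n0))" if "enum n0 n1 n2 n3" for n0 n1 n2 n3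
    using enum_one_pair[OF that] enum_two_values[OF that] by auto
  have "\<not> distinct [nu e, nu x, nu y, nu z]" using enum_distinct[OF ex] by blast
  moreover have "\<not> (nu x = nu e \<and> nu y = nu e \<and> nu z = nu e)"
    using enum_constant[of "nu e"] ex by (auto simp: enum_def)
  ultimately show False
    using pair[OF all(1)] pair[OF all(2)] pair[OF all(3)] pair[OF all(4)] pair[OF all(5)] pair[OF all(6)]
      two[OF all(1)] two[OF all(2)] two[OF all(3)] two[OF all(4)] two[OF all(5)] two[OF all(6)]
      two[OF all(7)] two[OF all(8)] two[OF all(9)] two[OF all(10)] two[OF all(11)] two[OF all(12)]
    by (cases "nu e = nu x"; cases "nu e = nu y"; cases "nu e = nu z"; cases "nu x = nu y"; cases "nu x = nu z";
        cases "nu y = nu z"; simp)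
qed

end

lemma (in nearly_gorenstein_semigroup) type_bounds:
  assumes cG: "card G = CARD('d) + 3"
  shows "CARD('d) \<le> card M \<and> card M \<le> 3"
proof -
  have "card M \<le> 3"
  proof (cases "\<exists>i j :: 'd. i \<noteq> j")
    case True
    then show ?thesis using card_le_three_rank[OF _ cG] by blast
  next
    case False
    then obtain i :: 'd where U: "UNIV = {i}" by auto
    have c1: "CARD('d) = 1" unfolding U by simp
    show ?thesis
    proof (rule ccontr)
      assume "\<not> card M \<le> 3"
      then interpret four_generated S G a "a i"
        using cG c1 U by unfold_locales auto
      show False by (rule four_generated_false)
    qed
  qed
  then show ?thesis using rank_le_card by blast
qed

theorem theorem3p9:
  fixes S G :: "(int ^ 'd) set" and a :: "'d \<Rightarrow> int ^ 'd"
  assumes "simplicial_affine_semigroup S G a"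
    and "card G = CARD('d) + 3"
    and "nearly_gorenstein TYPE('k::field) S a"
    and "\<not> gorenstein (semigroup_ring TYPE('k) S)"
  shows "CARD('d) \<le> semigroup_type S a \<and> semigroup_type S a \<le> 3"
proof -
  interpret simplicial_ring S G a "TYPE('k)" by unfold_locales (rule assms(1))
  have cm: "cohen_macaulay (semigroup_ring TYPE('k) S)" and tr: "S - {0} \<subseteq> canonical_trace S a"
    using assms(3) by (auto simp: nearly_gorenstein_def)
  have "\<exists>m\<in>max_apery S a. \<exists>m'\<in>max_apery S a. m \<noteq> m'"
  proof (rule ccontr)
    assume n: "\<not> ?thesis"
    obtain m where "m \<in> max_apery S a" using max_nonempty by blast
    then have "max_apery S a = {m}" using n by blast
    then show False using gorenstein_if_unique_max[OF cm] assms(4) by blast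
  qed
  then interpret nearly_gorenstein_semigroup S G a
    using tr cm_saturated[OF cm] by unfold_locales
  show ?thesis using type_bounds[OF assms(2)] unfolding type_card .
qed

end
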